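(* Let $\phi=(\phi_1,\phi_2,\phi_3)\in\mathcal O(\mathbb D^3,\mathbb D^3)$ extend to a $\mathcal C^3$-smooth map on $\overline{\mathbb D^3}$. (A) If $C_\phi f=f\circ\phi$ is compact on $H^2(\mathbb D^3)$, then: (1) $\phi(\mathbb T^3)\cap\mathbb T^3=\varnothing$; (2) for every $\xi\in\mathbb T^3$ and every $I\subset\{1,2,3\}$ with $|I|=2$ and $\phi_I(\xi)\in\mathbb T^2$, $\phi_I$ is truly three-dimensional at $\xi$; (3) for every $\xi\in\mathbb T^3$ and every $j\in\{1,2,3\}$ with $\phi_j(\xi)\in\mathbb T$, $\phi_j$ is truly at least two-dimensional at $\xi$. (B) Conversely, if (1) $\phi(\mathbb T^3)\cap\mathbb T^3=\varnothing$; (2) for every $\xi\in\mathbb T^3$ and every $I\subset\{1,2,3\}$ with $|I|=2$ and $\phi_I(\xi)\in\mathbb T^2$, $\phi_I$ is truly three-dimensional at $\xi$ of order $2$; (3) for every $\xi\in\mathbb T^3$ and $j$ with $\phi_j(\xi)\in\mathbb T$, $\phi_j$ is truly at least two-dimensional at $\xi$ of order $2$; then $C_\phi$ is compact on $H^2(\mathbb D^3)$.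
   Context: $H^2(\mathbb D^3)$ is the Hardy space of holomorphic $f$ on $\mathbb D^3$ with $\sup_{0<r<1}\int_{\mathbb T^3}|f(r\zeta)|^2d\sigma_3(\zeta)<\infty$. $\phi_I=(\phi_{i_1},\phi_{i_2})$ for $I=\{i_1<i_2\}$. For $\xi=(e^{i\alpha_1},e^{i\alpha_2},e^{i\alpha_3})\in\mathbb T^3$, $\theta\in\mathbb R^3$, write $\xi e^{i\theta}=(e^{i(\alpha_k+\theta_k)})_k$ and $\xi z=(e^{i\alpha_k}z_k)_k$. (i) For $\varphi\in\mathcal O(\mathbb D^3,\mathbb D)\cap\mathcal C^2(\overline{\mathbb D^3})$ with $\varphi(\xi)\in\mathbb T$, let $\tilde\varphi(z)=\overline{\varphi(\xi)}\varphi(\xi z)$ and $\psi(\theta)=\overline{\varphi(\xi)}\varphi(\xi e^{i\theta})$. $\varphi$ is truly at least two-dimensional at $\xi$ if: at least two of $\frac{\partial\tilde\varphi}{\partial z_k}(1,1,1)$, $k=1,2,3$, are nonzero; and, taking $k_0$ with $\frac{\partial\tilde\varphi}{\partial z_{k_0}}(1,1,1)\ne0$ (say $k_0=1$ after relabeling coordinates), writing $\mathrm{Im}\,\psi(\theta)=L(\theta)+G(\theta)$ with $L$ linear, $G(\theta)=O(|\theta|^2)$, the map $U(\theta)=(L(\theta)+G(\theta),\theta_2,\theta_3)$ is a local diffeomorphism at $0$ and, writing $\mathrm{Re}\,\psi\circ U^{-1}(u)=1+H(u)$, $H$ is not (on any neighbourhood of $0$) a function of $u_1$ alone. $\varphi$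 is truly at least two-dimensional at $\xi$ of order $2$ if, writing $\mathrm{Re}\,\psi(\theta)=1-Q(\theta)+o(|\theta|^2)$, the quadratic form $Q$ has signature $(2,0)$ or $(3,0)$. (ii) For $\varphi=(\varphi_1,\varphi_2)\in\mathcal O(\mathbb D^3,\mathbb D^2)\cap\mathcal C^2(\overline{\mathbb D^3})$ with $\varphi(\xi)\in\mathbb T^2$, let $\tilde\varphi_j(z)=\overline{\varphi_j(\xi)}\varphi_j(\xi z)$ and $\psi_j(\theta)=\overline{\varphi_j(\xi)}\varphi_j(\xi e^{i\theta})$. $\varphi$ is truly three-dimensional at $\xi$ if $\nabla\tilde\varphi_1(1,1,1),\nabla\tilde\varphi_2(1,1,1)$ are linearly independent and, assuming after relabeling that $\big(\frac{\partial\tilde\varphi_j}{\partial z_k}(1,1,1)\big)_{1\le j,k\le 2}$ is invertible, writing $\mathrm{Im}\,\psi_j(\theta)=L_j(\theta)+G_j(\theta)$ with $L_j$ linear and $G_j(\theta)=O(|\theta|^2)$, with $U(\theta)=(L_1(\theta)+G_1(\theta),L_2(\theta)+G_2(\theta),\theta_3)$ a local diffeomorphism at $0$ and $\mathrm{Re}\,\psi_j\circ U^{-1}(u)=1+H_j(u)$, it is not the case that both $H_1$ and $H_2$ are, on a neighbourhood of $0$, functions of $(u_1,u_2)$ alone. $\varphi$ is truly three-dimensional at $\xi$ of order $2$ if the gradients above are linearly independent and, writing $\mathrm{Re}\,\psi_j(\theta)=1-Q_j(\theta)+o(|\theta|^2)$, both $Q_1,Q_2$ have signature $(3,0)$. 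*)

theory Defs
  imports "HOL-Analysis.Analysis"
begin

definition poly_D :: "(complex^3) set" where
  "poly_D = {z. \<forall>i. cmod (z$i) < 1}"

definition poly_cD :: "(complex^3) set" where
  "poly_cD = {z. \<forall>i. cmod (z$i) \<le> 1}"

definition torus3 :: "(complex^3) set" where
  "torus3 = {z. \<forall>i. cmod (z$i) = 1}"

definition pmul :: "complex^3 \<Rightarrow> complex^3 \<Rightarrow> complex^3" where
  "pmul \<xi> z = (\<chi> k. \<xi>$k * z$k)"

definition expi :: "real^3 \<Rightarrow> complex^3" where
  "expi \<theta> = (\<chi> k. cis (\<theta>$k))"

definition one3 :: "complex^3" where
  "one3 = (\<chi> k. 1)"

definition holo3 :: "(complex^3 \<Rightarrow> complex) \<Rightarrow> (complex^3) set \<Rightarrow> bool" where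
  "holo3 f S \<longleftrightarrow> (\<forall>z\<in>S. \<exists>f'. (f has_derivative f') (at z) \<and> (\<forall>c v. f' (c *s v) = c * f' v))"

text \<open>C^k on an open set D with all derivatives up to order k extending continuously to C
  (the derivative functions are required to be continuous on C, and are arbitrary
  (i.e. the extension) on C - D).  With C = D (open) this is the usual C^k.\<close>
fun Ck_upto :: "nat \<Rightarrow> ('a::real_normed_vector \<Rightarrow> 'b::real_normed_vector) \<Rightarrow> 'a set \<Rightarrow> 'a set \<Rightarrow> bool" where
  "Ck_upto 0 f D C = continuous_on C f"
| "Ck_upto (Suc k) f D C = (continuous_on C f \<and>
     (\<exists>f'. (\<forall>x\<in>D. (f has_derivative f' x) (at x)) \<and> (\<forall>v. Ck_upto k (\<lambda>x. f' x v) D C)))"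

definition local_diffeo_data ::
  "(real^3 \<Rightarrow> real^3) \<Rightarrow> real^3 \<Rightarrow> (real^3) set \<Rightarrow> (real^3) set \<Rightarrow> (real^3 \<Rightarrow> real^3) \<Rightarrow> bool" where
  "local_diffeo_data U x V W Ui \<longleftrightarrow> open V \<and> x \<in> V \<and> open W \<and> U ` V = W \<and>
     (\<forall>y\<in>V. Ui (U y) = y) \<and> (\<forall>w\<in>W. U (Ui w) = w) \<and> Ck_upto 1 U V V \<and> Ck_upto 1 Ui W W"

definition local_diffeo_at :: "(real^3 \<Rightarrow> real^3) \<Rightarrow> real^3 \<Rightarrow> bool" where
  "local_diffeo_at U x \<longleftrightarrow> (\<exists>V W Ui. local_diffeo_data U x V W Ui)"

definition ttilde :: "(complex^3 \<Rightarrow> complex) \<Rightarrow> complex^3 \<Rightarrow> complex^3 \<Rightarrow> complex" where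
  "ttilde g \<xi> = (\<lambda>z. cnj (g \<xi>) * g (pmul \<xi> z))"

definition psi :: "(complex^3 \<Rightarrow> complex) \<Rightarrow> complex^3 \<Rightarrow> real^3 \<Rightarrow> complex" where
  "psi g \<xi> = (\<lambda>\<theta>. cnj (g \<xi>) * g (pmul \<xi> (expi \<theta>)))"

text \<open>Complex partial derivative in the k-th variable, taken within the closed unit disc
  (so that it makes sense at boundary points such as (1,1,1)).\<close>
definition cpartial :: "(complex^3 \<Rightarrow> complex) \<Rightarrow> complex^3 \<Rightarrow> 3 \<Rightarrow> complex" where
  "cpartial F z k = (THE d. ((\<lambda>w. F (\<chi> i. if i = k then w else z$i)) has_field_derivative d)
                              (at (z$k) within cball 0 1))"

definition cgrad :: "(complex^3 \<Rightarrow> complex) \<Rightarrow> complex^3 \<Rightarrow> complex^3" where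
  "cgrad F z = (\<chi> k. cpartial F z k)"

definition lin_indep2 :: "complex^3 \<Rightarrow> complex^3 \<Rightarrow> bool" where
  "lin_indep2 v w \<longleftrightarrow> (\<forall>a b::complex. a *s v + b *s w = 0 \<longrightarrow> a = 0 \<and> b = 0)"

definition quadform :: "real^3^3 \<Rightarrow> real^3 \<Rightarrow> real" where
  "quadform A \<theta> = \<theta> \<bullet> (A *v \<theta>)"

definition pos_index :: "(real^3 \<Rightarrow> real) \<Rightarrow> nat" where
  "pos_index Q = Max {dim S | S. subspace S \<and> (\<forall>x\<in>S. x \<noteq> 0 \<longrightarrow> Q x > 0)}"

definition neg_index :: "(real^3 \<Rightarrow> real) \<Rightarrow> nat" where
  "neg_index Q = pos_index (\<lambda>x. - Q x)"

definition signature :: "(real^3 \<Rightarrow> real) \<Rightarrow> nat \<times> nat" where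
  "signature Q = (pos_index Q, neg_index Q)"

definition quad_expansion :: "(complex^3 \<Rightarrow> complex) \<Rightarrow> complex^3 \<Rightarrow> (real^3 \<Rightarrow> real) \<Rightarrow> bool" where
  "quad_expansion g \<xi> Q \<longleftrightarrow> (\<exists>A. Q = quadform A) \<and>
     ((\<lambda>\<theta>. (Re (psi g \<xi> \<theta>) - (1 - Q \<theta>)) / (norm \<theta>)^2) \<longlongrightarrow> 0) (at 0)"

definition truly2d :: "(complex^3 \<Rightarrow> complex) \<Rightarrow> complex^3 \<Rightarrow> bool" where
  "truly2d g \<xi> \<longleftrightarrow>
     2 \<le> card {k. cpartial (ttilde g \<xi>) one3 k \<noteq> 0} \<and>
     (\<forall>k0. cpartial (ttilde g \<xi>) one3 k0 \<noteq> 0 \<longrightarrow>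
        (let U = (\<lambda>\<theta>. \<chi> k. if k = k0 then Im (psi g \<xi> \<theta>) else \<theta>$k) in
          local_diffeo_at U 0 \<and>
          (\<forall>V W Ui. local_diffeo_data U 0 V W Ui \<longrightarrow>
             (\<forall>N. open N \<and> 0 \<in> N \<and> N \<subseteq> W \<longrightarrow>
                \<not> (\<exists>h. \<forall>u\<in>N. Re (psi g \<xi> (Ui u)) - 1 = h (u$k0))))))"

definition truly2d_ord2 :: "(complex^3 \<Rightarrow> complex) \<Rightarrow> complex^3 \<Rightarrow> bool" where
  "truly2d_ord2 g \<xi> \<longleftrightarrow> (\<exists>Q. quad_expansion g \<xi> Q \<and> signature Q \<in> {(2,0),(3,0)})"

definition truly3d :: "(complex^3 \<Rightarrow> complex) \<Rightarrow> (complex^3 \<Rightarrow> complex) \<Rightarrow> complex^3 \<Rightarrow> bool" where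
  "truly3d g1 g2 \<xi> \<longleftrightarrow>
     lin_indep2 (cgrad (ttilde g1 \<xi>) one3) (cgrad (ttilde g2 \<xi>) one3) \<and>
     (\<forall>k1 k2. k1 \<noteq> k2 \<and>
        cpartial (ttilde g1 \<xi>) one3 k1 * cpartial (ttilde g2 \<xi>) one3 k2
        - cpartial (ttilde g1 \<xi>) one3 k2 * cpartial (ttilde g2 \<xi>) one3 k1 \<noteq> 0 \<longrightarrow>
        (let U = (\<lambda>\<theta>. \<chi> k. if k = k1 then Im (psi g1 \<xi> \<theta>)
                             else if k = k2 then Im (psi g2 \<xi> \<theta>) else \<theta>$k) in
          local_diffeo_at U 0 \<and>
          (\<forall>V W Ui. local_diffeo_data U 0 V W Ui \<longrightarrow>
             (\<forall>N. open N \<and> 0 \<in> N \<and> N \<subseteq> W \<longrightarrow>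
                \<not> (\<exists>h1 h2. \<forall>u\<in>N. Re (psi g1 \<xi> (Ui u)) - 1 = h1 (u$k1) (u$k2) \<and>
                                  Re (psi g2 \<xi> (Ui u)) - 1 = h2 (u$k1) (u$k2))))))"

definition truly3d_ord2 :: "(complex^3 \<Rightarrow> complex) \<Rightarrow> (complex^3 \<Rightarrow> complex) \<Rightarrow> complex^3 \<Rightarrow> bool" where
  "truly3d_ord2 g1 g2 \<xi> \<longleftrightarrow>
     lin_indep2 (cgrad (ttilde g1 \<xi>) one3) (cgrad (ttilde g2 \<xi>) one3) \<and>
     (\<exists>Q1 Q2. quad_expansion g1 \<xi> Q1 \<and> quad_expansion g2 \<xi> Q2 \<and>
              signature Q1 = (3,0) \<and> signature Q2 = (3,0))"

definition circ_mean :: "(complex^3 \<Rightarrow> complex) \<Rightarrow> real \<Rightarrow> real" where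
  "circ_mean f r = integral (cbox 0 (\<chi> k. 2*pi))
       (\<lambda>\<theta>::real^3. (cmod (f (complex_of_real r *s expi \<theta>)))^2) / (2*pi)^3"

definition H2 :: "(complex^3 \<Rightarrow> complex) set" where
  "H2 = {f. holo3 f poly_D \<and> bdd_above (circ_mean f ` {0<..<1})}"

definition H2_norm :: "(complex^3 \<Rightarrow> complex) \<Rightarrow> real" where
  "H2_norm f = sqrt (SUP r\<in>{0<..<1}. circ_mean f r)"

definition compact_comp_op :: "(complex^3 \<Rightarrow> complex^3) \<Rightarrow> bool" where
  "compact_comp_op \<phi> \<longleftrightarrow> (\<forall>f\<in>H2. f \<circ> \<phi> \<in> H2) \<and>
     (\<forall>F::nat \<Rightarrow> complex^3 \<Rightarrow> complex. (\<forall>n. F n \<in> H2) \<and> (\<exists>B. \<forall>n. H2_norm (F n) \<le> B) \<longrightarrow>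
        (\<exists>g\<in>H2. \<exists>r. strict_mono r \<and>
           (\<lambda>n. H2_norm (\<lambda>z. (F (r n) \<circ> \<phi>) z - g z)) \<longlonglongrightarrow> 0))"

end

theory Submission
  imports Defs "HOL-Complex_Analysis.Great_Picard"
begin

text \<open>Necessity: on normalized Szego kernels concentrated at a boundary point, a compact operator must tend to zero in norm;
  if one of the conditions fails, the sets where the relevant coordinates of \<open>\<phi>\<close> are \<open>\<delta>\<close>-close to that point are too large for this.
  Nonvanishing of the gradients comes from the boundary Schwarz lemma.

  Sufficiency: definiteness of the Hessians bounds the measure of the sets where \<open>\<phi> \<circ> expi\<close> is close to a
  boundary point by a power of the distance larger than one. Hence the integrals of \<open>|szego b (\<phi> (expi \<theta>))|\<^sup>p\<close> are bounded
  uniformly in \<open>b\<close> for \<open>p = 9/8\<close>, and by the Schur test the part of \<open>G \<circ> \<phi>\<close> living where \<open>\<phi>\<close> is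
  close to the boundary has small norm, uniformly in \<open>G\<close>. On the rest Montel's theorem gives compactness.\<close>

text \<open>Both directions turn on one count. The kernel for a set J of coordinates at distance
  \<delta> from the boundary has squared norm of order \<delta> to the power -|J|, and its modulus
  has the same order where these coordinates are within O(\<delta>) of the boundary point. So a set
  of measure c times \<delta> to the power |J| keeps the image of the normalised kernel away from 0,
  and the failure of any condition in (A) provides such sets. For the converse the measure has to
  beat this order. One boundary coordinate gives exponent 3/2: one power from the imaginary part, a
  half from the Hessian. Two give \<delta>1 * \<delta>2 * sqrt \<delta>1 with \<delta>1 \<le>
  \<delta>2, hence only 5/4 for each; the third stays inside by (1). The exponent 9/8 lies between 1
  and 5/4: below 5/4 the dyadic sums converge, above 1 the bound yields uniform integrability. With
  \<delta> = s^8 the exponents become the integers 8, 9, 10. Boundary values of functions in H2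
  never occur; dilations replace them, and the factor tends to 1 only after the estimates.\<close>

section \<open>Integration over three coordinates in any order\<close>

definition vec3 :: "3 \<Rightarrow> 3 \<Rightarrow> real \<Rightarrow> real \<Rightarrow> real \<Rightarrow> real^3" where
  "vec3 i j x y z = (\<chi> l. if l = i then x else if l = j then y else z)"

lemma vec3_nth:
  assumes "distinct [i,j,k]"
  shows "vec3 i j x y z $ i = x" "vec3 i j x y z $ j = y" "vec3 i j x y z $ k = z"
  using assms by (auto simp: vec3_def)

lemma UNIV_3_distinct: "distinct [i,j,k::3] \<Longrightarrow> UNIV = {i,j,k}"
proof -
  assume "distinct [i,j,k::3]"
  then have "card {i,j,k} = CARD(3)" by simp
  then show ?thesis by (metis card_subset_eq finite_class.finite_UNIV subset_UNIV)
qed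

lemma exhaust_3_distinct: "distinct [i,j,k::3] \<Longrightarrow> l = i \<or> l = j \<or> l = k"
  using UNIV_3_distinct by blast

lemma all_3_distinct: "distinct [i,j,k::3] \<Longrightarrow> (\<forall>l. P l) \<longleftrightarrow> P i \<and> P j \<and> P k"
  using exhaust_3_distinct by metis

lemma sum_3_distinct: "distinct [i,j,k::3] \<Longrightarrow> sum f UNIV = f i + f j + f k"
  by (subst UNIV_3_distinct) (auto simp: add.assoc)

lemma prod_3_distinct: "distinct [i,j,k::3] \<Longrightarrow> prod f UNIV = f i * f j * f k"
  by (subst UNIV_3_distinct) (auto simp: mult.assoc)

lemma vec_eq_3_distinct: "distinct [i,j,k::3] \<Longrightarrow> x = y \<longleftrightarrow> x$i = y$i \<and> x$j = y$j \<and> x$k = y$k"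
  by (simp add: vec_eq_iff all_3_distinct)

lemma prod_Basis_vec: "(\<Prod>b\<in>(Basis :: (real^'n) set). f b) = (\<Prod>l\<in>UNIV. f (axis l 1))"
proof -
  have "(Basis :: (real^'n) set) = range (\<lambda>l. axis l 1)"
    by (auto simp: Basis_vec_def)
  then show ?thesis
    by (metis (mono_tags, lifting) axis_eq_axis inj_onI prod.reindex_cong zero_neq_one)
qed

lemma vec3_measurable[measurable]: "(\<lambda>(x,y,z). vec3 i j x y z) \<in> borel_measurable (lborel \<Otimes>\<^sub>M lborel \<Otimes>\<^sub>M lborel)"
proof -
  have "continuous_on UNIV (\<lambda>(x,y,z). vec3 i j x y z)"
    unfolding vec3_def split_beta
    apply (intro continuous_intros)
    subgoal for l by (cases "l = i"; cases "l = j") (auto intro!: continuous_intros)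
    done
  then have "(\<lambda>(x,y,z). vec3 i j x y z) \<in> borel_measurable borel"
    by (rule borel_measurable_continuous_onI)
  then show ?thesis by (simp add: lborel_prod)
qed

text \<open>Lebesgue measure is determined by its values on open boxes, and a box pulls back to a
  product of three intervals in the permuted order. Later the order of integration has to follow the
  geometry at a given point, so no order of the indices may be preferred.\<close>

lemma lborel_eq_distr_vec3:
  assumes d: "distinct [i,j,k]"
  shows "lborel = distr (lborel \<Otimes>\<^sub>M lborel \<Otimes>\<^sub>M lborel) borel (\<lambda>(x,y,z). vec3 i j x y z)"
proof (rule lborel_eqI)
  let ?g = "\<lambda>(x,y,z). vec3 i j x y z"
  fix l u :: "real^3" assume le: "\<And>b. b \<in> Basis \<Longrightarrow> l \<bullet> b \<le> u \<bullet> b"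
  have le': "l $ m \<le> u $ m" for m
    using le[of "axis m 1"] by (simp add: inner_axis)
  have "?g -` box l u \<inter> space (lborel \<Otimes>\<^sub>M lborel \<Otimes>\<^sub>M lborel) = box (l$i) (u$i) \<times> box (l$j) (u$j) \<times> box (l$k) (u$k)"
    using d by (auto simp: mem_box_cart space_pair_measure all_3_distinct[OF d] vec3_nth[OF d])
  then have "emeasure (distr (lborel \<Otimes>\<^sub>M lborel \<Otimes>\<^sub>M lborel) borel ?g) (box l u)
     = emeasure (lborel \<Otimes>\<^sub>M lborel \<Otimes>\<^sub>M lborel) (box (l$i) (u$i) \<times> box (l$j) (u$j) \<times> box (l$k) (u$k))"
    by (subst emeasure_distr) auto
  also have "\<dots> = ennreal (u$i - l$i) * (ennreal (u$j - l$j) * ennreal (u$k - l$k))"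
  proof -
    have "emeasure (lborel \<Otimes>\<^sub>M lborel \<Otimes>\<^sub>M lborel) (box (l$i) (u$i) \<times> box (l$j) (u$j) \<times> box (l$k) (u$k))
      = emeasure lborel (box (l$i) (u$i)) * emeasure (lborel \<Otimes>\<^sub>M lborel) (box (l$j) (u$j) \<times> box (l$k) (u$k))"
      unfolding lborel_prod by (subst lborel_prod[symmetric], rule lborel.emeasure_pair_measure_Times) (auto simp flip: lborel_prod)
    also have "emeasure (lborel \<Otimes>\<^sub>M lborel) (box (l$j) (u$j) \<times> box (l$k) (u$k))
      = emeasure lborel (box (l$j) (u$j)) * emeasure lborel (box (l$k) (u$k))"
      by (rule lborel.emeasure_pair_measure_Times) auto
    finally show ?thesis using le' by simp
  qed
  also have "\<dots> = ennreal (\<Prod>m\<in>UNIV. u$m - l$m)"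
    using le' by (simp add: prod_3_distinct[OF d] ennreal_mult mult.assoc)
  finally show "emeasure (distr (lborel \<Otimes>\<^sub>M lborel \<Otimes>\<^sub>M lborel) borel ?g) (box l u) = (\<Prod>b\<in>Basis. (u - l) \<bullet> b)"
    by (simp add: prod_Basis_vec inner_axis)
qed simp

lemma nn_integral_vec3:
  assumes d: "distinct [i,j,k]" and [measurable]: "f \<in> borel_measurable borel"
  shows "(\<integral>\<^sup>+t. f t \<partial>lborel) = (\<integral>\<^sup>+x. \<integral>\<^sup>+y. \<integral>\<^sup>+z. f (vec3 i j x y z) \<partial>lborel \<partial>lborel \<partial>lborel)"
proof -
  have m[measurable]: "(\<lambda>p. f (vec3 i j (fst p) (fst (snd p)) (snd (snd p)))) \<in> borel_measurable (lborel \<Otimes>\<^sub>M lborel \<Otimes>\<^sub>M lborel)"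
    using measurable_compose[OF vec3_measurable[of i j] assms(2)[unfolded lborel_def]]
    by (simp add: split_beta')
  have "(\<integral>\<^sup>+t. f t \<partial>lborel) = (\<integral>\<^sup>+p. f (vec3 i j (fst p) (fst (snd p)) (snd (snd p))) \<partial>(lborel \<Otimes>\<^sub>M lborel \<Otimes>\<^sub>M lborel))"
    using vec3_measurable[of i j]
    by (subst lborel_eq_distr_vec3[OF d], subst nn_integral_distr) (auto simp: split_beta')
  also have "\<dots> = (\<integral>\<^sup>+x. \<integral>\<^sup>+q. f (vec3 i j x (fst q) (snd q)) \<partial>(lborel \<Otimes>\<^sub>M lborel) \<partial>lborel)"
    by (subst lborel_prod, subst lborel_pair.nn_integral_fst[symmetric]) (use m in \<open>auto simp: lborel_prod\<close>)
  also have "\<dots> = (\<integral>\<^sup>+x. \<integral>\<^sup>+y. \<integral>\<^sup>+z. f (vec3 i j x y z) \<partial>lborel \<partial>lborel \<partial>lborel)"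
  proof (rule nn_integral_cong)
    fix x :: real
    have "(\<lambda>q. f (vec3 i j x (fst q) (snd q))) \<in> borel_measurable (lborel \<Otimes>\<^sub>M lborel)"
      using measurable_Pair2[OF m, of x] by simp
    from lborel.nn_integral_fst[OF this]
    show "(\<integral>\<^sup>+q. f (vec3 i j x (fst q) (snd q)) \<partial>(lborel \<Otimes>\<^sub>M lborel)) = (\<integral>\<^sup>+y. \<integral>\<^sup>+z. f (vec3 i j x y z) \<partial>lborel \<partial>lborel)"
      by simp
  qed
  finally show ?thesis .
qed

text \<open>If \<open>g\<close> is nonzero at \<open>x0\<close>, its support lies in the interval of
  radius \<open>a\<close> about \<open>x0\<close>; centring the interval at a point of the support
  costs the factor 2.\<close>

lemma nn_integral_le_diameter:
  fixes g :: "real \<Rightarrow> ennreal"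
  assumes d: "\<And>x y. g x \<noteq> 0 \<Longrightarrow> g y \<noteq> 0 \<Longrightarrow> \<bar>x - y\<bar> \<le> a" and le: "\<And>x. g x \<le> M"
  shows "(\<integral>\<^sup>+x. g x \<partial>lborel) \<le> M * ennreal (2 * a)"
proof (cases "\<exists>x. g x \<noteq> 0")
  case True
  then obtain x0 where x0: "g x0 \<noteq> 0" by blast
  have "0 \<le> a" using d[OF x0 x0] by simp
  have "(\<integral>\<^sup>+x. g x \<partial>lborel) \<le> (\<integral>\<^sup>+x. M * indicator {x0 - a..x0 + a} x \<partial>lborel)"
    using d[OF x0] le by (intro nn_integral_mono) (force simp: indicator_def abs_le_iff)
  also have "\<dots> = M * ennreal (2 * a)"
    using \<open>0 \<le> a\<close> by (subst nn_integral_cmult_indicator) auto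
  finally show ?thesis .
qed auto

text \<open>The extent in direction j is measured only inside slices with fixed i-th coordinate, and
  the extent in direction k only on lines with both fixed. A thin set that is tilted or curved thus
  gets the product of its true thicknesses, which its bounding box would miss. The one-dimensional
  bound is applied three times from the inside; a nonzero inner integral means that the slice meets
  S, so the hypotheses on S reach the outer integrals.\<close>

lemma emeasure_nested_slices:
  assumes d: "distinct [i,j,k::3]" and S: "S \<in> sets borel"
    and a: "\<And>x y. x \<in> S \<Longrightarrow> y \<in> S \<Longrightarrow> \<bar>x$i - y$i\<bar> \<le> a"
    and b: "\<And>x y. x \<in> S \<Longrightarrow> y \<in> S \<Longrightarrow> x$i = y$i \<Longrightarrow> \<bar>x$j - y$j\<bar> \<le> b"
    and c: "\<And>x y. x \<in> S \<Longrightarrow> y \<in> S \<Longrightarrow> x$i = y$i \<Longrightarrow> x$j = y$j \<Longrightarrow> \<bar>x$k - y$k\<bar> \<le> c"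
  shows "emeasure lborel S \<le> ennreal (2*c) * ennreal (2*b) * ennreal (2*a)"
proof -
  note v = vec3_nth[OF d]
  define f where "f = (\<lambda>x y z. indicator S (vec3 i j x y z) :: ennreal)"
  have f: "f x y z \<noteq> 0 \<longleftrightarrow> vec3 i j x y z \<in> S" for x y z
    by (auto simp: f_def indicator_def)
  have fz: "(\<integral>\<^sup>+z. f x y z \<partial>lborel) \<noteq> 0 \<Longrightarrow> \<exists>z. vec3 i j x y z \<in> S" for x y
  proof (rule ccontr)
    assume nz: "(\<integral>\<^sup>+z. f x y z \<partial>lborel) \<noteq> 0" and "\<not> (\<exists>z. vec3 i j x y z \<in> S)"
    then have "f x y z = 0" for z using f by blast
    then show False using nz by simp
  qed
  have fyz: "(\<integral>\<^sup>+y. \<integral>\<^sup>+z. f x y z \<partial>lborel \<partial>lborel) \<noteq> 0 \<Longrightarrow> \<exists>y z. vec3 i j x y z \<in> S" for x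
  proof (rule ccontr)
    assume nz: "(\<integral>\<^sup>+y. \<integral>\<^sup>+z. f x y z \<partial>lborel \<partial>lborel) \<noteq> 0" and "\<not> (\<exists>y z. vec3 i j x y z \<in> S)"
    then have "(\<integral>\<^sup>+z. f x y z \<partial>lborel) = 0" for y using fz by blast
    then show False using nz by simp
  qed
  have 1: "(\<integral>\<^sup>+z. f x y z \<partial>lborel) \<le> 1 * ennreal (2*c)" for x y
  proof (rule nn_integral_le_diameter)
    fix z z' assume "f x y z \<noteq> 0" "f x y z' \<noteq> 0"
    then show "\<bar>z - z'\<bar> \<le> c"
      unfolding f using c[of "vec3 i j x y z" "vec3 i j x y z'"] by (simp add: v)
  qed (simp add: f_def indicator_def)
  have 2: "(\<integral>\<^sup>+y. \<integral>\<^sup>+z. f x y z \<partial>lborel \<partial>lborel) \<le> (1 * ennreal (2*c)) * ennreal (2*b)" for x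
  proof (rule nn_integral_le_diameter[OF _ 1])
    fix y y' assume "(\<integral>\<^sup>+z. f x y z \<partial>lborel) \<noteq> 0" "(\<integral>\<^sup>+z. f x y' z \<partial>lborel) \<noteq> 0"
    then obtain z z' where "vec3 i j x y z \<in> S" "vec3 i j x y' z' \<in> S"
      using fz by blast
    from b[OF this] show "\<bar>y - y'\<bar> \<le> b" by (simp add: v)
  qed
  have 3: "(\<integral>\<^sup>+x. \<integral>\<^sup>+y. \<integral>\<^sup>+z. f x y z \<partial>lborel \<partial>lborel \<partial>lborel) \<le> ((1 * ennreal (2*c)) * ennreal (2*b)) * ennreal (2*a)"
  proof (rule nn_integral_le_diameter[OF _ 2])
    fix x x' assume "(\<integral>\<^sup>+y. \<integral>\<^sup>+z. f x y z \<partial>lborel \<partial>lborel) \<noteq> 0" "(\<integral>\<^sup>+y. \<integral>\<^sup>+z. f x' y z \<partial>lborel \<partial>lborel) \<noteq> 0"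
    then obtain y z y' z' where "vec3 i j x y z \<in> S" "vec3 i j x' y' z' \<in> S"
      using fyz by blast
    from a[OF this] show "\<bar>x - x'\<bar> \<le> a" by (simp add: v)
  qed
  have "emeasure lborel S = (\<integral>\<^sup>+t. indicator S t \<partial>lborel)"
    using S by simp
  also have "\<dots> = (\<integral>\<^sup>+x. \<integral>\<^sup>+y. \<integral>\<^sup>+z. f x y z \<partial>lborel \<partial>lborel \<partial>lborel)"
    unfolding f_def using S by (intro nn_integral_vec3[OF d]) auto
  finally show ?thesis using 3 by simp
qed

lemma measure_nested_slices:
  assumes d: "distinct [i,j,k::3]" and S: "S \<in> sets borel"
    and a: "\<And>x y. x \<in> S \<Longrightarrow> y \<in> S \<Longrightarrow> \<bar>x$i - y$i\<bar> \<le> a"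
    and b: "\<And>x y. x \<in> S \<Longrightarrow> y \<in> S \<Longrightarrow> x$i = y$i \<Longrightarrow> \<bar>x$j - y$j\<bar> \<le> b"
    and c: "\<And>x y. x \<in> S \<Longrightarrow> y \<in> S \<Longrightarrow> x$i = y$i \<Longrightarrow> x$j = y$j \<Longrightarrow> \<bar>x$k - y$k\<bar> \<le> c"
    and nn: "0 \<le> a" "0 \<le> b" "0 \<le> c"
  shows "measure lborel S \<le> 8 * a * b * c"
proof -
  have "emeasure lborel S \<le> ennreal (2*c) * ennreal (2*b) * ennreal (2*a)"
    by (rule emeasure_nested_slices[OF d S a b c])
  also have "\<dots> = ennreal (8 * a * b * c)"
    using nn by (simp add: ennreal_mult[symmetric] algebra_simps)
  finally show ?thesis using nn by (simp add: measure_def enn2real_leI)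
qed

text \<open>A shear preserves volume: for fixed first two coordinates the third ranges over an
  interval of length \<open>2 * c\<close> about a moving centre.\<close>

lemma measure_slab:
  assumes d: "distinct [i,j,k]" and nn: "0 \<le> a" "0 \<le> b" "0 \<le> c"
  shows "measure lborel {t::real^3. \<bar>t$i\<bar> \<le> a \<and> \<bar>t$j\<bar> \<le> b \<and> \<bar>t$k - (p * t$i + q * t$j)\<bar> \<le> c} = 8 * a * b * c"
    (is "measure _ ?S = _")
proof -
  note v = vec3_nth[OF d]
  have "closed ?S"
    by (intro closed_Collect_conj closed_Collect_le continuous_intros)
  then have [measurable]: "?S \<in> sets borel" by simp
  have "emeasure lborel ?S = (\<integral>\<^sup>+t. indicator ?S t \<partial>lborel)"
    by (rule nn_integral_indicator[symmetric]) simp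
  also have "\<dots> = (\<integral>\<^sup>+x. \<integral>\<^sup>+y. \<integral>\<^sup>+z. indicator ?S (vec3 i j x y z) \<partial>lborel \<partial>lborel \<partial>lborel)"
    by (rule nn_integral_vec3[OF d]) simp
  also have "\<dots> = (\<integral>\<^sup>+x. \<integral>\<^sup>+y. \<integral>\<^sup>+z. indicator {-a..a} x * (indicator {-b..b} y * indicator {(p*x+q*y) - c .. (p*x+q*y) + c} z) \<partial>lborel \<partial>lborel \<partial>lborel)"
    by (intro nn_integral_cong) (auto simp: indicator_def v abs_le_iff)
  also have "\<dots> = (\<integral>\<^sup>+x. \<integral>\<^sup>+y. indicator {-a..a} x * (indicator {-b..b} y * ennreal (2 * c)) \<partial>lborel \<partial>lborel)"
    using nn by (simp add: nn_integral_cmult)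
  also have "\<dots> = ennreal (2*a) * (ennreal (2*b) * ennreal (2*c))"
    using nn by (simp add: nn_integral_cmult nn_integral_multc)
  also have "\<dots> = ennreal (8 * a * b * c)"
    using nn by (simp add: ennreal_mult[symmetric] algebra_simps)
  finally show ?thesis using nn by (simp add: measure_def)
qed

text \<open>The gauge integral is read as a Lebesgue integral of the function times the indicator of
  the box, where the permutation of coordinates is a change of measure, and is then split up
  again.\<close>

lemma integral_cbox_vec3:
  fixes f :: "real^3 \<Rightarrow> 'b::euclidean_space"
  assumes d: "distinct [i,j,k]" and f: "continuous_on UNIV f"
  shows "integral (cbox a b) f = integral {a$i..b$i} (\<lambda>x. integral {a$j..b$j} (\<lambda>y. integral {a$k..b$k} (\<lambda>z. f (vec3 i j x y z))))"
proof -
  note v = vec3_nth[OF d]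
  let ?g = "\<lambda>p. f (vec3 i j (fst p) (fst (snd p)) (snd (snd p)))"
  let ?C = "cbox (a$i, a$j, a$k) (b$i, b$j, b$k)"
  have vc: "continuous_on UNIV (\<lambda>p. vec3 i j (fst p) (fst (snd p)) (snd (snd p)))"
    unfolding vec3_def
    apply (intro continuous_intros)
    subgoal for l by (cases "l = i"; cases "l = j") (auto intro!: continuous_intros)
    done
  have gc: "continuous_on A ?g" for A
    by (rule continuous_on_subset[OF continuous_on_compose2[OF f vc]]) auto
  have m: "(\<lambda>x. indicator (cbox a b) x *\<^sub>R f x) \<in> borel_measurable borel"
    by (intro borel_measurable_scaleR borel_measurable_indicator borel_measurable_continuous_onI f) auto
  have ind: "indicator (cbox a b) (vec3 i j x y z) = (indicator ?C (x,y,z) :: real)" for x y z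
    by (auto simp: indicator_def mem_box_cart all_3_distinct[OF d] v cbox_Pair_eq)
  have "integral (cbox a b) f = (LINT t:cbox a b|lborel. f t)"
    by (rule set_borel_integral_eq_integral(2)[symmetric])
       (simp add: set_integrable_def borel_integrable_compact continuous_on_subset[OF f])
  also have "\<dots> = (LINT p|(lborel \<Otimes>\<^sub>M lborel \<Otimes>\<^sub>M lborel). indicator ?C p *\<^sub>R ?g p)"
    unfolding set_lebesgue_integral_def
    using vec3_measurable[of i j] m
    by (subst lborel_eq_distr_vec3[OF d], subst integral_distr) (auto simp: split_beta' ind)
  also have "\<dots> = (LINT p:?C|lborel. ?g p)"
    by (simp add: lborel_prod set_lebesgue_integral_def)
  also have "\<dots> = integral ?C ?g"
    by (rule set_borel_integral_eq_integral(2))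
       (simp add: set_integrable_def borel_integrable_compact gc del: cbox_Pair_eq)
  also have "\<dots> = integral {a$i..b$i} (\<lambda>x. integral (cbox (a$j, a$k) (b$j, b$k)) (\<lambda>q. f (vec3 i j x (fst q) (snd q))))"
    by (subst integral_prod_continuous[OF gc]) simp
  also have "\<dots> = integral {a$i..b$i} (\<lambda>x. integral {a$j..b$j} (\<lambda>y. integral {a$k..b$k} (\<lambda>z. f (vec3 i j x y z))))"
  proof -
    have "continuous_on A (\<lambda>q. f (vec3 i j x (fst q) (snd q)))" for x A
      using continuous_on_compose2[OF gc[of UNIV], of A "\<lambda>q. (x, q)"]
      by (simp add: continuous_on_Pair)
    from integral_prod_continuous[OF this] show ?thesis by simp
  qed
  finally show ?thesis .
qed

lemma integral_periodic_shift_real: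
  fixes g :: "real \<Rightarrow> 'b::euclidean_space"
  assumes g: "continuous_on UNIV g" and per: "\<And>x. g (x + p) = g x" and p: "0 \<le> p"
  shows "integral {a..a+p} g = integral {0..p} g"
proof -
  have i: "g integrable_on {u..v}" for u v
    by (rule integrable_continuous_real) (rule continuous_on_subset[OF g], simp)
  have sh: "integral {u+p..v+p} g = integral {u..v} g" for u v
    using integral_shift_Icc_real[of u v g p] per by (simp add: o_def add.commute)
  show ?thesis
  proof (cases "a \<le> 0")
    case True
    have "integral {a..a+p} g + integral {a+p..p} g = integral {a..p} g"
      using True p by (intro Henstock_Kurzweil_Integration.integral_combine i) auto
    moreover have "integral {a..0} g + integral {0..p} g = integral {a..p} g"
      using True p by (intro Henstock_Kurzweil_Integration.integral_combine i) auto
    ultimately show ?thesis using sh[of a 0] by (simp add: algebra_simps) (metis add.commute add_left_cancel)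
  next
    case False
    have "integral {0..p} g + integral {p..a+p} g = integral {0..a+p} g"
      using False p by (intro Henstock_Kurzweil_Integration.integral_combine i) auto
    moreover have "integral {0..a} g + integral {a..a+p} g = integral {0..a+p} g"
      using False p by (intro Henstock_Kurzweil_Integration.integral_combine i) auto
    ultimately show ?thesis using sh[of 0 a] by (simp add: algebra_simps) (metis add.commute add_left_cancel)
  qed
qed

lemma continuous_vec3_z: "continuous_on UNIV (\<lambda>z. vec3 i j x y z)"
  unfolding vec3_def
  apply (intro continuous_intros)
  subgoal for l by (cases "l = i"; cases "l = j") (auto intro!: continuous_intros)
  done

lemma ex_distinct_3: "\<exists>i j. distinct [i,j,k::3]"
proof -
  have "distinct [1,2,3::3]" "distinct [2,3,1::3]" "distinct [1,3,2::3]" by simp_all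
  then show ?thesis using exhaust_3[of k] by metis
qed

lemma integral_periodic_shift_coord:
  fixes f :: "real^3 \<Rightarrow> 'b::euclidean_space"
  assumes f: "continuous_on UNIV f" and per: "\<And>t l. f (t + axis l p) = f t" and p: "0 \<le> p"
    and a: "\<And>l. l \<noteq> k \<Longrightarrow> a $ l = a' $ l"
  shows "integral (cbox a (a + (\<chi> l. p))) f = integral (cbox a' (a' + (\<chi> l. p))) f"
proof -
  obtain i j where d: "distinct [i,j,k]"
    using ex_distinct_3 by blast
  have "integral {a$k..a$k+p} (\<lambda>z. f (vec3 i j x y z)) = integral {a'$k..a'$k+p} (\<lambda>z. f (vec3 i j x y z))" for x y
  proof -
    have c: "continuous_on UNIV (\<lambda>z. f (vec3 i j x y z))"
      by (rule continuous_on_compose2[OF f continuous_vec3_z]) auto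
    have "vec3 i j x y (z + p) = vec3 i j x y z + axis k p" for z
      using d by (simp add: vec_eq_3_distinct[OF d] vec3_nth[OF d] axis_def)
    then have pe: "f (vec3 i j x y (z + p)) = f (vec3 i j x y z)" for z
      using per by simp
    show ?thesis
      using integral_periodic_shift_real[OF c pe p, of "a$k"] integral_periodic_shift_real[OF c pe p, of "a'$k"] by simp
  qed
  moreover have "a$i = a'$i" "a$j = a'$j" using a d by auto
  ultimately show ?thesis
    by (simp add: integral_cbox_vec3[OF d f])
qed

lemma integral_periodic_shift:
  fixes f :: "real^3 \<Rightarrow> 'b::euclidean_space"
  assumes f: "continuous_on UNIV f" and per: "\<And>t l. f (t + axis l p) = f t" and p: "0 \<le> p"
  shows "integral (cbox a (a + (\<chi> l. p))) f = integral (cbox 0 (\<chi> l. p)) f"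
proof -
  \<comment> \<open>The corner of the cube is moved to the origin one coordinate at a time;
    \<open>a1\<close> and \<open>a2\<close> are the intermediate corners.\<close>
  define a1 :: "real^3" where "a1 = (\<chi> l. if l = 1 then 0 else a$l)"
  define a2 :: "real^3" where "a2 = (\<chi> l. if l = 1 \<or> l = 2 then 0 else a$l)"
  note sh = integral_periodic_shift_coord[OF f per p]
  have "integral (cbox a (a + (\<chi> l. p))) f = integral (cbox a1 (a1 + (\<chi> l. p))) f"
    by (rule sh[of 1]) (auto simp: a1_def)
  also have "\<dots> = integral (cbox a2 (a2 + (\<chi> l. p))) f"
    by (rule sh[of 2]) (auto simp: a1_def a2_def)
  also have "\<dots> = integral (cbox 0 (0 + (\<chi> l. p))) f"
    apply (rule sh[of 3]) using exhaust_3 by (auto simp: a2_def)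
  finally show ?thesis by simp
qed

section \<open>The polydisc, the torus and Cauchy's formula\<close>

abbreviation cube :: "(real^3) set" where "cube \<equiv> cbox 0 (\<chi> k. 2 * pi)"

text \<open>The Cauchy-Szego kernel with the conjugation left to the parameter: the reproducing
  kernel at a point w is \<open>szego b\<close> with b the conjugate of w. In this form the kernel
  is holomorphic and symmetric in both arguments.\<close>

definition szego :: "complex^3 \<Rightarrow> complex^3 \<Rightarrow> complex" where
  "szego b z = (\<Prod>k\<in>UNIV. inverse (1 - b$k * z$k))"

lemma expi_nth [simp]: "expi \<theta> $ k = cis (\<theta> $ k)"
  by (simp add: expi_def)

lemma pmul_nth [simp]: "pmul x y $ k = x $ k * y $ k"
  by (simp add: pmul_def)

lemma continuous_expi [continuous_intros]: "continuous_on A f \<Longrightarrow> continuous_on A (\<lambda>x. expi (f x))"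
  unfolding expi_def by (intro continuous_intros)

lemma expi_add: "expi (a + b) = pmul (expi a) (expi b)"
  by (simp add: vec_eq_iff cis_mult)

lemma expi_period: "expi (t + axis l (2*pi)) = expi t"
  by (simp add: vec_eq_iff axis_def cis_mult[symmetric])

lemma open_poly_D: "open poly_D"
proof -
  have *: "poly_D = (\<Inter>i. {z. cmod (z$i) < 1})" by (auto simp: poly_D_def)
  show ?thesis unfolding *
    by (intro open_INT ballI finite_class.finite_UNIV open_Collect_less continuous_intros)
qed

lemma convex_poly_D: "convex poly_D"
proof -
  have *: "poly_D = (\<Inter>i. (\<lambda>z. z$i) -` ball 0 1)" by (auto simp: poly_D_def)
  moreover have "convex ((\<lambda>z. z$i) -` ball 0 1 :: (complex^3) set)" for i
    by (rule convex_linear_vimage) (auto intro!: bounded_linear.linear bounded_linear_vec_nth)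
  ultimately show ?thesis unfolding * by (intro convex_INT)
qed

lemma poly_D_subset_cD: "poly_D \<subseteq> poly_cD"
  by (auto simp: poly_D_def poly_cD_def less_imp_le)

lemma torus3_subset_cD: "torus3 \<subseteq> poly_cD"
  by (auto simp: torus3_def poly_cD_def)

lemma expi_in_torus3: "expi \<theta> \<in> torus3"
  by (simp add: torus3_def)

lemma expi_in_cD: "expi \<theta> \<in> poly_cD"
  by (simp add: poly_cD_def)

lemma scale_cD: "cmod c \<le> 1 \<Longrightarrow> z \<in> poly_cD \<Longrightarrow> c *s z \<in> poly_cD"
  by (auto simp: poly_cD_def norm_mult intro: mult_le_one)

lemma scale_cD_D: "cmod c < 1 \<Longrightarrow> z \<in> poly_cD \<Longrightarrow> c *s z \<in> poly_D"
  unfolding poly_cD_def poly_D_def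
  by (simp add: norm_mult) (meson mult_left_le norm_ge_zero order_le_less_trans)

lemma scale_D_D: "cmod c \<le> 1 \<Longrightarrow> z \<in> poly_D \<Longrightarrow> c *s z \<in> poly_D"
  unfolding poly_cD_def poly_D_def
  by (simp add: norm_mult) (meson mult_left_le_one_le norm_ge_zero order_le_less_trans)

lemma continuous_smult [continuous_intros]:
  "continuous_on A f \<Longrightarrow> continuous_on A g \<Longrightarrow> continuous_on A (\<lambda>x. f x *s (g x :: complex^3))"
  unfolding vector_scalar_mult_def by (intro continuous_intros) 

lemma continuous_pmul [continuous_intros]:
  "continuous_on A f \<Longrightarrow> continuous_on A g \<Longrightarrow> continuous_on A (\<lambda>x. pmul (f x) (g x))"
  unfolding pmul_def by (intro continuous_intros) 

lemma holo3_continuous: "holo3 f S \<Longrightarrow> continuous_on S f"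
  unfolding holo3_def
  by (metis continuous_at_imp_continuous_on has_derivative_continuous)

lemma bounded_linear_smult_left: "bounded_linear (\<lambda>c::complex. c *s (v :: complex^3))"
proof (rule bounded_linear_intro[where K="norm v"])
  fix c :: complex
  have "norm (c *s v) = cmod c * norm v"
    by (simp add: norm_vec_def norm_mult L2_set_right_distrib)
  then show "norm (c *s v) \<le> norm c * norm v" by simp
qed (simp_all add: vec_eq_iff algebra_simps)

lemma holo3_line:
  assumes f: "holo3 f S" and S: "\<And>\<zeta>. \<zeta> \<in> U \<Longrightarrow> a + \<zeta> *s v \<in> S"
  shows "(\<lambda>\<zeta>. f (a + \<zeta> *s v)) holomorphic_on U"
proof (rule holomorphic_onI)
  fix \<zeta> assume "\<zeta> \<in> U"
  then obtain f' where f': "(f has_derivative f') (at (a + \<zeta> *s v))" "\<And>c v. f' (c *s v) = c * f' v"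
    using f S unfolding holo3_def by blast
  have "((\<lambda>\<zeta>. a + \<zeta> *s v) has_derivative (\<lambda>c. c *s v)) (at \<zeta>)"
    by (rule has_derivative_eq_rhs[OF has_derivative_add[OF has_derivative_const
          bounded_linear_imp_has_derivative[OF bounded_linear_smult_left]]]) simp
  from diff_chain_at[OF this f'(1)]
  have "((\<lambda>\<zeta>. f (a + \<zeta> *s v)) has_derivative (\<lambda>c. c * f' v)) (at \<zeta>)"
    by (simp add: o_def f'(2))
  then show "(\<lambda>\<zeta>. f (a + \<zeta> *s v)) field_differentiable at \<zeta> within U"
    unfolding field_differentiable_def has_field_derivative_def
    by (intro exI[of _ "f' v"]) (auto simp: mult.commute[of _ "f' v"] intro: has_derivative_at_withinI)
qed

text \<open>On the unit circle du / (u - w) equals i dt / (1 - \<open>cis (-t)\<close> w), which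
  turns Cauchy's formula into integration against one factor of the Szego kernel.\<close>

lemma cauchy_circle:
  fixes g :: "complex \<Rightarrow> complex"
  assumes g: "continuous_on (cball 0 1) g" "g holomorphic_on ball 0 1" and w: "cmod w < 1"
  shows "((\<lambda>t. g (cis t) * inverse (1 - cis (-t) * w)) has_integral 2 * pi * g w) {0..2*pi}"
proof -
  have "((\<lambda>u. g u / (u - w)) has_contour_integral (2 * of_real pi * \<i> * g w)) (circlepath 0 1)"
    using Cauchy_integral_circlepath[OF g] w by simp
  then have "((\<lambda>t. g (cis t) / (cis t - w) * \<i> * cis t) has_integral (2 * of_real pi * \<i> * g w)) {0..2*pi}"
    unfolding circlepath_def using has_contour_integral_part_circlepath_iff[of 0 "2*pi" "\<lambda>u. g u / (u - w)"] by simp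
  from has_integral_mult_right[OF this, of "- \<i>"]
  have *: "((\<lambda>t. - \<i> * (g (cis t) / (cis t - w) * \<i> * cis t)) has_integral - \<i> * (2 * of_real pi * \<i> * g w)) {0..2*pi}" .
  have gen: "- (\<i> * (A * B * \<i> * C)) = A * (C * B)" for A B C :: complex
    using i_squared by algebra
  have "- \<i> * (g (cis t) / (cis t - w) * \<i> * cis t) = g (cis t) * inverse (1 - cis (-t) * w)" for t
  proof -
    have "cis t - w \<noteq> 0" using w by (metis norm_cis right_minus_eq less_irrefl)
    moreover have "1 - cis (-t) * w = cis (-t) * (cis t - w)"
      by (simp add: algebra_simps cis_mult)
    moreover have "inverse (cis (-t)) = cis t" by (simp add: cis_inverse)
    ultimately show ?thesis
      by (simp add: divide_inverse gen)
  qed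
  with * show ?thesis by (simp add: mult.assoc mult.left_commute)
qed

definition upd3 :: "complex^3 \<Rightarrow> 3 \<Rightarrow> complex \<Rightarrow> complex^3" where
  "upd3 z k c = (\<chi> i. if i = k then c else z$i)"

lemma upd3_nth [simp]: "upd3 z k c $ i = (if i = k then c else z$i)"
  by (simp add: upd3_def)

text \<open>Because of the factor t < 1 the slice is holomorphic on the closed disc, so
  \<open>f\<close> is evaluated only inside the polydisc although the integration runs over the unit
  circle.\<close>

lemma cauchy_slice:
  fixes f :: "complex^3 \<Rightarrow> complex"
  assumes f: "holo3 f poly_D" and t: "0 \<le> t" "t < 1" and z: "z \<in> poly_cD" and w: "cmod w < 1"
  shows "integral {0..2*pi} (\<lambda>s. f (complex_of_real t *s upd3 z k (cis s)) * inverse (1 - cis (-s) * w))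
       = 2 * pi * f (complex_of_real t *s upd3 z k w)"
proof -
  define a where "a = complex_of_real t *s upd3 z k 0"
  define v where "v = axis k (complex_of_real t)"
  have eq: "complex_of_real t *s upd3 z k \<zeta> = a + \<zeta> *s v" for \<zeta>
    by (auto simp: vec_eq_iff a_def v_def axis_def)
  have "(\<lambda>\<zeta>. f (a + \<zeta> *s v)) holomorphic_on cball 0 1"
  proof (rule holo3_line[OF f])
    fix \<zeta> :: complex assume "\<zeta> \<in> cball 0 1"
    then have "upd3 z k \<zeta> \<in> poly_cD" using z by (auto simp: poly_cD_def)
    then show "a + \<zeta> *s v \<in> poly_D"
      unfolding eq[symmetric] using t by (intro scale_cD_D) auto
  qed
  then have "continuous_on (cball 0 1) (\<lambda>\<zeta>. f (a + \<zeta> *s v))" "(\<lambda>\<zeta>. f (a + \<zeta> *s v)) holomorphic_on ball 0 1"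
    by (auto intro: holomorphic_on_imp_continuous_on elim: holomorphic_on_subset)
  from integral_unique[OF cauchy_circle[OF this w]] show ?thesis unfolding eq .
qed

lemma szego_vec: "distinct [i,j,k] \<Longrightarrow> szego b z = inverse (1 - b$i * z$i) * inverse (1 - b$j * z$j) * inverse (1 - b$k * z$k)"
  by (simp add: szego_def prod_3_distinct)

lemma continuous_szego [continuous_intros]:
  assumes "continuous_on A f" "continuous_on A g" "\<And>x k. x \<in> A \<Longrightarrow> f x $ k * g x $ k \<noteq> 1"
  shows "continuous_on A (\<lambda>x. szego (f x) (g x))"
  unfolding szego_def
proof (intro continuous_on_prod continuous_on_inverse ballI)
  show "continuous_on A (\<lambda>x. 1 - f x $ k * g x $ k)" for k
    using assms(1,2) by (intro continuous_intros)
  show "1 - f x $ k * g x $ k \<noteq> 0" if "x \<in> A" for x k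
    using assms(3)[OF that, of k] by auto
qed

lemma mult_neq_1_of_norm: "cmod a \<le> 1 \<Longrightarrow> cmod b < 1 \<Longrightarrow> a * b \<noteq> 1"
proof
  assume "cmod a \<le> 1" "cmod b < 1" "a * b = 1"
  then have "cmod a * cmod b = 1" by (metis norm_mult norm_one)
  moreover have "cmod a * cmod b \<le> 1 * cmod b" using \<open>cmod a \<le> 1\<close> by (intro mult_right_mono) auto
  ultimately show False using \<open>cmod b < 1\<close> by simp
qed

lemma poly_D_nth: "z \<in> poly_D \<Longrightarrow> cmod (z $ k) < 1"
  by (simp add: poly_D_def)

lemma poly_cD_nth: "z \<in> poly_cD \<Longrightarrow> cmod (z $ k) \<le> 1"
  by (simp add: poly_cD_def)

lemma continuous_dilate:
  fixes f :: "complex^3 \<Rightarrow> complex"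
  assumes f: "holo3 f poly_D" and t: "0 \<le> t" "t < 1"
  shows "continuous_on A (\<lambda>\<theta>. f (complex_of_real t *s expi \<theta>))"
  by (rule continuous_on_compose2[OF holo3_continuous[OF f]])
     (use t in \<open>auto intro!: continuous_intros scale_cD_D expi_in_cD continuous_on_id\<close>)

lemma continuous_szego_expi:
  assumes w: "w \<in> poly_D"
  shows "continuous_on A (\<lambda>\<theta>. szego (expi (- \<theta>)) w)"
  by (intro continuous_intros mult_neq_1_of_norm) (use w in \<open>auto simp: poly_D_nth\<close>)

text \<open>The one-variable formula is applied to the coordinates 3, 2, 1 in turn; each time an
  angle is integrated out and the corresponding coordinate of \<open>w\<close> takes its
  place.\<close>

lemma cauchy_polydisc:
  fixes f :: "complex^3 \<Rightarrow> complex"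
  assumes f: "holo3 f poly_D" and t: "0 \<le> t" "t < 1" and w: "w \<in> poly_D"
  shows "integral cube (\<lambda>\<theta>. f (complex_of_real t *s expi \<theta>) * szego (expi (- \<theta>)) w)
       = (2 * pi)^3 * f (complex_of_real t *s w)"
proof -
  have d: "distinct [1,2,3::3]" by simp
  note v = vec3_nth[OF d]
  let ?I = "integral {0..2*pi}"
  define T where "T = complex_of_real t"
  define K where "K = (\<lambda>k x. inverse (1 - cis (-x) * w $ k))"
  have w': "cmod (w $ k) < 1" for k using w by (simp add: poly_D_nth)
  \<comment> \<open>The four equations describe the point reached at each stage and are numbered by
    the coordinate integrated next; at 0 all coordinates have been replaced.\<close>
  have 3: "expi (vec3 1 2 x y z) = upd3 (expi (vec3 1 2 x y 0)) 3 (cis z)" for x y z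
    by (auto simp: vec_eq_3_distinct[OF d] v)
  have 2: "upd3 (expi (vec3 1 2 x y 0)) 3 (w$3) = upd3 (upd3 (expi (vec3 1 2 x 0 0)) 3 (w$3)) 2 (cis y)" for x y
    by (auto simp: vec_eq_3_distinct[OF d] v)
  have 1: "upd3 (upd3 (expi (vec3 1 2 x 0 0)) 3 (w$3)) 2 (w$2) = upd3 (upd3 (upd3 (expi 0) 3 (w$3)) 2 (w$2)) 1 (cis x)" for x
    by (auto simp: vec_eq_3_distinct[OF d] v)
  have 0: "upd3 (upd3 (upd3 (expi 0) 3 (w$3)) 2 (w$2)) 1 (w$1) = w"
    by (auto simp: vec_eq_3_distinct[OF d])
  have cD: "upd3 z k c \<in> poly_cD" if "z \<in> poly_cD" "cmod c \<le> 1" for z k c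
    using that by (auto simp: poly_cD_def)
  note sl = cauchy_slice[OF f t, folded T_def K_def]
  have "continuous_on UNIV (\<lambda>\<theta>. f (complex_of_real t *s expi \<theta>) * szego (expi (- \<theta>)) w)"
    by (intro continuous_on_mult continuous_dilate[OF f t] continuous_szego_expi[OF w])
  from integral_cbox_vec3[OF d this, of 0 "\<chi> k. 2*pi"]
  have "integral cube (\<lambda>\<theta>. f (complex_of_real t *s expi \<theta>) * szego (expi (- \<theta>)) w)
      = ?I (\<lambda>x. ?I (\<lambda>y. ?I (\<lambda>z. K 1 x * K 2 y * (f (T *s upd3 (expi (vec3 1 2 x y 0)) 3 (cis z)) * K 3 z))))"
    by (simp add: T_def K_def v szego_vec[OF d] 3[symmetric] mult_ac)
  also have "\<dots> = ?I (\<lambda>x. ?I (\<lambda>y. K 1 x * K 2 y * (2 * pi * f (T *s upd3 (expi (vec3 1 2 x y 0)) 3 (w$3)))))"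
    unfolding K_def T_def by (simp only: integral_mult_right cauchy_slice[OF f t expi_in_cD w'])
  also have "\<dots> = ?I (\<lambda>x. ?I (\<lambda>y. 2 * pi * K 1 x * (f (T *s upd3 (upd3 (expi (vec3 1 2 x 0 0)) 3 (w$3)) 2 (cis y)) * K 2 y)))"
    by (intro Henstock_Kurzweil_Integration.integral_cong) (subst 2, simp only: mult_ac)
  also have "\<dots> = ?I (\<lambda>x. 2 * pi * K 1 x * (2 * pi * f (T *s upd3 (upd3 (expi (vec3 1 2 x 0 0)) 3 (w$3)) 2 (w$2))))"
    unfolding K_def T_def
    by (simp only: integral_mult_right cauchy_slice[OF f t cD[OF expi_in_cD less_imp_le[OF w']] w'])
  also have "\<dots> = ?I (\<lambda>x. (2 * pi) * (2 * pi) * (f (T *s upd3 (upd3 (upd3 (expi 0) 3 (w$3)) 2 (w$2)) 1 (cis x)) * K 1 x))"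
    by (simp add: 1 mult_ac)
  also have "\<dots> = (2 * pi) * (2 * pi) * (2 * pi * f (T *s upd3 (upd3 (upd3 (expi 0) 3 (w$3)) 2 (w$2)) 1 (w$1)))"
    unfolding K_def T_def
    by (simp only: integral_mult_right cauchy_slice[OF f t cD[OF cD[OF expi_in_cD less_imp_le[OF w']] less_imp_le[OF w']] w'])
  also have "\<dots> = (2 * pi)^3 * f (complex_of_real t *s w)"
    by (simp add: 0 T_def power3_eq_cube)
  finally show ?thesis .
qed

section \<open>Circular means and the H2 norm\<close>

lemma measure_cube: "measure lborel cube = (2*pi)^3"
  by (subst content_cbox_cart) (auto simp: interval_eq_empty_cart not_less)

lemma continuous_norm_dilate:
  fixes f :: "complex^3 \<Rightarrow> complex"
  assumes f: "holo3 f poly_D" and t: "0 \<le> t" "t < 1"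
  shows "continuous_on A (\<lambda>\<theta>. (cmod (f (complex_of_real t *s expi \<theta>)))\<^sup>2)"
  by (intro continuous_intros continuous_dilate assms)

lemma circ_mean_le_H2_norm:
  assumes f: "f \<in> H2" and t: "0 < t" "t < 1"
  shows "circ_mean f t \<le> (H2_norm f)\<^sup>2"
proof -
  have b: "bdd_above (circ_mean f ` {0<..<1})" using f by (simp add: H2_def)
  have "holo3 f poly_D" using f by (simp add: H2_def)
  then have "0 \<le> circ_mean f t" using t by (auto simp: circ_mean_def intro!: divide_nonneg_nonneg Henstock_Kurzweil_Integration.integral_nonneg integrable_continuous continuous_norm_dilate)
  moreover have "circ_mean f t \<le> (SUP r\<in>{0<..<1}. circ_mean f r)"
    using t by (intro cSUP_upper b) auto
  ultimately show ?thesis by (simp add: H2_norm_def)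
qed

text \<open>Cauchy--Schwarz, from \<open>2 |f g| \<le> s |f|\<^sup>2 + |g|\<^sup>2 / s\<close> with the optimal \<open>s\<close>.\<close>

lemma square_le_of_young:
  assumes "\<And>s. 0 < s \<Longrightarrow> 2 * x \<le> s * A + B / s" "0 \<le> A" "0 \<le> B" "0 \<le> (x::real)"
  shows "x\<^sup>2 \<le> A * B"
proof (cases "A = 0 \<or> x = 0")
  case True
  show ?thesis
  proof (cases "x = 0")
    case False
    then have "A = 0" "0 < x" using True assms(4) by auto
    \<comment> \<open>For \<open>A = 0\<close> the weight can be taken so large that the remaining
      term drops below x, contradicting x > 0.\<close>
    have "2 * x \<le> B / ((B + 1) / x)" using assms(1)[of "(B + 1) / x"] \<open>A = 0\<close> \<open>0 < x\<close> assms(3) by simp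
    also have "\<dots> = x * (B / (B + 1))" by simp
    also have "\<dots> \<le> x * 1" using \<open>0 < x\<close> assms(3) by (intro mult_left_mono) auto
    finally show ?thesis using \<open>0 < x\<close> by simp
  qed (use assms in auto)
next
  case False
  then have "0 < A" "0 < x" using assms by auto
  \<comment> \<open>The weight \<open>x / A\<close> makes the first term equal to x.\<close>
  then have "2 * x \<le> x + B * A / x" using assms(1)[of "x / A"] by simp
  then show ?thesis using \<open>0 < x\<close> by (simp add: field_simps power2_eq_square)
qed

lemma integral_Cauchy_Schwarz:
  fixes f g :: "'a::euclidean_space \<Rightarrow> complex"
  assumes f: "continuous_on (cbox a b) f" and g: "continuous_on (cbox a b) g"
  shows "(cmod (integral (cbox a b) (\<lambda>x. f x * g x)))\<^sup>2 \<le> integral (cbox a b) (\<lambda>x. (cmod (f x))\<^sup>2) * integral (cbox a b) (\<lambda>x. (cmod (g x))\<^sup>2)"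
proof (rule square_le_of_young)
  let ?I = "integral (cbox a b)"
  have i: "(\<lambda>x. (cmod (f x))\<^sup>2) integrable_on cbox a b" "(\<lambda>x. (cmod (g x))\<^sup>2) integrable_on cbox a b"
    by (intro integrable_continuous continuous_intros f g)+
  then show "0 \<le> ?I (\<lambda>x. (cmod (f x))\<^sup>2)" "0 \<le> ?I (\<lambda>x. (cmod (g x))\<^sup>2)"
    by (auto intro: Henstock_Kurzweil_Integration.integral_nonneg)
  fix s :: real assume s: "0 < s"
  have "cmod (?I (\<lambda>x. f x * g x)) \<le> ?I (\<lambda>x. (s / 2) * (cmod (f x))\<^sup>2 + (1 / (2 * s)) * (cmod (g x))\<^sup>2)"
  proof (rule integral_norm_bound_integral)
    fix x
    have "0 \<le> (s * cmod (f x) - cmod (g x))\<^sup>2" by simp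
    then have "2 * s * (cmod (f x) * cmod (g x)) \<le> s\<^sup>2 * (cmod (f x))\<^sup>2 + (cmod (g x))\<^sup>2"
      by (simp add: power2_eq_square algebra_simps)
    then show "cmod (f x * g x) \<le> (s / 2) * (cmod (f x))\<^sup>2 + (1 / (2 * s)) * (cmod (g x))\<^sup>2"
      using s by (simp add: norm_mult field_simps power2_eq_square)
  qed (intro integrable_continuous continuous_intros f g)+
  also have "\<dots> = (s / 2) * ?I (\<lambda>x. (cmod (f x))\<^sup>2) + (1 / (2 * s)) * ?I (\<lambda>x. (cmod (g x))\<^sup>2)"
    using i by (subst Henstock_Kurzweil_Integration.integral_add) (simp_all only: integrable_on_mult_right Henstock_Kurzweil_Integration.integral_mult_right)
  finally show "2 * cmod (?I (\<lambda>x. f x * g x)) \<le> s * ?I (\<lambda>x. (cmod (f x))\<^sup>2) + ?I (\<lambda>x. (cmod (g x))\<^sup>2) / s"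
    using s by (simp add: field_simps)
qed simp

text \<open>Invariance of the measure on the torus under rotation: multiplication by
  \<open>expi \<alpha>\<close> translates the angles, and periodicity moves the cube back. The
  corner \<open>a\<close> is free because the necessity argument works on the cube centred at
  0.\<close>

lemma integral_cube_pmul:
  fixes h :: "complex^3 \<Rightarrow> 'b::euclidean_space"
  assumes h: "continuous_on UNIV (\<lambda>\<theta>. h (expi \<theta>))"
  shows "integral (cbox a (a + (\<chi> k. 2*pi))) (\<lambda>\<theta>. h (pmul (expi \<alpha>) (expi \<theta>))) = integral cube (\<lambda>\<theta>. h (expi \<theta>))"
proof -
  have "integral (cbox a (a + (\<chi> k. 2*pi))) (\<lambda>\<theta>. h (pmul (expi \<alpha>) (expi \<theta>)))
      = integral (cbox ((a + \<alpha>) - \<alpha>) (((a + \<alpha>) + (\<chi> k. 2*pi)) - \<alpha>)) (\<lambda>\<theta>. h (expi (\<theta> + \<alpha>)))"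
    by (simp add: expi_add[symmetric] add.commute)
  also have "\<dots> = integral (cbox (a + \<alpha>) ((a + \<alpha>) + (\<chi> k. 2*pi))) (\<lambda>\<theta>. h (expi \<theta>))"
    by (rule integral_shift_cbox)
  also have "\<dots> = integral cube (\<lambda>\<theta>. h (expi \<theta>))"
    by (rule integral_periodic_shift[OF h]) (auto simp: expi_period)
  finally show ?thesis .
qed

lemma continuous_comp_expi:
  assumes "continuous_on poly_cD g" "cmod c \<le> 1"
  shows "continuous_on A (\<lambda>\<theta>. g (c *s expi \<theta>))"
  by (rule continuous_on_compose2[OF assms(1)])
     (use assms(2) in \<open>auto intro!: continuous_intros scale_cD expi_in_cD continuous_on_id\<close>)

text \<open>Cauchy's formula for \<open>g \<cdot> h\<close> with \<open>h \<lambda> = (1 - r\<^sup>2) / (1 - r \<lambda>)\<close>, which is \<open>1\<close> at \<open>r\<close>, produces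
  the positive Poisson kernel.\<close>

definition poisson :: "real \<Rightarrow> real \<Rightarrow> real" where
  "poisson r t = (1 - r\<^sup>2) / (cmod (1 - r * cis t))\<^sup>2"

lemma poisson_nonneg: "0 \<le> r \<Longrightarrow> r < 1 \<Longrightarrow> 0 \<le> poisson r t"
  unfolding poisson_def by (intro divide_nonneg_nonneg) (auto simp: power_le_one)

lemma continuous_poisson: "0 \<le> r \<Longrightarrow> r < 1 \<Longrightarrow> continuous_on A (poisson r)"
  unfolding poisson_def using mult_neq_1_of_norm[of "cis _" r]
  by (intro continuous_intros) (auto simp: mult.commute)

lemma poisson_circle:
  fixes g :: "complex \<Rightarrow> complex"
  assumes g: "continuous_on (cball 0 1) g" "g holomorphic_on ball 0 1" and r: "0 \<le> r" "r < 1"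
  shows "((\<lambda>t. complex_of_real (poisson r t) * g (cis t)) has_integral 2 * pi * g r) {0..2*pi}"
proof -
  let ?R = "complex_of_real r"
  define h where "h = (\<lambda>z. (1 - ?R\<^sup>2) * inverse (1 - ?R * z))"
  have nz: "1 - ?R * z \<noteq> 0" if "cmod z \<le> 1" for z
    using mult_neq_1_of_norm[OF that, of ?R] r by (auto simp: mult.commute)
  have "continuous_on (cball 0 1) (\<lambda>z. g z * h z)"
    unfolding h_def using nz by (intro continuous_intros g) auto
  moreover have "(\<lambda>z. g z * h z) holomorphic_on ball 0 1"
    unfolding h_def using nz by (intro holomorphic_intros g) auto
  moreover have "cmod ?R < 1" using r by simp
  ultimately have *: "((\<lambda>t. g (cis t) * h (cis t) * inverse (1 - cis (-t) * ?R)) has_integral 2 * pi * (g ?R * h ?R)) {0..2*pi}"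
    by (rule cauchy_circle)
  have 1: "h ?R = 1"
    using nz[of ?R] r by (simp add: power2_eq_square h_def)
  have 2: "h (cis t) * inverse (1 - cis (-t) * ?R) = complex_of_real (poisson r t)" for t
  proof -
    have "complex_of_real ((cmod (1 - r * cis t))\<^sup>2) = (1 - ?R * cis t) * (1 - cis (-t) * ?R)"
      unfolding complex_norm_square by (simp add: cis_cnj mult.commute)
    then show ?thesis by (simp add: divide_inverse mult.assoc h_def poisson_def)
  qed
  have "g (cis t) * h (cis t) * inverse (1 - cis (-t) * ?R) = complex_of_real (poisson r t) * g (cis t)" for t
    by (simp only: 2[symmetric] mult_ac)
  then show ?thesis using * by (simp only: 1 mult_1_right)
qed

lemma integral_poisson:
  assumes r: "0 \<le> r" "r < 1"
  shows "integral {0..2*pi} (poisson r) = 2 * pi"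
proof -
  have "((\<lambda>t. complex_of_real (poisson r t)) has_integral of_real (2 * pi)) {0..2*pi}"
    using poisson_circle[of "\<lambda>_. 1" r] r by simp
  from has_integral_linear[OF this bounded_linear_Re] have "(poisson r has_integral 2 * pi) {0..2*pi}"
    by (simp add: o_def)
  then show ?thesis by (simp add: integral_unique)
qed

text \<open>Cauchy-Schwarz for the probability density \<open>poisson r\<close> divided by 2 pi,
  with the kernel written as a product of two square roots; it is the sub-mean-value property of the
  squared modulus.\<close>

lemma poisson_circle_norm:
  fixes g :: "complex \<Rightarrow> complex"
  assumes g: "continuous_on (cball 0 1) g" "g holomorphic_on ball 0 1" and r: "0 \<le> r" "r < 1"
  shows "2 * pi * (cmod (g r))\<^sup>2 \<le> integral {0..2*pi} (\<lambda>t. poisson r t * (cmod (g (cis t)))\<^sup>2)"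
proof -
  let ?I = "integral (cbox 0 (2*pi))"
  let ?P = "poisson r"
  note P0 = poisson_nonneg[OF r]
  have cg: "continuous_on A (\<lambda>t. g (cis t))" for A
    by (rule continuous_on_compose2[OF g(1)]) (auto intro!: continuous_intros)
  have s2: "complex_of_real (sqrt (?P t)) * complex_of_real (sqrt (?P t)) = complex_of_real (?P t)" for t
    using P0[of t] by (metis of_real_mult real_sqrt_mult_self abs_of_nonneg)
  have "2 * pi * g r = ?I (\<lambda>t. complex_of_real (sqrt (?P t)) * (complex_of_real (sqrt (?P t)) * g (cis t)))"
    using integral_unique[OF poisson_circle[OF g r]] by (simp add: s2 mult.assoc[symmetric])
  then have "(cmod (2 * pi * g r))\<^sup>2 \<le> ?I (\<lambda>t. (cmod (complex_of_real (sqrt (?P t))))\<^sup>2) * ?I (\<lambda>t. (cmod (complex_of_real (sqrt (?P t)) * g (cis t)))\<^sup>2)"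
    by (simp only:) (intro integral_Cauchy_Schwarz continuous_intros continuous_poisson r cg)
  also have "\<dots> = 2 * pi * ?I (\<lambda>t. ?P t * (cmod (g (cis t)))\<^sup>2)"
    using P0 integral_poisson[OF r] by (simp add: norm_mult power_mult_distrib)
  finally have "(2*pi) * (2 * pi * (cmod (g r))\<^sup>2) \<le> 2 * pi * ?I (\<lambda>t. ?P t * (cmod (g (cis t)))\<^sup>2)"
    by (simp add: norm_mult power_mult_distrib power2_eq_square)
  then show ?thesis by (subst (asm) mult_le_cancel_left_pos) simp_all
qed

text \<open>The one-variable inequality is applied on each disc \<zeta> \<mapsto> \<zeta>
  \<open>*s expi \<theta>\<close> and averaged over \<theta>. After exchanging the integrals, the
  inner one does not depend on t by rotation invariance, and the Poisson kernel integrates to 2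
  pi.\<close>

lemma circ_mean_le_boundary:
  assumes g: "continuous_on poly_cD g" and hg: "holo3 g poly_D" and r: "0 \<le> r" "r < 1"
  shows "circ_mean g r \<le> circ_mean g 1"
proof -
  let ?I = "integral cube"
  let ?J = "integral (cbox 0 (2*pi))"
  define M1 where "M1 = ?I (\<lambda>\<theta>. (cmod (g (expi \<theta>)))\<^sup>2)"
  let ?P = "poisson r"
  have cg: "continuous_on A (\<lambda>\<theta>. g (c *s expi \<theta>))" if "cmod c \<le> 1" for A c
    by (rule continuous_comp_expi[OF g that])
  have slice: "2 * pi * (cmod (g (r *s expi \<theta>)))\<^sup>2 \<le> ?J (\<lambda>t. ?P t * (cmod (g (cis t *s expi \<theta>)))\<^sup>2)" for \<theta>
  proof -
    have "continuous_on (cball 0 1) (\<lambda>\<zeta>. g (\<zeta> *s expi \<theta>))"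
      by (rule continuous_on_compose2[OF g]) (auto intro!: continuous_intros scale_cD expi_in_cD)
    moreover have "(\<lambda>\<zeta>. g (0 + \<zeta> *s expi \<theta>)) holomorphic_on ball 0 1"
      by (rule holo3_line[OF hg]) (auto intro!: scale_cD_D expi_in_cD)
    ultimately show ?thesis
      using poisson_circle_norm[of "\<lambda>\<zeta>. g (\<zeta> *s expi \<theta>)" r] r by simp
  qed
  have cPg: "continuous_on A (\<lambda>(\<theta>, t). ?P t * (cmod (g (cis t *s expi \<theta>)))\<^sup>2)" for A
    unfolding split_beta
    by (intro continuous_intros continuous_on_compose2[OF continuous_poisson[OF r, of UNIV]] continuous_on_compose2[OF g])
       (auto intro!: scale_cD expi_in_cD continuous_intros)
  have "2 * pi * ?I (\<lambda>\<theta>. (cmod (g (r *s expi \<theta>)))\<^sup>2) = ?I (\<lambda>\<theta>. 2 * pi * (cmod (g (r *s expi \<theta>)))\<^sup>2)"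
    by simp
  also have "\<dots> \<le> ?I (\<lambda>\<theta>. ?J (\<lambda>t. ?P t * (cmod (g (cis t *s expi \<theta>)))\<^sup>2))"
  proof (intro integral_le integrable_continuous)
    show "continuous_on cube (\<lambda>\<theta>. 2 * pi * (cmod (g (r *s expi \<theta>)))\<^sup>2)"
      using r by (intro continuous_intros cg) auto
    show "continuous_on cube (\<lambda>\<theta>. ?J (\<lambda>t. ?P t * (cmod (g (cis t *s expi \<theta>)))\<^sup>2))"
      by (intro integral_continuous_on_param cPg)
  qed (use slice in auto)
  also have "\<dots> = ?J (\<lambda>t. ?I (\<lambda>\<theta>. ?P t * (cmod (g (cis t *s expi \<theta>)))\<^sup>2))"
    by (rule integral_swap_continuous[OF cPg])
  also have "\<dots> = ?J (\<lambda>t. ?P t * M1)"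
  proof -
    have "?I (\<lambda>\<theta>. (cmod (g (cis t *s expi \<theta>)))\<^sup>2) = M1" for t
    proof -
      have "(\<lambda>\<theta>. (cmod (g (cis t *s expi \<theta>)))\<^sup>2) = (\<lambda>\<theta>. (cmod (g (pmul (expi (\<chi> k. t)) (expi \<theta>))))\<^sup>2)"
      proof
        fix \<theta> have "cis t *s expi \<theta> = pmul (expi (\<chi> k. t)) (expi \<theta>)" by (simp add: vec_eq_iff)
        then show "(cmod (g (cis t *s expi \<theta>)))\<^sup>2 = (cmod (g (pmul (expi (\<chi> k. t)) (expi \<theta>))))\<^sup>2" by simp
      qed
      then show ?thesis
        using integral_cube_pmul[of "\<lambda>z. (cmod (g z))\<^sup>2" 0 "\<chi> k. t"] cg[of 1]
        by (simp add: M1_def continuous_intros)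
    qed
    then show ?thesis by simp
  qed
  also have "\<dots> = 2 * pi * M1"
    using integral_poisson[OF r] by simp
  finally have "?I (\<lambda>\<theta>. (cmod (g (r *s expi \<theta>)))\<^sup>2) \<le> M1" by simp
  then show ?thesis by (simp add: circ_mean_def M1_def divide_right_mono)
qed

section \<open>Point evaluations, equicontinuity and compactness in H2\<close>

lemma two_pi_cube_pos: "0 < (2 * pi)^3"
  by simp

lemma integral_dilate_le:
  assumes f: "f \<in> H2" and t: "0 < t" "t < 1"
  shows "integral cube (\<lambda>\<theta>. (cmod (f (complex_of_real t *s expi \<theta>)))\<^sup>2) \<le> (2*pi)^3 * (H2_norm f)\<^sup>2"
  using circ_mean_le_H2_norm[OF assms] by (simp add: circ_mean_def field_simps)

lemma H2_holo3: "f \<in> H2 \<Longrightarrow> holo3 f poly_D"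
  by (simp add: H2_def)

lemma circ_mean_nonneg: "holo3 f poly_D \<Longrightarrow> 0 \<le> t \<Longrightarrow> t < 1 \<Longrightarrow> 0 \<le> circ_mean f t"
  by (auto simp: circ_mean_def intro!: divide_nonneg_nonneg Henstock_Kurzweil_Integration.integral_nonneg integrable_continuous continuous_norm_dilate)

lemma H2_norm_le:
  assumes f: "holo3 f poly_D" and b: "\<And>t. 0 < t \<Longrightarrow> t < 1 \<Longrightarrow> circ_mean f t \<le> B\<^sup>2" and B: "0 \<le> B"
  shows "f \<in> H2" "H2_norm f \<le> B"
proof -
  show "f \<in> H2" using f b by (auto simp: H2_def intro!: bdd_aboveI2[where M="B\<^sup>2"])
  have "(SUP r\<in>{0<..<1}. circ_mean f r) \<le> B\<^sup>2"
    by (rule cSUP_least) (use b in auto)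
  then show "H2_norm f \<le> B" using B by (simp add: H2_norm_def real_le_lsqrt)
qed

lemma H2_norm_nonneg: "f \<in> H2 \<Longrightarrow> 0 \<le> H2_norm f"
proof -
  assume f: "f \<in> H2"
  have "0 \<le> circ_mean f (1/2)" using circ_mean_nonneg[OF H2_holo3[OF f]] by simp
  also have "\<dots> \<le> (SUP r\<in>{0<..<1}. circ_mean f r)"
    using f by (intro cSUP_upper) (auto simp: H2_def)
  finally show ?thesis by (simp add: H2_norm_def)
qed

text \<open>Writing z as t times a point that is still inside brings z within reach of
  \<open>cauchy_polydisc\<close>, which computes values at such points from the torus of radius t <
  1.\<close>

lemma ex_dilate:
  assumes z: "z \<in> poly_D"
  obtains t where "0 < t" "t < 1" "complex_of_real (1/t) *s z \<in> poly_D"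
proof -
  define m where "m = Max (range (\<lambda>k. cmod (z $ k)))"
  have m: "cmod (z $ k) \<le> m" for k unfolding m_def by (rule Max_ge) auto
  have "m < 1" unfolding m_def using z by (subst Max_less_iff) (auto simp: poly_D_def)
  moreover have "0 \<le> m" using m[of 1] norm_ge_zero order_trans by blast
  ultimately obtain t where t: "0 < t" "t < 1" "m < t"
    using that[of "(m + 1) / 2"] by (metis dense order.strict_trans1)
  show ?thesis
  proof (rule that[OF t(1,2)])
    have "cmod (z $ k) < t" for k using m[of k] t(3) by simp
    then show "complex_of_real (1 / t) *s z \<in> poly_D"
      using t by (auto simp: poly_D_def norm_mult norm_divide field_simps)
  qed
qed

lemma smult_inverse: "t \<noteq> 0 \<Longrightarrow> complex_of_real t *s (complex_of_real (1/t) *s z) = z"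
  by (simp add: vec_eq_iff)

text \<open>The squared distance of two Cauchy kernels in unnormalised L2 of the torus; it serves as
  a modulus of continuity common to all functions in a ball of H2.\<close>

definition szego_dist :: "complex^3 \<Rightarrow> complex^3 \<Rightarrow> real" where
  "szego_dist w w' = integral cube (\<lambda>\<theta>. (cmod (szego (expi (- \<theta>)) w - szego (expi (- \<theta>)) w'))\<^sup>2)"

text \<open>Cauchy's formulas at \<open>w\<close> and \<open>w'\<close> are subtracted and
  Cauchy-Schwarz is applied. The function enters only through its norm, which is what makes the
  family equicontinuous.\<close>

lemma H2_diff_bound:
  assumes f: "f \<in> H2" and t: "0 < t" "t < 1" and w: "w \<in> poly_D" "w' \<in> poly_D"
  shows "(cmod (f (complex_of_real t *s w) - f (complex_of_real t *s w')))\<^sup>2 \<le> (H2_norm f)\<^sup>2 * szego_dist w w'"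
proof -
  let ?c = "(2 * pi)^3 :: real"
  let ?F = "\<lambda>\<theta>. f (complex_of_real t *s expi \<theta>)"
  let ?K = "\<lambda>w \<theta>. szego (expi (- \<theta>)) w"
  have t0: "0 \<le> t" using t by simp
  note h = H2_holo3[OF f]
  have i: "(\<lambda>\<theta>. ?F \<theta> * ?K v \<theta>) integrable_on cube" if "v \<in> poly_D" for v
    by (intro integrable_continuous continuous_on_mult continuous_dilate[OF h t0 t(2)] continuous_szego_expi[OF that])
  have "of_real ?c * (f (complex_of_real t *s w) - f (complex_of_real t *s w')) = integral cube (\<lambda>\<theta>. ?F \<theta> * ?K w \<theta> - ?F \<theta> * ?K w' \<theta>)"
    by (subst Henstock_Kurzweil_Integration.integral_diff[OF i[OF w(1)] i[OF w(2)]])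
       (simp only: cauchy_polydisc[OF h t0 t(2) w(1)] cauchy_polydisc[OF h t0 t(2) w(2)], simp add: algebra_simps)
  also have "\<dots> = integral cube (\<lambda>\<theta>. ?F \<theta> * (?K w \<theta> - ?K w' \<theta>))"
    by (simp add: algebra_simps)
  finally have "(cmod (of_real ?c * (f (complex_of_real t *s w) - f (complex_of_real t *s w'))))\<^sup>2
     \<le> integral cube (\<lambda>\<theta>. (cmod (?F \<theta>))\<^sup>2) * szego_dist w w'"
    unfolding szego_dist_def
    by (simp only:) (intro integral_Cauchy_Schwarz continuous_on_diff continuous_dilate[OF h t0 t(2)] continuous_szego_expi w)
  also have "\<dots> \<le> (?c * (H2_norm f)\<^sup>2) * szego_dist w w'"
  proof (rule mult_right_mono[OF integral_dilate_le[OF f t]])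
    show "0 \<le> szego_dist w w'" unfolding szego_dist_def
      by (intro Henstock_Kurzweil_Integration.integral_nonneg integrable_continuous continuous_intros continuous_szego_expi w) auto
  qed
  finally have *: "?c * (?c * (cmod (f (complex_of_real t *s w) - f (complex_of_real t *s w')))\<^sup>2) \<le> ?c * ((H2_norm f)\<^sup>2 * szego_dist w w')"
    by (simp only: norm_mult power_mult_distrib norm_of_real power2_eq_square) (simp add: mult_ac)
  \<comment> \<open>The surplus factor (2 pi)^3 exceeds 1 and is simply dropped.\<close>
  have "1 * (cmod (f (complex_of_real t *s w) - f (complex_of_real t *s w')))\<^sup>2 \<le> ?c * (cmod (f (complex_of_real t *s w) - f (complex_of_real t *s w')))\<^sup>2"
    by (intro mult_right_mono one_le_power) (use pi_ge_two in auto)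
  also have "\<dots> \<le> (H2_norm f)\<^sup>2 * szego_dist w w'"
    using * by (subst (asm) mult_le_cancel_left_pos) auto
  finally show ?thesis by simp
qed

lemma continuous_szego_dist:
  assumes w: "w \<in> poly_D"
  shows "continuous_on poly_D (szego_dist w)"
  unfolding szego_dist_def
proof (rule integral_continuous_on_param)
  have "continuous_on (poly_D \<times> cube) (\<lambda>p. szego (expi (- snd p)) (fst p))"
    by (intro continuous_intros mult_neq_1_of_norm) (auto simp: poly_D_nth)
  moreover have "continuous_on (poly_D \<times> cube) (\<lambda>p. szego (expi (- snd p)) w)"
    by (rule continuous_on_compose2[OF continuous_szego_expi[OF w, of UNIV]]) (auto intro!: continuous_intros)
  ultimately show "continuous_on (poly_D \<times> cube) (\<lambda>(x, \<theta>). (cmod (szego (expi (- \<theta>)) w - szego (expi (- \<theta>)) x))\<^sup>2)"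
    unfolding split_beta by (intro continuous_on_power continuous_on_norm continuous_on_diff)
qed

lemma szego_dist_self: "szego_dist w w = 0"
  by (simp add: szego_dist_def)

text \<open>\<open>szego_dist\<close> is continuous and vanishes on the diagonal, so the bound by
  B^2 times this distance becomes small near z for all functions in the ball at once.\<close>

lemma H2_equicontinuous:
  assumes z: "z \<in> poly_D" and e: "0 < e"
  obtains d where "0 < d" "\<And>z'. dist z' z < d \<Longrightarrow> z' \<in> poly_D"
    "\<And>z' f. dist z' z < d \<Longrightarrow> f \<in> H2 \<Longrightarrow> H2_norm f \<le> B \<Longrightarrow> cmod (f z' - f z) < e"
proof -
  obtain t where t: "0 < t" "t < 1" and tz: "complex_of_real (1/t) *s z \<in> poly_D"
    using ex_dilate[OF z] by blast
  let ?w = "complex_of_real (1/t) *s z"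
  define U where "U = (\<lambda>z'. complex_of_real (1/t) *s z') -` poly_D"
  have c: "continuous_on UNIV (\<lambda>z'::complex^3. complex_of_real (1/t) *s z')"
    by (intro continuous_intros)
  have "open U" unfolding U_def using c open_poly_D by (rule open_vimage[rotated])
  have zU: "z \<in> U" using tz by (simp add: U_def)
  have "continuous_on U (\<lambda>z'. (B\<^sup>2) * szego_dist ?w (complex_of_real (1/t) *s z'))"
    by (intro continuous_intros continuous_on_compose2[OF continuous_szego_dist[OF tz] continuous_on_subset[OF c]])
       (auto simp: U_def)
  then have "((\<lambda>z'. (B\<^sup>2) * szego_dist ?w (complex_of_real (1/t) *s z')) \<longlongrightarrow> (B\<^sup>2) * szego_dist ?w ?w) (at z)"
    using \<open>open U\<close> zU by (metis continuous_on_eq_continuous_at isCont_def)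
  then have "eventually (\<lambda>z'. (B\<^sup>2) * szego_dist ?w (complex_of_real (1/t) *s z') < e\<^sup>2) (at z)"
    using e by (intro order_tendstoD(2)) (auto simp: szego_dist_self)
  then obtain d1 where d1: "0 < d1" "\<And>z'. z' \<noteq> z \<Longrightarrow> dist z' z < d1 \<Longrightarrow> (B\<^sup>2) * szego_dist ?w (complex_of_real (1/t) *s z') < e\<^sup>2"
    by (auto simp: eventually_at)
  obtain d2 where d2: "0 < d2" "\<And>z'. dist z' z < d2 \<Longrightarrow> z' \<in> U"
    using \<open>open U\<close> zU by (auto simp: open_dist)
  show ?thesis
  proof (rule that[of "min d1 d2"])
    fix z' f assume z': "dist z' z < min d1 d2"
    then have w': "complex_of_real (1/t) *s z' \<in> poly_D" using d2(2)[of z'] by (simp add: U_def)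
    from scale_D_D[OF _ this, of "complex_of_real t"] show "z' \<in> poly_D"
      using t by (simp only: smult_inverse) simp
    assume f: "f \<in> H2" "H2_norm f \<le> B"
    show "cmod (f z' - f z) < e"
    proof (cases "z' = z")
      case False
      have eq: "complex_of_real t *s (complex_of_real (1/t) *s u) = u" for u using t by (intro smult_inverse) auto
      have "(cmod (f z - f z'))\<^sup>2 \<le> (H2_norm f)\<^sup>2 * szego_dist ?w (complex_of_real (1/t) *s z')"
        using H2_diff_bound[OF f(1) t tz w'] by (simp only: eq)
      also have "\<dots> \<le> B\<^sup>2 * szego_dist ?w (complex_of_real (1/t) *s z')"
        using f H2_norm_nonneg[OF f(1)] unfolding szego_dist_def
        by (intro mult_right_mono power_mono Henstock_Kurzweil_Integration.integral_nonneg integrable_continuous continuous_intros continuous_szego_expi w' tz) auto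
      also have "\<dots> < e\<^sup>2" using d1(2)[OF False] z' by simp
      finally have "(cmod (f z - f z'))\<^sup>2 < e\<^sup>2" .
      from power2_less_imp_less[OF this] e show ?thesis by (simp only: norm_minus_commute less_imp_le)
    qed (use e in auto)
  qed (use d1 d2 in auto)
qed

lemma H2_equicontinuous_ex:
  "z \<in> poly_D \<Longrightarrow> 0 < e \<Longrightarrow> \<exists>d>0. \<forall>z'. dist z' z < d \<longrightarrow> z' \<in> poly_D \<and> (\<forall>f. f \<in> H2 \<longrightarrow> H2_norm f \<le> B \<longrightarrow> cmod (f z' - f z) < e)"
  apply (rule H2_equicontinuous[where B=B], assumption, assumption)
  subgoal for d by (intro exI[of _ d]) simp
  done

lemma H2_eval_bound:
  assumes z: "z \<in> poly_D"
  obtains C where "0 \<le> C" "\<And>f. f \<in> H2 \<Longrightarrow> cmod (f z) \<le> C * H2_norm f"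
proof -
  obtain t where t: "0 < t" "t < 1" and w: "complex_of_real (1/t) *s z \<in> poly_D"
    using ex_dilate[OF z] by blast
  let ?w = "complex_of_real (1/t) *s z"
  let ?K = "\<lambda>\<theta>. szego (expi (- \<theta>)) ?w"
  define C where "C = integral cube (\<lambda>\<theta>. (cmod (?K \<theta>))\<^sup>2)"
  have C0: "0 \<le> C" unfolding C_def
    by (intro Henstock_Kurzweil_Integration.integral_nonneg integrable_continuous continuous_intros continuous_szego_expi w) auto
  show ?thesis
  proof (rule that[of "sqrt C"])
    fix f assume f: "f \<in> H2"
    have t0: "0 \<le> t" using t by simp
    have "complex_of_real ((2*pi)^3) * f z = integral cube (\<lambda>\<theta>. f (complex_of_real t *s expi \<theta>) * ?K \<theta>)"
      using cauchy_polydisc[OF H2_holo3[OF f] t0 t(2) w] smult_inverse[of t z] t by simp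
    then have "(cmod (complex_of_real ((2*pi)^3) * f z))\<^sup>2 \<le> integral cube (\<lambda>\<theta>. (cmod (f (complex_of_real t *s expi \<theta>)))\<^sup>2) * C"
      unfolding C_def
      by (simp only:) (intro integral_Cauchy_Schwarz continuous_dilate[OF H2_holo3[OF f] t0 t(2)] continuous_szego_expi w)
    also have "\<dots> \<le> ((2*pi)^3 * (H2_norm f)\<^sup>2) * C"
      by (rule mult_right_mono[OF integral_dilate_le[OF f t] C0])
    finally have "(2*pi)^3 * ((2*pi)^3 * (cmod (f z))\<^sup>2) \<le> (2*pi)^3 * ((H2_norm f)\<^sup>2 * C)"
      by (simp only: norm_mult power_mult_distrib norm_of_real power2_eq_square) (simp add: mult_ac)
    then have "(2*pi)^3 * (cmod (f z))\<^sup>2 \<le> (H2_norm f)\<^sup>2 * C"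
      by (subst (asm) mult_le_cancel_left_pos) auto
    moreover have "1 * (cmod (f z))\<^sup>2 \<le> (2*pi)^3 * (cmod (f z))\<^sup>2"
      by (intro mult_right_mono one_le_power) (use pi_ge_two in auto)
    ultimately have "(cmod (f z))\<^sup>2 \<le> (sqrt C * H2_norm f)\<^sup>2"
      using C0 by (simp add: power_mult_distrib mult.commute)
    then show "cmod (f z) \<le> sqrt C * H2_norm f"
      using C0 H2_norm_nonneg[OF f] by (meson mult_nonneg_nonneg power2_le_imp_le real_sqrt_ge_zero)
  qed (use C0 in auto)
qed

lemma szego_has_derivative:
  assumes "\<And>k. b$k * z$k \<noteq> 1"
  shows "(szego b has_derivative (\<lambda>v. \<Sum>k\<in>UNIV. (b$k * inverse (1 - b$k * z$k) * szego b z) * v$k)) (at z)"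
proof -
  have d: "distinct [1,2,3::3]" by simp
  have nz: "1 - b$k * z$k \<noteq> 0" for k using assms[of k] by auto
  have 1: "((\<lambda>z. inverse (1 - b$k * z$k)) has_derivative (\<lambda>v. b$k * inverse (1 - b$k * z$k) * inverse (1 - b$k * z$k) * v$k)) (at z)" for k
    using nz[of k]
    by (auto intro!: derivative_eq_intros bounded_linear_imp_has_derivative bounded_linear_vec_nth simp: field_simps)
  have "szego b = (\<lambda>z. inverse (1 - b$1 * z$1) * inverse (1 - b$2 * z$2) * inverse (1 - b$3 * z$3))"
    by (simp add: fun_eq_iff szego_vec[OF d])
  moreover have "((\<lambda>z. inverse (1 - b$1 * z$1) * inverse (1 - b$2 * z$2) * inverse (1 - b$3 * z$3)) has_derivative
      (\<lambda>v. \<Sum>k\<in>UNIV. (b$k * inverse (1 - b$k * z$k) * szego b z) * v$k)) (at z)"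
    by (rule has_derivative_eq_rhs[OF has_derivative_mult[OF has_derivative_mult[OF 1 1] 1]])
       (simp add: fun_eq_iff sum_3_distinct[OF d] szego_vec[OF d] algebra_simps)
  ultimately show ?thesis by simp
qed

lemma holo3_szego:
  assumes "\<And>k. cmod (b$k) \<le> 1"
  shows "holo3 (szego b) poly_D"
  unfolding holo3_def
proof
  fix z assume "z \<in> poly_D"
  then have "b$k * z$k \<noteq> 1" for k using assms by (intro mult_neq_1_of_norm) (auto simp: poly_D_def)
  from szego_has_derivative[OF this]
  show "\<exists>f'. (szego b has_derivative f') (at z) \<and> (\<forall>c v. f' (c *s v) = c * f' v)"
    by (intro exI conjI) (auto simp: sum_distrib_left mult_ac intro!: sum.cong)
qed

text \<open>Differentiation under the integral sign, where \<open>g\<close> is merely continuous.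
  Limits of holomorphic functions are recognised as holomorphic by representing them in this
  form.\<close>

lemma holo3_cauchy_integral:
  assumes g: "continuous_on cube g"
  shows "holo3 (\<lambda>w. integral cube (\<lambda>\<theta>. g \<theta> * szego (expi (- \<theta>)) w)) poly_D"
  unfolding holo3_def
proof
  fix w assume w: "w \<in> poly_D"
  define P :: "3 \<Rightarrow> (complex^3) \<Rightarrow>\<^sub>L complex" where "P = (\<lambda>k. Blinfun (\<lambda>v. v $ k))"
  have P: "blinfun_apply (P k) v = v $ k" for k v
    unfolding P_def by (subst bounded_linear_Blinfun_apply) (auto intro: bounded_linear_vec_nth)
  define c where "c = (\<lambda>k \<theta> w. g \<theta> * (expi (- \<theta>) $ k * inverse (1 - expi (- \<theta>) $ k * w $ k) * szego (expi (- \<theta>)) w))"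
  \<comment> \<open>Leibniz' rule asks for a continuous family of bounded linear maps, hence the
    derivative is assembled from the coordinate projections \<open>P k\<close>.\<close>
  define fx where "fx = (\<lambda>w \<theta>. \<Sum>k\<in>UNIV. blinfun_mult_right (c k \<theta> w) o\<^sub>L P k)"
  have fx: "blinfun_apply (fx w \<theta>) v = (\<Sum>k\<in>UNIV. c k \<theta> w * v $ k)" for w \<theta> v
    by (simp add: fx_def blinfun.sum_left P)
  have gc: "continuous_on (poly_D \<times> cube) (\<lambda>p. g (snd p))"
    by (rule continuous_on_compose2[OF g]) (auto intro!: continuous_intros)
  have nz: "1 - expi (- \<theta>) $ k * w $ k \<noteq> 0" if "w \<in> poly_D" for w \<theta> k
    using mult_neq_1_of_norm[of "expi (- \<theta>) $ k" "w $ k"] that by (auto simp: poly_D_nth)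
  have e: "continuous_on A (\<lambda>p. expi (- snd p))" for A :: "((complex^3) \<times> (real^3)) set"
    by (intro continuous_intros)
  have "((\<lambda>w. integral cube (\<lambda>\<theta>. g \<theta> * szego (expi (- \<theta>)) w)) has_derivative integral cube (fx w)) (at w within poly_D)"
  proof (rule leibniz_rule[where U=poly_D])
    fix w :: "complex^3" and \<theta> assume w: "w \<in> poly_D"
    have "((\<lambda>w. szego (expi (- \<theta>)) w) has_derivative (\<lambda>v. \<Sum>k\<in>UNIV. (expi (- \<theta>) $ k * inverse (1 - expi (- \<theta>) $ k * w $ k) * szego (expi (- \<theta>)) w) * v$k)) (at w)"
      by (rule szego_has_derivative, rule mult_neq_1_of_norm) (use w in \<open>auto simp: poly_D_nth\<close>)
    from has_derivative_mult_right[OF this, of "g \<theta>"]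
    have "((\<lambda>w. g \<theta> * szego (expi (- \<theta>)) w) has_derivative blinfun_apply (fx w \<theta>)) (at w)"
      by (rule has_derivative_eq_rhs) (simp add: fun_eq_iff fx c_def sum_distrib_left mult.assoc)
    then show "((\<lambda>w. g \<theta> * szego (expi (- \<theta>)) w) has_derivative blinfun_apply (fx w \<theta>)) (at w within poly_D)"
      by (rule has_derivative_at_withinI)
  next
    fix w assume "w \<in> poly_D"
    then show "(\<lambda>\<theta>. g \<theta> * szego (expi (- \<theta>)) w) integrable_on cube"
      by (intro integrable_continuous continuous_on_mult g continuous_szego_expi)
  next
    have "continuous_on (poly_D \<times> cube) (\<lambda>p. c k (snd p) (fst p))" for k
      unfolding c_def
      by (intro continuous_on_mult gc continuous_on_inverse continuous_szego e continuous_intros ballI mult_neq_1_of_norm nz)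
         (auto simp: poly_D_nth)
    then have "continuous_on (poly_D \<times> cube) (\<lambda>p. \<Sum>k\<in>UNIV. blinfun_mult_right (c k (snd p) (fst p)) o\<^sub>L P k)"
      by (intro continuous_intros bounded_linear.continuous_on[OF bounded_linear_blinfun_mult_right])
    then show "continuous_on (poly_D \<times> cube) (\<lambda>(w, \<theta>). fx w \<theta>)"
      unfolding fx_def split_beta .
  qed (use w convex_poly_D in auto)
  then have "((\<lambda>w. integral cube (\<lambda>\<theta>. g \<theta> * szego (expi (- \<theta>)) w)) has_derivative integral cube (fx w)) (at w)"
    by (simp only: at_within_open[OF w open_poly_D])
  moreover have "blinfun_apply (integral cube (fx w)) (a *s v) = a * blinfun_apply (integral cube (fx w)) v" for a v
  proof -
    have "continuous_on cube (\<lambda>\<theta>. c k \<theta> w)" for k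
      unfolding c_def using w
      by (intro continuous_on_mult g continuous_on_inverse continuous_szego_expi continuous_intros ballI nz)
    then have "continuous_on cube (fx w)"
      unfolding fx_def
      by (intro continuous_intros bounded_linear.continuous_on[OF bounded_linear_blinfun_mult_right])
    then have i: "fx w integrable_on cube" by (rule integrable_continuous)
    have ap: "blinfun_apply (integral cube (fx w)) v = integral cube (\<lambda>\<theta>. blinfun_apply (fx w \<theta>) v)" for v
      by (rule blinfun_apply_integral[OF i])
    have "blinfun_apply (fx w \<theta>) (a *s v) = a * blinfun_apply (fx w \<theta>) v" for \<theta>
      by (simp add: fx sum_distrib_left mult_ac)
    then show ?thesis by (simp add: ap)
  qed
  ultimately show "\<exists>f'. ((\<lambda>w. integral cube (\<lambda>\<theta>. g \<theta> * szego (expi (- \<theta>)) w)) has_derivative f') (at w) \<and> (\<forall>a v. f' (a *s v) = a * f' v)"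
    by blast
qed

lemma holo3_mult_const: "holo3 f S \<Longrightarrow> holo3 (\<lambda>z. c * f z) S"
  unfolding holo3_def
proof
  fix z assume "\<forall>z\<in>S. \<exists>f'. (f has_derivative f') (at z) \<and> (\<forall>c v. f' (c *s v) = c * f' v)" "z \<in> S"
  then obtain f' where "(f has_derivative f') (at z)" "\<forall>c v. f' (c *s v) = c * f' v" by blast
  then show "\<exists>f'. ((\<lambda>z. c * f z) has_derivative f') (at z) \<and> (\<forall>c v. f' (c *s v) = c * f' v)"
    by (intro exI[of _ "\<lambda>v. c * f' v"]) (auto intro: has_derivative_mult_right)
qed

lemma holo3_diff: "holo3 f S \<Longrightarrow> holo3 g S \<Longrightarrow> holo3 (\<lambda>z. f z - g z) S"
  unfolding holo3_def
proof
  fix z assume "\<forall>z\<in>S. \<exists>f'. (f has_derivative f') (at z) \<and> (\<forall>c v. f' (c *s v) = c * f' v)"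
    "\<forall>z\<in>S. \<exists>f'. (g has_derivative f') (at z) \<and> (\<forall>c v. f' (c *s v) = c * f' v)" "z \<in> S"
  then obtain f' g' where "(f has_derivative f') (at z)" "\<forall>c v. f' (c *s v) = c * f' v"
     "(g has_derivative g') (at z)" "\<forall>c v. g' (c *s v) = c * g' v" by blast
  then show "\<exists>f'. ((\<lambda>z. f z - g z) has_derivative f') (at z) \<and> (\<forall>c v. f' (c *s v) = c * f' v)"
    by (intro exI[of _ "\<lambda>v. f' v - g' v"]) (auto intro: has_derivative_diff simp: algebra_simps)
qed

lemma holo3_dilate:
  assumes h: "holo3 h (poly_D)" and S: "\<And>z. z \<in> S \<Longrightarrow> c *s z \<in> poly_D"
  shows "holo3 (\<lambda>z. h (c *s z)) S"
  unfolding holo3_def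
proof
  fix z assume "z \<in> S"
  then obtain h' where h': "(h has_derivative h') (at (c *s z))" "\<And>a v. h' (a *s v) = a * h' v"
    using h S unfolding holo3_def by blast
  have "bounded_linear (\<lambda>z::complex^3. c *s z)"
  proof (rule bounded_linear_intro[where K="cmod c"])
    fix z :: "complex^3"
    have "norm (c *s z) = cmod c * norm z"
      by (simp add: norm_vec_def norm_mult L2_set_right_distrib)
    then show "norm (c *s z) \<le> norm z * cmod c" by simp
  qed (simp_all add: vec_eq_iff algebra_simps)
  from diff_chain_at[OF bounded_linear_imp_has_derivative[OF this] h'(1)]
  show "\<exists>f'. ((\<lambda>z. h (c *s z)) has_derivative f') (at z) \<and> (\<forall>a v. f' (a *s v) = a * f' v)"
    by (intro exI[of _ "\<lambda>v. c * h' v"]) (auto simp: o_def h'(2))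
qed

text \<open>The pointwise bound of |a - b|^2 by 2 |a|^2 + 2 |b|^2 is integrated. The constants are
  harmless, since differences only have to stay in H2 and in a fixed ball.\<close>

lemma H2_diff:
  assumes f: "f \<in> H2" and g: "g \<in> H2"
  shows "(\<lambda>z. f z - g z) \<in> H2" "H2_norm (\<lambda>z. f z - g z) \<le> sqrt (2 * (H2_norm f)\<^sup>2 + 2 * (H2_norm g)\<^sup>2)"
proof -
  have "circ_mean (\<lambda>z. f z - g z) t \<le> (sqrt (2 * (H2_norm f)\<^sup>2 + 2 * (H2_norm g)\<^sup>2))\<^sup>2" if t: "0 < t" "t < 1" for t
  proof -
    let ?R = "complex_of_real t"
    have t0: "0 \<le> t" using t by simp
    have c: "continuous_on A (\<lambda>\<theta>. f (?R *s expi \<theta>))" "continuous_on A (\<lambda>\<theta>. g (?R *s expi \<theta>))" for A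
      using continuous_dilate H2_holo3 f g t0 t by blast+
    have i: "(\<lambda>\<theta>. (cmod (f (?R *s expi \<theta>)))\<^sup>2) integrable_on cube" "(\<lambda>\<theta>. (cmod (g (?R *s expi \<theta>)))\<^sup>2) integrable_on cube"
      by (intro integrable_continuous continuous_intros c)+
    have "integral cube (\<lambda>\<theta>. (cmod (f (?R *s expi \<theta>) - g (?R *s expi \<theta>)))\<^sup>2)
      \<le> integral cube (\<lambda>\<theta>. 2 * (cmod (f (?R *s expi \<theta>)))\<^sup>2 + 2 * (cmod (g (?R *s expi \<theta>)))\<^sup>2)"
    proof (intro integral_le integrable_continuous continuous_intros c)
      fix \<theta>
      let ?a = "f (?R *s expi \<theta>)" and ?b = "g (?R *s expi \<theta>)"
      have "(cmod (?a - ?b))\<^sup>2 \<le> (cmod ?a + cmod ?b)\<^sup>2" by (intro power_mono norm_triangle_ineq4) auto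
      also have "\<dots> \<le> 2 * (cmod ?a)\<^sup>2 + 2 * (cmod ?b)\<^sup>2"
        using sum_squares_bound[of "cmod ?a" "cmod ?b"] by (simp add: power2_sum)
      finally show "(cmod (?a - ?b))\<^sup>2 \<le> 2 * (cmod ?a)\<^sup>2 + 2 * (cmod ?b)\<^sup>2" .
    qed
    also have "\<dots> = 2 * integral cube (\<lambda>\<theta>. (cmod (f (?R *s expi \<theta>)))\<^sup>2) + 2 * integral cube (\<lambda>\<theta>. (cmod (g (?R *s expi \<theta>)))\<^sup>2)"
      using i by (subst Henstock_Kurzweil_Integration.integral_add) (simp_all only: integrable_on_mult_right Henstock_Kurzweil_Integration.integral_mult_right)
    finally have "circ_mean (\<lambda>z. f z - g z) t \<le> 2 * circ_mean f t + 2 * circ_mean g t"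
      by (simp add: circ_mean_def field_simps)
    also have "\<dots> \<le> 2 * (H2_norm f)\<^sup>2 + 2 * (H2_norm g)\<^sup>2"
      using circ_mean_le_H2_norm f g t by (intro add_mono mult_left_mono) auto
    finally show ?thesis by simp
  qed
  note b = this
  from H2_norm_le[OF holo3_diff[OF H2_holo3[OF f] H2_holo3[OF g]] b]
  show "(\<lambda>z. f z - g z) \<in> H2" "H2_norm (\<lambda>z. f z - g z) \<le> sqrt (2 * (H2_norm f)\<^sup>2 + 2 * (H2_norm g)\<^sup>2)" by auto
qed

text \<open>A diagonal sequence converges on a countable dense set; equicontinuity spreads this to
  locally uniform convergence. Holomorphy of the limit and the bound on its norm follow because the
  integrals over tori of radius t < 1 pass to the limit.\<close>

lemma H2_Montel:
  assumes F: "\<And>n. F n \<in> H2" and B: "\<And>n. H2_norm (F n) \<le> B"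
  obtains g r where "g \<in> H2" "H2_norm g \<le> B" "strict_mono (r :: nat \<Rightarrow> nat)"
    "\<And>K. compact K \<Longrightarrow> K \<subseteq> poly_D \<Longrightarrow> uniform_limit K (\<lambda>n. F (r n)) g sequentially"
proof -
  have B0: "0 \<le> B" using B[of 0] H2_norm_nonneg[OF F[of 0]] by simp
  obtain T :: "(complex^3) set" where T: "countable T" "T \<subseteq> poly_D" "poly_D \<subseteq> closure T"
    using separable by blast
  have "\<forall>z\<in>poly_D. \<exists>C>0. \<forall>f\<in>H2. cmod (f z) \<le> C * H2_norm f"
  proof
    fix z :: "complex^3" assume "z \<in> poly_D"
    then obtain C where C: "0 \<le> C" "\<And>f. f \<in> H2 \<Longrightarrow> cmod (f z) \<le> C * H2_norm f"
      using H2_eval_bound by blast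
    have "cmod (f z) \<le> (C + 1) * H2_norm f" if "f \<in> H2" for f
      using C(2)[OF that] H2_norm_nonneg[OF that] by (simp add: algebra_simps)
    then show "\<exists>C>0. \<forall>f\<in>H2. cmod (f z) \<le> C * H2_norm f"
      using C(1) by (intro exI[of _ "C + 1"]) auto
  qed
  then obtain C where C: "\<And>z. z \<in> poly_D \<Longrightarrow> 0 < C z" "\<And>z f. z \<in> poly_D \<Longrightarrow> f \<in> H2 \<Longrightarrow> cmod (f z) \<le> C z * H2_norm f"
    by metis
  \<comment> \<open>The diagonal principle wants one bound for all points, whereas evaluations are
    bounded point by point; dividing by \<open>C x\<close> equalises them.\<close>
  obtain r where r: "strict_mono (r::nat\<Rightarrow>nat)" and rT: "\<And>x. x \<in> T \<Longrightarrow> \<exists>l. (\<lambda>n. F (r n) x / C x) \<longlonglongrightarrow> l"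
  proof (rule function_convergent_subsequence[OF T(1), of "\<lambda>n x. F n x / C x" B])
    fix n x assume "x \<in> T"
    then have x: "x \<in> poly_D" using T by blast
    have "cmod (F n x) \<le> C x * B"
      using C(2)[OF x F[of n]] B[of n] C(1)[OF x] by (meson less_imp_le mult_left_mono order_trans)
    then show "cmod (F n x / C x) \<le> B"
      using C(1)[OF x] by (simp add: norm_divide field_simps)
  qed blast
  have convT: "convergent (\<lambda>n. F (r n) x)" if xT: "x \<in> T" for x
  proof -
    have "x \<in> poly_D" using xT T by blast
    obtain l where "(\<lambda>n. F (r n) x / C x) \<longlonglongrightarrow> l" using rT[OF xT] by blast
    from tendsto_mult_left[OF this, of "C x"] show ?thesis
      using C(1)[OF \<open>x \<in> poly_D\<close>] by (auto simp: convergent_def)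
  qed
  have cau: "\<exists>d>0. \<exists>N. \<forall>z'. dist z' z < d \<longrightarrow> z' \<in> poly_D \<and> (\<forall>m\<ge>N. \<forall>n\<ge>N. cmod (F (r m) z' - F (r n) z') < e)"
    if z: "z \<in> poly_D" and e: "0 < e" for z e
  proof -
    \<comment> \<open>The comparison of two members at z' passes through z, the dense point x, and
      back: five differences.\<close>
    have e5: "0 < e / 5" using e by simp
    obtain d where d: "0 < d" "\<And>z'. dist z' z < d \<Longrightarrow> z' \<in> poly_D"
      "\<And>z' f. dist z' z < d \<Longrightarrow> f \<in> H2 \<Longrightarrow> H2_norm f \<le> B \<Longrightarrow> cmod (f z' - f z) < e/5"
      using H2_equicontinuous_ex[OF z e5, of B] by metis
    obtain x where x: "x \<in> T" "dist x z < d"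
      using T(3) z d(1) by (meson closure_approachable subsetD)
    have "Cauchy (\<lambda>n. F (r n) x)" using convT[OF x(1)] by (simp add: Cauchy_convergent_iff)
    then obtain N where N: "\<And>m n. m \<ge> N \<Longrightarrow> n \<ge> N \<Longrightarrow> cmod (F (r m) x - F (r n) x) < e/5"
      using e5 by (meson CauchyD)
    have "cmod (F (r m) z' - F (r n) z') < e" if z': "dist z' z < d" and mn: "m \<ge> N" "n \<ge> N" for z' m n
    proof -
      let ?m = "F (r m)" and ?n = "F (r n)"
      have "?m z' - ?n z' = (?m z' - ?m z) - (?m x - ?m z) + (?m x - ?n x) + (?n x - ?n z) - (?n z' - ?n z)"
        by simp
      also have "cmod \<dots> \<le> cmod (?m z' - ?m z) + cmod (?m x - ?m z) + cmod (?m x - ?n x) + cmod (?n x - ?n z) + cmod (?n z' - ?n z)"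
        by (smt (verit) norm_triangle_ineq norm_triangle_ineq4)
      also have "\<dots> < e/5 + e/5 + e/5 + e/5 + e/5"
        by (intro add_strict_mono d(3) z' x N mn F B)
      finally show ?thesis by simp
    qed
    then show ?thesis using d(1,2) by blast
  qed
  define g where "g = (\<lambda>z. lim (\<lambda>n. F (r n) z))"
  have lim: "(\<lambda>n. F (r n) z) \<longlonglongrightarrow> g z" if z: "z \<in> poly_D" for z
  proof -
    have "Cauchy (\<lambda>n. F (r n) z)"
    proof (rule CauchyI)
      fix e :: real assume "0 < e"
      from cau[OF z this] show "\<exists>M. \<forall>m\<ge>M. \<forall>n\<ge>M. cmod (F (r m) z - F (r n) z) < e"
        by (metis dist_self)
    qed
    then show ?thesis by (simp add: g_def Cauchy_convergent_iff convergent_LIMSEQ_iff)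
  qed
  have unif: "uniform_limit K (\<lambda>n. F (r n)) g sequentially" if K: "compact K" "K \<subseteq> poly_D" for K
  proof (rule uniform_limitI)
    fix e :: real assume "0 < e"
    then have e2: "0 < e / 2" by simp
    have "\<forall>z\<in>K. \<exists>d>0. \<exists>N. \<forall>z'. dist z' z < d \<longrightarrow> z' \<in> poly_D \<and> (\<forall>m\<ge>N. \<forall>n\<ge>N. cmod (F (r m) z' - F (r n) z') < e/2)"
      using cau[OF _ e2] K by blast
    then obtain d N where dN: "\<And>z. z \<in> K \<Longrightarrow> 0 < (d z :: real)"
      "\<And>z z' m n. z \<in> K \<Longrightarrow> dist z' z < d z \<Longrightarrow> m \<ge> N z \<Longrightarrow> n \<ge> N z \<Longrightarrow> cmod (F (r m) z' - F (r n) z') < e/2"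
      by metis
    obtain D where D: "D \<subseteq> K" "finite D" "K \<subseteq> (\<Union>z\<in>D. ball z (d z))"
      by (rule compactE_image[OF K(1), of K "\<lambda>z. ball z (d z)"]) (use dN(1) in auto)
    define M where "M = Max (insert 0 (N ` D))"
    have M: "N z \<le> M" if "z \<in> D" for z unfolding M_def using that D(2) by (intro Max_ge) auto
    show "\<forall>\<^sub>F n in sequentially. \<forall>x\<in>K. dist (F (r n) x) (g x) < e"
      unfolding eventually_sequentially
    proof (intro exI[of _ M] allI impI ballI)
      fix n x assume n: "M \<le> n" and x: "x \<in> K"
      then obtain z where z: "z \<in> D" "dist x z < d z" using D(3) by (auto simp: dist_commute)
      have le: "cmod (F (r n) x - F (r m) x) \<le> e/2" if "m \<ge> M" for m
        using dN(2)[of z x n m] z D(1) M[OF z(1)] n that by force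
      have "(\<lambda>m. cmod (F (r n) x - F (r m) x)) \<longlonglongrightarrow> cmod (F (r n) x - g x)"
        using lim x K by (intro tendsto_intros) auto
      then have "cmod (F (r n) x - g x) \<le> e/2"
        by (rule LIMSEQ_le_const2) (use le in blast)
      then show "dist (F (r n) x) (g x) < e" using \<open>0 < e\<close> by (simp add: dist_norm)
    qed
  qed
  have torus: "uniform_limit cube (\<lambda>n \<theta>. F (r n) (complex_of_real t *s expi \<theta>)) (\<lambda>\<theta>. g (complex_of_real t *s expi \<theta>)) sequentially"
    if t: "0 \<le> t" "t < 1" for t
  proof -
    let ?e = "\<lambda>\<theta>. complex_of_real t *s expi \<theta>"
    have "compact (?e ` cube)"
      by (intro compact_continuous_image continuous_intros compact_cbox continuous_on_id)
    moreover have "?e ` cube \<subseteq> poly_D" using t by (auto intro!: scale_cD_D expi_in_cD)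
    ultimately have "uniform_limit (?e ` cube) (\<lambda>n. F (r n)) g sequentially" by (rule unif)
    then show ?thesis by (auto simp: uniform_limit_iff)
  qed
  have gcont: "continuous_on cube (\<lambda>\<theta>. g (complex_of_real t *s expi \<theta>))" if t: "0 \<le> t" "t < 1" for t
    by (rule uniform_limit_theorem[OF _ torus[OF t]]) (auto intro!: always_eventually continuous_dilate H2_holo3 F t)
  \<comment> \<open>Cauchy's formula survives uniform convergence on the torus, so near any point g
    is a Cauchy integral of a continuous function; this is how its holomorphy is obtained
    below.\<close>
  have cauchy: "integral cube (\<lambda>\<theta>. g (complex_of_real t *s expi \<theta>) * szego (expi (- \<theta>)) w) = (2 * pi)^3 * g (complex_of_real t *s w)"
    if t: "0 < t" "t < 1" and w: "w \<in> poly_D" for t w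
  proof -
    have t0: "0 \<le> t" using t by simp
    have "bounded ((\<lambda>\<theta>. szego (expi (- \<theta>)) w) ` cube)" "bounded ((\<lambda>\<theta>. g (complex_of_real t *s expi \<theta>)) ` cube)"
      by (intro compact_imp_bounded compact_continuous_image continuous_szego_expi w gcont t0 t(2) compact_cbox)+
    then have ul: "uniform_limit cube (\<lambda>n \<theta>. F (r n) (complex_of_real t *s expi \<theta>) * szego (expi (- \<theta>)) w)
        (\<lambda>\<theta>. g (complex_of_real t *s expi \<theta>) * szego (expi (- \<theta>)) w) sequentially"
      by (intro uniform_lim_mult torus t0 t uniform_limit_const)
    have "\<And>n. continuous_on cube (\<lambda>\<theta>. F (r n) (complex_of_real t *s expi \<theta>) * szego (expi (- \<theta>)) w)"
      by (intro continuous_on_mult continuous_dilate H2_holo3 F t0 t continuous_szego_expi w)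
    from uniform_limit_integral_cbox[OF ul this] obtain I J where
      I: "\<And>n. ((\<lambda>\<theta>. F (r n) (complex_of_real t *s expi \<theta>) * szego (expi (- \<theta>)) w) has_integral I n) cube"
      and J: "((\<lambda>\<theta>. g (complex_of_real t *s expi \<theta>) * szego (expi (- \<theta>)) w) has_integral J) cube" and IJ: "I \<longlonglongrightarrow> J"
      by auto
    have "I n = (2 * pi)^3 * F (r n) (complex_of_real t *s w)" for n
      using integral_unique[OF I[of n]] cauchy_polydisc[OF H2_holo3[OF F[of "r n"]] t0 t(2) w] by simp
    then have "I = (\<lambda>n. (2 * pi)^3 * F (r n) (complex_of_real t *s w))" by auto
    moreover have "(\<lambda>n. (2 * pi)^3 * F (r n) (complex_of_real t *s w)) \<longlonglongrightarrow> (2 * pi)^3 * g (complex_of_real t *s w)"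
      by (intro tendsto_intros lim scale_D_D w) (use t in auto)
    ultimately have "J = (2 * pi)^3 * g (complex_of_real t *s w)" using IJ LIMSEQ_unique by blast
    then show ?thesis using integral_unique[OF J] by simp
  qed
  have hg: "holo3 g poly_D"
    unfolding holo3_def
  proof
    fix z :: "complex^3" assume z: "z \<in> poly_D"
    obtain t where t: "0 < t" "t < 1" and tz: "complex_of_real (1/t) *s z \<in> poly_D"
      using ex_dilate[OF z] by blast
    have t0: "0 \<le> t" using t by simp
    define U where "U = (\<lambda>z'. complex_of_real (1/t) *s z') -` poly_D"
    have "open U" unfolding U_def
      by (rule open_vimage[OF open_poly_D]) (intro continuous_intros)
    let ?h = "\<lambda>w. integral cube (\<lambda>\<theta>. g (complex_of_real t *s expi \<theta>) * szego (expi (- \<theta>)) w)"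
    have "holo3 (\<lambda>z. inverse ((2*pi)^3) * ?h (complex_of_real (1/t) *s z)) U"
      by (intro holo3_mult_const holo3_dilate holo3_cauchy_integral gcont t0 t) (simp add: U_def)
    moreover have zU: "z \<in> U" using tz by (simp add: U_def)
    ultimately obtain g' where g': "((\<lambda>z. inverse ((2*pi)^3) * ?h (complex_of_real (1/t) *s z)) has_derivative g') (at z)"
        "\<forall>c v. g' (c *s v) = c * g' v"
      unfolding holo3_def by blast
    have "inverse ((2*pi)^3) * ?h (complex_of_real (1/t) *s z') = g z'" if "z' \<in> U" for z'
      using cauchy[OF t, of "complex_of_real (1/t) *s z'"] that smult_inverse[of t z'] t by (simp add: U_def)
    from has_derivative_transform_within_open[OF g'(1) \<open>open U\<close> zU this]
    have "(g has_derivative g') (at z)" .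
    then show "\<exists>f'. (g has_derivative f') (at z) \<and> (\<forall>c v. f' (c *s v) = c * f' v)" using g'(2) by blast
  qed
  have "circ_mean g t \<le> B\<^sup>2" if t: "0 < t" "t < 1" for t
  proof -
    have t0: "0 \<le> t" using t by simp
    let ?e = "\<lambda>\<theta>. complex_of_real t *s expi \<theta>"
    \<comment> \<open>The squared modulus is written as a product with the conjugate, so that
      uniform convergence passes through the product to the integral.\<close>
    have "bounded ((\<lambda>\<theta>. cnj (g (?e \<theta>))) ` cube)" "bounded ((\<lambda>\<theta>. g (?e \<theta>)) ` cube)"
      by (intro compact_imp_bounded compact_continuous_image continuous_intros gcont t0 t(2) compact_cbox)+
    moreover have "uniform_limit cube (\<lambda>n \<theta>. cnj (F (r n) (?e \<theta>))) (\<lambda>\<theta>. cnj (g (?e \<theta>))) sequentially"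
      using torus[OF t0 t(2)] by (simp add: uniform_limit_iff dist_norm flip: complex_cnj_diff)
    ultimately have ul: "uniform_limit cube (\<lambda>n \<theta>. F (r n) (?e \<theta>) * cnj (F (r n) (?e \<theta>))) (\<lambda>\<theta>. g (?e \<theta>) * cnj (g (?e \<theta>))) sequentially"
      by (intro uniform_lim_mult torus t0 t)
    have "\<And>n. continuous_on cube (\<lambda>\<theta>. F (r n) (?e \<theta>) * cnj (F (r n) (?e \<theta>)))"
      by (intro continuous_intros continuous_dilate H2_holo3 F t0 t)
    from uniform_limit_integral_cbox[OF ul this] obtain I J where
      I: "\<And>n. ((\<lambda>\<theta>. F (r n) (?e \<theta>) * cnj (F (r n) (?e \<theta>))) has_integral I n) cube"
      and J: "((\<lambda>\<theta>. g (?e \<theta>) * cnj (g (?e \<theta>))) has_integral J) cube" and IJ: "I \<longlonglongrightarrow> J"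
      by auto
    have sq: "Re (z * cnj z) = (cmod z)\<^sup>2" for z
      by (simp only: Re_complex_of_real flip: complex_norm_square)
    have J': "((\<lambda>\<theta>. (cmod (g (?e \<theta>)))\<^sup>2) has_integral Re J) cube"
      using has_integral_linear[OF J bounded_linear_Re] by (simp only: o_def sq)
    have I': "((\<lambda>\<theta>. (cmod (F (r n) (?e \<theta>)))\<^sup>2) has_integral Re (I n)) cube" for n
      using has_integral_linear[OF I bounded_linear_Re] by (simp only: o_def sq)
    have "Re (I n) \<le> (2*pi)^3 * B\<^sup>2" for n
    proof -
      have "Re (I n) \<le> (2*pi)^3 * (H2_norm (F (r n)))\<^sup>2"
        using integral_dilate_le[OF F[of "r n"] t] integral_unique[OF I'[of n]] by simp
      also have "\<dots> \<le> (2*pi)^3 * B\<^sup>2"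
        using B H2_norm_nonneg[OF F] by (intro mult_left_mono power_mono) auto
      finally show ?thesis .
    qed
    then have "Re J \<le> (2*pi)^3 * B\<^sup>2"
      using tendsto_Re[OF IJ] by (intro LIMSEQ_le_const2) auto
    then show ?thesis using integral_unique[OF J'] by (simp add: circ_mean_def field_simps)
  qed
  from H2_norm_le[OF hg this B0] show ?thesis using that r unif by blast
qed

section \<open>Derivatives on the closed polydisc and the boundary Schwarz lemma\<close>

lemma Ck_upto_bounded_linear:
  assumes T: "bounded_linear T"
  shows "Ck_upto k f D C \<Longrightarrow> Ck_upto k (\<lambda>x. T (f x)) D C"
proof (induction k arbitrary: f)
  case 0
  then show ?case by (simp add: bounded_linear.continuous_on[OF T])
next
  case (Suc k)
  then obtain f' where f': "\<forall>x\<in>D. (f has_derivative f' x) (at x)" "\<forall>v. Ck_upto k (\<lambda>x. f' x v) D C"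
    by auto
  have "\<forall>x\<in>D. ((\<lambda>x. T (f x)) has_derivative (\<lambda>v. T (f' x v))) (at x)"
    using f'(1) bounded_linear.has_derivative[OF T] by blast
  moreover have "\<forall>v. Ck_upto k (\<lambda>x. T (f' x v)) D C" using f'(2) Suc.IH by blast
  moreover have "continuous_on C (\<lambda>x. T (f x))" using Suc.prems by (simp add: bounded_linear.continuous_on[OF T])
  ultimately show ?case by auto
qed

lemma Ck_upto_continuous: "Ck_upto k f D C \<Longrightarrow> continuous_on C f"
  by (cases k) auto

lemma Ck_upto_mono: "Ck_upto (Suc k) f D C \<Longrightarrow> Ck_upto k f D C"
proof (induction k arbitrary: f)
  case (Suc k)
  then show ?case by (subst Ck_upto.simps) (metis Ck_upto.simps(2))
qed auto

text \<open>Points of the boundary are approached along radii from the open polydisc, so identities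
  between continuous functions carry over from the inside.\<close>

lemma poly_cD_radial_limit:
  assumes h: "continuous_on poly_cD h" and x: "x \<in> poly_cD"
  shows "((\<lambda>t. h (complex_of_real t *s x)) \<longlongrightarrow> h x) (at_left 1)"
proof -
  have "continuous_on {0..1} (\<lambda>t. h (complex_of_real t *s x))"
    by (rule continuous_on_compose2[OF h]) (auto intro!: continuous_intros scale_cD x)
  from this[unfolded continuous_on, rule_format, of 1] have "((\<lambda>t. h (complex_of_real t *s x)) \<longlongrightarrow> h x) (at 1 within {0..1})"
    by simp
  moreover have "at 1 within {0..1} = at_left (1::real)"
    by (rule at_within_Icc_at_left) simp
  ultimately show ?thesis by simp
qed

lemma limit_eq_of_eventually_eq:
  fixes a b :: "'b::t2_space"
  assumes "(f \<longlongrightarrow> a) F" "(g \<longlongrightarrow> b) F" "eventually (\<lambda>t. f t = g t) F" "F \<noteq> bot"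
  shows "a = b"
proof -
  have "(g \<longlongrightarrow> a) F" using assms(1) tendsto_cong[OF assms(3), of a] by simp
  then show ?thesis using tendsto_unique[OF assms(4) _ assms(2)] by simp
qed

lemma eventually_at_left_unit: "eventually (\<lambda>t::real. 0 < t \<and> t < 1) (at_left 1)"
  using eventually_at_left_real[of 0 1] by (auto elim: eventually_mono)

text \<open>The derivative in the open polydisc extends to the closed polydisc as the derivative within it:
  apply the mean value inequality on the dilated segment from \<open>t x\<close> to \<open>t y\<close> and let \<open>t \<rightarrow> 1\<close>.\<close>

lemma boundary_derivative:
  fixes f :: "complex^3 \<Rightarrow> 'b::real_normed_vector"
  assumes f: "continuous_on poly_cD f"
    and f': "\<And>x. x \<in> poly_D \<Longrightarrow> (f has_derivative f' x) (at x)"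
    and c: "\<And>v. continuous_on poly_cD (\<lambda>x. f' x v)" and x: "x \<in> poly_cD"
  shows "(f has_derivative f' x) (at x within poly_cD)"
proof -
  \<comment> \<open>At a boundary point nothing but continuity in x for each fixed v is given;
    linearity in v is inherited as a radial limit.\<close>
  have lin: "linear (f' x)"
  proof (rule linearI)
    fix a b
    have "((\<lambda>t. f' (complex_of_real t *s x) (a + b)) \<longlongrightarrow> f' x (a + b)) (at_left 1)"
      "((\<lambda>t. f' (complex_of_real t *s x) a + f' (complex_of_real t *s x) b) \<longlongrightarrow> f' x a + f' x b) (at_left 1)"
      by (intro tendsto_intros poly_cD_radial_limit c x)+
    moreover have "eventually (\<lambda>t. f' (complex_of_real t *s x) (a + b) = f' (complex_of_real t *s x) a + f' (complex_of_real t *s x) b) (at_left 1)"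
      using eventually_at_left_unit
    proof eventually_elim
      case (elim t)
      then have "complex_of_real t *s x \<in> poly_D" using x by (intro scale_cD_D) auto
      from has_derivative_linear[OF f'[OF this]] show ?case by (rule linear_add)
    qed
    ultimately show "f' x (a + b) = f' x a + f' x b"
      by (rule limit_eq_of_eventually_eq) simp
  next
    fix r a
    have "((\<lambda>t. f' (complex_of_real t *s x) (r *\<^sub>R a)) \<longlongrightarrow> f' x (r *\<^sub>R a)) (at_left 1)"
      "((\<lambda>t. r *\<^sub>R f' (complex_of_real t *s x) a) \<longlongrightarrow> r *\<^sub>R f' x a) (at_left 1)"
      by (intro tendsto_intros poly_cD_radial_limit c x)+
    moreover have "eventually (\<lambda>t. f' (complex_of_real t *s x) (r *\<^sub>R a) = r *\<^sub>R f' (complex_of_real t *s x) a) (at_left 1)"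
      using eventually_at_left_unit
    proof eventually_elim
      case (elim t)
      then have "complex_of_real t *s x \<in> poly_D" using x by (intro scale_cD_D) auto
      from has_derivative_linear[OF f'[OF this]] show ?case by (rule linear_scale)
    qed
    ultimately show "f' x (r *\<^sub>R a) = r *\<^sub>R f' x a"
      by (rule limit_eq_of_eventually_eq) simp
  qed
  show ?thesis
    unfolding has_derivative_within_alt
  proof (intro conjI allI impI)
    show bl: "bounded_linear (f' x)" using lin by (simp add: linear_conv_bounded_linear)
    fix e :: real assume e: "0 < e"
    \<comment> \<open>\<open>S p\<close> dominates the operator norm of the difference of the
      derivatives at p and x, and is visibly continuous in p.\<close>
    define S where "S = (\<lambda>p. \<Sum>b\<in>Basis. norm (f' p b - f' x b))"
    have "continuous_on poly_cD S" unfolding S_def by (intro continuous_intros c)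
    moreover have "S x = 0" by (simp add: S_def)
    ultimately obtain d where d: "0 < d" "\<And>p. p \<in> poly_cD \<Longrightarrow> dist p x < d \<Longrightarrow> S p < e"
      using x e unfolding continuous_on_iff
      by (metis abs_less_iff dist_real_def diff_zero)
    show "\<exists>d>0. \<forall>y\<in>poly_cD. norm (y - x) < d \<longrightarrow> norm (f y - f x - f' x (y - x)) \<le> e * norm (y - x)"
    proof (intro exI[of _ d] conjI ballI impI d(1))
      fix y assume y: "y \<in> poly_cD" "norm (y - x) < d"
      \<comment> \<open>Subtracting the candidate for the linear part leaves a function whose
        derivative near x has norm at most e.\<close>
      define g where "g = (\<lambda>p. f p - f' x p)"
      have b: "norm (g p - g q) \<le> e * norm (p - q)" if pq: "p \<in> poly_D \<inter> ball x d" "q \<in> poly_D \<inter> ball x d" for p q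
      proof (rule differentiable_bound[where S="poly_D \<inter> ball x d"])
        show "convex (poly_D \<inter> ball x d)" by (intro convex_Int convex_poly_D convex_ball)
        fix p assume p: "p \<in> poly_D \<inter> ball x d"
        show "(g has_derivative (\<lambda>v. f' p v - f' x v)) (at p within poly_D \<inter> ball x d)"
          unfolding g_def using p
          by (intro has_derivative_diff has_derivative_at_withinI[OF f'] bounded_linear_imp_has_derivative bl) auto
        show "onorm (\<lambda>v. f' p v - f' x v) \<le> e"
        proof (rule onorm_le)
          fix v :: "complex^3"
          have lp: "linear (\<lambda>v. f' p v - f' x v)"
            using has_derivative_linear[OF f'] p lin by (intro linear_compose_sub) auto
          define T where "T = (\<lambda>v. f' p v - f' x v)"
          have "T v = T (\<Sum>b\<in>Basis. (v \<bullet> b) *\<^sub>R b)" by (simp add: euclidean_representation)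
          also have "\<dots> = (\<Sum>b\<in>Basis. (v \<bullet> b) *\<^sub>R T b)"
            using lp by (simp only: linear_sum linear_scale flip: T_def)
          finally have "f' p v - f' x v = (\<Sum>b\<in>Basis. (v \<bullet> b) *\<^sub>R (f' p b - f' x b))"
            by (simp add: T_def)
          also have "norm \<dots> \<le> (\<Sum>b\<in>Basis. norm v * norm (f' p b - f' x b))"
            by (rule sum_norm_le) (simp add: Basis_le_norm mult_right_mono)
          also have "\<dots> = norm v * S p" by (simp add: S_def sum_distrib_left)
          also have "\<dots> \<le> norm v * e"
            using d(2)[of p] p poly_D_subset_cD by (intro mult_left_mono) (auto simp: dist_commute less_imp_le)
          finally show "norm (f' p v - f' x v) \<le> e * norm v" by (simp add: mult.commute)
        qed
      qed (use pq in auto)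
      have gc: "continuous_on poly_cD g"
        unfolding g_def by (intro continuous_intros f linear_continuous_on bl)
      have "((\<lambda>t. norm (g (complex_of_real t *s y) - g (complex_of_real t *s x))) \<longlongrightarrow> norm (g y - g x)) (at_left 1)"
        by (intro tendsto_intros poly_cD_radial_limit gc x y)
      moreover have "((\<lambda>t. e * norm (complex_of_real t *s y - complex_of_real t *s x)) \<longlongrightarrow> e * norm (y - x)) (at_left 1)"
        by (intro tendsto_intros poly_cD_radial_limit[where h="\<lambda>x. x"] x y continuous_on_id)
      moreover have "eventually (\<lambda>t. norm (g (complex_of_real t *s y) - g (complex_of_real t *s x)) \<le> e * norm (complex_of_real t *s y - complex_of_real t *s x)) (at_left 1)"
      proof -
        have "eventually (\<lambda>t. dist (complex_of_real t *s y) x < d) (at_left 1)" "eventually (\<lambda>t. dist (complex_of_real t *s x) x < d) (at_left 1)"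
          by (rule order_tendstoD(2)[OF tendsto_dist[OF poly_cD_radial_limit[where h="\<lambda>x. x"] tendsto_const]];
              use d(1) x y in \<open>auto simp: dist_norm\<close>)+
        then show ?thesis using eventually_at_left_unit
        proof eventually_elim
          case (elim t)
          then show ?case using x y by (intro b) (auto intro!: scale_cD_D simp: dist_commute)
        qed
      qed
      ultimately have "norm (g y - g x) \<le> e * norm (y - x)"
        by (intro tendsto_le[of "at_left (1::real)"]) auto
      then show "norm (f y - f x - f' x (y - x)) \<le> e * norm (y - x)"
        by (simp add: g_def linear_diff[OF lin] algebra_simps)
    qed
  qed
qed

lemma C1_boundary:
  fixes f :: "complex^3 \<Rightarrow> 'b::real_normed_vector"
  assumes "Ck_upto (Suc k) f poly_D poly_cD"
  obtains f' where "\<And>x. x \<in> poly_cD \<Longrightarrow> (f has_derivative f' x) (at x within poly_cD)" "\<And>v. Ck_upto k (\<lambda>x. f' x v) poly_D poly_cD"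
proof -
  obtain f' where f': "\<forall>x\<in>poly_D. (f has_derivative f' x) (at x)" "\<forall>v. Ck_upto k (\<lambda>x. f' x v) poly_D poly_cD"
    and f: "continuous_on poly_cD f"
    using assms by auto
  have "(f has_derivative f' x) (at x within poly_cD)" if "x \<in> poly_cD" for x
    by (rule boundary_derivative[OF f _ _ that]) (use f' Ck_upto_continuous in blast)+
  then show ?thesis using that f'(2) by blast
qed

text \<open>Inside, uniqueness identifies the derivative with the complex linear one; radial limits
  extend this to the boundary.\<close>

lemma boundary_derivative_complex_linear:
  assumes h: "holo3 f poly_D" and d: "\<And>x. x \<in> poly_cD \<Longrightarrow> (f has_derivative f' x) (at x within poly_cD)"
    and c: "\<And>v. continuous_on poly_cD (\<lambda>x. f' x v)" and x: "x \<in> poly_cD"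
  shows "f' x (a *s v) = a * f' x v"
proof -
  have D: "f' x (a *s v) = a * f' x v" if x: "x \<in> poly_D" for x
  proof -
    obtain g where g: "(f has_derivative g) (at x)" "\<forall>c v. g (c *s v) = c * g v"
      using h x unfolding holo3_def by blast
    have "(f has_derivative f' x) (at x within poly_D)"
      using d[of x] x poly_D_subset_cD has_derivative_subset by blast
    then have "(f has_derivative f' x) (at x)" by (simp only: at_within_open[OF x open_poly_D])
    then have "f' x = g" using g(1) by (rule has_derivative_unique)
    then show ?thesis using g(2) by simp
  qed
  have "((\<lambda>t. f' (complex_of_real t *s x) (a *s v)) \<longlongrightarrow> f' x (a *s v)) (at_left 1)"
    "((\<lambda>t. a * f' (complex_of_real t *s x) v) \<longlongrightarrow> a * f' x v) (at_left 1)"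
    by (intro tendsto_intros poly_cD_radial_limit c x)+
  moreover have "eventually (\<lambda>t. f' (complex_of_real t *s x) (a *s v) = a * f' (complex_of_real t *s x) v) (at_left 1)"
    using eventually_at_left_unit
  proof eventually_elim
    case (elim t)
    then show ?case using x by (intro D scale_cD_D) auto
  qed
  ultimately show ?thesis
    by (rule limit_eq_of_eventually_eq) simp
qed

lemma vec_decomp: "(v :: complex^3) = (\<Sum>k\<in>UNIV. (v$k) *s axis k 1)"
  by (simp add: basis_expansion)

text \<open>Complex linearity of the outer derivative turns the real chain rule into a complex
  derivative. The curve may touch the boundary, hence derivatives within sets throughout.\<close>

lemma chain_boundary:
  assumes d: "(f has_derivative f') (at (\<gamma> z) within poly_cD)" and l: "\<And>a v. f' (a *s v) = a * f' v"
    and \<gamma>: "\<And>k. ((\<lambda>z. \<gamma> z $ k) has_field_derivative \<gamma>' k) (at z within S)" and sub: "\<gamma> ` S \<subseteq> poly_cD"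
  shows "((\<lambda>z. f (\<gamma> z)) has_field_derivative (\<Sum>k\<in>UNIV. \<gamma>' k * f' (axis k 1))) (at z within S)"
proof -
  have "(\<gamma> has_derivative (\<lambda>c. \<chi> k. \<gamma>' k * c)) (at z within S)"
    using \<gamma> unfolding has_field_derivative_def
    by (subst has_derivative_componentwise_within) (auto simp: Basis_vec_def inner_axis axis_eq_axis intro!: has_derivative_inner_left)
  from has_derivative_in_compose[OF this has_derivative_subset[OF d sub]]
  have "((\<lambda>z. f (\<gamma> z)) has_derivative (\<lambda>c. f' (\<chi> k. \<gamma>' k * c))) (at z within S)" .
  moreover have "f' (\<chi> k. \<gamma>' k * c) = (\<Sum>k\<in>UNIV. \<gamma>' k * f' (axis k 1)) * c" for c
  proof -
    have lin: "linear f'" by (rule has_derivative_linear[OF d])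
    have "f' (\<chi> k. \<gamma>' k * c) = f' (\<Sum>k\<in>UNIV. (\<gamma>' k * c) *s axis k 1)"
      by (subst vec_decomp) simp
    also have "\<dots> = (\<Sum>k\<in>UNIV. (\<gamma>' k * c) * f' (axis k 1))"
      by (simp add: linear_sum[OF lin] l)
    finally show ?thesis by (simp add: sum_distrib_right sum_distrib_left mult_ac)
  qed
  ultimately show ?thesis unfolding has_field_derivative_def by simp
qed

text \<open>The point 1 is a limit point of the closed disc, so a derivative within it is unique;
  the definite description in \<open>cpartial\<close> depends on this.\<close>

lemma has_field_derivative_cball_unique:
  assumes "(f has_field_derivative d) (at 1 within cball 0 (1::real))" "(f has_field_derivative d') (at 1 within cball 0 1)"
  shows "d = (d' :: complex)"
proof -
  have "at (1::complex) within cball 0 1 \<noteq> bot"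
    using islimpt_subset[OF islimpt_ball[of 1 "0::complex" 1, THEN iffD2] ball_subset_cball]
    by (simp add: trivial_limit_within)
  then show ?thesis using assms unfolding has_field_derivative_iff by (rule tendsto_unique)
qed

lemma cpartial_ttilde:
  assumes d: "\<And>x. x \<in> poly_cD \<Longrightarrow> (g has_derivative g' x) (at x within poly_cD)"
    and l: "\<And>x a v. x \<in> poly_cD \<Longrightarrow> g' x (a *s v) = a * g' x v" and \<xi>: "\<xi> \<in> torus3"
  shows "cpartial (ttilde g \<xi>) one3 k = cnj (g \<xi>) * (\<xi> $ k * g' \<xi> (axis k 1))"
proof -
  define \<gamma> where "\<gamma> = (\<lambda>w. pmul \<xi> (\<chi> i. if i = k then w else one3 $ i))"
  have \<xi>1: "cmod (\<xi> $ i) = 1" for i using \<xi> by (simp add: torus3_def)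
  have g1: "\<gamma> 1 = \<xi>" by (simp add: \<gamma>_def vec_eq_iff one3_def)
  have "((\<lambda>w. g (\<gamma> w)) has_field_derivative (\<Sum>i\<in>UNIV. (if i = k then \<xi> $ k else 0) * g' \<xi> (axis i 1))) (at 1 within cball 0 1)"
  proof (rule chain_boundary)
    show "(g has_derivative g' \<xi>) (at (\<gamma> 1) within poly_cD)"
      unfolding g1 by (rule d) (use \<xi> torus3_subset_cD in blast)
    show "((\<lambda>z. \<gamma> z $ i) has_field_derivative (if i = k then \<xi> $ k else 0)) (at 1 within cball 0 1)" for i
      by (auto simp: \<gamma>_def intro!: derivative_eq_intros)
    show "\<gamma> ` cball 0 1 \<subseteq> poly_cD"
      by (auto simp: poly_cD_def \<gamma>_def norm_mult \<xi>1 one3_def)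
  qed (use l \<xi> torus3_subset_cD in blast)
  moreover have "(\<Sum>i\<in>UNIV. (if i = k then \<xi> $ k else 0) * g' \<xi> (axis i 1)) = \<xi> $ k * g' \<xi> (axis k 1)"
    by (subst sum.remove[of _ k]) (auto intro!: sum.neutral)
  ultimately have "((\<lambda>w. g (\<gamma> w)) has_field_derivative \<xi> $ k * g' \<xi> (axis k 1)) (at 1 within cball 0 1)"
    by simp
  from DERIV_cmult[OF this, of "cnj (g \<xi>)"]
  have *: "((\<lambda>w. ttilde g \<xi> (\<chi> i. if i = k then w else one3 $ i)) has_field_derivative cnj (g \<xi>) * (\<xi> $ k * g' \<xi> (axis k 1))) (at 1 within cball 0 1)"
    unfolding ttilde_def \<gamma>_def .
  have one: "one3 $ k = 1" by (simp add: one3_def)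
  show ?thesis
    unfolding cpartial_def one
    by (rule the_equality, rule *, erule has_field_derivative_cball_unique[OF _ *])
qed

definition tangent :: "complex^3 \<Rightarrow> real^3 \<Rightarrow> real^3 \<Rightarrow> complex^3" where
  "tangent \<xi> \<theta> v = (\<chi> k. of_real (v$k) * (\<i> * (\<xi>$k * cis (\<theta>$k))))"

lemma torus_derivative: "((\<lambda>\<theta>. pmul \<xi> (expi \<theta>)) has_derivative tangent \<xi> \<theta>) (at \<theta>)"
proof -
  have "((\<lambda>\<theta>. \<xi>$k * cis (\<theta>$k)) has_derivative (\<lambda>v. of_real (v$k) * (\<i> * (\<xi>$k * cis (\<theta>$k))))) (at \<theta>)" for k
  proof -
    have "((\<lambda>\<theta>. cis (\<theta>$k)) has_derivative (\<lambda>v. (v$k) *\<^sub>R (\<i> * cis (\<theta>$k)))) (at \<theta>)"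
      by (rule has_derivative_cis[OF bounded_linear_imp_has_derivative[OF bounded_linear_vec_nth]])
    from has_derivative_mult_right[OF this, of "\<xi>$k"] show ?thesis
      by (simp add: scaleR_conv_of_real mult_ac)
  qed
  then show ?thesis
    unfolding tangent_def
    by (subst has_derivative_componentwise_within) (auto simp: Basis_vec_def inner_axis intro!: has_derivative_inner_left)
qed

lemma tangent_decomp: "tangent \<xi> \<theta> v = (\<Sum>k\<in>UNIV. (v$k) *\<^sub>R axis k (\<i> * (\<xi>$k * cis (\<theta>$k))))"
proof -
  have "(\<Sum>k\<in>UNIV. (v$k) *\<^sub>R axis k (\<i> * (\<xi>$k * cis (\<theta>$k)))) $ i = of_real (v$i) * (\<i> * (\<xi>$i * cis (\<theta>$i)))" for i
    by (simp add: axis_def sum_component, subst sum.remove[of _ i]) (auto simp: scaleR_conv_of_real intro!: sum.neutral)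
  then show ?thesis by (simp add: tangent_def vec_eq_iff)
qed

lemma torus_mult_cD: "\<xi> \<in> torus3 \<Longrightarrow> pmul \<xi> (expi \<theta>) \<in> poly_cD"
  by (simp add: torus3_def poly_cD_def norm_mult)

lemma continuous_on_torus_comp:
  assumes "continuous_on poly_cD h" "\<xi> \<in> torus3"
  shows "continuous_on A (\<lambda>\<theta>. h (pmul \<xi> (expi \<theta>)))"
  by (rule continuous_on_compose2[OF assms(1)])
     (use torus_mult_cD[OF assms(2)] in \<open>auto intro!: continuous_intros continuous_on_id\<close>)

lemma torus_chain:
  assumes d: "\<And>x. x \<in> poly_cD \<Longrightarrow> (h has_derivative h' x) (at x within poly_cD)" and \<xi>: "\<xi> \<in> torus3"
  shows "((\<lambda>\<theta>. h (pmul \<xi> (expi \<theta>))) has_derivative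
      (\<lambda>v. \<Sum>k\<in>UNIV. (v$k) *\<^sub>R h' (pmul \<xi> (expi \<theta>)) (axis k (\<i> * (\<xi>$k * cis (\<theta>$k)))))) (at \<theta>)"
proof -
  let ?E = "\<lambda>\<theta>. pmul \<xi> (expi \<theta>)"
  have sub: "?E ` UNIV \<subseteq> poly_cD" using torus_mult_cD[OF \<xi>] by auto
  have dd: "(h has_derivative h' (?E \<theta>)) (at (?E \<theta>) within poly_cD)" by (rule d[OF torus_mult_cD[OF \<xi>]])
  from has_derivative_in_compose[OF torus_derivative has_derivative_subset[OF dd sub]]
  have "((\<lambda>\<theta>. h (?E \<theta>)) has_derivative (\<lambda>v. h' (?E \<theta>) (tangent \<xi> \<theta> v))) (at \<theta>)" .
  moreover have "h' (?E \<theta>) (tangent \<xi> \<theta> v) = (\<Sum>k\<in>UNIV. (v$k) *\<^sub>R h' (?E \<theta>) (axis k (\<i> * (\<xi>$k * cis (\<theta>$k)))))" for v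
    using has_derivative_linear[OF dd] by (simp add: tangent_decomp linear_sum linear_scale)
  ultimately show ?thesis by simp
qed

lemma axis_Re_Im: "axis k (c::complex) = Re c *\<^sub>R axis k 1 + Im c *\<^sub>R axis k \<i>"
  by (simp add: vec_eq_iff axis_def complex_eq_iff)

text \<open>On the torus \<open>psi\<close> is \<open>C\<^sup>2\<close>: \<open>p\<close> and \<open>q\<close> are its first and second partial derivatives.\<close>

lemma psi_C2:
  assumes h: "holo3 g poly_D" and C: "Ck_upto 2 g poly_D poly_cD" and \<xi>: "\<xi> \<in> torus3"
  obtains p q where
    "\<And>\<theta>. (psi g \<xi> has_derivative (\<lambda>v. \<Sum>k\<in>UNIV. (v$k) *\<^sub>R p k \<theta>)) (at \<theta>)"
    "\<And>k \<theta>. (p k has_derivative (\<lambda>v. \<Sum>l\<in>UNIV. (v$l) *\<^sub>R q k l \<theta>)) (at \<theta>)"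
    "\<And>k l. continuous_on UNIV (q k l)"
    "\<And>k. cpartial (ttilde g \<xi>) one3 k = - \<i> * p k 0"
proof -
  let ?E = "\<lambda>\<theta>. pmul \<xi> (expi \<theta>)"
  have "Ck_upto (Suc 1) g poly_D poly_cD" using C by (simp add: numeral_2_eq_2)
  then obtain g' where g': "\<And>x. x \<in> poly_cD \<Longrightarrow> (g has_derivative g' x) (at x within poly_cD)" "\<And>v. Ck_upto (Suc 0) (\<lambda>x. g' x v) poly_D poly_cD"
    by (metis C1_boundary One_nat_def)
  have gl: "g' x (a *s v) = a * g' x v" if "x \<in> poly_cD" for x a v
    by (rule boundary_derivative_complex_linear[OF h g'(1) Ck_upto_continuous[OF g'(2)] that])
  have "\<forall>k. \<exists>D'. (\<forall>x\<in>poly_cD. ((\<lambda>x. g' x (axis k 1)) has_derivative D' x) (at x within poly_cD)) \<and> (\<forall>v. continuous_on poly_cD (\<lambda>x. D' x v))"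
    by (metis C1_boundary[OF g'(2)] Ck_upto.simps(1))
  then obtain D' where D': "\<And>k x. x \<in> poly_cD \<Longrightarrow> ((\<lambda>x. g' x (axis k 1)) has_derivative D' k x) (at x within poly_cD)" "\<And>k v. continuous_on poly_cD (\<lambda>x. D' k x v)"
    by metis
  define a where "a = (\<lambda>k \<theta>. \<i> * (\<xi>$k * cis ((\<theta>::real^3)$k)))"
  define p where "p = (\<lambda>k \<theta>. cnj (g \<xi>) * (a k \<theta> * g' (?E \<theta>) (axis k 1)))"
  \<comment> \<open>Product rule: the first summand differentiates the factor e^(i \<theta>_k),
    hence occurs only for \<open>l = k\<close>; the second differentiates the partial derivative of
    g along the torus.\<close>
  define q where "q = (\<lambda>k l \<theta>. cnj (g \<xi>) * ((if l = k then \<i> * a k \<theta> else 0) * g' (?E \<theta>) (axis k 1) + a k \<theta> * D' k (?E \<theta>) (axis l (a l \<theta>))))"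
  have ax: "axis k c = c *s axis k 1" for k and c :: complex by (simp add: vec_eq_iff axis_def)
  show ?thesis
  proof (rule that[of p q])
    fix \<theta>
    have "g' (?E \<theta>) (axis k (\<i> * (\<xi>$k * cis (\<theta>$k)))) = a k \<theta> * g' (?E \<theta>) (axis k 1)" for k
      by (subst ax) (simp add: gl[OF torus_mult_cD[OF \<xi>]] a_def)
    with has_derivative_mult_right[OF torus_chain[OF g'(1) \<xi>, of \<theta>], of "cnj (g \<xi>)"]
    show "(psi g \<xi> has_derivative (\<lambda>v. \<Sum>k\<in>UNIV. (v$k) *\<^sub>R p k \<theta>)) (at \<theta>)"
      by (simp add: psi_def p_def sum_distrib_left)
  next
    fix k \<theta>
    have a: "(a k has_derivative (\<lambda>v. (v$k) *\<^sub>R (\<i> * a k \<theta>))) (at \<theta>)"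
    proof -
      have "((\<lambda>\<theta>. cis (\<theta>$k)) has_derivative (\<lambda>v. (v$k) *\<^sub>R (\<i> * cis (\<theta>$k)))) (at \<theta>)"
        by (rule has_derivative_cis[OF bounded_linear_imp_has_derivative[OF bounded_linear_vec_nth]])
      from has_derivative_mult_right[OF this, of "\<i> * \<xi>$k"] show ?thesis
        by (simp add: a_def mult_ac)
    qed
    have "((\<lambda>\<theta>. g' (?E \<theta>) (axis k 1)) has_derivative
      (\<lambda>v. \<Sum>l\<in>UNIV. (v$l) *\<^sub>R D' k (?E \<theta>) (axis l (a l \<theta>)))) (at \<theta>)"
      unfolding a_def by (rule torus_chain[OF D'(1) \<xi>])
    from has_derivative_mult_right[OF has_derivative_mult[OF a this], of "cnj (g \<xi>)"]
    show "(p k has_derivative (\<lambda>v. \<Sum>l\<in>UNIV. (v$l) *\<^sub>R q k l \<theta>)) (at \<theta>)"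
      unfolding p_def
    proof (rule has_derivative_eq_rhs)
      have 1: "(\<Sum>l\<in>UNIV. (v$l) *\<^sub>R (cnj (g \<xi>) * ((if l = k then \<i> * a k \<theta> else 0) * g' (?E \<theta>) (axis k 1)))) = cnj (g \<xi>) * ((v$k) *\<^sub>R (\<i> * a k \<theta>) * g' (?E \<theta>) (axis k 1))" for v :: "real^3"
        by (subst sum.remove[of _ k]) (auto intro!: sum.neutral)
      show "(\<lambda>v. cnj (g \<xi>) * (a k \<theta> * (\<Sum>l\<in>UNIV. (v$l) *\<^sub>R D' k (?E \<theta>) (axis l (a l \<theta>))) + (v$k) *\<^sub>R (\<i> * a k \<theta>) * g' (?E \<theta>) (axis k 1)))
          = (\<lambda>v. \<Sum>l\<in>UNIV. (v$l) *\<^sub>R q k l \<theta>)"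
        by (rule ext) (simp only: q_def distrib_left scaleR_right_distrib sum.distrib 1, simp add: sum_distrib_left)
    qed
  next
    fix k l
    have ac: "continuous_on UNIV (a k)" for k unfolding a_def by (intro continuous_intros)
    \<comment> \<open>Continuity of \<open>D'\<close> is known for fixed directions only, while the
      direction here moves with \<theta>; real linearity reduces it to the two fixed directions
      given by 1 and i.\<close>
    have eq: "D' k (?E \<theta>) (axis l (a l \<theta>)) = Re (a l \<theta>) *\<^sub>R D' k (?E \<theta>) (axis l 1) + Im (a l \<theta>) *\<^sub>R D' k (?E \<theta>) (axis l \<i>)" for \<theta>
    proof -
      have lin: "linear (D' k (?E \<theta>))" using has_derivative_linear[OF D'(1)[OF torus_mult_cD[OF \<xi>]]] .
      show ?thesis by (subst axis_Re_Im) (simp only: linear_add[OF lin] linear_scale[OF lin])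
    qed
    have 1: "continuous_on UNIV (\<lambda>\<theta>. g' (?E \<theta>) (axis k 1))"
      by (rule continuous_on_torus_comp[OF Ck_upto_continuous[OF g'(2)] \<xi>])
    have 2: "continuous_on UNIV (\<lambda>\<theta>. D' k (?E \<theta>) v)" for v
      by (rule continuous_on_torus_comp[OF D'(2) \<xi>])
    show "continuous_on UNIV (q k l)"
      unfolding q_def eq
      by (cases "l = k") (simp_all, (intro continuous_intros 1 2 ac)+)
  next
    fix k
    show "cpartial (ttilde g \<xi>) one3 k = - \<i> * p k 0"
    proof -
      have E0: "?E 0 = \<xi>" by (simp add: vec_eq_iff)
      have gen: "- \<i> * (A * (\<i> * (B * 1) * C)) = A * (B * C)" for A B C :: complex
        using i_squared by algebra
      have "cpartial (ttilde g \<xi>) one3 k = cnj (g \<xi>) * (\<xi> $ k * g' \<xi> (axis k 1))"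
        by (rule cpartial_ttilde[OF g'(1) gl \<xi>])
      also have "\<dots> = - \<i> * p k 0"
        unfolding p_def a_def E0 by (simp only: gen zero_index cis_zero)
      finally show ?thesis .
    qed
  qed
qed

text \<open>Boundary Schwarz lemma: by Schwarz--Pick at \<open>0\<close>, \<open>|1 - g r| \<ge> c (1 - r)\<close> with \<open>c > 0\<close> unless \<open>|g 0| = 1\<close>.\<close>

lemma boundary_critical_imp_constant:
  assumes c: "continuous_on (cball 0 1) g" and h: "g holomorphic_on ball 0 1"
    and le: "\<And>z. cmod z \<le> 1 \<Longrightarrow> cmod (g z) \<le> 1" and g1: "g 1 = 1"
    and d: "(g has_field_derivative 0) (at 1 within cball 0 1)" and z: "cmod z \<le> 1"
  shows "g z = 1"
proof (cases "\<exists>z0. cmod z0 < 1 \<and> cmod (g z0) = 1")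
  case True
  then obtain z0 where z0: "cmod z0 < 1" "cmod (g z0) = 1" by blast
  have "g constant_on ball 0 1"
    by (rule maximum_modulus_principle[OF h _ _ _ order_refl, of z0]) (use z0 le in auto)
  then obtain b where b: "\<And>w. w \<in> ball 0 1 \<Longrightarrow> g w = b" unfolding constant_on_def by blast
  have "g w = b" if "w \<in> closure (ball 0 1)" for w
    by (rule continuous_constant_on_closure[of "ball 0 1" g]) (use c b that in \<open>auto\<close>)
  then have "g w = b" if "w \<in> cball 0 1" for w using that by simp
  then show ?thesis using g1 z by (metis dist_0_norm mem_cball norm_one order_refl)
next
  case False
  then have lt: "cmod (g w) < 1" if "cmod w < 1" for w
    using le[of w] that by (metis less_eq_real_def)
  define a where "a = g 0"
  have a: "cmod a < 1" using lt[of 0] by (simp add: a_def)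
  have nz: "1 - cnj a * w \<noteq> 0" if "cmod w < 1" for w
    using mult_neq_1_of_norm[of "cnj a" w] a that by auto
  \<comment> \<open>Divided by the first square this is the identity for 1 - |m|^2, where m is the
    Moebius transformation sending \<open>a\<close> to 0. It shows that m maps into the disc and
    later converts Schwarz' bound for m into one for 1 - |g r|.\<close>
  have id: "(cmod (1 - cnj a * w))\<^sup>2 - (cmod (w - a))\<^sup>2 = (1 - (cmod a)\<^sup>2) * (1 - (cmod w)\<^sup>2)" for w
    unfolding cmod_power2 by (simp add: power2_eq_square algebra_simps)
  define m where "m = (\<lambda>z. (g z - a) / (1 - cnj a * g z))"
  have mh: "m holomorphic_on ball 0 1"
    unfolding m_def using h nz lt by (intro holomorphic_intros) auto
  have m1: "cmod (m w) < 1" if "cmod w < 1" for w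
  proof -
    have "0 < (1 - (cmod a)\<^sup>2) * (1 - (cmod (g w))\<^sup>2)"
      using a lt[OF that] by (intro mult_pos_pos) (auto simp: power_less_one_iff abs_square_less_1)
    then have "(cmod (g w - a))\<^sup>2 < (cmod (1 - cnj a * g w))\<^sup>2" using id[of "g w"] by simp
    then have "cmod (g w - a) < cmod (1 - cnj a * g w)" by (rule power2_less_imp_less) simp
    then show ?thesis using nz[OF lt[OF that]] by (simp add: m_def norm_divide)
  qed
  \<comment> \<open>The chain of estimates below ends in (1 - r) (1 - |a|)^2 \<le> 2 (1 - |a|^2) |g
    r - 1|, and \<open>K\<close> is the resulting ratio.\<close>
  define K where "K = (1 - cmod a)\<^sup>2 / (2 * (1 - (cmod a)\<^sup>2))"
  have a2: "0 < 1 - (cmod a)\<^sup>2" using a by (simp add: power_less_one_iff abs_square_less_1)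
  have K: "0 < K" using a a2 by (simp add: K_def)
  have lower: "K * (1 - r) \<le> cmod (g r - 1)" if r: "0 < r" "r < 1" for r
  proof -
    let ?w = "g (complex_of_real r)"
    have w: "cmod ?w < 1" using lt r by simp
    have "m 0 = 0" by (simp add: m_def a_def)
    then have "cmod (m r) \<le> r" using Schwarz_Lemma(1)[OF mh _ m1, of "complex_of_real r"] r by simp
    then have "cmod (?w - a) \<le> r * cmod (1 - cnj a * ?w)"
      using nz[OF w] by (simp add: m_def norm_divide pos_divide_le_eq)
    then have "(cmod (?w - a))\<^sup>2 \<le> r\<^sup>2 * (cmod (1 - cnj a * ?w))\<^sup>2"
      by (metis norm_ge_zero power_mono power_mult_distrib)
    then have 1: "(1 - r\<^sup>2) * (cmod (1 - cnj a * ?w))\<^sup>2 \<le> (1 - (cmod a)\<^sup>2) * (1 - (cmod ?w)\<^sup>2)"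
      using id[of ?w] by (simp add: algebra_simps)
    have "1 - cmod a \<le> 1 - cmod a * cmod ?w" using w by (simp add: mult_left_le)
    also have "\<dots> \<le> cmod (1 - cnj a * ?w)"
      using norm_triangle_ineq2[of 1 "cnj a * ?w"] by (simp add: norm_mult)
    finally have 2: "(1 - cmod a)\<^sup>2 \<le> (cmod (1 - cnj a * ?w))\<^sup>2" using a by (intro power_mono) auto
    have "1 - (cmod ?w)\<^sup>2 = (1 - cmod ?w) * (1 + cmod ?w)" by (simp add: power2_eq_square algebra_simps)
    also have "\<dots> \<le> cmod (?w - 1) * 2"
      using w norm_triangle_ineq2[of 1 ?w] by (intro mult_mono) (auto simp: norm_minus_commute)
    finally have 3: "1 - (cmod ?w)\<^sup>2 \<le> cmod (?w - 1) * 2" .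
    have "r\<^sup>2 \<le> r" using r by (simp add: power2_eq_square mult_left_le)
    then have "(1 - r) * (1 - cmod a)\<^sup>2 \<le> (1 - r\<^sup>2) * (cmod (1 - cnj a * ?w))\<^sup>2"
      using 2 r by (intro mult_mono) (auto simp: power_le_one)
    also note 1
    also have "(1 - (cmod a)\<^sup>2) * (1 - (cmod ?w)\<^sup>2) \<le> (1 - (cmod a)\<^sup>2) * (cmod (?w - 1) * 2)"
      using 3 a2 by (intro mult_left_mono) auto
    finally show ?thesis using a2 by (simp add: K_def field_simps)
  qed
  have "((\<lambda>y. (g y - g 1) / (y - 1)) \<longlongrightarrow> 0) (at 1 within cball 0 1)"
    using d by (simp add: has_field_derivative_iff)
  then have "eventually (\<lambda>y. cmod ((g y - g 1) / (y - 1)) < K) (at 1 within cball 0 1)"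
    using K order_tendstoD(2)[OF tendsto_norm_zero] by blast
  then obtain e where e: "0 < e" "\<And>y. y \<in> cball 0 1 \<Longrightarrow> y \<noteq> 1 \<Longrightarrow> dist y 1 < e \<Longrightarrow> cmod ((g y - g 1) / (y - 1)) < K"
    unfolding eventually_at by blast
  \<comment> \<open>Close enough to 1 for the vanishing derivative to give |g r - 1| <
    \<open>K * (1 - r)\<close>, which contradicts \<open>lower\<close>.\<close>
  define r where "r = 1 - min (e/2) (1/2)"
  have r: "0 < r" "r < 1" "1 - r < e" using e(1) by (auto simp: r_def min_def)
  have eq: "cmod (complex_of_real r - 1) = 1 - r"
    by (metis abs_minus_commute abs_of_pos diff_gt_0_iff_gt norm_of_real of_real_1 of_real_diff r(2))
  have "cmod ((g r - g 1) / (complex_of_real r - 1)) < K"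
    using r by (intro e(2)) (auto simp: dist_norm eq)
  then have "cmod (g r - 1) < K * (1 - r)"
    using r by (simp add: g1 norm_divide eq pos_divide_less_eq)
  with lower[OF r(1,2)] show ?thesis by simp
qed

section \<open>The function psi at a boundary point of modulus one\<close>

lemma poly_cD_bound:
  assumes c: "continuous_on poly_cD g" and m: "\<And>z. z \<in> poly_D \<Longrightarrow> cmod (g z) < 1" and z: "z \<in> poly_cD"
  shows "cmod (g z) \<le> 1"
proof -
  have "((\<lambda>t. cmod (g (complex_of_real t *s z))) \<longlongrightarrow> cmod (g z)) (at_left 1)"
    by (intro tendsto_norm poly_cD_radial_limit c z)
  moreover have "eventually (\<lambda>t. cmod (g (complex_of_real t *s z)) \<le> 1) (at_left 1)"
    using eventually_at_left_unit
  proof eventually_elim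
    case (elim t)
    then show ?case using m z by (intro less_imp_le m scale_cD_D) auto
  qed
  ultimately show ?thesis by (intro tendsto_upperbound) auto
qed

lemma torus3_nth: "\<xi> \<in> torus3 \<Longrightarrow> cmod (\<xi> $ k) = 1"
  by (simp add: torus3_def)

context
  fixes g :: "complex^3 \<Rightarrow> complex" and \<xi> :: "complex^3"
  assumes h: "holo3 g poly_D" and C2: "Ck_upto 2 g poly_D poly_cD"
    and m: "\<And>z. z \<in> poly_D \<Longrightarrow> cmod (g z) < 1" and \<xi>: "\<xi> \<in> torus3" and u: "cmod (g \<xi>) = 1"
begin

lemma psi_0: "psi g \<xi> 0 = 1"
proof -
  have "pmul \<xi> (expi 0) = \<xi>" by (simp add: vec_eq_iff)
  then show ?thesis using u by (simp add: psi_def mult.commute flip: complex_norm_square)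
qed

lemma norm_psi_le: "cmod (psi g \<xi> \<theta>) \<le> 1"
  using poly_cD_bound[OF Ck_upto_continuous[OF C2] m torus_mult_cD[OF \<xi>]] u by (simp add: psi_def norm_mult)

lemma continuous_psi: "continuous_on A (psi g \<xi>)"
  unfolding psi_def by (intro continuous_intros continuous_on_torus_comp[OF Ck_upto_continuous[OF C2] \<xi>])

text \<open>The derivative at 1 along the monomial curve is the combination of the partial
  derivatives with coefficients \<open>n k\<close>. If it vanishes, the boundary Schwarz lemma makes
  the composition constant. Natural exponents keep the curve in the closed polydisc.\<close>

lemma power_curve:
  fixes n :: "3 \<Rightarrow> nat"
  defines "f \<equiv> (\<lambda>\<zeta>. cnj (g \<xi>) * g (pmul \<xi> (\<chi> k. \<zeta> ^ n k)))"
  assumes s: "(\<Sum>k\<in>UNIV. of_nat (n k) * cpartial (ttilde g \<xi>) one3 k) = 0" and z: "cmod z \<le> 1"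
  shows "f z = 1"
proof (rule boundary_critical_imp_constant[OF _ _ _ _ _ z])
  let ?\<gamma> = "\<lambda>\<zeta>. pmul \<xi> (\<chi> k. \<zeta> ^ n k)"
  have "Ck_upto (Suc 1) g poly_D poly_cD" using C2 by (simp add: numeral_2_eq_2)
  then obtain g' where g': "\<And>x. x \<in> poly_cD \<Longrightarrow> (g has_derivative g' x) (at x within poly_cD)" "\<And>v. Ck_upto 1 (\<lambda>x. g' x v) poly_D poly_cD"
    by (metis C1_boundary)
  have gl: "g' x (a *s v) = a * g' x v" if "x \<in> poly_cD" for x a v
    by (rule boundary_derivative_complex_linear[OF h g'(1) Ck_upto_continuous[OF g'(2)] that])
  have sub: "?\<gamma> \<zeta> \<in> poly_cD" if "cmod \<zeta> \<le> 1" for \<zeta>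
    using that by (auto simp: poly_cD_def norm_mult torus3_nth[OF \<xi>] norm_power power_le_one)
  have d: "((\<lambda>\<zeta>. g (?\<gamma> \<zeta>)) has_field_derivative (\<Sum>k\<in>UNIV. (\<xi>$k * (of_nat (n k) * \<zeta> ^ (n k - 1))) * g' (?\<gamma> \<zeta>) (axis k 1))) (at \<zeta> within S)"
    if "cmod \<zeta> \<le> 1" and S: "S \<subseteq> cball 0 1" for \<zeta> S
  proof (rule chain_boundary)
    show "(g has_derivative g' (?\<gamma> \<zeta>)) (at (?\<gamma> \<zeta>) within poly_cD)" by (rule g'(1)[OF sub[OF that(1)]])
    show "\<And>a v. g' (?\<gamma> \<zeta>) (a *s v) = a * g' (?\<gamma> \<zeta>) v" by (rule gl[OF sub[OF that(1)]])
    show "((\<lambda>z. ?\<gamma> z $ k) has_field_derivative \<xi>$k * (of_nat (n k) * \<zeta> ^ (n k - 1))) (at \<zeta> within S)" for k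
      by (auto intro!: derivative_eq_intros)
    show "?\<gamma> ` S \<subseteq> poly_cD" using sub S by auto
  qed
  have df: "(f has_field_derivative cnj (g \<xi>) * (\<Sum>k\<in>UNIV. (\<xi>$k * (of_nat (n k) * \<zeta> ^ (n k - 1))) * g' (?\<gamma> \<zeta>) (axis k 1))) (at \<zeta> within S)"
    if "cmod \<zeta> \<le> 1" and S: "S \<subseteq> cball 0 1" for \<zeta> S
    unfolding f_def by (rule DERIV_cmult[OF d[OF that]])
  show "continuous_on (cball 0 1) f"
    unfolding continuous_on_eq_continuous_within
    using df[of _ "cball 0 1"] DERIV_continuous by fastforce
  show "f holomorphic_on ball 0 1"
    using df[of _ "ball 0 1"] ball_subset_cball by (force simp: holomorphic_on_def field_differentiable_def)
  show "cmod (f \<zeta>) \<le> 1" if "cmod \<zeta> \<le> 1" for \<zeta>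
    using poly_cD_bound[OF Ck_upto_continuous[OF C2] m sub[OF that]] u by (simp add: f_def norm_mult)
  have one: "?\<gamma> 1 = \<xi>" by (simp add: vec_eq_iff)
  show "f 1 = 1" unfolding f_def one using u by (simp add: mult.commute flip: complex_norm_square)
  have "cnj (g \<xi>) * (\<Sum>k\<in>UNIV. (\<xi>$k * (of_nat (n k) * 1 ^ (n k - 1))) * g' \<xi> (axis k 1))
    = (\<Sum>k\<in>UNIV. of_nat (n k) * cpartial (ttilde g \<xi>) one3 k)"
    by (simp add: cpartial_ttilde[OF g'(1) gl \<xi>] sum_distrib_left mult_ac)
  then have "cnj (g \<xi>) * (\<Sum>k\<in>UNIV. (\<xi>$k * (of_nat (n k) * 1 ^ (n k - 1))) * g' \<xi> (axis k 1)) = 0"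
    using s by (rule trans)
  then show "(f has_field_derivative 0) (at 1 within cball 0 1)"
    using df[of 1 "cball 0 1"] unfolding one by (simp only: norm_one order_refl)
qed

text \<open>If all partial derivatives vanished, the curve with all exponents 1 would give |g 0| = 1
  at \<zeta> = 0, but 0 is an interior point.\<close>

lemma cpartial_nonzero: "\<exists>k. cpartial (ttilde g \<xi>) one3 k \<noteq> 0"
proof (rule ccontr)
  assume "\<not> ?thesis"
  then have "(\<Sum>k\<in>UNIV. of_nat 1 * cpartial (ttilde g \<xi>) one3 k) = 0" by simp
  from power_curve[of "\<lambda>_. 1", OF this, of 0] have "cnj (g \<xi>) * g (pmul \<xi> (\<chi> k. 0)) = 1" by simp
  moreover have "cmod (g (pmul \<xi> (\<chi> k. 0))) < 1" by (rule m) (simp add: poly_D_def)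
  ultimately show False using u by (metis complex_mod_cnj less_irrefl mult_1 norm_mult norm_one)
qed

text \<open>Along \<open>t \<mapsto> (t, n t)\<close> in the last two angles \<open>psi\<close> is constant; these curves become dense as \<open>n\<close> grows.\<close>

lemma psi_eq_1_of_single_partial:
  assumes z: "\<And>k. k \<noteq> k0 \<Longrightarrow> cpartial (ttilde g \<xi>) one3 k = 0" and \<theta>: "\<theta> $ k0 = 0"
  shows "psi g \<xi> \<theta> = 1"
proof -
  obtain i j where d: "distinct [i,j,k0]" using ex_distinct_3 by blast
  have eq: "psi g \<xi> (vec3 i j t (real q * t) 0) = 1" for q t
  proof -
    define n where "n = (\<lambda>k. if k = i then 1 else if k = j then q else 0)"
    have "(\<Sum>k\<in>UNIV. of_nat (n k) * cpartial (ttilde g \<xi>) one3 k) = 0"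
      using d z by (intro sum.neutral) (auto simp: n_def)
    from power_curve[OF this, of "cis t"]
    have "cnj (g \<xi>) * g (pmul \<xi> (\<chi> k. cis t ^ n k)) = 1" by simp
    moreover have "(\<chi> k. cis t ^ n k) = expi (vec3 i j t (real q * t) 0)"
      using d Complex.DeMoivre[of t q] by (auto simp: vec_eq_3_distinct[OF d] vec3_nth[OF d] n_def)
    ultimately show ?thesis by (simp add: psi_def)
  qed
  \<comment> \<open>\<open>s q\<close> differs from the i-th angle by O(1/q), and q + 1 times
    \<open>s q\<close> equals the j-th angle up to a multiple of 2 pi; so the curve with exponents 1
    and q + 1 passes arbitrarily near the given point.\<close>
  define s where "s = (\<lambda>q::nat. (\<theta>$j + 2 * pi * of_int \<lfloor>real (Suc q) * \<theta>$i / (2*pi)\<rfloor>) / real (Suc q))"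
  have 1: "psi g \<xi> (vec3 i j (s q) (\<theta>$j) 0) = 1" for q
  proof -
    have "real (Suc q) * s q = \<theta>$j + 2 * pi * of_int \<lfloor>real (Suc q) * \<theta>$i / (2*pi)\<rfloor>" by (simp add: s_def)
    moreover have "cis (x + 2 * pi * of_int l) = cis x" for x l
      by (simp add: cis_mult[symmetric] cis_multiple_2pi)
    ultimately have "expi (vec3 i j (s q) (real (Suc q) * s q) 0) = expi (vec3 i j (s q) (\<theta>$j) 0)"
      by (simp add: vec_eq_3_distinct[OF d] vec3_nth[OF d])
    then show ?thesis using eq[of "s q" "Suc q"] by (simp add: psi_def)
  qed
  have "s \<longlonglongrightarrow> \<theta>$i"
  proof (rule LIMSEQ_I)
    fix e :: real assume e: "0 < e"
    obtain N where N: "(\<bar>\<theta>$j\<bar> + 2*pi) / e < real N" using reals_Archimedean2 by blast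
    show "\<exists>N. \<forall>q\<ge>N. norm (s q - \<theta>$i) < e"
    proof (intro exI[of _ N] allI impI)
      fix q assume q: "N \<le> q"
      define x where "x = real (Suc q) * \<theta>$i / (2*pi)"
      have "\<bar>of_int \<lfloor>x\<rfloor> - x\<bar> \<le> 1" by linarith
      then have "\<bar>2 * pi * of_int \<lfloor>x\<rfloor> - 2 * pi * x\<bar> \<le> 2 * pi * 1"
        unfolding right_diff_distrib[symmetric] abs_mult by (intro mult_mono) auto
      moreover have "2 * pi * x = real (Suc q) * \<theta>$i" by (simp add: x_def)
      ultimately have "\<bar>\<theta>$j + 2 * pi * of_int \<lfloor>x\<rfloor> - real (Suc q) * \<theta>$i\<bar> \<le> \<bar>\<theta>$j\<bar> + 2 * pi" by linarith
      moreover have "s q - \<theta>$i = (\<theta>$j + 2 * pi * of_int \<lfloor>x\<rfloor> - real (Suc q) * \<theta>$i) / real (Suc q)"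
        by (simp add: s_def x_def diff_divide_distrib)
      ultimately have "norm (s q - \<theta>$i) \<le> (\<bar>\<theta>$j\<bar> + 2*pi) / real (Suc q)"
        by (simp add: abs_divide divide_right_mono)
      also have "\<dots> < e" using N q e by (simp add: field_simps) (smt (verit) mult_left_mono of_nat_le_iff)
      finally show "norm (s q - \<theta>$i) < e" .
    qed
  qed
  then have "(\<lambda>q. vec3 i j (s q) (\<theta>$j) 0) \<longlonglongrightarrow> vec3 i j (\<theta>$i) (\<theta>$j) 0"
    unfolding vec3_def by (intro vec_tendstoI) auto
  then have "(\<lambda>q. psi g \<xi> (vec3 i j (s q) (\<theta>$j) 0)) \<longlonglongrightarrow> psi g \<xi> (vec3 i j (\<theta>$i) (\<theta>$j) 0)"
    using continuous_psi[of UNIV] by (intro isCont_tendsto_compose[of _ "psi g \<xi>"]) (auto simp: continuous_on_eq_continuous_at)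
  then have "psi g \<xi> (vec3 i j (\<theta>$i) (\<theta>$j) 0) = 1" using 1 LIMSEQ_unique[OF _ tendsto_const] by simp
  moreover have "vec3 i j (\<theta>$i) (\<theta>$j) 0 = \<theta>"
    using \<theta> by (simp add: vec_eq_3_distinct[OF d] vec3_nth[OF d])
  ultimately show ?thesis by simp
qed

text \<open>Re psi has its maximum 1 at 0. Hence the first-order part of psi is purely imaginary,
  and the real part starts with the quadratic form.\<close>

lemma Re_psi_derivative_0:
  assumes p: "(psi g \<xi> has_derivative (\<lambda>v. \<Sum>k\<in>UNIV. (v$k) *\<^sub>R p k)) (at 0)"
  shows "Re (p k) = 0"
proof -
  have "((\<lambda>\<theta>. Re (psi g \<xi> \<theta>)) has_derivative (\<lambda>v. Re (\<Sum>k\<in>UNIV. (v$k) *\<^sub>R p k))) (at 0)"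
    by (intro bounded_linear.has_derivative[OF bounded_linear_Re] p)
  moreover have "Re (psi g \<xi> \<theta>) \<le> Re (psi g \<xi> 0)" for \<theta>
    using norm_psi_le[of \<theta>] complex_Re_le_cmod[of "psi g \<xi> \<theta>"] by (simp add: psi_0)
  ultimately have "(\<lambda>v. Re (\<Sum>k\<in>UNIV. (v$k) *\<^sub>R p k)) = (\<lambda>v. 0)"
    by (intro differential_zero_maxmin[of 0 UNIV "\<lambda>\<theta>. Re (psi g \<xi> \<theta>)"]) auto
  from fun_cong[OF this, of "axis k 1"] show ?thesis
    by (simp add: sum.remove[of UNIV k] axis_def)
qed

end

section \<open>Local inverses and their effect on measure\<close>

lemma matrix_smult: "(\<chi> k l. a k l) *v v = (\<chi> k. \<Sum>l\<in>UNIV. (v$l) * (a k l :: real))"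
  by (simp add: matrix_vector_mult_def mult.commute)

lemma continuous_det3:
  fixes A :: "'a::topological_space \<Rightarrow> real^3^3"
  assumes "\<And>k l. continuous_on S (\<lambda>x. A x $ k $ l)"
  shows "continuous_on S (\<lambda>x. det (A x))"
  unfolding det_3 by (intro continuous_on_add continuous_on_diff continuous_on_mult assms)

text \<open>Inverse function theorem; the inverse is \<open>C\<^sup>1\<close> by Cramer's rule.\<close>

lemma local_diffeo_C1:
  fixes w :: "3 \<Rightarrow> real^3 \<Rightarrow> real"
  assumes d: "\<And>k \<theta>. (w k has_derivative (\<lambda>v. \<Sum>l\<in>UNIV. (v$l) * a k l \<theta>)) (at \<theta>)"
    and c: "\<And>k l. continuous_on UNIV (a k l)" and inv: "det (\<chi> k l. a k l 0) \<noteq> 0"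
  shows "local_diffeo_at (\<lambda>\<theta>. \<chi> k. w k \<theta>) 0"
proof -
  define A where "A = (\<lambda>\<theta>. (\<chi> k l. a k l \<theta>) :: real^3^3)"
  define f' where "f' = (\<lambda>\<theta>. Blinfun ((*v) (A \<theta>)))"
  have f': "blinfun_apply (f' \<theta>) = (*v) (A \<theta>)" for \<theta>
    unfolding f'_def by (rule bounded_linear_Blinfun_apply) (rule matrix_vector_mul_bounded_linear)
  have der: "((\<lambda>\<theta>. \<chi> k. w k \<theta>) has_derivative (*v) (A \<theta>)) (at \<theta>)" for \<theta>
    unfolding A_def matrix_smult
    by (subst has_derivative_componentwise_within)
       (auto simp: Basis_vec_def inner_axis A_def matrix_vector_mult_def mult.commute intro!: has_derivative_inner_left d)
  have Ac: "continuous_on S (\<lambda>\<theta>. A \<theta> $ k $ l)" for k l S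
    unfolding A_def using continuous_on_subset[OF c] by simp
  have Av: "continuous_on S (\<lambda>\<theta>. A \<theta> *v v)" for v S
    unfolding matrix_vector_mult_def by (intro continuous_intros Ac)
  have cf': "continuous_on UNIV f'"
    by (rule continuous_on_blinfun_componentwise) (simp add: f' Av)
  obtain B where B: "B ** A 0 = mat 1"
    using inv by (auto simp: A_def invertible_det_nz[symmetric] invertible_def)
  define iv where "iv = Blinfun ((*v) B)"
  have iv: "blinfun_apply iv = (*v) B"
    unfolding iv_def by (rule bounded_linear_Blinfun_apply) (rule matrix_vector_mul_bounded_linear)
  have "iv o\<^sub>L f' 0 = id_blinfun"
    by (rule blinfun_eqI) (simp add: iv f' matrix_vector_mul_assoc B)
  with der cf' obtain U' V g g' where g: "open U'" "(0::real^3) \<in> U'" "open V" 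
    "homeomorphism U' V (\<lambda>\<theta>. \<chi> k. w k \<theta>) g"
    "\<And>y. y \<in> V \<Longrightarrow> (g has_derivative (g' y)) (at y)"
    "\<And>y. y \<in> V \<Longrightarrow> g' y = inv (blinfun_apply (f'(g y)))"
    "\<And>y. y \<in> V \<Longrightarrow> bij (blinfun_apply (f'(g y)))"
    using inverse_function_theorem[of UNIV "\<lambda>\<theta>. \<chi> k. w k \<theta>" f' 0 iv] unfolding f' by (metis UNIV_I open_UNIV)
  have gc: "continuous_on V g" using g(4) by (simp add: homeomorphism_def)
  have dnz: "det (A (g y)) \<noteq> 0" if "y \<in> V" for y
  proof -
    have "inj ((*v) (A (g y)))" using g(7)[OF that] by (simp add: f' bij_def)
    then show ?thesis by (metis det_nz_iff_inj matrix_of_matrix_vector_mul matrix_vector_mul_linear)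
  qed
  have g'eq: "g' y v = (\<chi> k. det (\<chi> i j. if j = k then v$i else A (g y)$i$j) / det (A (g y)))" if y: "y \<in> V" for y v
  proof -
    let ?x = "\<chi> k. det (\<chi> i j. if j = k then v$i else A (g y)$i$j) / det (A (g y))"
    have "A (g y) *v ?x = v" using cramer[OF dnz[OF y], of ?x v] by simp
    then have "blinfun_apply (f' (g y)) ?x = v" by (simp only: f')
    then show ?thesis
      unfolding g(6)[OF y] by (rule inv_f_eq[OF bij_is_inj[OF g(7)[OF y]]])
  qed
  have Ck1: "Ck_upto 1 (\<lambda>\<theta>. \<chi> k. w k \<theta>) U' U'"
  proof -
    have "continuous_on U' (\<lambda>\<theta>. \<chi> k. w k \<theta>)" using g(4) by (simp add: homeomorphism_def)
    then show ?thesis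
      using der Av by (auto intro!: exI[of _ "\<lambda>\<theta>. (*v) (A \<theta>)"])
  qed
  have Ck2: "Ck_upto 1 g V V"
  proof -
    have "continuous_on V (\<lambda>y. g' y v)" for v
    proof -
      have cA: "continuous_on V (\<lambda>y. A (g y) $ i $ j)" for i j
        by (rule continuous_on_compose2[OF Ac gc]) auto
      have "continuous_on V (\<lambda>y. det ((\<chi> i j. if j = k then v$i else A (g y)$i$j) :: real^3^3))" for k
      proof (rule continuous_det3)
        show "continuous_on V (\<lambda>x. ((\<chi> i j. if j = k then v $ i else A (g x) $ i $ j) :: real^3^3) $ ka $ l)" for ka l
          by (cases "l = k") (simp_all add: cA)
      qed
      moreover have "continuous_on V (\<lambda>y. det (A (g y)))"
        by (rule continuous_det3) (rule cA)
      ultimately have "continuous_on V (\<lambda>y. \<chi> k. det (\<chi> i j. if j = k then v$i else A (g y)$i$j) / det (A (g y)))"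
        using dnz by (intro continuous_on_vec_lambda continuous_on_divide) auto
      then show ?thesis by (rule continuous_on_eq) (simp add: g'eq)
    qed
    then show ?thesis using gc g(5) by (auto intro!: exI[of _ g'])
  qed
  show ?thesis
    unfolding local_diffeo_at_def local_diffeo_data_def
    using g(1-3) Ck1 Ck2 g(4) by (intro exI[of _ U'] exI[of _ V] exI[of _ g]) (auto simp: homeomorphism_def)
qed

text \<open>The image of a set of measure \<open>\<mu>\<close> under a local inverse of a \<open>C\<^sup>1\<close> map has measure at least \<open>\<mu> / B\<close>,
  where \<open>B\<close> bounds the Jacobian of the map.\<close>

lemma local_inverse_measure_ge:
  fixes w :: "3 \<Rightarrow> real^3 \<Rightarrow> real"
  assumes d: "\<And>k \<theta>. (w k has_derivative (\<lambda>v. \<Sum>l\<in>UNIV. (v$l) * a k l \<theta>)) (at \<theta>)"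
    and c: "\<And>k l. continuous_on UNIV (a k l)"
    and dat: "local_diffeo_data (\<lambda>\<theta>. \<chi> k. w k \<theta>) 0 V W Ui"
  obtains B where "0 < B" "\<And>S. compact S \<Longrightarrow> S \<subseteq> W \<Longrightarrow> Ui ` S \<subseteq> cball 0 1 \<Longrightarrow> measure lebesgue S \<le> B * measure lebesgue (Ui ` S)"
proof -
  define A where "A = (\<lambda>\<theta>. (\<chi> k l. a k l \<theta>) :: real^3^3)"
  have der: "((\<lambda>\<theta>. \<chi> k. w k \<theta>) has_derivative (*v) (A \<theta>)) (at \<theta>)" for \<theta>
    unfolding A_def matrix_smult
    by (subst has_derivative_componentwise_within)
       (auto simp: Basis_vec_def inner_axis A_def matrix_vector_mult_def mult.commute intro!: has_derivative_inner_left d)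
  have Ac: "continuous_on S (\<lambda>\<theta>. A \<theta> $ k $ l)" for k l S
    unfolding A_def using continuous_on_subset[OF c] by simp
  have dc: "continuous_on S (\<lambda>\<theta>. \<bar>det (A \<theta>)\<bar>)" for S
    by (intro continuous_intros continuous_det3 Ac)
  have "compact ((\<lambda>\<theta>. \<bar>det (A \<theta>)\<bar>) ` cball 0 1)"
    by (rule compact_continuous_image[OF dc]) simp
  then obtain B where B: "0 < B" "\<And>\<theta>. \<theta> \<in> cball 0 1 \<Longrightarrow> \<bar>det (A \<theta>)\<bar> \<le> B"
    by (auto dest!: compact_imp_bounded simp: bounded_pos)
  show ?thesis
  proof (rule that[OF B(1)])
    fix S assume S: "compact S" "S \<subseteq> W" "Ui ` S \<subseteq> cball 0 1"
    let ?U = "\<lambda>\<theta>. \<chi> k. w k \<theta>"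
    have "continuous_on W Ui" using dat by (simp add: local_diffeo_data_def)
    then have cS: "compact (Ui ` S)"
      by (rule compact_continuous_image[OF continuous_on_subset[OF _ S(2)] S(1)])
    have "?U (Ui y) = y" if "y \<in> S" for y using dat S(2) that by (simp add: local_diffeo_data_def subset_iff)
    then have "?U ` (Ui ` S) = S" by (simp only: image_image cong: image_cong) simp
    moreover have "measure lebesgue (?U ` (Ui ` S)) \<le> B * measure lebesgue (Ui ` S)"
    proof (rule measure_bounded_differentiable_image)
      show "Ui ` S \<in> lmeasurable" by (rule lmeasurable_compact[OF cS])
      show "(?U has_derivative (*v) (A \<theta>)) (at \<theta> within Ui ` S)" for \<theta>
        by (rule has_derivative_at_withinI[OF der])
      have cS': "continuous_on (Ui ` S) (\<lambda>\<theta>. \<bar>det (matrix ((*v) (A \<theta>)))\<bar>)" using dc by simp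
      have "set_integrable lborel (Ui ` S) (\<lambda>\<theta>. \<bar>det (matrix ((*v) (A \<theta>)))\<bar>)"
        unfolding set_integrable_def by (rule borel_integrable_compact[OF cS cS'])
      then show "(\<lambda>\<theta>. \<bar>det (matrix ((*v) (A \<theta>)))\<bar>) integrable_on Ui ` S"
        by (rule set_borel_integral_eq_integral(1))
      show "\<bar>det (matrix ((*v) (A \<theta>)))\<bar> \<le> B" if "\<theta> \<in> Ui ` S" for \<theta>
        using B(2) that S(3) by auto
    qed
    ultimately show "measure lebesgue S \<le> B * measure lebesgue (Ui ` S)" by simp
  qed
qed

section \<open>Normalised reproducing kernels as test functions\<close>

text \<open>On the torus the conjugate of the kernel is again a Cauchy kernel, with parameter t
  times the conjugate of b. Cauchy's formula therefore evaluates the integral: the reproducing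
  property applied to the kernel itself.\<close>

lemma szego_circ_mean:
  assumes b: "b \<in> poly_D" and t: "0 < t" "t < 1"
  shows "circ_mean (szego b) t = (\<Prod>k\<in>UNIV. inverse (1 - t\<^sup>2 * (cmod (b$k))\<^sup>2))"
proof -
  let ?R = "complex_of_real t"
  let ?w = "?R *s (\<chi> k. cnj (b$k))"
  have w: "?w \<in> poly_D" using b t by (intro scale_D_D) (auto simp: poly_D_def)
  have h: "holo3 (szego b) poly_D" by (rule holo3_szego) (use b in \<open>auto simp: poly_D_def less_imp_le\<close>)
  have t0: "0 \<le> t" using t by simp
  have sq: "complex_of_real ((cmod (szego b (?R *s expi \<theta>)))\<^sup>2) = szego b (?R *s expi \<theta>) * szego (expi (- \<theta>)) ?w" for \<theta>
    unfolding complex_norm_square by (simp add: szego_def cis_cnj mult_ac)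
  have "((\<lambda>\<theta>. complex_of_real ((cmod (szego b (?R *s expi \<theta>)))\<^sup>2)) has_integral of_real (integral cube (\<lambda>\<theta>. (cmod (szego b (?R *s expi \<theta>)))\<^sup>2))) cube"
    by (intro has_integral_of_real integrable_integral integrable_continuous continuous_norm_dilate[OF h t0 t(2)])
  then have "complex_of_real (integral cube (\<lambda>\<theta>. (cmod (szego b (?R *s expi \<theta>)))\<^sup>2)) = (2*pi)^3 * szego b (?R *s ?w)"
    unfolding sq cauchy_polydisc[OF h t0 t(2) w, symmetric] by (simp only: integral_unique)
  also have "szego b (?R *s ?w) = complex_of_real (\<Prod>k\<in>UNIV. inverse (1 - t\<^sup>2 * (cmod (b$k))\<^sup>2))"
  proof -
    have "b$k * (?R *s ?w)$k = complex_of_real (t\<^sup>2 * (cmod (b$k))\<^sup>2)" for k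
      using complex_norm_square[of "b$k"] by (simp add: power2_eq_square mult_ac)
    then show ?thesis unfolding szego_def by (simp del: of_real_mult)
  qed
  finally have "complex_of_real (integral cube (\<lambda>\<theta>. (cmod (szego b (?R *s expi \<theta>)))\<^sup>2)) = complex_of_real ((2*pi)^3 * (\<Prod>k\<in>UNIV. inverse (1 - t\<^sup>2 * (cmod (b$k))\<^sup>2)))"
    by simp
  then have "integral cube (\<lambda>\<theta>. (cmod (szego b (?R *s expi \<theta>)))\<^sup>2) = (2*pi)^3 * (\<Prod>k\<in>UNIV. inverse (1 - t\<^sup>2 * (cmod (b$k))\<^sup>2))"
    by (simp only: of_real_eq_iff)
  then show ?thesis by (simp add: circ_mean_def)
qed

text \<open>The squared H2 norm of \<open>szego b\<close>, obtained from
  \<open>szego_circ_mean\<close> as t tends to 1.\<close>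

definition szego_sq :: "complex^3 \<Rightarrow> real" where
  "szego_sq b = (\<Prod>k\<in>UNIV. inverse (1 - (cmod (b$k))\<^sup>2))"

lemma sq_less_1: "cmod x < 1 \<Longrightarrow> (cmod x)\<^sup>2 < 1"
  by (simp add: abs_square_less_1)

lemma szego_sq_pos: "b \<in> poly_D \<Longrightarrow> 0 < szego_sq b"
  unfolding szego_sq_def using sq_less_1 by (intro prod_pos) (auto simp: poly_D_def)

lemma normalized_szego:
  assumes b: "b \<in> poly_D"
  shows "(\<lambda>z. of_real (1 / sqrt (szego_sq b)) * szego b z) \<in> H2" (is "?f \<in> _")
    and "H2_norm (\<lambda>z. of_real (1 / sqrt (szego_sq b)) * szego b z) \<le> 1"
proof -
  have h: "holo3 ?f poly_D"
    by (intro holo3_mult_const holo3_szego) (use b in \<open>auto simp: poly_D_def less_imp_le\<close>)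
  have "circ_mean ?f t \<le> 1\<^sup>2" if t: "0 < t" "t < 1" for t
  proof -
    have eq: "circ_mean ?f t = (1 / szego_sq b) * circ_mean (szego b) t"
      using szego_sq_pos[OF b] by (simp add: circ_mean_def norm_mult norm_divide power_mult_distrib power_divide)
    have le: "circ_mean (szego b) t \<le> szego_sq b"
      unfolding szego_circ_mean[OF b t] szego_sq_def
    proof (intro prod_mono conjI)
      fix k
      have bk: "(cmod (b$k))\<^sup>2 < 1" using b by (intro sq_less_1) (simp add: poly_D_def)
      have le: "t\<^sup>2 * (cmod (b$k))\<^sup>2 \<le> 1 * (cmod (b$k))\<^sup>2" using t by (intro mult_right_mono) (auto simp: power_le_one)
      show "inverse (1 - t\<^sup>2 * (cmod (b$k))\<^sup>2) \<le> inverse (1 - (cmod (b$k))\<^sup>2)"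
        using bk le by (intro le_imp_inverse_le) auto
      show "0 \<le> inverse (1 - t\<^sup>2 * (cmod (b$k))\<^sup>2)" using bk le by simp
    qed
    show ?thesis
      unfolding eq using mult_left_mono[OF le, of "1 / szego_sq b"] szego_sq_pos[OF b] by simp
  qed
  from H2_norm_le[OF h this] show "?f \<in> H2" "H2_norm ?f \<le> 1" by auto
qed

text \<open>For h continuous on the closed polydisc the circular mean is continuous in the radius up
  to 1.\<close>

lemma circ_mean_boundary_le:
  assumes h: "continuous_on poly_cD h" and le: "\<And>t. 0 < t \<Longrightarrow> t < 1 \<Longrightarrow> circ_mean h t \<le> M"
  shows "circ_mean h 1 \<le> M"
proof -
  have "continuous_on {0..1} (\<lambda>t::real. integral cube (\<lambda>\<theta>. (cmod (h (complex_of_real t *s expi \<theta>)))\<^sup>2))"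
  proof (rule integral_continuous_on_param)
    show "continuous_on ({0..1} \<times> cube) (\<lambda>(t, \<theta>). (cmod (h (complex_of_real t *s expi \<theta>)))\<^sup>2)"
      unfolding split_beta
      by (intro continuous_intros continuous_on_compose2[OF h]) (auto intro!: scale_cD expi_in_cD)
  qed
  then have "continuous_on {0..1} (circ_mean h)"
    unfolding circ_mean_def by (intro continuous_intros) auto
  from this[unfolded continuous_on, rule_format, of 1]
  have "(circ_mean h \<longlongrightarrow> circ_mean h 1) (at_left 1)"
    by (simp add: at_within_Icc_at_left)
  moreover have "eventually (\<lambda>t. circ_mean h t \<le> M) (at_left 1)"
    using eventually_at_left_unit by eventually_elim (use le in auto)
  ultimately show ?thesis by (intro tendsto_upperbound) auto
qed

lemma torus3_expi: "\<xi> \<in> torus3 \<Longrightarrow> \<exists>\<alpha>. \<xi> = expi \<alpha>"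
  using rcis_cmod_Arg[of "\<xi>$_"]
  by (intro exI[of _ "\<chi> k. Arg (\<xi>$k)"]) (simp add: vec_eq_iff torus3_def rcis_def)

lemma integral_ge_measure:
  fixes f :: "real^3 \<Rightarrow> real"
  assumes f: "continuous_on (cbox a b) f" "\<And>x. 0 \<le> f x" and S: "compact S" "S \<subseteq> cbox a b"
    and m: "\<And>x. x \<in> S \<Longrightarrow> m \<le> f x"
  shows "m * measure lebesgue S \<le> integral (cbox a b) f"
proof -
  have "set_integrable lborel S f"
    unfolding set_integrable_def by (rule borel_integrable_compact[OF S(1) continuous_on_subset[OF f(1) S(2)]])
  then have fS: "f integrable_on S" by (rule set_borel_integral_eq_integral(1))
  have lS: "S \<in> lmeasurable" by (rule lmeasurable_compact[OF S(1)])
  then have i1: "(\<lambda>x. 1::real) integrable_on S" using lmeasurable_iff_integrable_on by blast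
  have "m * measure lebesgue S = integral S (\<lambda>x. m * 1)"
    by (simp only: lmeasure_integral[OF lS] Henstock_Kurzweil_Integration.integral_mult_right)
  also have "\<dots> \<le> integral S f"
    by (intro integral_le integrable_on_mult_right i1 fS) (use m in auto)
  also have "\<dots> \<le> integral (cbox a b) f"
    by (rule integral_subset_le[OF S(2) fS integrable_continuous[OF f(1)]]) (use f in auto)
  finally show ?thesis .
qed

text \<open>Testing compactness on the normalized reproducing kernels at \<open>w k = (1 - \<delta>) \<phi> \<xi> k\<close> for \<open>k \<in> J\<close>
  (and \<open>0\<close> elsewhere).\<close>

lemma not_compact_of_large_sets:
  assumes comp: "compact_comp_op \<phi>" and cont: "continuous_on poly_cD \<phi>"
    and maps: "\<phi> ` poly_D \<subseteq> poly_D" and maps': "\<phi> ` poly_cD \<subseteq> poly_cD" and \<xi>: "\<xi> \<in> torus3"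
    and J: "J \<noteq> {}" "\<And>j. j \<in> J \<Longrightarrow> cmod (\<phi> \<xi> $ j) = 1" and c: "0 < c" "0 < \<delta>0"
    and sets: "\<And>\<delta>. 0 < \<delta> \<Longrightarrow> \<delta> < \<delta>0 \<Longrightarrow> \<exists>S. compact S \<and> S \<subseteq> cball 0 1 \<and> c * \<delta> ^ card J \<le> measure lebesgue S \<and>
      (\<forall>\<theta>\<in>S. \<forall>j\<in>J. cmod (1 - psi (\<lambda>z. \<phi> z $ j) \<xi> \<theta>) \<le> C * \<delta>)"
  shows False
proof -
  define d0 where "d0 = min \<delta>0 1 / 2"
  have d0: "0 < d0" "d0 < 1" "d0 < \<delta>0" using c(2) by (auto simp: d0_def min_def)
  define \<delta> where "\<delta> = (\<lambda>n. d0 / real (Suc n))"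
  have \<delta>: "0 < \<delta> n" "\<delta> n < 1" "\<delta> n < \<delta>0" for n
  proof -
    have "\<delta> n \<le> d0" using d0 by (simp add: \<delta>_def divide_le_eq mult_left_le[of 1] field_simps)
    then show "0 < \<delta> n" "\<delta> n < 1" "\<delta> n < \<delta>0" using d0 by (auto simp: \<delta>_def)
  qed
  have \<delta>0: "\<delta> \<longlonglongrightarrow> 0" unfolding \<delta>_def
    using tendsto_mult_right_zero[OF LIMSEQ_inverse_real_of_nat, of d0] by (simp add: divide_inverse)
  \<comment> \<open>The conjugate makes \<open>b n $ k\<close> times the k-th coordinate of \<phi>
    equal to (1 - \<delta>) psi for k in J; for other k the parameter 0 turns the factor of the
    kernel into 1.\<close>
  define b where "b = (\<lambda>n. (\<chi> k. if k \<in> J then of_real (1 - \<delta> n) * cnj (\<phi> \<xi> $ k) else 0) :: complex^3)"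
  have nb: "cmod (b n $ k) = (if k \<in> J then 1 - \<delta> n else 0)" for n k
    using J(2) \<delta>(2)[of n] by (simp add: b_def norm_mult del: of_real_diff)
  have b: "b n \<in> poly_D" for n using nb[of n] \<delta>[of n] by (simp add: poly_D_def)
  define F where "F = (\<lambda>n z. of_real (1 / sqrt (szego_sq (b n))) * szego (b n) z)"
  have F: "F n \<in> H2" "H2_norm (F n) \<le> 1" for n unfolding F_def by (rule normalized_szego[OF b])+
  have Fop: "F n \<circ> \<phi> \<in> H2" for n using comp F(1) by (auto simp: compact_comp_op_def)
  obtain g r where g: "g \<in> H2" and r: "strict_mono r"
    and lim: "(\<lambda>n. H2_norm (\<lambda>z. (F (r n) \<circ> \<phi>) z - g z)) \<longlonglongrightarrow> 0"
    using comp F unfolding compact_comp_op_def by blast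
  define N where "N = (\<lambda>n. H2_norm (\<lambda>z. (F (r n) \<circ> \<phi>) z - g z))"
  have N0: "0 \<le> N n" for n unfolding N_def by (rule H2_norm_nonneg[OF H2_diff(1)[OF Fop g]])
  have inv: "1 / szego_sq (b n) = (2 * \<delta> n - (\<delta> n)\<^sup>2) ^ card J" for n
  proof -
    have "1 / szego_sq (b n) = (\<Prod>k\<in>UNIV. if k \<in> J then 2 * \<delta> n - (\<delta> n)\<^sup>2 else 1)"
      unfolding szego_sq_def divide_inverse prod_inversef[symmetric] nb
      by (auto simp: power2_eq_square algebra_simps intro!: prod.cong)
    also have "\<dots> = (2 * \<delta> n - (\<delta> n)\<^sup>2) ^ card J"
      by (simp add: prod.If_cases)
    finally show ?thesis .
  qed
  have cJ: "0 < card J" using J(1) by (simp add: card_gt_0_iff)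
  \<comment> \<open>The normalised kernels tend to 0 at every interior point, since their norms blow
    up while their values stay bounded; convergence in H2 implies pointwise convergence, so the
    limit can only be 0.\<close>
  have g0: "g z = 0" if z: "z \<in> poly_D" for z
  proof -
    obtain K where K: "0 \<le> K" "\<And>f. f \<in> H2 \<Longrightarrow> cmod (f z) \<le> K * H2_norm f" by (rule H2_eval_bound[OF z]) blast
    have "(\<lambda>n. F (r n) (\<phi> z) - g z) \<longlonglongrightarrow> 0"
    proof (rule Lim_null_comparison)
      show "\<forall>\<^sub>F n in sequentially. norm (F (r n) (\<phi> z) - g z) \<le> K * N n"
        using K(2)[OF H2_diff(1)[OF Fop g]] by (simp add: N_def)
      show "(\<lambda>n. K * N n) \<longlonglongrightarrow> 0" using tendsto_mult_right_zero[OF lim] by (simp add: N_def)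
    qed
    moreover have "(\<lambda>n. F n (\<phi> z)) \<longlonglongrightarrow> 0"
    proof (rule Lim_null_comparison)
      define M where "M = (\<Prod>k\<in>UNIV. inverse (1 - cmod (\<phi> z $ k)))"
      have pz: "cmod (\<phi> z $ k) < 1" for k using maps z by (auto simp: poly_D_def)
      have "cmod (szego (b n) (\<phi> z)) \<le> M" for n
        unfolding szego_def M_def prod_norm[symmetric]
      proof (intro prod_mono conjI)
        fix k
        have "cmod (b n $ k * \<phi> z $ k) \<le> 1 * cmod (\<phi> z $ k)"
          unfolding norm_mult using \<delta>[of n] by (intro mult_right_mono) (auto simp: nb)
        then have "1 - cmod (\<phi> z $ k) \<le> cmod (1 - b n $ k * \<phi> z $ k)"
          using norm_triangle_ineq2[of 1 "b n $ k * \<phi> z $ k"] by simp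
        then show "cmod (inverse (1 - b n $ k * \<phi> z $ k)) \<le> inverse (1 - cmod (\<phi> z $ k))"
          unfolding norm_inverse using pz by (intro le_imp_inverse_le) auto
      qed auto
      then show "\<forall>\<^sub>F n in sequentially. norm (F n (\<phi> z)) \<le> sqrt (1 / szego_sq (b n)) * M"
        using szego_sq_pos[OF b, THEN less_imp_le] by (intro always_eventually allI)
          (auto simp: F_def norm_mult norm_divide real_sqrt_divide intro!: mult_left_mono divide_right_mono)
      have "(\<lambda>n. sqrt ((2 * \<delta> n - (\<delta> n)\<^sup>2) ^ card J) * M) \<longlonglongrightarrow> sqrt ((2 * 0 - 0\<^sup>2) ^ card J) * M"
        by (intro tendsto_intros \<delta>0)
      then show "(\<lambda>n. sqrt (1 / szego_sq (b n)) * M) \<longlonglongrightarrow> 0" by (simp add: inv zero_power[OF cJ])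
    qed
    then have "(\<lambda>n. F (r n) (\<phi> z)) \<longlonglongrightarrow> 0" using r LIMSEQ_subseq_LIMSEQ unfolding o_def by blast
    ultimately have "(\<lambda>n. F (r n) (\<phi> z) - (F (r n) (\<phi> z) - g z)) \<longlonglongrightarrow> 0 - 0" by (intro tendsto_diff)
    then show ?thesis by (simp add: LIMSEQ_const_iff)
  qed
  have Fc: "continuous_on poly_cD (F n \<circ> \<phi>)" for n
  proof -
    have "continuous_on poly_cD (F n)"
      unfolding F_def
    proof (intro continuous_intros)
      fix z k assume "z \<in> poly_cD"
      then show "b n $ k * z $ k \<noteq> 1"
        using mult_neq_1_of_norm[of "z$k" "b n$k"] b[of n] by (simp add: poly_cD_def poly_D_def mult.commute)
    qed
    then show ?thesis by (intro continuous_on_compose cont continuous_on_subset[OF _ maps'])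
  qed
  have up: "circ_mean (F (r n) \<circ> \<phi>) 1 \<le> (N n)\<^sup>2" for n
  proof (rule circ_mean_boundary_le[OF Fc])
    fix t :: real assume t: "0 < t" "t < 1"
    have "circ_mean (F (r n) \<circ> \<phi>) t = circ_mean (\<lambda>z. (F (r n) \<circ> \<phi>) z - g z) t"
      unfolding circ_mean_def using t by (simp add: g0 scale_cD_D expi_in_cD)
    then show "circ_mean (F (r n) \<circ> \<phi>) t \<le> (N n)\<^sup>2"
      using circ_mean_le_H2_norm[OF H2_diff(1)[OF Fop g] t] by (simp add: N_def)
  qed
  obtain \<alpha> where \<alpha>: "\<xi> = expi \<alpha>" using torus3_expi[OF \<xi>] by blast
  \<comment> \<open>The added 1 pays for the passage from psi to (1 - \<delta>) psi.\<close>
  define C' where "C' = \<bar>C\<bar> + 1"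
  have C': "1 \<le> C'" by (simp add: C'_def)
  \<comment> \<open>The measure contributes \<delta> to the power |J|, the normalisation another
    such power, and the squared kernel the power -2 |J|: everything cancels and this positive
    constant remains for all n.\<close>
  define low where "low = c / (C' ^ 2) ^ card J / (2*pi)^3"
  have lowpos: "0 < low" using c(1) C' by (simp add: low_def)
  have lower: "low \<le> circ_mean (F n \<circ> \<phi>) 1" for n
  proof -
    obtain S where S: "compact S" "S \<subseteq> cball 0 1" "c * \<delta> n ^ card J \<le> measure lebesgue S"
      and SC: "\<And>\<theta> j. \<theta> \<in> S \<Longrightarrow> j \<in> J \<Longrightarrow> cmod (1 - psi (\<lambda>z. \<phi> z $ j) \<xi> \<theta>) \<le> C * \<delta> n"
      using sets[OF \<delta>(1,3)[of n]] by blast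
    let ?a = "(\<chi> k. - pi) :: real^3"
    let ?f = "\<lambda>\<theta>. (cmod (F n (\<phi> (pmul \<xi> (expi \<theta>)))))\<^sup>2"
    \<comment> \<open>The unit ball lies in the cube with sides from -pi to pi, on which the
      parametrisation of the torus is used here.\<close>
    have Sbox: "S \<subseteq> cbox ?a (?a + (\<chi> k. 2*pi))"
    proof
      fix \<theta> assume "\<theta> \<in> S"
      then have "norm \<theta> \<le> 1" using S(2) by auto
      then have "\<bar>\<theta> $ k\<bar> \<le> 1" for k using component_le_norm_cart[of \<theta> k] by linarith
      moreover have "1 \<le> pi" using pi_ge_two by linarith
      ultimately have "\<bar>\<theta> $ k\<bar> \<le> pi" for k using order_trans by blast
      then show "\<theta> \<in> cbox ?a (?a + (\<chi> k. 2*pi))"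
        by (simp add: mem_box_cart abs_le_iff minus_le_iff)
    qed
    define m where "m = (\<delta> n ^ card J) * inverse (((C' * \<delta> n)\<^sup>2) ^ card J)"
    have mS: "m \<le> ?f \<theta>" if \<theta>: "\<theta> \<in> S" for \<theta>
    proof -
      let ?w = "\<phi> (pmul \<xi> (expi \<theta>))"
      have w1: "cmod (?w $ k) \<le> 1" for k using maps' torus_mult_cD[OF \<xi>] by (auto simp: poly_cD_def image_subset_iff)
      have "(\<Prod>k\<in>UNIV. if k \<in> J then inverse ((C' * \<delta> n)\<^sup>2) else 1) \<le> (\<Prod>k\<in>UNIV. (cmod (inverse (1 - b n $ k * ?w $ k)))\<^sup>2)"
      proof (intro prod_mono conjI)
        fix k
        show "(if k \<in> J then inverse ((C' * \<delta> n)\<^sup>2) else 1) \<le> (cmod (inverse (1 - b n $ k * ?w $ k)))\<^sup>2"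
        proof (cases "k \<in> J")
          case True
          let ?p = "psi (\<lambda>z. \<phi> z $ k) \<xi> \<theta>"
          have bw: "b n $ k * ?w $ k = of_real (1 - \<delta> n) * ?p" using True by (simp add: b_def psi_def)
          have "cmod ?p \<le> 1" using w1[of k] J(2)[OF True] by (simp add: psi_def norm_mult)
          then have p1: "\<delta> n * cmod ?p \<le> \<delta> n * 1" using \<delta>[of n] by (intro mult_left_mono) auto
          have eq: "1 - b n $ k * ?w $ k = (1 - ?p) + of_real (\<delta> n) * ?p" unfolding bw by (simp add: algebra_simps)
          have "cmod (1 - b n $ k * ?w $ k) \<le> cmod (1 - ?p) + cmod (of_real (\<delta> n) * ?p)"
            unfolding eq by (rule norm_triangle_ineq)
          also have "\<dots> \<le> C * \<delta> n + \<delta> n"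
            using SC[OF \<theta> True] p1 \<delta>(1)[of n] by (intro add_mono) (auto simp: norm_mult)
          also have "\<dots> \<le> C' * \<delta> n" using \<delta>(1)[of n] by (simp add: C'_def algebra_simps mult_right_mono)
          finally have le: "cmod (1 - b n $ k * ?w $ k) \<le> C' * \<delta> n" .
          have "b n $ k * ?w $ k \<noteq> 1"
            using mult_neq_1_of_norm[OF w1[of k], of "b n $ k"] b[of n] by (simp add: poly_D_def mult.commute)
          then have "0 < cmod (1 - b n $ k * ?w $ k)" by simp
          then have "inverse ((C' * \<delta> n)\<^sup>2) \<le> inverse ((cmod (1 - b n $ k * ?w $ k))\<^sup>2)"
            using le by (intro le_imp_inverse_le power_mono) auto
          then show ?thesis using True by (simp add: norm_inverse power_inverse)
        next
          case False
          then show ?thesis by (simp add: b_def)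
        qed
        show "0 \<le> (if k \<in> J then inverse ((C' * \<delta> n)\<^sup>2) else 1)" by simp
      qed
      also have "\<dots> = (cmod (szego (b n) ?w))\<^sup>2"
        by (simp only: szego_def prod_power_distrib flip: prod_norm)
      finally have 1: "inverse (((C' * \<delta> n)\<^sup>2) ^ card J) \<le> (cmod (szego (b n) ?w))\<^sup>2"
        by (simp add: prod.If_cases power_inverse)
      have "\<delta> n \<le> 2 * \<delta> n - (\<delta> n)\<^sup>2" using \<delta>[of n] by (simp add: power2_eq_square mult_left_le)
      then have 2: "\<delta> n ^ card J \<le> 1 / szego_sq (b n)" unfolding inv using \<delta>[of n] by (intro power_mono) auto
      have "m \<le> (1 / szego_sq (b n)) * (cmod (szego (b n) ?w))\<^sup>2"
        unfolding m_def using 1 2 \<delta>[of n] szego_sq_pos[OF b[of n]] by (intro mult_mono) auto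
      also have "\<dots> = ?f \<theta>"
        using szego_sq_pos[OF b[of n]] by (simp add: F_def norm_mult norm_divide power_mult_distrib power_divide)
      finally show ?thesis .
    qed
    have Fc': "continuous_on A (\<lambda>\<theta>. F n (\<phi> (pmul \<xi> (expi \<theta>))))" for A
      using continuous_on_torus_comp[OF Fc[of n] \<xi>, of A] by (simp add: o_def)
    have "m * measure lebesgue S \<le> integral (cbox ?a (?a + (\<chi> k. 2*pi))) ?f"
      by (rule integral_ge_measure[OF _ _ S(1) Sbox mS]) (auto intro!: continuous_intros Fc')
    also have "\<dots> = integral cube (\<lambda>\<theta>. (cmod (F n (\<phi> (expi \<theta>))))\<^sup>2)"
    proof -
      have "continuous_on UNIV (\<lambda>\<theta>. (cmod (F n (\<phi> (expi \<theta>))))\<^sup>2)"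
        using continuous_comp_expi[OF Fc[of n], of 1 UNIV] by (intro continuous_intros) (simp add: o_def)
      from integral_cube_pmul[of "\<lambda>z. (cmod (F n (\<phi> z)))\<^sup>2", OF this] show ?thesis by (simp add: \<alpha>)
    qed
    also have "\<dots> = (2*pi)^3 * circ_mean (F n \<circ> \<phi>) 1" by (simp add: circ_mean_def)
    finally have 3: "m * measure lebesgue S \<le> (2*pi)^3 * circ_mean (F n \<circ> \<phi>) 1" .
    have m0: "0 \<le> m" using \<delta>[of n] by (simp add: m_def)
    have "m * (c * \<delta> n ^ card J) \<le> m * measure lebesgue S" using S(3) m0 by (rule mult_left_mono)
    moreover have "m * (c * \<delta> n ^ card J) = c / (C' ^ 2) ^ card J"
      using \<delta>(1)[of n] C' unfolding m_def by (simp add: power_mult_distrib power2_eq_square field_simps)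
    ultimately have "c / (C' ^ 2) ^ card J \<le> (2*pi)^3 * circ_mean (F n \<circ> \<phi>) 1" using 3 by linarith
    then show ?thesis unfolding low_def pos_divide_le_eq[OF two_pi_cube_pos] by (simp only: mult.commute)
  qed
  have sq: "(\<lambda>n. (N n)\<^sup>2) \<longlonglongrightarrow> 0\<^sup>2" using lim unfolding N_def by (intro tendsto_intros)
  have "low \<le> (N n)\<^sup>2" for n using lower[of "r n"] up[of n] by linarith
  then have "low \<le> 0\<^sup>2" by (intro LIMSEQ_le_const[OF sq] exI allI impI)
  then show False using lowpos by simp
qed

section \<open>Large sets near a boundary point\<close>

lemma has_derivative_local_bound:
  fixes f :: "'a::real_normed_vector \<Rightarrow> 'b::real_normed_vector"
  assumes "(f has_derivative f') (at x)"
  obtains B d where "0 < B" "0 < d" "\<And>y. norm (y - x) < d \<Longrightarrow> norm (f y - f x) \<le> B * norm (y - x)"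
proof -
  obtain K where K: "0 < K" "\<And>v. norm (f' v) \<le> norm v * K"
    using has_derivative_bounded_linear[OF assms] bounded_linear.pos_bounded by blast
  obtain d where d: "0 < d" "\<And>y. norm (y - x) < d \<Longrightarrow> norm (f y - f x - f' (y - x)) \<le> 1 * norm (y - x)"
    using assms unfolding has_derivative_at_alt by (metis zero_less_one)
  show ?thesis
  proof (rule that[of "K + 1" d])
    fix y assume "norm (y - x) < d"
    from d(2)[OF this] K(2)[of "y - x"] show "norm (f y - f x) \<le> (K + 1) * norm (y - x)"
      using norm_triangle_ineq[of "f y - f x - f' (y - x)" "f' (y - x)"] by (simp add: algebra_simps)
  qed (use K d in auto)
qed

lemma measure_cbox_If:
  assumes "0 \<le> a" "0 \<le> b"
  shows "measure lebesgue (cbox (\<chi> k::3. - (if k \<in> K then a else b)) (\<chi> k. if k \<in> K then a else (b :: real))) = (2 * a) ^ card K * (2 * b) ^ card (- K)"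
proof -
  have "measure lebesgue (cbox (\<chi> k::3. - (if k \<in> K then a else b)) (\<chi> k. if k \<in> K then a else b)) = (\<Prod>k\<in>UNIV. if k \<in> K then 2 * a else 2 * b)"
    using assms by (simp add: content_cbox_cart interval_eq_empty_cart not_less) (auto intro!: prod.cong simp: not_less)
  also have "\<dots> = (2 * a) ^ card K * (2 * b) ^ card (- K)"
    by (simp add: prod.If_cases)
  finally show ?thesis .
qed

text \<open>If the real parts are, in the coordinates \<open>u = w \<theta>\<close>, functions of \<open>(u k)\<close> for \<open>k \<in> K\<close> only, they are
  \<open>O(\<delta>)\<close> on the image of a box with sides \<open>\<delta>\<close> in these coordinates and fixed sides in the others.\<close>

lemma large_sets_of_diffeo:
  fixes w :: "3 \<Rightarrow> real^3 \<Rightarrow> real" and E :: "'j \<Rightarrow> real^3 \<Rightarrow> real"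
  assumes d: "\<And>k \<theta>. (w k has_derivative (\<lambda>v. \<Sum>l\<in>UNIV. (v$l) * a k l \<theta>)) (at \<theta>)"
    and c: "\<And>k l. continuous_on UNIV (a k l)" and w0: "\<And>k. w k 0 = 0"
    and dat: "local_diffeo_data (\<lambda>\<theta>. \<chi> k. w k \<theta>) 0 V W Ui"
    and N: "open N" "0 \<in> N" "N \<subseteq> W" and J: "finite J"
    and E: "\<And>j. j \<in> J \<Longrightarrow> \<exists>E'. (E j has_derivative E') (at 0)" "\<And>j. j \<in> J \<Longrightarrow> E j 0 = 0"
    and dep: "\<And>j u u'. j \<in> J \<Longrightarrow> u \<in> N \<Longrightarrow> u' \<in> N \<Longrightarrow> (\<And>k. k \<in> K \<Longrightarrow> u$k = u'$k) \<Longrightarrow> E j (Ui u) = E j (Ui u')"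
  obtains c' \<delta>0 C where "0 < c'" "0 < \<delta>0" "0 \<le> C"
    "\<And>\<delta>. 0 < \<delta> \<Longrightarrow> \<delta> < \<delta>0 \<Longrightarrow> \<exists>S. compact S \<and> S \<subseteq> cball 0 1 \<and> c' * \<delta> ^ card K \<le> measure lebesgue S \<and>
      (\<forall>\<theta>\<in>S. (\<forall>k\<in>K. \<bar>w k \<theta>\<bar> \<le> \<delta>) \<and> (\<forall>j\<in>J. \<bar>E j \<theta>\<bar> \<le> C * \<delta>))"
proof -
  obtain B where B: "0 < B" "\<And>S. compact S \<Longrightarrow> S \<subseteq> W \<Longrightarrow> Ui ` S \<subseteq> cball 0 1 \<Longrightarrow> measure lebesgue S \<le> B * measure lebesgue (Ui ` S)"
    using local_inverse_measure_ge[OF d c dat] by blast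
  note dd = dat[unfolded local_diffeo_data_def]
  have U0: "(\<chi> k. w k 0) = 0" by (simp add: vec_eq_iff w0)
  have Ui0: "Ui 0 = 0" using dd U0 by metis
  have Ui: "w k (Ui u) = u $ k" if "u \<in> W" for u k using dd that by (metis vec_lambda_beta)
  have W: "open W" "0 \<in> W" using dd N by auto
  have Uic: "continuous_on W Ui" using dd by simp
  have "Ck_upto 1 Ui W W" using dat by (simp only: local_diffeo_data_def)
  then obtain DU where "\<forall>x\<in>W. (Ui has_derivative DU x) (at x)" by auto
  then have Ui': "(Ui has_derivative DU 0) (at 0)" using W(2) by blast
  obtain B1 d1 where B1: "0 < B1" "0 < d1" "\<And>y. norm (y - 0) < d1 \<Longrightarrow> norm (Ui y - Ui 0) \<le> B1 * norm (y - 0)"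
    using has_derivative_local_bound[OF Ui'] by blast
  have "\<exists>B d. 0 < B \<and> 0 < d \<and> (\<forall>y. norm y < d \<longrightarrow> \<bar>E j y\<bar> \<le> B * norm y)" if j: "j \<in> J" for j
  proof -
    obtain E' where "(E j has_derivative E') (at 0)" using E(1)[OF j] by blast
    from has_derivative_local_bound[OF this] obtain B d where
      "0 < B" "0 < d" "\<And>y. norm (y - 0) < d \<Longrightarrow> norm (E j y - E j 0) \<le> B * norm (y - 0)" by blast
    then show ?thesis using E(2)[OF j] by (intro exI[of _ B] exI[of _ d]) auto
  qed
  then obtain BE dE where BE: "\<And>j. j \<in> J \<Longrightarrow> 0 < BE j" "\<And>j. j \<in> J \<Longrightarrow> 0 < dE j"
     "\<And>j y. j \<in> J \<Longrightarrow> norm y < dE j \<Longrightarrow> \<bar>E j y\<bar> \<le> BE j * norm y" by metis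
  \<comment> \<open>The inserted 1 forces the image of the box into the unit ball.\<close>
  define d2 where "d2 = Min (insert 1 (dE ` J))"
  have d2: "0 < d2" "\<And>j. j \<in> J \<Longrightarrow> d2 \<le> dE j" "d2 \<le> 1" unfolding d2_def using J BE by auto
  define B2 where "B2 = (\<Sum>j\<in>J. BE j)"
  have B2: "BE j \<le> B2" if "j \<in> J" for j unfolding B2_def using that J BE(1) by (intro member_le_sum) (auto intro: less_imp_le)
  have B20: "0 \<le> B2" unfolding B2_def using BE(1) by (intro sum_nonneg) (auto intro: less_imp_le)
  obtain d3 where d3: "0 < d3" "cball 0 d3 \<subseteq> N" using N open_contains_cball by blast
  \<comment> \<open>A vector with entries at most \<rho> has norm at most 3 \<rho>; the factor 6
    leaves room for the strict inequalities.\<close>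
  define \<rho> where "\<rho> = min (min d1 (d2 / B1)) d3 / 6"
  have \<rho>: "0 < \<rho>" "6 * \<rho> \<le> d1" "6 * \<rho> \<le> d2 / B1" "6 * \<rho> \<le> d3" using B1 d2 d3 by (auto simp: \<rho>_def)
  have nle: "norm u \<le> 3 * r" if "\<And>k. \<bar>u $ k\<bar> \<le> r" for u :: "real^3" and r
  proof -
    have "norm u \<le> (\<Sum>k\<in>UNIV. \<bar>u $ k\<bar>)" by (rule norm_le_l1_cart)
    also have "\<dots> \<le> (\<Sum>k\<in>(UNIV::3 set). r)" by (intro sum_mono that)
    finally show ?thesis by simp
  qed
  have small: "u \<in> N" "norm (Ui u) \<le> B1 * norm u" "norm (Ui u) < d2" if "\<And>k. \<bar>u $ k\<bar> \<le> \<rho>" for u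
  proof -
    have n: "norm u \<le> 3 * \<rho>" by (rule nle[OF that])
    then show "u \<in> N" using d3 \<rho> by auto
    show le: "norm (Ui u) \<le> B1 * norm u" using B1(3)[of u] n \<rho> by (simp add: Ui0)
    also have "\<dots> \<le> B1 * (3 * \<rho>)" using n B1(1) by (intro mult_left_mono) auto
    also have "\<dots> < B1 * (6 * \<rho>)" using B1(1) \<rho>(1) by simp
    also have "\<dots> \<le> d2" using \<rho>(3) B1(1) by (simp add: field_simps)
    finally show "norm (Ui u) < d2" .
  qed
  show ?thesis
  proof (rule that[of "2 ^ card K * (2 * \<rho>) ^ card (- K) / B" \<rho> "B2 * (B1 * 3)"])
    show "0 < 2 ^ card K * (2 * \<rho>) ^ card (- K) / B" using \<rho> B by simp
    show "0 \<le> B2 * (B1 * 3)" using B20 B1 by simp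
    fix \<delta> :: real assume \<delta>: "0 < \<delta>" "\<delta> < \<rho>"
    define S where "S = cbox (\<chi> k::3. - (if k \<in> K then \<delta> else \<rho>)) (\<chi> k. if k \<in> K then \<delta> else \<rho>)"
    have S: "\<bar>u $ k\<bar> \<le> \<rho>" "k \<in> K \<Longrightarrow> \<bar>u $ k\<bar> \<le> \<delta>" if "u \<in> S" for u k
      using that \<delta> by (auto simp: S_def mem_box_cart abs_le_iff minus_le_iff split: if_splits) (smt (verit))+
    have SN: "S \<subseteq> N" using small(1) S(1) by blast
    have cS: "compact S" by (simp add: S_def)
    have sub: "Ui ` S \<subseteq> cball 0 1" using small(3) S(1) d2(3) by fastforce
    have "compact (Ui ` S)"
      by (rule compact_continuous_image[OF continuous_on_subset[OF Uic] cS]) (use SN N in auto)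
    moreover have "2 ^ card K * (2 * \<rho>) ^ card (- K) / B * \<delta> ^ card K \<le> measure lebesgue (Ui ` S)"
    proof -
      have "measure lebesgue S = (2 * \<delta>) ^ card K * (2 * \<rho>) ^ card (- K)"
        unfolding S_def using \<delta> \<rho> by (intro measure_cbox_If) auto
      moreover have "measure lebesgue S \<le> B * measure lebesgue (Ui ` S)"
        using SN N by (intro B(2) cS sub) auto
      ultimately show ?thesis using B(1) by (simp add: field_simps power_mult_distrib)
    qed
    moreover have "(\<forall>k\<in>K. \<bar>w k \<theta>\<bar> \<le> \<delta>) \<and> (\<forall>j\<in>J. \<bar>E j \<theta>\<bar> \<le> B2 * (B1 * 3) * \<delta>)" if \<theta>: "\<theta> \<in> Ui ` S" for \<theta>
    proof -
      obtain u where u: "u \<in> S" "\<theta> = Ui u" using \<theta> by blast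
      have "\<bar>w k \<theta>\<bar> \<le> \<delta>" if "k \<in> K" for k
        using Ui[of u k] S(2)[OF u(1) that] SN N u by auto
      moreover have "\<bar>E j \<theta>\<bar> \<le> B2 * (B1 * 3) * \<delta>" if j: "j \<in> J" for j
      proof -
        \<comment> \<open>The coordinates outside K are set to 0. By \<open>dep\<close> this does
          not change the value of E, but the new point has norm O(\<delta>), so the bound for E near
          0 applies.\<close>
        define u' where "u' = (\<chi> k. if k \<in> K then u $ k else 0)"
        have u'd: "\<bar>u' $ k\<bar> \<le> \<delta>" for k using S(2)[OF u(1)] \<delta> by (simp add: u'_def)
        then have u'r: "\<bar>u' $ k\<bar> \<le> \<rho>" for k using \<delta> by (meson less_imp_le order_trans)
        have "E j \<theta> = E j (Ui u')"
          unfolding u(2) by (rule dep[OF j]) (use SN u small(1)[OF u'r] in \<open>auto simp: u'_def\<close>)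
        also have "\<bar>\<dots>\<bar> \<le> BE j * norm (Ui u')"
          using small(3)[OF u'r] d2(2)[OF j] by (intro BE(3)[OF j]) auto
        also have "\<dots> \<le> B2 * (B1 * (3 * \<delta>))"
        proof (intro mult_mono B2[OF j] B20)
          have "norm (Ui u') \<le> B1 * norm u'" by (rule small(2)[OF u'r])
          also have "\<dots> \<le> B1 * (3 * \<delta>)" using nle[OF u'd] B1(1) by (intro mult_left_mono) auto
          finally show "norm (Ui u') \<le> B1 * (3 * \<delta>)" .
        qed simp
        finally show ?thesis by (simp add: mult.assoc)
      qed
      ultimately show ?thesis by blast
    qed
    ultimately show "\<exists>S. compact S \<and> S \<subseteq> cball 0 1 \<and> 2 ^ card K * (2 * \<rho>) ^ card (- K) / B * \<delta> ^ card K \<le> measure lebesgue S \<and>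
      (\<forall>\<theta>\<in>S. (\<forall>k\<in>K. \<bar>w k \<theta>\<bar> \<le> \<delta>) \<and> (\<forall>j\<in>J. \<bar>E j \<theta>\<bar> \<le> B2 * (B1 * 3) * \<delta>))"
      by (intro exI[of _ "Ui ` S"]) (use sub in blast)
  qed (rule \<rho>(1))
qed

lemma onorm_partials_le:
  fixes a :: "3 \<Rightarrow> complex"
  shows "onorm (\<lambda>v::real^3. \<Sum>k\<in>UNIV. (v$k) *\<^sub>R a k) \<le> (\<Sum>k\<in>UNIV. cmod (a k))"
proof (rule onorm_le)
  fix v :: "real^3"
  have "cmod (\<Sum>k\<in>UNIV. (v$k) *\<^sub>R a k) \<le> (\<Sum>k\<in>UNIV. cmod (a k) * norm v)"
    by (rule sum_norm_le) (simp add: mult.commute[of "cmod _"] component_le_norm_cart mult_right_mono)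
  then show "cmod (\<Sum>k\<in>UNIV. (v$k) *\<^sub>R a k) \<le> (\<Sum>k\<in>UNIV. cmod (a k)) * norm v"
    by (simp add: sum_distrib_right)
qed

lemma C1_lipschitz:
  fixes f :: "real^3 \<Rightarrow> complex"
  assumes d: "\<And>\<theta>. (f has_derivative (\<lambda>v. \<Sum>k\<in>UNIV. (v$k) *\<^sub>R a k \<theta>)) (at \<theta>)"
    and c: "\<And>k. continuous_on UNIV (a k)"
  obtains C where "0 \<le> C" "\<And>\<theta> \<theta>'. norm \<theta> \<le> R \<Longrightarrow> norm \<theta>' \<le> R \<Longrightarrow> cmod (f \<theta> - f \<theta>') \<le> C * norm (\<theta> - \<theta>')"
proof -
  have "compact ((\<lambda>\<theta>. \<Sum>k\<in>UNIV. cmod (a k \<theta>)) ` cball 0 R)"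
    by (intro compact_continuous_image continuous_intros continuous_on_subset[OF c]) auto
  then obtain C where C: "0 < C" "\<And>\<theta>. norm \<theta> \<le> R \<Longrightarrow> \<bar>\<Sum>k\<in>UNIV. cmod (a k \<theta>)\<bar> \<le> C"
    by (auto dest!: compact_imp_bounded simp: bounded_pos)
  show ?thesis
  proof (rule that[of C])
    fix \<theta> \<theta>' :: "real^3" assume "norm \<theta> \<le> R" "norm \<theta>' \<le> R"
    then show "cmod (f \<theta> - f \<theta>') \<le> C * norm (\<theta> - \<theta>')"
      by (intro differentiable_bound[where S="cball 0 R" and f'="\<lambda>\<theta> v. \<Sum>k\<in>UNIV. (v$k) *\<^sub>R a k \<theta>"])
         (auto intro: has_derivative_at_withinI[OF d] order_trans[OF onorm_partials_le order_trans[OF abs_ge_self C(2)]])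
  qed (use C in auto)
qed

text \<open>Mean value inequality for f minus its linear part on the ball of radius
  \<open>norm \<theta>\<close>, where the first derivatives have moved by at most a constant times
  \<open>norm \<theta>\<close>.\<close>

lemma C2_taylor:
  fixes f :: "real^3 \<Rightarrow> complex"
  assumes d: "\<And>\<theta>. (f has_derivative (\<lambda>v. \<Sum>k\<in>UNIV. (v$k) *\<^sub>R p k \<theta>)) (at \<theta>)"
    and d2: "\<And>k \<theta>. (p k has_derivative (\<lambda>v. \<Sum>l\<in>UNIV. (v$l) *\<^sub>R q k l \<theta>)) (at \<theta>)"
    and c: "\<And>k l. continuous_on UNIV (q k l)"
  obtains C where "0 \<le> C" "\<And>\<theta>. norm \<theta> \<le> 1 \<Longrightarrow> cmod (f \<theta> - f 0 - (\<Sum>k\<in>UNIV. (\<theta>$k) *\<^sub>R p k 0)) \<le> C * (norm \<theta>)\<^sup>2"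
proof -
  have "\<exists>C\<ge>0. \<forall>\<theta>. norm \<theta> \<le> 1 \<longrightarrow> cmod (p k \<theta> - p k 0) \<le> C * norm \<theta>" for k
  proof -
    obtain C where "0 \<le> C" "\<And>\<theta> \<theta>'. norm \<theta> \<le> 1 \<Longrightarrow> norm \<theta>' \<le> 1 \<Longrightarrow> cmod (p k \<theta> - p k \<theta>') \<le> C * norm (\<theta> - \<theta>')"
      using C1_lipschitz[OF d2[of k] c[of k], where R=1] by blast
    from this(1) this(2)[of _ 0] show ?thesis by (intro exI[of _ C]) simp
  qed
  then obtain C where C: "\<And>k. 0 \<le> C k" "\<And>k \<theta>. norm \<theta> \<le> 1 \<Longrightarrow> cmod (p k \<theta> - p k 0) \<le> C k * norm \<theta>" by metis
  show ?thesis
  proof (rule that[of "\<Sum>k\<in>UNIV. C k"])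
    show "0 \<le> (\<Sum>k\<in>UNIV. C k)" by (intro sum_nonneg C)
    fix \<theta> :: "real^3" assume \<theta>: "norm \<theta> \<le> 1"
    define h where "h = (\<lambda>\<theta>. f \<theta> - (\<Sum>k\<in>UNIV. (\<theta>$k) *\<^sub>R p k 0))"
    have "cmod (h \<theta> - h 0) \<le> ((\<Sum>k\<in>UNIV. C k) * norm \<theta>) * norm (\<theta> - 0)"
    proof (rule differentiable_bound[where S="cball 0 (norm \<theta>)" and f'="\<lambda>x v. \<Sum>k\<in>UNIV. (v$k) *\<^sub>R (p k x - p k 0)"])
      fix x :: "real^3" assume x: "x \<in> cball 0 (norm \<theta>)"
      have "(h has_derivative (\<lambda>v. (\<Sum>k\<in>UNIV. (v$k) *\<^sub>R p k x) - (\<Sum>k\<in>UNIV. (v$k) *\<^sub>R p k 0))) (at x)"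
        unfolding h_def
        by (intro has_derivative_diff d has_derivative_sum has_derivative_scaleR_left bounded_linear_imp_has_derivative bounded_linear_vec_nth)
      moreover have "(\<lambda>v. \<Sum>k\<in>UNIV. (v$k) *\<^sub>R (p k x - p k 0)) = (\<lambda>v. (\<Sum>k\<in>UNIV. (v$k) *\<^sub>R p k x) - (\<Sum>k\<in>UNIV. (v$k) *\<^sub>R p k 0))"
        by (simp only: scaleR_diff_right sum_subtractf)
      ultimately show "(h has_derivative (\<lambda>v. \<Sum>k\<in>UNIV. (v$k) *\<^sub>R (p k x - p k 0))) (at x within cball 0 (norm \<theta>))"
        by (simp only: has_derivative_at_withinI)
      have "(\<Sum>k\<in>UNIV. cmod (p k x - p k 0)) \<le> (\<Sum>k\<in>UNIV. C k * norm \<theta>)"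
      proof (rule sum_mono)
        fix k
        have "cmod (p k x - p k 0) \<le> C k * norm x" using x \<theta> by (intro C) auto
        also have "\<dots> \<le> C k * norm \<theta>" using x C(1) by (intro mult_left_mono) auto
        finally show "cmod (p k x - p k 0) \<le> C k * norm \<theta>" .
      qed
      then show "onorm (\<lambda>v. \<Sum>k\<in>UNIV. (v$k) *\<^sub>R (p k x - p k 0)) \<le> (\<Sum>k\<in>UNIV. C k) * norm \<theta>"
        by (intro order_trans[OF onorm_partials_le]) (simp add: sum_distrib_right)
    qed auto
    moreover have "h \<theta> - h 0 = f \<theta> - f 0 - (\<Sum>k\<in>UNIV. (\<theta>$k) *\<^sub>R p k 0)" by (simp add: h_def)
    ultimately show "cmod (f \<theta> - f 0 - (\<Sum>k\<in>UNIV. (\<theta>$k) *\<^sub>R p k 0)) \<le> (\<Sum>k\<in>UNIV. C k) * (norm \<theta>)\<^sup>2"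
      by (simp add: power2_eq_square mult.assoc)
  qed
qed

lemma det_two_rows:
  assumes "k1 \<noteq> k2"
  shows "det ((\<chi> k l. if k = k1 then a l else if k = k2 then b l else if k = l then 1 else 0) :: real^3^3) = a k1 * b k2 - a k2 * b k1"
  using exhaust_3[of k1] exhaust_3[of k2] assms by (auto simp: det_3)

lemma det_one_row:
  "det ((\<chi> k l. if k = k0 then a l else if k = l then 1 else 0) :: real^3^3) = a k0"
  using exhaust_3[of k0] by (auto simp: det_3)

lemma sum_if_eq: "(\<Sum>l\<in>UNIV. (v$l) * (if k = l then 1 else 0)) = (v :: real^'n) $ k"
proof -
  have "(\<Sum>l\<in>UNIV. (v$l) * (if k = l then 1 else 0)) = (\<Sum>l\<in>UNIV. if k = l then v$l else 0)"
    by (intro sum.cong) auto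
  then show ?thesis by simp
qed

lemma ex_derivative_Re_minus_1:
  "(f has_derivative f') (at x) \<Longrightarrow> \<exists>E'. ((\<lambda>\<theta>. Re (f \<theta>) - 1) has_derivative E') (at x)"
  by (rule exI, rule has_derivative_diff[OF bounded_linear.has_derivative[OF bounded_linear_Re] has_derivative_const])

lemma norm_le_3:
  assumes "\<And>k. \<bar>u $ k\<bar> \<le> r"
  shows "norm (u :: real^3) \<le> 3 * r"
proof -
  have "norm u \<le> (\<Sum>k\<in>UNIV. \<bar>u $ k\<bar>)" by (rule norm_le_l1_cart)
  also have "\<dots> \<le> (\<Sum>k\<in>(UNIV::3 set). r)" by (intro sum_mono assms)
  finally show ?thesis by simp
qed

text \<open>\<open>norm \<theta> = O(\<surd>\<delta>)\<close> on the slab, so the quadratic part of \<open>psi\<close> is \<open>O(\<delta>)\<close> there.\<close>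

lemma slab_sets:
  fixes L :: "3 \<Rightarrow> real"
  assumes k: "L k \<noteq> 0"
  obtains c \<delta>0 M where "0 < c" "0 < \<delta>0" "0 \<le> M"
    "\<And>\<delta>. 0 < \<delta> \<Longrightarrow> \<delta> < \<delta>0 \<Longrightarrow> \<exists>S. compact S \<and> S \<subseteq> cball 0 1 \<and> c * \<delta> ^ 2 \<le> measure lebesgue S \<and>
      (\<forall>\<theta>\<in>S. \<bar>\<Sum>k\<in>UNIV. \<theta>$k * L k\<bar> \<le> \<bar>L k\<bar> * \<delta> \<and> (norm \<theta>)\<^sup>2 \<le> M * \<delta>)"
proof -
  obtain i j where d: "distinct [i,j,k]" using ex_distinct_3 by blast
  \<comment> \<open>With p and q the kernel of the linear form L is the graph t_k = p t_i + q
    t_j.\<close>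
  define p where "p = - L i / L k"
  define q where "q = - L j / L k"
  define m where "m = 1 + \<bar>p\<bar> + \<bar>q\<bar>"
  have m: "1 \<le> m" by (simp add: m_def)
  define M where "M = (3 * m)\<^sup>2"
  have M: "0 < M" using m by (simp add: M_def)
  show ?thesis
  proof (rule that[of 8 "min 1 (1 / M)" M])
    show "0 < min 1 (1 / M)" using M by simp
    fix \<delta> :: real assume \<delta>: "0 < \<delta>" "\<delta> < min 1 (1 / M)"
    \<comment> \<open>Half-widths sqrt \<delta> along the kernel of L and \<delta> across it: the
      volume is 8 \<delta>^2, the order required when two coordinates are tested.\<close>
    define S where "S = {t::real^3. \<bar>t$i\<bar> \<le> sqrt \<delta> \<and> \<bar>t$j\<bar> \<le> sqrt \<delta> \<and> \<bar>t$k - (p * t$i + q * t$j)\<bar> \<le> \<delta>}"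
    have sd: "\<delta> \<le> sqrt \<delta>" using \<delta> by (intro real_le_rsqrt) (auto simp: power2_eq_square mult_left_le)
    have nS: "(norm t)\<^sup>2 \<le> M * \<delta>" if "t \<in> S" for t
    proof -
      have t: "\<bar>t$i\<bar> \<le> sqrt \<delta>" "\<bar>t$j\<bar> \<le> sqrt \<delta>" "\<bar>t$k - (p * t$i + q * t$j)\<bar> \<le> \<delta>" using that by (auto simp: S_def)
      have "\<bar>p * t$i\<bar> \<le> \<bar>p\<bar> * sqrt \<delta>" "\<bar>q * t$j\<bar> \<le> \<bar>q\<bar> * sqrt \<delta>"
        using t by (auto simp: abs_mult intro!: mult_left_mono)
      then have "\<bar>t$k\<bar> \<le> m * sqrt \<delta>" using t(3) sd unfolding m_def distrib_right by linarith
      moreover have "sqrt \<delta> \<le> m * sqrt \<delta>" using m \<delta> by (simp add: mult_le_cancel_right1)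
      ultimately have "\<forall>l. \<bar>t$l\<bar> \<le> m * sqrt \<delta>" using t by (subst all_3_distinct[OF d]) auto
      then have "norm t \<le> 3 * (m * sqrt \<delta>)" by (intro norm_le_3) auto
      then have "(norm t)\<^sup>2 \<le> (3 * (m * sqrt \<delta>))\<^sup>2" by (intro power_mono) auto
      then show ?thesis using \<delta> by (simp add: M_def power_mult_distrib)
    qed
    have "M * \<delta> \<le> 1" using \<delta> M by (simp add: field_simps)
    then have "norm t \<le> 1" if "t \<in> S" for t using nS[OF that] by (metis abs_norm_cancel abs_square_le_1 order_trans)
    then have sub: "S \<subseteq> cball 0 1" by auto
    have "closed S" unfolding S_def by (intro closed_Collect_conj closed_Collect_le continuous_intros)
    with sub have cS: "compact S" using bounded_subset bounded_cball compact_eq_bounded_closed by blast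
    have "measure lebesgue S = measure lborel S" using cS by (intro measure_completion) (simp add: borel_compact)
    also have "\<dots> = 8 * sqrt \<delta> * sqrt \<delta> * \<delta>" unfolding S_def by (rule measure_slab[OF d]) (use \<delta> in auto)
    finally have mS: "8 * \<delta> ^ 2 \<le> measure lebesgue S" using \<delta> by (simp add: power2_eq_square)
    have "\<bar>\<Sum>k\<in>UNIV. t$k * L k\<bar> \<le> \<bar>L k\<bar> * \<delta>" if "t \<in> S" for t
    proof -
      have "(\<Sum>k\<in>UNIV. t$k * L k) = L k * (t$k - (p * t$i + q * t$j))"
        using k by (simp add: sum_3_distinct[OF d] p_def q_def field_simps)
      also have "\<bar>\<dots>\<bar> \<le> \<bar>L k\<bar> * \<delta>"
        unfolding abs_mult using that by (intro mult_left_mono) (auto simp: S_def)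
      finally show ?thesis .
    qed
    then show "\<exists>S. compact S \<and> S \<subseteq> cball 0 1 \<and> 8 * \<delta> ^ 2 \<le> measure lebesgue S \<and>
      (\<forall>\<theta>\<in>S. \<bar>\<Sum>k\<in>UNIV. \<theta>$k * L k\<bar> \<le> \<bar>L k\<bar> * \<delta> \<and> (norm \<theta>)\<^sup>2 \<le> M * \<delta>)"
      using cS sub mS nS by blast
  qed (use M in auto)
qed

section \<open>Necessity\<close>

context
  fixes \<phi> :: "complex^3 \<Rightarrow> complex^3"
  assumes holo: "\<forall>j. holo3 (\<lambda>z. \<phi> z $ j) poly_D"
    and maps: "\<phi> ` poly_D \<subseteq> poly_D"
    and smooth: "Ck_upto 3 \<phi> poly_D poly_cD"
begin

lemma comp_holo: "holo3 (\<lambda>z. \<phi> z $ j) poly_D"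
  using holo by blast

lemma comp_C2: "Ck_upto 2 (\<lambda>z. \<phi> z $ j) poly_D poly_cD"
proof -
  have "Ck_upto (Suc 2) \<phi> poly_D poly_cD" using smooth by (simp add: numeral_3_eq_3 numeral_2_eq_2)
  from Ck_upto_bounded_linear[OF bounded_linear_vec_nth Ck_upto_mono[OF this]] show ?thesis .
qed

lemma comp_maps: "z \<in> poly_D \<Longrightarrow> cmod (\<phi> z $ j) < 1"
  using maps by (auto simp: poly_D_def)

lemma phi_continuous: "continuous_on poly_cD \<phi>"
  by (rule Ck_upto_continuous[OF smooth])

lemma phi_cD: "\<phi> ` poly_cD \<subseteq> poly_cD"
proof
  fix w assume "w \<in> \<phi> ` poly_cD"
  then obtain z where z: "z \<in> poly_cD" "w = \<phi> z" by blast
  have "cmod (\<phi> z $ j) \<le> 1" for j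
    by (rule poly_cD_bound[OF Ck_upto_continuous[OF comp_C2] _ z(1)]) (rule comp_maps)
  then show "w \<in> poly_cD" by (simp add: poly_cD_def z(2))
qed

lemma psi_data:
  assumes \<xi>: "\<xi> \<in> torus3" and u: "cmod (\<phi> \<xi> $ j) = 1"
  obtains p q where
    "\<And>\<theta>. (psi (\<lambda>z. \<phi> z $ j) \<xi> has_derivative (\<lambda>v. \<Sum>k\<in>UNIV. (v$k) *\<^sub>R p k \<theta>)) (at \<theta>)"
    "\<And>k \<theta>. (p k has_derivative (\<lambda>v. \<Sum>l\<in>UNIV. (v$l) *\<^sub>R q k l \<theta>)) (at \<theta>)"
    "\<And>k l. continuous_on UNIV (q k l)" "\<And>k. continuous_on UNIV (p k)"
    "\<And>k. p k 0 = \<i> * of_real (Im (p k 0))"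
    "\<And>k. cpartial (ttilde (\<lambda>z. \<phi> z $ j) \<xi>) one3 k = of_real (Im (p k 0))"
proof -
  obtain p q where pq:
    "\<And>\<theta>. (psi (\<lambda>z. \<phi> z $ j) \<xi> has_derivative (\<lambda>v. \<Sum>k\<in>UNIV. (v$k) *\<^sub>R p k \<theta>)) (at \<theta>)"
    "\<And>k \<theta>. (p k has_derivative (\<lambda>v. \<Sum>l\<in>UNIV. (v$l) *\<^sub>R q k l \<theta>)) (at \<theta>)"
    "\<And>k l. continuous_on UNIV (q k l)"
    "\<And>k. cpartial (ttilde (\<lambda>z. \<phi> z $ j) \<xi>) one3 k = - \<i> * p k 0"
    by (rule psi_C2[OF comp_holo comp_C2 \<xi>, of j]) blast
  have "Re (p k 0) = 0" for k
    by (rule Re_psi_derivative_0[OF comp_holo comp_C2 _ \<xi> u pq(1)]) (rule comp_maps)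
  then have p0: "p k 0 = \<i> * of_real (Im (p k 0))" for k by (simp add: complex_eq_iff)
  have "continuous_on UNIV (p k)" for k
    by (intro continuous_at_imp_continuous_on ballI has_derivative_continuous[OF pq(2)])
  moreover have "cpartial (ttilde (\<lambda>z. \<phi> z $ j) \<xi>) one3 k = of_real (Im (p k 0))" for k
  proof -
    have "- \<i> * p k 0 = of_real (Im (p k 0))" by (subst p0) (simp add: complex_eq_iff)
    then show ?thesis using pq(4) by simp
  qed
  ultimately show ?thesis by (intro that[OF pq(1-3) _ p0])
qed

lemma phi_psi_0: "cmod (\<phi> \<xi> $ j) = 1 \<Longrightarrow> \<xi> \<in> torus3 \<Longrightarrow> psi (\<lambda>z. \<phi> z $ j) \<xi> 0 = 1"
  by (rule psi_0[OF comp_holo comp_C2]) (auto intro: comp_maps)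

lemma phi_norm_psi_le: "cmod (\<phi> \<xi> $ j) = 1 \<Longrightarrow> \<xi> \<in> torus3 \<Longrightarrow> cmod (psi (\<lambda>z. \<phi> z $ j) \<xi> \<theta>) \<le> 1"
  by (rule norm_psi_le[OF comp_holo comp_C2]) (auto intro: comp_maps)

text \<open>With all three coordinates tested the critical exponent is 3, the dimension of the
  torus. Each psi is Lipschitz, so a cube of side 2 \<delta> already is a large set.\<close>

lemma necessity_torus:
  assumes comp: "compact_comp_op \<phi>"
  shows "\<phi> ` torus3 \<inter> torus3 = {}"
proof (rule ccontr)
  assume "\<not> ?thesis"
  then obtain \<xi> where \<xi>: "\<xi> \<in> torus3" "\<phi> \<xi> \<in> torus3" by blast
  then have u: "cmod (\<phi> \<xi> $ j) = 1" for j by (simp add: torus3_def)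
  have "\<exists>C\<ge>0. \<forall>\<theta>. norm \<theta> \<le> 1 \<longrightarrow> cmod (1 - psi (\<lambda>z. \<phi> z $ j) \<xi> \<theta>) \<le> C * norm \<theta>" for j
  proof -
    obtain p q where pq: "\<And>\<theta>. (psi (\<lambda>z. \<phi> z $ j) \<xi> has_derivative (\<lambda>v. \<Sum>k\<in>UNIV. (v$k) *\<^sub>R p k \<theta>)) (at \<theta>)"
      "\<And>k. continuous_on UNIV (p k)" by (rule psi_data[OF \<xi>(1) u, of j]) blast
    obtain C where C: "0 \<le> C" "\<And>\<theta> \<theta>'. norm \<theta> \<le> 1 \<Longrightarrow> norm \<theta>' \<le> 1 \<Longrightarrow> cmod (psi (\<lambda>z. \<phi> z $ j) \<xi> \<theta> - psi (\<lambda>z. \<phi> z $ j) \<xi> \<theta>') \<le> C * norm (\<theta> - \<theta>')"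
      using C1_lipschitz[OF pq, where R=1] by blast
    show ?thesis using C(1) C(2)[of 0] by (intro exI[of _ C]) (simp add: phi_psi_0[OF u \<xi>(1)])
  qed
  then obtain C where C: "\<And>j. 0 \<le> C j" "\<And>j \<theta>. norm \<theta> \<le> 1 \<Longrightarrow> cmod (1 - psi (\<lambda>z. \<phi> z $ j) \<xi> \<theta>) \<le> C j * norm \<theta>"
    by metis
  define K where "K = (\<Sum>j\<in>UNIV. C j)"
  have K: "C j \<le> K" for j unfolding K_def using C(1) by (intro member_le_sum) auto
  show False
  proof (rule not_compact_of_large_sets[OF comp phi_continuous maps phi_cD \<xi>(1), of UNIV 8 "1/3" "3 * K"])
    fix \<delta> :: real assume \<delta>: "0 < \<delta>" "\<delta> < 1/3"
    define S where "S = cbox (\<chi> k::3. - (if k \<in> UNIV then \<delta> else 0)) (\<chi> k. if k \<in> (UNIV :: 3 set) then \<delta> else 0)"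
    have S: "norm u \<le> 3 * \<delta>" if "u \<in> S" for u
      using that by (intro norm_le_3) (auto simp: S_def mem_box_cart abs_le_iff minus_le_iff)
    have "measure lebesgue S = 8 * \<delta> ^ card (UNIV :: 3 set)"
      unfolding S_def using \<delta> by (subst measure_cbox_If) (auto simp: power_mult_distrib)
    moreover have "cmod (1 - psi (\<lambda>z. \<phi> z $ j) \<xi> u) \<le> 3 * K * \<delta>" if "u \<in> S" for u j
    proof -
      have "cmod (1 - psi (\<lambda>z. \<phi> z $ j) \<xi> u) \<le> C j * norm u" using S[OF that] \<delta> by (intro C) auto
      also have "\<dots> \<le> K * (3 * \<delta>)" using K C(1) S[OF that] by (intro mult_mono) (auto intro: order_trans)
      finally show ?thesis by simp
    qed
    moreover have "S \<subseteq> cball 0 1" using S \<delta> by force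
    ultimately show "\<exists>S. compact S \<and> S \<subseteq> cball 0 1 \<and> 8 * \<delta> ^ card (UNIV :: 3 set) \<le> measure lebesgue S \<and>
      (\<forall>\<theta>\<in>S. \<forall>j\<in>UNIV. cmod (1 - psi (\<lambda>z. \<phi> z $ j) \<xi> \<theta>) \<le> 3 * K * \<delta>)"
      by (intro exI[of _ S]) (auto simp: S_def)
  qed (use u in auto)
qed

text \<open>The critical exponent is 2. If the gradients are dependent, both first-order parts are
  multiples of one linear form and the slab of thickness \<delta> and width sqrt \<delta> is too
  large. If the real parts depend on the two imaginary parts only, the preimage of a box with two
  short sides and one fixed side is too large.\<close>

lemma necessity_pair:
  assumes comp: "compact_comp_op \<phi>" and \<xi>: "\<xi> \<in> torus3" and i: "i1 \<noteq> i2"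
    and u: "cmod (\<phi> \<xi> $ i1) = 1" "cmod (\<phi> \<xi> $ i2) = 1"
  shows "truly3d (\<lambda>z. \<phi> z $ i1) (\<lambda>z. \<phi> z $ i2) \<xi>"
proof -
  let ?g1 = "\<lambda>z. \<phi> z $ i1" and ?g2 = "\<lambda>z. \<phi> z $ i2"
  obtain p q where p: "\<And>\<theta>. (psi ?g1 \<xi> has_derivative (\<lambda>v. \<Sum>k\<in>UNIV. (v$k) *\<^sub>R p k \<theta>)) (at \<theta>)"
    "\<And>k \<theta>. (p k has_derivative (\<lambda>v. \<Sum>l\<in>UNIV. (v$l) *\<^sub>R q k l \<theta>)) (at \<theta>)"
    "\<And>k l. continuous_on UNIV (q k l)" "\<And>k. continuous_on UNIV (p k)"
    "\<And>k. p k 0 = \<i> * of_real (Im (p k 0))" "\<And>k. cpartial (ttilde ?g1 \<xi>) one3 k = of_real (Im (p k 0))"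
    by (rule psi_data[OF \<xi> u(1)]) blast
  obtain p' q' where p': "\<And>\<theta>. (psi ?g2 \<xi> has_derivative (\<lambda>v. \<Sum>k\<in>UNIV. (v$k) *\<^sub>R p' k \<theta>)) (at \<theta>)"
    "\<And>k \<theta>. (p' k has_derivative (\<lambda>v. \<Sum>l\<in>UNIV. (v$l) *\<^sub>R q' k l \<theta>)) (at \<theta>)"
    "\<And>k l. continuous_on UNIV (q' k l)" "\<And>k. continuous_on UNIV (p' k)"
    "\<And>k. p' k 0 = \<i> * of_real (Im (p' k 0))" "\<And>k. cpartial (ttilde ?g2 \<xi>) one3 k = of_real (Im (p' k 0))"
    by (rule psi_data[OF \<xi> u(2)]) blast
  define a where "a = (\<lambda>k. Im (p k 0))"
  define b where "b = (\<lambda>k. Im (p' k 0))"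
  note psi0 = phi_psi_0[OF u(1) \<xi>] phi_psi_0[OF u(2) \<xi>]
  have card: "card {i1, i2} = 2" using i by simp
  note nc = not_compact_of_large_sets[OF comp phi_continuous maps phi_cD \<xi>, of "{i1,i2}", unfolded card]
  have lin: "lin_indep2 (cgrad (ttilde ?g1 \<xi>) one3) (cgrad (ttilde ?g2 \<xi>) one3)"
  proof (rule ccontr)
    assume "\<not> ?thesis"
    then obtain \<alpha> \<beta> where ab: "\<alpha> \<noteq> 0 \<or> \<beta> \<noteq> 0"
      and eq: "\<alpha> *s cgrad (ttilde ?g1 \<xi>) one3 + \<beta> *s cgrad (ttilde ?g2 \<xi>) one3 = 0"
      unfolding lin_indep2_def by blast
    have eqk: "\<alpha> * of_real (a k) + \<beta> * of_real (b k) = 0" for k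
      using arg_cong[OF eq, of "\<lambda>v. v $ k"] by (simp add: cgrad_def p(6) p'(6) a_def b_def)
    \<comment> \<open>The dependence is over the complex numbers, the gradients are real;
      eliminating the coefficients leaves the vanishing of the real minors.\<close>
    have cross: "a k * b l = a l * b k" for k l
    proof -
      have "\<alpha> * (of_real (a k) * of_real (b l) - of_real (a l) * of_real (b k)) = 0"
        "\<beta> * (of_real (a k) * of_real (b l) - of_real (a l) * of_real (b k)) = 0"
        using eqk[of k] eqk[of l] by algebra+
      then have "complex_of_real (a k) * of_real (b l) - of_real (a l) * of_real (b k) = 0" using ab by auto
      then have "complex_of_real (a k * b l) = complex_of_real (a l * b k)" by simp
      then show ?thesis by (simp only: of_real_eq_iff)
    qed
    \<comment> \<open>One nonzero real form of which both gradients are multiples. If both gradients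
      vanished, any nonzero form would serve, with both multiples 0.\<close>
    obtain L k s t where L: "L (k :: 3) \<noteq> (0 :: real)" "\<And>l. a l = s * L l" "\<And>l. b l = t * L l"
    proof (cases "\<exists>k. a k \<noteq> 0")
      case True
      then obtain k where k: "a k \<noteq> 0" by blast
      show ?thesis
      proof (rule that[of a k 1 "b k / a k"])
        show "b l = b k / a k * a l" for l using cross[of k l] k by (simp add: field_simps)
      qed (use k in auto)
    next
      case False
      show ?thesis
      proof (cases "\<exists>k. b k \<noteq> 0")
        case True
        then obtain k where "b k \<noteq> 0" by blast
        then show ?thesis using False by (intro that[of b k 0 1]) auto
      next
        case nb: False
        then show ?thesis using False by (intro that[of "\<lambda>_. 1" 1 0 0]) auto
      qed
    qed
    obtain c \<delta>0 M where S: "0 < c" "0 < \<delta>0" "0 \<le> M"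
      "\<And>\<delta>. 0 < \<delta> \<Longrightarrow> \<delta> < \<delta>0 \<Longrightarrow> \<exists>S. compact S \<and> S \<subseteq> cball 0 1 \<and> c * \<delta> ^ 2 \<le> measure lebesgue S \<and>
      (\<forall>\<theta>\<in>S. \<bar>\<Sum>k\<in>UNIV. \<theta>$k * L k\<bar> \<le> \<bar>L k\<bar> * \<delta> \<and> (norm \<theta>)\<^sup>2 \<le> M * \<delta>)"
      by (rule slab_sets[of L k, OF L(1)]) blast
    obtain C1 where C1: "0 \<le> C1" "\<And>\<theta>. norm \<theta> \<le> 1 \<Longrightarrow> cmod (psi ?g1 \<xi> \<theta> - psi ?g1 \<xi> 0 - (\<Sum>k\<in>UNIV. (\<theta>$k) *\<^sub>R p k 0)) \<le> C1 * (norm \<theta>)\<^sup>2"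
      using C2_taylor[OF p(1-3)] by blast
    obtain C2 where C2: "0 \<le> C2" "\<And>\<theta>. norm \<theta> \<le> 1 \<Longrightarrow> cmod (psi ?g2 \<xi> \<theta> - psi ?g2 \<xi> 0 - (\<Sum>k\<in>UNIV. (\<theta>$k) *\<^sub>R p' k 0)) \<le> C2 * (norm \<theta>)\<^sup>2"
      using C2_taylor[OF p'(1-3)] by blast
    \<comment> \<open>The first-order part is an imaginary multiple of L, hence O(\<delta>) on the
      slab; the Taylor remainder is O of the squared norm, again O(\<delta>).\<close>
    have est: "cmod (1 - z) \<le> \<bar>\<nu>\<bar> * (\<bar>L k\<bar> * \<delta>) + C * (M * \<delta>)"
      if \<theta>: "\<bar>\<Sum>k\<in>UNIV. \<theta>$k * L k\<bar> \<le> \<bar>L k\<bar> * \<delta>" "(norm \<theta>)\<^sup>2 \<le> M * \<delta>" and "0 \<le> C"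
        and le: "cmod (z - 1 - (\<Sum>k\<in>UNIV. (\<theta>$k) *\<^sub>R r k)) \<le> C * (norm \<theta>)\<^sup>2" and r: "\<And>k. r k = \<i> * of_real (\<nu> * L k)"
      for z \<nu> \<delta> C r and \<theta> :: "real^3"
    proof -
      have "(\<Sum>k\<in>UNIV. (\<theta>$k) *\<^sub>R r k) = \<i> * of_real (\<nu> * (\<Sum>k\<in>UNIV. \<theta>$k * L k))"
        by (simp add: r sum_distrib_left scaleR_conv_of_real mult_ac)
      then have "cmod (\<Sum>k\<in>UNIV. (\<theta>$k) *\<^sub>R r k) = \<bar>\<nu>\<bar> * \<bar>\<Sum>k\<in>UNIV. \<theta>$k * L k\<bar>"
        by (simp only: norm_mult norm_of_real abs_mult) simp
      also have "\<dots> \<le> \<bar>\<nu>\<bar> * (\<bar>L k\<bar> * \<delta>)" by (intro mult_left_mono \<theta>) auto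
      finally have 1: "cmod (\<Sum>k\<in>UNIV. (\<theta>$k) *\<^sub>R r k) \<le> \<bar>\<nu>\<bar> * (\<bar>L k\<bar> * \<delta>)" .
      have 2: "C * (norm \<theta>)\<^sup>2 \<le> C * (M * \<delta>)" by (intro mult_left_mono \<theta> \<open>0 \<le> C\<close>)
      have "cmod (1 - z) = cmod ((z - 1 - (\<Sum>k\<in>UNIV. (\<theta>$k) *\<^sub>R r k)) + (\<Sum>k\<in>UNIV. (\<theta>$k) *\<^sub>R r k))"
        by (simp add: norm_minus_commute)
      then show ?thesis
        using norm_triangle_ineq[of "z - 1 - (\<Sum>k\<in>UNIV. (\<theta>$k) *\<^sub>R r k)" "\<Sum>k\<in>UNIV. (\<theta>$k) *\<^sub>R r k"] 1 2 le by linarith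
    qed
    define K where "K = max (\<bar>s\<bar> * \<bar>L k\<bar> + C1 * M) (\<bar>t\<bar> * \<bar>L k\<bar> + C2 * M)"
    show False
    proof (rule nc[of c \<delta>0 K])
      fix \<delta> :: real assume \<delta>: "0 < \<delta>" "\<delta> < \<delta>0"
      from S(4)[OF this] obtain S where S: "compact S" "S \<subseteq> cball 0 1" "c * \<delta> ^ 2 \<le> measure lebesgue S"
        "\<And>\<theta>. \<theta> \<in> S \<Longrightarrow> \<bar>\<Sum>k\<in>UNIV. \<theta>$k * L k\<bar> \<le> \<bar>L k\<bar> * \<delta>" "\<And>\<theta>. \<theta> \<in> S \<Longrightarrow> (norm \<theta>)\<^sup>2 \<le> M * \<delta>" by blast
      have "cmod (1 - psi (\<lambda>z. \<phi> z $ j) \<xi> \<theta>) \<le> K * \<delta>" if \<theta>: "\<theta> \<in> S" and j: "j \<in> {i1, i2}" for \<theta> j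
      proof -
        have n: "norm \<theta> \<le> 1" using S(2) \<theta> by auto
        have "cmod (1 - psi ?g1 \<xi> \<theta>) \<le> \<bar>s\<bar> * (\<bar>L k\<bar> * \<delta>) + C1 * (M * \<delta>)"
          by (rule est[OF S(4,5)[OF \<theta>] C1(1) C1(2)[OF n, unfolded psi0]]) (subst p(5), simp add: L(2)[unfolded a_def])
        also have "\<dots> = (\<bar>s\<bar> * \<bar>L k\<bar> + C1 * M) * \<delta>" by (simp add: algebra_simps)
        also have "\<dots> \<le> K * \<delta>" using \<delta> by (intro mult_right_mono) (auto simp: K_def)
        finally have 1: "cmod (1 - psi ?g1 \<xi> \<theta>) \<le> K * \<delta>" .
        have "cmod (1 - psi ?g2 \<xi> \<theta>) \<le> \<bar>t\<bar> * (\<bar>L k\<bar> * \<delta>) + C2 * (M * \<delta>)"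
          by (rule est[OF S(4,5)[OF \<theta>] C2(1) C2(2)[OF n, unfolded psi0]]) (subst p'(5), simp add: L(3)[unfolded b_def])
        also have "\<dots> = (\<bar>t\<bar> * \<bar>L k\<bar> + C2 * M) * \<delta>" by (simp add: algebra_simps)
        also have "\<dots> \<le> K * \<delta>" using \<delta> by (intro mult_right_mono) (auto simp: K_def)
        finally show ?thesis using 1 j by auto
      qed
      then show "\<exists>S. compact S \<and> S \<subseteq> cball 0 1 \<and> c * \<delta>\<^sup>2 \<le> measure lebesgue S \<and>
         (\<forall>\<theta>\<in>S. \<forall>j\<in>{i1, i2}. cmod (1 - psi (\<lambda>z. \<phi> z $ j) \<xi> \<theta>) \<le> K * \<delta>)"
        using S(1-3) by blast
    qed (use u S in auto)
  qed
  show ?thesis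
    unfolding truly3d_def Let_def
  proof (intro conjI allI impI lin)
    fix k1 k2 :: 3
    assume k: "k1 \<noteq> k2 \<and> cpartial (ttilde ?g1 \<xi>) one3 k1 * cpartial (ttilde ?g2 \<xi>) one3 k2
        - cpartial (ttilde ?g1 \<xi>) one3 k2 * cpartial (ttilde ?g2 \<xi>) one3 k1 \<noteq> 0"
    then have "complex_of_real (a k1 * b k2 - a k2 * b k1) \<noteq> 0" by (simp add: p(6) p'(6) a_def b_def)
    then have minor: "a k1 * b k2 - a k2 * b k1 \<noteq> 0" by (metis of_real_0)
    have k12: "k1 \<noteq> k2" using k by blast
    define w where "w = (\<lambda>k \<theta>. if k = k1 then Im (psi ?g1 \<xi> \<theta>) else if k = k2 then Im (psi ?g2 \<xi> \<theta>) else \<theta> $ k)"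
    define A where "A = (\<lambda>k l \<theta>. if k = k1 then Im (p l \<theta>) else if k = k2 then Im (p' l \<theta>) else if k = l then 1 else (0::real))"
    have wd: "(w k has_derivative (\<lambda>v. \<Sum>l\<in>UNIV. (v$l) * A k l \<theta>)) (at \<theta>)" for k \<theta>
    proof -
      have "((\<lambda>\<theta>. Im (psi ?g1 \<xi> \<theta>)) has_derivative (\<lambda>v. \<Sum>l\<in>UNIV. (v$l) * Im (p l \<theta>))) (at \<theta>)"
        using bounded_linear.has_derivative[OF bounded_linear_Im p(1)] by simp
      moreover have "((\<lambda>\<theta>. Im (psi ?g2 \<xi> \<theta>)) has_derivative (\<lambda>v. \<Sum>l\<in>UNIV. (v$l) * Im (p' l \<theta>))) (at \<theta>)"
        using bounded_linear.has_derivative[OF bounded_linear_Im p'(1)] by simp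
      moreover have "((\<lambda>\<theta>. \<theta> $ k) has_derivative (\<lambda>v. \<Sum>l\<in>UNIV. (v$l) * (if k = l then 1 else 0))) (at \<theta>)"
        by (rule has_derivative_eq_rhs[OF bounded_linear_imp_has_derivative[OF bounded_linear_vec_nth]]) (simp add: sum_if_eq)
      ultimately show ?thesis unfolding w_def A_def by (cases "k = k1"; cases "k = k2") simp_all
    qed
    have Ac: "continuous_on UNIV (A k l)" for k l
      unfolding A_def using p(4) p'(4) by (cases "k = k1"; cases "k = k2"; cases "k = l") (auto intro!: continuous_intros)
    have "(\<chi> k l. A k l 0) = ((\<chi> k l. if k = k1 then a l else if k = k2 then b l else if k = l then 1 else 0) :: real^3^3)"
      by (simp add: vec_eq_iff A_def a_def b_def)
    then have det: "det (\<chi> k l. A k l 0) \<noteq> 0" using minor by (simp only: det_two_rows[OF k12] not_False_eq_True)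
    have U: "(\<lambda>\<theta>. \<chi> k. if k = k1 then Im (psi ?g1 \<xi> \<theta>) else if k = k2 then Im (psi ?g2 \<xi> \<theta>) else \<theta> $ k) = (\<lambda>\<theta>. \<chi> k. w k \<theta>)"
      by (simp add: w_def)
    show "local_diffeo_at (\<lambda>\<theta>. \<chi> k. if k = k1 then Im (psi ?g1 \<xi> \<theta>) else if k = k2 then Im (psi ?g2 \<xi> \<theta>) else \<theta> $ k) 0"
      unfolding U by (rule local_diffeo_C1[OF wd Ac det])
    fix V W Ui N
    assume dat: "local_diffeo_data (\<lambda>\<theta>. \<chi> k. if k = k1 then Im (psi ?g1 \<xi> \<theta>) else if k = k2 then Im (psi ?g2 \<xi> \<theta>) else \<theta> $ k) 0 V W Ui"
      and N: "open N \<and> 0 \<in> N \<and> N \<subseteq> W"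
    show "\<nexists>h1 h2. \<forall>u\<in>N. Re (psi ?g1 \<xi> (Ui u)) - 1 = h1 (u $ k1) (u $ k2) \<and> Re (psi ?g2 \<xi> (Ui u)) - 1 = h2 (u $ k1) (u $ k2)"
    proof
      assume "\<exists>h1 h2. \<forall>u\<in>N. Re (psi ?g1 \<xi> (Ui u)) - 1 = h1 (u $ k1) (u $ k2) \<and> Re (psi ?g2 \<xi> (Ui u)) - 1 = h2 (u $ k1) (u $ k2)"
      then obtain h1 h2 where h: "\<And>u. u \<in> N \<Longrightarrow> Re (psi ?g1 \<xi> (Ui u)) - 1 = h1 (u $ k1) (u $ k2)"
         "\<And>u. u \<in> N \<Longrightarrow> Re (psi ?g2 \<xi> (Ui u)) - 1 = h2 (u $ k1) (u $ k2)" by blast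
      define E where "E = (\<lambda>j \<theta>. Re (psi (\<lambda>z. \<phi> z $ j) \<xi> \<theta>) - 1)"
      have w0: "w k 0 = 0" for k by (simp add: w_def psi0)
      have E': "\<exists>E'. (E j has_derivative E') (at 0)" if "j \<in> {i1, i2}" for j
        using that ex_derivative_Re_minus_1[OF p(1)[of 0]] ex_derivative_Re_minus_1[OF p'(1)[of 0]]
        unfolding E_def by blast
      have E0: "E j 0 = 0" if "j \<in> {i1, i2}" for j using that psi0 by (auto simp: E_def)
      have dep: "E j (Ui v) = E j (Ui v')" if "j \<in> {i1, i2}" "v \<in> N" "v' \<in> N" "\<And>k. k \<in> {k1, k2} \<Longrightarrow> v $ k = v' $ k" for j v v'
        using that h[of v] h[of v'] by (auto simp: E_def)
      obtain c \<delta>0 C where S: "0 < c" "0 < \<delta>0" "0 \<le> C"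
        "\<And>\<delta>. 0 < \<delta> \<Longrightarrow> \<delta> < \<delta>0 \<Longrightarrow> \<exists>S. compact S \<and> S \<subseteq> cball 0 1 \<and> c * \<delta> ^ card {k1, k2} \<le> measure lebesgue S \<and>
          (\<forall>\<theta>\<in>S. (\<forall>k\<in>{k1, k2}. \<bar>w k \<theta>\<bar> \<le> \<delta>) \<and> (\<forall>j\<in>{i1, i2}. \<bar>E j \<theta>\<bar> \<le> C * \<delta>))"
        by (rule large_sets_of_diffeo[where K="{k1,k2}" and J="{i1,i2}" and N=N, OF wd Ac w0 dat[unfolded U] _ _ _ _ E' E0 dep]) (use N in auto)
      show False
      proof (rule nc[of c \<delta>0 "C + 1"])
        fix \<delta> :: real assume \<delta>: "0 < \<delta>" "\<delta> < \<delta>0"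
        have "card {k1, k2} = 2" using k12 by simp
        from S(4)[OF \<delta>, unfolded this] obtain S where S: "compact S" "S \<subseteq> cball 0 1" "c * \<delta> ^ 2 \<le> measure lebesgue S"
          "\<And>\<theta> k. \<theta> \<in> S \<Longrightarrow> k \<in> {k1, k2} \<Longrightarrow> \<bar>w k \<theta>\<bar> \<le> \<delta>" "\<And>\<theta> j. \<theta> \<in> S \<Longrightarrow> j \<in> {i1, i2} \<Longrightarrow> \<bar>E j \<theta>\<bar> \<le> C * \<delta>"
          by blast
        have "cmod (1 - psi (\<lambda>z. \<phi> z $ j) \<xi> \<theta>) \<le> (C + 1) * \<delta>" if \<theta>: "\<theta> \<in> S" and j: "j \<in> {i1, i2}" for \<theta> j
        proof -
          have "\<bar>Im (psi (\<lambda>z. \<phi> z $ j) \<xi> \<theta>)\<bar> \<le> \<delta>"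
            using j S(4)[OF \<theta>, of k1] S(4)[OF \<theta>, of k2] k12 by (auto simp: w_def)
          then show ?thesis
            using cmod_le[of "1 - psi (\<lambda>z. \<phi> z $ j) \<xi> \<theta>"] S(5)[OF \<theta> j] by (simp add: E_def algebra_simps)
        qed
        then show "\<exists>S. compact S \<and> S \<subseteq> cball 0 1 \<and> c * \<delta>\<^sup>2 \<le> measure lebesgue S \<and>
           (\<forall>\<theta>\<in>S. \<forall>j\<in>{i1, i2}. cmod (1 - psi (\<lambda>z. \<phi> z $ j) \<xi> \<theta>) \<le> (C + 1) * \<delta>)"
          using S(1-3) by blast
      qed (use u S in auto)
    qed
  qed
qed

text \<open>The critical exponent is 1, so a neighbourhood of thickness \<delta> of a surface is too
  large. If only one partial derivative is nonzero, psi equals 1 on a whole coordinate plane; if the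
  real part depends on the imaginary part only, it is O(\<delta>) on the layer where the imaginary
  part is.\<close>

lemma necessity_single:
  assumes comp: "compact_comp_op \<phi>" and \<xi>: "\<xi> \<in> torus3" and u: "cmod (\<phi> \<xi> $ i) = 1"
  shows "truly2d (\<lambda>z. \<phi> z $ i) \<xi>"
proof -
  let ?g = "\<lambda>z. \<phi> z $ i"
  obtain p q where p: "\<And>\<theta>. (psi ?g \<xi> has_derivative (\<lambda>v. \<Sum>k\<in>UNIV. (v$k) *\<^sub>R p k \<theta>)) (at \<theta>)"
    "\<And>k. continuous_on UNIV (p k)"
    "\<And>k. cpartial (ttilde ?g \<xi>) one3 k = of_real (Im (p k 0))"
    by (rule psi_data[OF \<xi> u]) blast
  define a where "a = (\<lambda>k. Im (p k 0))"
  note psi0 = phi_psi_0[OF u \<xi>]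
  note nc = not_compact_of_large_sets[OF comp phi_continuous maps phi_cD \<xi>, of "{i}", simplified]
  have two: "2 \<le> card {k. cpartial (ttilde ?g \<xi>) one3 k \<noteq> 0}"
  proof (rule ccontr)
    assume "\<not> ?thesis"
    then have "card {k. cpartial (ttilde ?g \<xi>) one3 k \<noteq> 0} \<le> Suc 0" by simp
    then obtain k0 where k0: "{k. cpartial (ttilde ?g \<xi>) one3 k \<noteq> 0} \<subseteq> {k0}"
      unfolding card_le_Suc0_iff_eq[OF finite] by blast
    have one: "psi ?g \<xi> \<theta> = 1" if "\<theta> $ k0 = 0" for \<theta>
      by (rule psi_eq_1_of_single_partial[OF comp_holo comp_C2 _ \<xi> u _ that]) (use k0 comp_maps in auto)
    obtain C where C: "0 \<le> C" "\<And>\<theta> \<theta>'. norm \<theta> \<le> 1 \<Longrightarrow> norm \<theta>' \<le> 1 \<Longrightarrow> cmod (psi ?g \<xi> \<theta> - psi ?g \<xi> \<theta>') \<le> C * norm (\<theta> - \<theta>')"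
      using C1_lipschitz[OF p(1,2), where R=1] by blast
    show False
    \<comment> \<open>The constants come from the box with one side \<open>2 * \<delta>\<close> and
      two sides 2/3; its half-sides are at most 1/3, so it lies in the unit ball.\<close>
    proof (rule nc[of "2 * (2 / 3) ^ card (- {k0})" "1/3" "3 * C"])
      fix \<delta> :: real assume \<delta>: "0 < \<delta>" "\<delta> < 1/3"
      define S where "S = cbox (\<chi> k::3. - (if k \<in> {k0} then \<delta> else 1/3)) (\<chi> k. if k \<in> {k0} then \<delta> else 1/3)"
      have S: "\<bar>\<theta> $ k0\<bar> \<le> \<delta>" "\<bar>\<theta> $ k\<bar> \<le> 1/3" if "\<theta> \<in> S" for \<theta> k
        using that \<delta> by (auto simp: S_def mem_box_cart abs_le_iff minus_le_iff split: if_splits) (smt (verit))+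
      have n: "norm \<theta> \<le> 1" if "\<theta> \<in> S" for \<theta> using norm_le_3[of \<theta> "1/3"] S(2)[OF that] by simp
      have "measure lebesgue S = (2 * \<delta>) ^ card {k0} * (2 * (1 / 3)) ^ card (- {k0})"
        unfolding S_def using \<delta> by (intro measure_cbox_If) auto
      then have mS: "measure lebesgue S = 2 * (2 / 3) ^ card (- {k0}) * \<delta>" by simp
      have "cmod (1 - psi ?g \<xi> \<theta>) \<le> 3 * C * \<delta>" if \<theta>: "\<theta> \<in> S" for \<theta>
      proof -
        define \<theta>' where "\<theta>' = (\<chi> k. if k = k0 then 0 else \<theta> $ k)"
        have "\<bar>\<theta>' $ k\<bar> \<le> 1/3" for k using S(2)[OF \<theta>] by (simp add: \<theta>'_def)
        then have n': "norm \<theta>' \<le> 1" using norm_le_3[of \<theta>' "1/3"] by simp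
        have "psi ?g \<xi> \<theta>' = 1" by (rule one) (simp add: \<theta>'_def)
        then have "cmod (1 - psi ?g \<xi> \<theta>) \<le> C * norm (\<theta>' - \<theta>)" using C(2)[OF n' n[OF \<theta>]] by simp
        also have "norm (\<theta>' - \<theta>) \<le> 3 * \<delta>" using S(1)[OF \<theta>] \<delta> by (intro norm_le_3) (simp add: \<theta>'_def)
        then have "C * norm (\<theta>' - \<theta>) \<le> C * (3 * \<delta>)" using C(1) by (rule mult_left_mono)
        finally show ?thesis by simp
      qed
      then show "\<exists>S. compact S \<and> S \<subseteq> cball 0 1 \<and> 2 * (2 / 3) ^ card (- {k0}) * \<delta> \<le> measure lebesgue S \<and>
          (\<forall>\<theta>\<in>S. cmod (1 - psi ?g \<xi> \<theta>) \<le> 3 * C * \<delta>)"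
        using n mS by (intro exI[of _ S]) (auto simp: S_def)
    qed (use u in auto)
  qed
  show ?thesis
    unfolding truly2d_def Let_def
  proof (intro conjI allI impI two)
    fix k0 :: 3
    assume k: "cpartial (ttilde ?g \<xi>) one3 k0 \<noteq> 0"
    then have ak: "a k0 \<noteq> 0" by (simp add: p(3) a_def)
    define w where "w = (\<lambda>k \<theta>. if k = k0 then Im (psi ?g \<xi> \<theta>) else \<theta> $ k)"
    define A where "A = (\<lambda>k l \<theta>. if k = k0 then Im (p l \<theta>) else if k = l then 1 else (0::real))"
    have wd: "(w k has_derivative (\<lambda>v. \<Sum>l\<in>UNIV. (v$l) * A k l \<theta>)) (at \<theta>)" for k \<theta>
    proof -
      have "((\<lambda>\<theta>. Im (psi ?g \<xi> \<theta>)) has_derivative (\<lambda>v. \<Sum>l\<in>UNIV. (v$l) * Im (p l \<theta>))) (at \<theta>)"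
        using bounded_linear.has_derivative[OF bounded_linear_Im p(1)] by simp
      moreover have "((\<lambda>\<theta>. \<theta> $ k) has_derivative (\<lambda>v. \<Sum>l\<in>UNIV. (v$l) * (if k = l then 1 else 0))) (at \<theta>)"
        by (rule has_derivative_eq_rhs[OF bounded_linear_imp_has_derivative[OF bounded_linear_vec_nth]]) (simp add: sum_if_eq)
      ultimately show ?thesis unfolding w_def A_def by (cases "k = k0") simp_all
    qed
    have Ac: "continuous_on UNIV (A k l)" for k l
      unfolding A_def using p(2) by (cases "k = k0"; cases "k = l") (auto intro!: continuous_intros)
    have "(\<chi> k l. A k l 0) = ((\<chi> k l. if k = k0 then a l else if k = l then 1 else 0) :: real^3^3)"
      by (simp add: vec_eq_iff A_def a_def)
    then have det: "det (\<chi> k l. A k l 0) \<noteq> 0" using ak by (simp only: det_one_row not_False_eq_True)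
    have U: "(\<lambda>\<theta>. \<chi> k. if k = k0 then Im (psi ?g \<xi> \<theta>) else \<theta> $ k) = (\<lambda>\<theta>. \<chi> k. w k \<theta>)"
      by (simp add: w_def)
    show "local_diffeo_at (\<lambda>\<theta>. \<chi> k. if k = k0 then Im (psi ?g \<xi> \<theta>) else \<theta> $ k) 0"
      unfolding U by (rule local_diffeo_C1[OF wd Ac det])
    fix V W Ui N
    assume dat: "local_diffeo_data (\<lambda>\<theta>. \<chi> k. if k = k0 then Im (psi ?g \<xi> \<theta>) else \<theta> $ k) 0 V W Ui"
      and N: "open N \<and> 0 \<in> N \<and> N \<subseteq> W"
    show "\<nexists>h. \<forall>u\<in>N. Re (psi ?g \<xi> (Ui u)) - 1 = h (u $ k0)"
    proof
      assume "\<exists>h. \<forall>u\<in>N. Re (psi ?g \<xi> (Ui u)) - 1 = h (u $ k0)"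
      then obtain h where h: "\<And>u. u \<in> N \<Longrightarrow> Re (psi ?g \<xi> (Ui u)) - 1 = h (u $ k0)" by blast
      define E where "E = (\<lambda>j \<theta>. Re (psi (\<lambda>z. \<phi> z $ j) \<xi> \<theta>) - 1)"
      have w0: "w k 0 = 0" for k by (simp add: w_def psi0)
      have E': "\<exists>E'. (E j has_derivative E') (at 0)" if "j \<in> {i}" for j
        using that ex_derivative_Re_minus_1[OF p(1)[of 0]] unfolding E_def by blast
      have E0: "E j 0 = 0" if "j \<in> {i}" for j using that psi0 by (auto simp: E_def)
      have dep: "E j (Ui v) = E j (Ui v')" if "j \<in> {i}" "v \<in> N" "v' \<in> N" "\<And>k. k \<in> {k0} \<Longrightarrow> v $ k = v' $ k" for j v v'
        using that h[of v] h[of v'] by (auto simp: E_def)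
      obtain c \<delta>0 C where S: "0 < c" "0 < \<delta>0" "0 \<le> C"
        "\<And>\<delta>. 0 < \<delta> \<Longrightarrow> \<delta> < \<delta>0 \<Longrightarrow> \<exists>S. compact S \<and> S \<subseteq> cball 0 1 \<and> c * \<delta> ^ card {k0} \<le> measure lebesgue S \<and>
          (\<forall>\<theta>\<in>S. (\<forall>k\<in>{k0}. \<bar>w k \<theta>\<bar> \<le> \<delta>) \<and> (\<forall>j\<in>{i}. \<bar>E j \<theta>\<bar> \<le> C * \<delta>))"
        by (rule large_sets_of_diffeo[where K="{k0}" and J="{i}" and N=N, OF wd Ac w0 dat[unfolded U] _ _ _ _ E' E0 dep]) (use N in auto)
      show False
      proof (rule nc[of c \<delta>0 "C + 1"])
        fix \<delta> :: real assume \<delta>: "0 < \<delta>" "\<delta> < \<delta>0"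
        from S(4)[OF this] obtain S where S: "compact S" "S \<subseteq> cball 0 1" "c * \<delta> \<le> measure lebesgue S"
          "\<And>\<theta>. \<theta> \<in> S \<Longrightarrow> \<bar>w k0 \<theta>\<bar> \<le> \<delta>" "\<And>\<theta>. \<theta> \<in> S \<Longrightarrow> \<bar>E i \<theta>\<bar> \<le> C * \<delta>"
          by auto
        have "cmod (1 - psi ?g \<xi> \<theta>) \<le> (C + 1) * \<delta>" if \<theta>: "\<theta> \<in> S" for \<theta>
        proof -
          have "\<bar>Im (psi ?g \<xi> \<theta>)\<bar> \<le> \<delta>"
            using S(4)[OF \<theta>] by (simp add: w_def)
          then show ?thesis
            using cmod_le[of "1 - psi ?g \<xi> \<theta>"] S(5)[OF \<theta>] by (simp add: E_def algebra_simps)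
        qed
        then show "\<exists>S. compact S \<and> S \<subseteq> cball 0 1 \<and> c * \<delta> \<le> measure lebesgue S \<and>
           (\<forall>\<theta>\<in>S. cmod (1 - psi ?g \<xi> \<theta>) \<le> (C + 1) * \<delta>)"
          using S(1-3) by blast
      qed (use u S in auto)
    qed
  qed
qed

end

section \<open>Second-order estimates at a boundary point\<close>

lemma sum_norm_bound_3: "(\<And>k::3. f k \<le> (c::real)) \<Longrightarrow> sum f UNIV \<le> 3 * c"
  using sum_bounded_above[of UNIV f c] by simp

lemma third_index: "k0 \<noteq> m \<Longrightarrow> \<exists>k. distinct [m, k, k0 :: 3]"
  by (metis (full_types) distinct_length_2_or_more distinct_singleton ex_distinct_3 exhaust_3_distinct)

text \<open>F minus c/2 times s^2 is convex; its convexity inequality at the midpoint, written out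
  for F, gains c/4 - c/8.\<close>

lemma midpoint_of_second_derivative_ge:
  fixes F :: "real \<Rightarrow> real"
  assumes d1: "\<And>s. s \<in> {0..1} \<Longrightarrow> (F has_real_derivative F' s) (at s)"
    and d2: "\<And>s. s \<in> {0..1} \<Longrightarrow> (F' has_real_derivative F'' s) (at s)"
    and ge: "\<And>s. s \<in> {0..1} \<Longrightarrow> c \<le> F'' s"
  shows "F (1/2) \<le> (F 0 + F 1) / 2 - c / 8"
proof -
  have "convex_on {0..1} (\<lambda>s. F s - c / 2 * s\<^sup>2)"
  proof (rule f''_ge0_imp_convex[where f'="\<lambda>s. F' s - c * s" and f''="\<lambda>s. F'' s - c"])
    show "((\<lambda>s. F s - c / 2 * s\<^sup>2) has_real_derivative F' s - c * s) (at s)" if "s \<in> {0..1}" for s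
      using d1[OF that] by (auto intro!: derivative_eq_intros)
    show "((\<lambda>s. F' s - c * s) has_real_derivative F'' s - c) (at s)" if "s \<in> {0..1}" for s
      using d2[OF that] by (auto intro!: derivative_eq_intros)
  qed (use ge in auto)
  from convex_onD[OF this, of "1/2" 0 1]
  show ?thesis by (simp add: power2_eq_square field_simps)
qed

context
  fixes \<psi> :: "real^3 \<Rightarrow> complex" and p :: "3 \<Rightarrow> real^3 \<Rightarrow> complex" and q :: "3 \<Rightarrow> 3 \<Rightarrow> real^3 \<Rightarrow> complex"
    and a :: "3 \<Rightarrow> real"
  assumes d1: "\<And>\<theta>. (\<psi> has_derivative (\<lambda>v. \<Sum>k\<in>UNIV. (v$k) *\<^sub>R p k \<theta>)) (at \<theta>)"
    and d2: "\<And>k \<theta>. (p k has_derivative (\<lambda>v. \<Sum>l\<in>UNIV. (v$l) *\<^sub>R q k l \<theta>)) (at \<theta>)"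
    and qc: "\<And>k l. continuous_on UNIV (q k l)" and pc: "\<And>k. continuous_on UNIV (p k)"
    and p0: "\<And>k. p k 0 = \<i> * of_real (a k)"
    and \<psi>0: "\<psi> 0 = 1" and \<psi>1: "\<And>\<theta>. cmod (\<psi> \<theta>) \<le> 1"
begin

text \<open>Minus the Hessian form of Re psi at 0, thus twice the quadratic form Q of the expansion
  Re psi = 1 - Q + o.\<close>

definition neg_hess :: "real^3 \<Rightarrow> real" where
  "neg_hess v = - Re (\<Sum>k\<in>UNIV. \<Sum>l\<in>UNIV. (v$k * v$l) *\<^sub>R q k l 0)"

lemma line_deriv1:
  "((\<lambda>s. Re (\<beta> * \<psi> (\<theta> + s *\<^sub>R v))) has_real_derivative Re (\<beta> * (\<Sum>k\<in>UNIV. (v$k) *\<^sub>R p k (\<theta> + s *\<^sub>R v)))) (at s)"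
proof -
  have "((\<lambda>s. \<theta> + s *\<^sub>R v) has_derivative (\<lambda>s. s *\<^sub>R v)) (at s)"
    by (auto intro!: derivative_eq_intros)
  from diff_chain_at[OF this d1]
  have "((\<lambda>s. \<psi> (\<theta> + s *\<^sub>R v)) has_derivative (\<lambda>s'. \<Sum>k\<in>UNIV. (s' * v$k) *\<^sub>R p k (\<theta> + s *\<^sub>R v))) (at s)"
    by (simp add: o_def)
  from bounded_linear.has_derivative[OF bounded_linear_Re has_derivative_mult_right[OF this, of \<beta>]]
  show ?thesis
    unfolding has_field_derivative_def
    by (rule has_derivative_eq_rhs) (simp add: fun_eq_iff sum_distrib_left sum_distrib_right algebra_simps)
qed

lemma line_deriv2:
  "((\<lambda>s. Re (\<beta> * (\<Sum>k\<in>UNIV. (v$k) *\<^sub>R p k (\<theta> + s *\<^sub>R v)))) has_real_derivative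
     Re (\<beta> * (\<Sum>k\<in>UNIV. \<Sum>l\<in>UNIV. (v$k * v$l) *\<^sub>R q k l (\<theta> + s *\<^sub>R v)))) (at s)"
proof -
  have l: "((\<lambda>s. \<theta> + s *\<^sub>R v) has_derivative (\<lambda>s. s *\<^sub>R v)) (at s)"
    by (auto intro!: derivative_eq_intros)
  have "((\<lambda>s. p k (\<theta> + s *\<^sub>R v)) has_derivative (\<lambda>s'. \<Sum>l\<in>UNIV. (s' * v$l) *\<^sub>R q k l (\<theta> + s *\<^sub>R v))) (at s)" for k
    using diff_chain_at[OF l d2] by (simp add: o_def)
  then have "((\<lambda>s. \<Sum>k\<in>UNIV. (v$k) *\<^sub>R p k (\<theta> + s *\<^sub>R v)) has_derivative
      (\<lambda>s'. \<Sum>k\<in>UNIV. (v$k) *\<^sub>R (\<Sum>l\<in>UNIV. (s' * v$l) *\<^sub>R q k l (\<theta> + s *\<^sub>R v)))) (at s)"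
    by (intro has_derivative_sum has_derivative_scaleR_right)
  from bounded_linear.has_derivative[OF bounded_linear_Re has_derivative_mult_right[OF this, of \<beta>]]
  show ?thesis
    unfolding has_field_derivative_def
    by (rule has_derivative_eq_rhs) (simp add: fun_eq_iff sum_distrib_left sum_distrib_right scaleR_sum_right algebra_simps)
qed

text \<open>Nine entries of the Hessian, each off by at most \<eta>.\<close>

lemma neg_hess_perturb:
  assumes \<eta>: "\<And>k l. cmod (\<beta> * q k l \<theta> - q k l 0) \<le> \<eta>"
  shows "neg_hess v - 9 * \<eta> * (norm v)\<^sup>2 \<le> - Re (\<beta> * (\<Sum>k\<in>UNIV. \<Sum>l\<in>UNIV. (v$k * v$l) *\<^sub>R q k l \<theta>))"
proof -
  have "\<beta> * (\<Sum>k\<in>UNIV. \<Sum>l\<in>UNIV. (v$k * v$l) *\<^sub>R q k l \<theta>) - (\<Sum>k\<in>UNIV. \<Sum>l\<in>UNIV. (v$k * v$l) *\<^sub>R q k l 0)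
      = (\<Sum>k\<in>UNIV. \<Sum>l\<in>UNIV. (v$k * v$l) *\<^sub>R (\<beta> * q k l \<theta> - q k l 0))"
    by (simp add: sum_distrib_left sum_subtractf[symmetric] scaleR_diff_right)
  also have "cmod \<dots> \<le> (\<Sum>k\<in>UNIV. \<Sum>l\<in>UNIV. cmod ((v$k * v$l) *\<^sub>R (\<beta> * q k l \<theta> - q k l 0)))"
    by (intro sum_norm_le norm_sum)
  also have "\<dots> \<le> 3 * (3 * (norm v * norm v * \<eta>))"
    by (intro sum_norm_bound_3) (auto simp: abs_mult intro!: mult_mono component_le_norm_cart \<eta>)
  finally have "\<bar>Re (\<beta> * (\<Sum>k\<in>UNIV. \<Sum>l\<in>UNIV. (v$k * v$l) *\<^sub>R q k l \<theta>) - (\<Sum>k\<in>UNIV. \<Sum>l\<in>UNIV. (v$k * v$l) *\<^sub>R q k l 0))\<bar> \<le> 9 * \<eta> * (norm v)\<^sup>2"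
    using abs_Re_le_cmod order_trans by (fastforce simp: power2_eq_square mult_ac)
  then show ?thesis by (simp add: neg_hess_def abs_le_iff)
qed

text \<open>The parameter of a kernel may point to any boundary point near the value of \<phi>, not
  only to that value; the unimodular factor \<beta> accounts for this, and all bounds have to be
  uniform in it.\<close>

lemma local_small:
  assumes \<epsilon>: "0 < (\<epsilon>::real)"
  obtains \<rho> where "0 < \<rho>" "\<rho> \<le> 1"
    "\<And>\<beta> \<theta>. cmod \<beta> = 1 \<Longrightarrow> norm \<theta> < \<rho> \<Longrightarrow> cmod (1 - \<beta>) \<le> \<rho> \<Longrightarrow> (\<forall>k. cmod (\<beta> * p k \<theta> - p k 0) \<le> \<epsilon>) \<and> (\<forall>k l. cmod (\<beta> * q k l \<theta> - q k l 0) \<le> \<epsilon>)"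
proof -
  have one: "\<exists>r>0. \<forall>\<beta> \<theta>. cmod \<beta> = 1 \<longrightarrow> norm \<theta> < r \<longrightarrow> cmod (1 - \<beta>) \<le> r \<longrightarrow> cmod (\<beta> * f \<theta> - f 0) \<le> \<epsilon>"
    if f: "continuous_on UNIV f" for f :: "real^3 \<Rightarrow> complex"
  proof -
    obtain r1 where r1: "0 < r1" "\<And>\<theta>. norm \<theta> < r1 \<Longrightarrow> cmod (f \<theta> - f 0) < \<epsilon> / 2"
      using f \<epsilon> unfolding continuous_on_iff by (metis UNIV_I dist_0_norm dist_norm half_gt_zero dist_commute)
    \<comment> \<open>The second entry controls (1 - \<beta>) f 0, the error caused by the rotation;
      the 1 keeps the denominator positive.\<close>
    define r where "r = min r1 (\<epsilon> / (2 * (cmod (f 0) + 1)))"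
    have r: "0 < r" "r \<le> r1" "r * cmod (f 0) \<le> \<epsilon> / 2"
    proof -
      have pos: "0 < cmod (f 0) + 1" using norm_ge_zero[of "f 0"] by linarith
      then show "0 < r" "r \<le> r1" using r1 \<epsilon> by (auto simp: r_def)
      have "r * cmod (f 0) \<le> (\<epsilon> / (2 * (cmod (f 0) + 1))) * (cmod (f 0) + 1)"
        using \<epsilon> pos by (intro mult_mono) (auto simp: r_def)
      also have "\<dots> = \<epsilon> / 2" using pos by (simp add: field_simps)
      finally show "r * cmod (f 0) \<le> \<epsilon> / 2" .
    qed
    show ?thesis
    proof (intro exI[of _ r] conjI allI impI r(1))
      fix \<beta> :: complex and \<theta> :: "real^3"
      assume b: "cmod \<beta> = 1" "norm \<theta> < r" "cmod (1 - \<beta>) \<le> r"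
      have "\<beta> * f \<theta> - f 0 = \<beta> * (f \<theta> - f 0) - (1 - \<beta>) * f 0" by (simp add: algebra_simps)
      also have "cmod \<dots> \<le> cmod (f \<theta> - f 0) + cmod (1 - \<beta>) * cmod (f 0)"
        using norm_triangle_ineq4[of "\<beta> * (f \<theta> - f 0)" "(1 - \<beta>) * f 0"] by (simp add: norm_mult b)
      also have "\<dots> \<le> \<epsilon> / 2 + r * cmod (f 0)"
        using r1(2)[of \<theta>] b r by (intro add_mono mult_right_mono) auto
      finally show "cmod (\<beta> * f \<theta> - f 0) \<le> \<epsilon>" using r(3) by simp
    qed
  qed
  obtain rp where rp: "\<And>k. 0 < rp k" "\<And>k \<beta> \<theta>. cmod \<beta> = 1 \<Longrightarrow> norm \<theta> < rp k \<Longrightarrow> cmod (1 - \<beta>) \<le> rp k \<Longrightarrow> cmod (\<beta> * p k \<theta> - p k 0) \<le> \<epsilon>"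
    using one[OF pc] by metis
  obtain rq where rq: "\<And>k l. 0 < rq k l" "\<And>k l \<beta> \<theta>. cmod \<beta> = 1 \<Longrightarrow> norm \<theta> < rq k l \<Longrightarrow> cmod (1 - \<beta>) \<le> rq k l \<Longrightarrow> cmod (\<beta> * q k l \<theta> - q k l 0) \<le> \<epsilon>"
    using one[OF qc] by metis
  define \<rho> where "\<rho> = Min (insert 1 (range rp \<union> range (\<lambda>x. rq (fst x) (snd x))))"
  have fin: "finite (insert 1 (range rp \<union> range (\<lambda>x. rq (fst x) (snd x))))" by simp
  have "rp k \<in> insert 1 (range rp \<union> range (\<lambda>x. rq (fst x) (snd x)))" for k by blast
  then have lep: "\<rho> \<le> rp k" for k unfolding \<rho>_def using Min_le[OF fin] by blast
  have "rq k l \<in> insert 1 (range rp \<union> range (\<lambda>x. rq (fst x) (snd x)))" for k l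
    using rangeI[of "\<lambda>x. rq (fst x) (snd x)" "(k,l)"] by simp
  then have leq: "\<rho> \<le> rq k l" for k l unfolding \<rho>_def using Min_le[OF fin] by blast
  show ?thesis
  proof (rule that[of \<rho>])
    show "0 < \<rho>" unfolding \<rho>_def using rp(1) rq(1) by (subst Min_gr_iff[OF fin]) auto
    show "\<rho> \<le> 1" unfolding \<rho>_def using Min_le[OF fin] by blast
    fix \<beta> :: complex and \<theta> :: "real^3" assume b: "cmod \<beta> = 1" "norm \<theta> < \<rho>" "cmod (1 - \<beta>) \<le> \<rho>"
    show "(\<forall>k. cmod (\<beta> * p k \<theta> - p k 0) \<le> \<epsilon>) \<and> (\<forall>k l. cmod (\<beta> * q k l \<theta> - q k l 0) \<le> \<epsilon>)"
      using rp(2)[OF b(1) less_le_trans[OF b(2) lep] order_trans[OF b(3) lep]]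
        rq(2)[OF b(1) less_le_trans[OF b(2) leq] order_trans[OF b(3) leq]] by blast
  qed
qed

text \<open>\<open>Re (1 - \<beta> \<psi>) \<ge> 0\<close> is at most \<open>\<delta>\<close> at both ends of the segment, so its second derivative along the
  segment cannot be large.\<close>

lemma local_difference_bounds:
  assumes \<epsilon>: "0 < \<epsilon>"
  obtains \<rho> where "0 < \<rho>" "\<rho> \<le> 1"
    "\<And>\<beta> \<delta> \<theta> \<theta>'. cmod \<beta> = 1 \<Longrightarrow> \<delta> \<le> \<rho> \<Longrightarrow> norm \<theta> \<le> \<rho> \<Longrightarrow> norm \<theta>' \<le> \<rho> \<Longrightarrow> cmod (1 - \<beta> * \<psi> \<theta>) \<le> \<delta> \<Longrightarrow> cmod (1 - \<beta> * \<psi> \<theta>') \<le> \<delta> \<Longrightarrow>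
      \<bar>\<Sum>k\<in>UNIV. (\<theta> - \<theta>')$k * a k\<bar> \<le> 2 * \<delta> + \<epsilon> * norm (\<theta> - \<theta>') \<and> neg_hess (\<theta> - \<theta>') \<le> 8 * \<delta> + \<epsilon> * (norm (\<theta> - \<theta>'))\<^sup>2"
proof -
  have "0 < \<epsilon> / 9" using \<epsilon> by simp
  from local_small[OF this] obtain r where r: "0 < r" "r \<le> 1"
    "\<And>\<beta> \<theta>. cmod \<beta> = 1 \<Longrightarrow> norm \<theta> < r \<Longrightarrow> cmod (1 - \<beta>) \<le> r \<Longrightarrow> (\<forall>k. cmod (\<beta> * p k \<theta> - p k 0) \<le> \<epsilon>/9) \<and> (\<forall>k l. cmod (\<beta> * q k l \<theta> - q k l 0) \<le> \<epsilon>/9)"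
    by blast
  obtain C where C: "0 \<le> C" "\<And>\<theta> \<theta>'. norm \<theta> \<le> 1 \<Longrightarrow> norm \<theta>' \<le> 1 \<Longrightarrow> cmod (\<psi> \<theta> - \<psi> \<theta>') \<le> C * norm (\<theta> - \<theta>')"
    using C1_lipschitz[OF d1 pc, where R=1] by blast
  define \<rho> where "\<rho> = r / (2 * (C + 1))"
  have \<rho>: "0 < \<rho>" "\<rho> < r" "(C + 1) * \<rho> \<le> r"
    using r C by (auto simp: \<rho>_def field_simps intro: add_pos_nonneg)
  show ?thesis
  proof (rule that[of \<rho>])
    show "\<rho> \<le> 1" using \<rho> r by simp
    fix \<beta> \<delta> \<theta> \<theta>'
    assume b: "cmod \<beta> = 1" and \<delta>: "\<delta> \<le> \<rho>" and n: "norm \<theta> \<le> \<rho>" "norm \<theta>' \<le> \<rho>"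
      and le: "cmod (1 - \<beta> * \<psi> \<theta>) \<le> \<delta>" "cmod (1 - \<beta> * \<psi> \<theta>') \<le> \<delta>"
    define v where "v = \<theta> - \<theta>'"
    \<comment> \<open>As psi 0 = 1, a point of the level set near 0 forces \<beta> to be near 1.
      Hence uniformity over all unimodular \<beta> costs nothing.\<close>
    have "1 - \<beta> = (1 - \<beta> * \<psi> \<theta>) + \<beta> * (\<psi> \<theta> - \<psi> 0)" by (simp add: \<psi>0 algebra_simps)
    also have "cmod \<dots> \<le> \<delta> + C * norm \<theta>"
      using norm_triangle_ineq[of "1 - \<beta> * \<psi> \<theta>" "\<beta> * (\<psi> \<theta> - \<psi> 0)"] le(1) C(2)[of \<theta> 0] n \<rho> r by (simp add: norm_mult b)
    also have "\<dots> \<le> \<rho> + C * \<rho>" using \<delta> n C by (intro add_mono mult_left_mono) auto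
    also have "\<dots> \<le> r" using \<rho>(3) by (simp add: algebra_simps)
    finally have b1: "cmod (1 - \<beta>) \<le> r" .
    have sm: "cmod (\<beta> * p k x - p k 0) \<le> \<epsilon>/9" "cmod (\<beta> * q k l x - q k l 0) \<le> \<epsilon>/9" if "norm x \<le> \<rho>" for k l x
      using r(3)[OF b _ b1, of x] that \<rho> by auto
    \<comment> \<open>Mean value inequality for \<beta> psi minus its linear part at 0. Its
      imaginary part compares the linear form of the difference with two quantities of size at most
      \<delta>.\<close>
    have "cmod ((\<beta> * \<psi> \<theta> - (\<Sum>k\<in>UNIV. (\<theta>$k) *\<^sub>R p k 0)) - (\<beta> * \<psi> \<theta>' - (\<Sum>k\<in>UNIV. (\<theta>'$k) *\<^sub>R p k 0))) \<le> \<epsilon> * norm (\<theta> - \<theta>')"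
    proof (rule differentiable_bound[where S="cball 0 \<rho>" and f'="\<lambda>x v. \<Sum>k\<in>UNIV. (v$k) *\<^sub>R (\<beta> * p k x - p k 0)"])
      fix x :: "real^3" assume x: "x \<in> cball 0 \<rho>"
      have "((\<lambda>\<theta>. \<beta> * \<psi> \<theta> - (\<Sum>k\<in>UNIV. (\<theta>$k) *\<^sub>R p k 0)) has_derivative (\<lambda>v. \<beta> * (\<Sum>k\<in>UNIV. (v$k) *\<^sub>R p k x) - (\<Sum>k\<in>UNIV. (v$k) *\<^sub>R p k 0))) (at x)"
        by (intro has_derivative_diff has_derivative_mult_right d1 has_derivative_sum has_derivative_scaleR_left bounded_linear_imp_has_derivative bounded_linear_vec_nth)
      moreover have "(\<lambda>v. \<Sum>k\<in>UNIV. (v$k) *\<^sub>R (\<beta> * p k x - p k 0)) = (\<lambda>v. \<beta> * (\<Sum>k\<in>UNIV. (v$k) *\<^sub>R p k x) - (\<Sum>k\<in>UNIV. (v$k) *\<^sub>R p k 0))"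
        by (simp only: scaleR_diff_right sum_subtractf sum_distrib_left mult_scaleR_right)
      ultimately show "((\<lambda>\<theta>. \<beta> * \<psi> \<theta> - (\<Sum>k\<in>UNIV. (\<theta>$k) *\<^sub>R p k 0)) has_derivative (\<lambda>v. \<Sum>k\<in>UNIV. (v$k) *\<^sub>R (\<beta> * p k x - p k 0))) (at x within cball 0 \<rho>)"
        by (simp only: has_derivative_at_withinI)
      have "(\<Sum>k\<in>UNIV. cmod (\<beta> * p k x - p k 0)) \<le> 3 * (\<epsilon>/9)"
        using x by (intro sum_norm_bound_3 sm) auto
      then show "onorm (\<lambda>v. \<Sum>k\<in>UNIV. (v$k) *\<^sub>R (\<beta> * p k x - p k 0)) \<le> \<epsilon>"
        using \<epsilon> by (intro order_trans[OF onorm_partials_le]) auto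
    qed (use n in auto)
    then have "\<bar>Im ((\<beta> * \<psi> \<theta> - (\<Sum>k\<in>UNIV. (\<theta>$k) *\<^sub>R p k 0)) - (\<beta> * \<psi> \<theta>' - (\<Sum>k\<in>UNIV. (\<theta>'$k) *\<^sub>R p k 0)))\<bar> \<le> \<epsilon> * norm (\<theta> - \<theta>')"
      using abs_Im_le_cmod order_trans by blast
    moreover have "Im (\<Sum>k\<in>UNIV. (x$k) *\<^sub>R p k 0) = (\<Sum>k\<in>UNIV. x$k * a k)" for x by (simp add: p0)
    ultimately have "\<bar>Im (\<beta> * \<psi> \<theta>) - Im (\<beta> * \<psi> \<theta>') - (\<Sum>k\<in>UNIV. (\<theta> - \<theta>')$k * a k)\<bar> \<le> \<epsilon> * norm (\<theta> - \<theta>')"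
      by (simp add: left_diff_distrib sum_subtractf algebra_simps)
    moreover have "\<bar>Im (\<beta> * \<psi> \<theta>)\<bar> \<le> \<delta>" "\<bar>Im (\<beta> * \<psi> \<theta>')\<bar> \<le> \<delta>"
      using abs_Im_le_cmod[of "1 - \<beta> * \<psi> \<theta>"] abs_Im_le_cmod[of "1 - \<beta> * \<psi> \<theta>'"] le by auto
    ultimately have 1: "\<bar>\<Sum>k\<in>UNIV. (\<theta> - \<theta>')$k * a k\<bar> \<le> 2 * \<delta> + \<epsilon> * norm (\<theta> - \<theta>')" by linarith
    have seg: "norm (\<theta>' + s *\<^sub>R v) \<le> \<rho>" if "s \<in> {0..1}" for s
    proof -
      have "\<theta>' + s *\<^sub>R v = (1 - s) *\<^sub>R \<theta>' + s *\<^sub>R \<theta>" by (simp add: v_def algebra_simps)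
      also have "\<dots> \<in> cball 0 \<rho>" using n that by (intro convexD[OF convex_cball]) auto
      finally show ?thesis by simp
    qed
    \<comment> \<open>Nonnegativity at the midpoint and values at most \<delta> at the ends leave
      \<open>neg_hess v\<close> at most 8 \<delta> up to the perturbation; the 8 is the one in the
      midpoint inequality.\<close>
    have mid: "(1 - Re (\<beta> * \<psi> (\<theta>' + (1/2) *\<^sub>R v))) \<le> ((1 - Re (\<beta> * \<psi> (\<theta>' + 0 *\<^sub>R v))) + (1 - Re (\<beta> * \<psi> (\<theta>' + 1 *\<^sub>R v)))) / 2 - (neg_hess v - 9 * (\<epsilon>/9) * (norm v)\<^sup>2) / 8"
    proof (rule midpoint_of_second_derivative_ge[where F="\<lambda>s. 1 - Re (\<beta> * \<psi> (\<theta>' + s *\<^sub>R v))"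
          and F'="\<lambda>s. - Re (\<beta> * (\<Sum>k\<in>UNIV. (v$k) *\<^sub>R p k (\<theta>' + s *\<^sub>R v)))"
          and F''="\<lambda>s. - Re (\<beta> * (\<Sum>k\<in>UNIV. \<Sum>l\<in>UNIV. (v$k * v$l) *\<^sub>R q k l (\<theta>' + s *\<^sub>R v)))"])
      fix s :: real assume s: "s \<in> {0..1}"
      show "((\<lambda>s. 1 - Re (\<beta> * \<psi> (\<theta>' + s *\<^sub>R v))) has_real_derivative - Re (\<beta> * (\<Sum>k\<in>UNIV. (v$k) *\<^sub>R p k (\<theta>' + s *\<^sub>R v)))) (at s)"
        using DERIV_diff[OF DERIV_const line_deriv1, of 1 \<beta> \<theta>' v s] by simp
      show "((\<lambda>s. - Re (\<beta> * (\<Sum>k\<in>UNIV. (v$k) *\<^sub>R p k (\<theta>' + s *\<^sub>R v)))) has_real_derivative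
          - Re (\<beta> * (\<Sum>k\<in>UNIV. \<Sum>l\<in>UNIV. (v$k * v$l) *\<^sub>R q k l (\<theta>' + s *\<^sub>R v)))) (at s)"
        by (rule DERIV_minus[OF line_deriv2])
      show "neg_hess v - 9 * (\<epsilon>/9) * (norm v)\<^sup>2 \<le> - Re (\<beta> * (\<Sum>k\<in>UNIV. \<Sum>l\<in>UNIV. (v$k * v$l) *\<^sub>R q k l (\<theta>' + s *\<^sub>R v)))"
        by (rule neg_hess_perturb) (rule sm[OF seg[OF s]])
    qed
    have nn: "0 \<le> 1 - Re (\<beta> * \<psi> x)" for x
      using complex_Re_le_cmod[of "\<beta> * \<psi> x"] \<psi>1[of x] by (simp add: norm_mult b)
    have ends: "1 - Re (\<beta> * \<psi> \<theta>) \<le> \<delta>" "1 - Re (\<beta> * \<psi> \<theta>') \<le> \<delta>"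
      using complex_Re_le_cmod[of "1 - \<beta> * \<psi> \<theta>"] complex_Re_le_cmod[of "1 - \<beta> * \<psi> \<theta>'"] le by auto
    have simps: "\<theta>' + 1 *\<^sub>R v = \<theta>" "\<theta>' + 0 *\<^sub>R v = \<theta>'" "9 * (\<epsilon> / 9) = \<epsilon>" by (simp_all add: v_def)
    have lin: "0 \<le> \<delta> - w / 8" if "0 \<le> x" "x \<le> (y + z) / 2 - w / 8" "y \<le> \<delta>" "z \<le> \<delta>" for w x y z
      using that by (simp add: field_simps)
    have "0 \<le> \<delta> - (neg_hess v - \<epsilon> * (norm v)\<^sup>2) / 8"
      by (rule lin[OF nn mid[unfolded simps] ends(2,1)])
    then have "neg_hess v \<le> 8 * \<delta> + \<epsilon> * (norm v)\<^sup>2" by simp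
    with 1 show "\<bar>\<Sum>k\<in>UNIV. (\<theta> - \<theta>')$k * a k\<bar> \<le> 2 * \<delta> + \<epsilon> * norm (\<theta> - \<theta>') \<and> neg_hess (\<theta> - \<theta>') \<le> 8 * \<delta> + \<epsilon> * (norm (\<theta> - \<theta>'))\<^sup>2"
      by (simp add: v_def)
  qed (rule \<rho>(1))
qed

text \<open>Comparing the expansion \<open>Re \<psi> = 1 - Q + o\<close> with Taylor's formula along lines.\<close>

lemma quadform_eq_neg_hess:
  assumes Q: "Q = quadform A" and lim: "((\<lambda>\<theta>. (Re (\<psi> \<theta>) - (1 - Q \<theta>)) / (norm \<theta>)\<^sup>2) \<longlongrightarrow> 0) (at 0)"
  shows "Q v = neg_hess v / 2"
proof (cases "v = 0")
  case True
  then show ?thesis by (simp add: Q quadform_def neg_hess_def)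
next
  case False
  have Qs: "Q (s *\<^sub>R v) = s\<^sup>2 * Q v" for s
    by (simp add: Q quadform_def matrix_vector_mult_scaleR power2_eq_square)
  let ?H = "neg_hess v"
  let ?f = "\<lambda>s. Re (\<psi> (s *\<^sub>R v))"
  let ?f' = "\<lambda>s. Re (\<Sum>k\<in>UNIV. (v$k) *\<^sub>R p k (s *\<^sub>R v))"
  have f1: "(?f has_real_derivative ?f' s) (at s)" for s using line_deriv1[of 1 0 v s] by simp
  have "(?f' has_real_derivative - ?H) (at 0)" using line_deriv2[of 1 v 0 0] by (simp add: neg_hess_def)
  moreover have f'0: "?f' 0 = 0" by (simp add: p0)
  ultimately have "((\<lambda>s. ?f' s / s) \<longlongrightarrow> - ?H) (at 0)" unfolding has_field_derivative_iff by simp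
  have "\<bar>Q v - ?H / 2\<bar> \<le> e" if e: "0 < e" for e
  proof -
    have e2: "0 < e / 2" using e by simp
    obtain d where d: "0 < d" "\<And>s. s \<noteq> 0 \<Longrightarrow> \<bar>s\<bar> < d \<Longrightarrow> \<bar>?f' s / s + ?H\<bar> < e / 2"
      using LIM_D[OF \<open>((\<lambda>s. ?f' s / s) \<longlongrightarrow> - ?H) (at 0)\<close> e2] by (auto simp only: diff_0_right real_norm_def diff_minus_eq_add)
    have e3: "0 < e / 2 / (norm v)\<^sup>2" using e2 False by simp
    obtain d' where d': "0 < d'" "\<And>\<theta>. \<theta> \<noteq> 0 \<Longrightarrow> norm \<theta> < d' \<Longrightarrow> \<bar>(Re (\<psi> \<theta>) - (1 - Q \<theta>)) / (norm \<theta>)\<^sup>2\<bar> < e / 2 / (norm v)\<^sup>2"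
      using LIM_D[OF lim e3] by (auto simp only: diff_0_right real_norm_def)
    define s where "s = min (d / 2) (d' / (2 * norm v))"
    have s: "0 < s" "s < d" "norm (s *\<^sub>R v) < d'"
    proof -
      show "0 < s" "s < d" using d d' False by (auto simp: s_def min_def)
      have "s * norm v \<le> d' / (2 * norm v) * norm v" by (intro mult_right_mono) (auto simp: s_def)
      also have "\<dots> = d' / 2" using False by simp
      finally show "norm (s *\<^sub>R v) < d'" using \<open>0 < s\<close> d'(1) by simp
    qed
    \<comment> \<open>By the definition of the second derivative at 0, the derivative of this
      function is at most \<open>e / 2 * s\<close> on the segment, so its increment is at most e/2
      times s^2.\<close>
    have "norm (?f s + ?H / 2 * s\<^sup>2 - (?f 0 + ?H / 2 * 0\<^sup>2)) \<le> (e / 2 * s) * norm (s - 0)"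
    proof (rule field_differentiable_bound[where S="{0..s}" and f="\<lambda>x. ?f x + ?H / 2 * x\<^sup>2" and f'="\<lambda>x. ?f' x + ?H * x"])
      show "((\<lambda>x. ?f x + ?H / 2 * x\<^sup>2) has_field_derivative ?f' x + ?H * x) (at x within {0..s})" for x
      proof -
        have "((\<lambda>x. h / 2 * x\<^sup>2) has_real_derivative h * x) (at x)" for h :: real
          by (auto intro!: derivative_eq_intros)
        from has_field_derivative_at_within[OF DERIV_add[OF f1 this]] show ?thesis .
      qed
      show "convex {0..s}" "s \<in> {0..s}" "0 \<in> {0..s}" using s by auto
      show "norm (?f' x + ?H * x) \<le> e / 2 * s" if x: "x \<in> {0..s}" for x
      proof (cases "x = 0")
        case True
        then show ?thesis using f'0 e s by simp
      next
        case False
        then have "\<bar>?f' x / x + ?H\<bar> < e / 2" using x s by (intro d) auto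
        then have "\<bar>?f' x / x + ?H\<bar> * \<bar>x\<bar> \<le> e / 2 * \<bar>x\<bar>" by (intro mult_right_mono) auto
        also have "\<dots> \<le> e / 2 * s" using x e by (intro mult_left_mono) auto
        also have "\<bar>?f' x / x + ?H\<bar> * \<bar>x\<bar> = \<bar>?f' x + ?H * x\<bar>"
          unfolding abs_mult[symmetric] using False by (simp add: distrib_right)
        finally show ?thesis by simp
      qed
    qed
    then have 1: "\<bar>?f s + ?H / 2 * s\<^sup>2 - 1\<bar> \<le> e / 2 * s\<^sup>2"
      using s by (simp add: \<psi>0 power2_eq_square mult.assoc)
    have "\<bar>(Re (\<psi> (s *\<^sub>R v)) - (1 - Q (s *\<^sub>R v))) / (norm (s *\<^sub>R v))\<^sup>2\<bar> < e / 2 / (norm v)\<^sup>2"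
      using s False by (intro d') auto
    then have "\<bar>?f s - (1 - s\<^sup>2 * Q v)\<bar> / (s\<^sup>2 * (norm v)\<^sup>2) < e / 2 / (norm v)\<^sup>2"
      by (simp add: Qs power_mult_distrib abs_divide)
    then have 2: "\<bar>?f s - (1 - s\<^sup>2 * Q v)\<bar> < e / 2 * s\<^sup>2"
      using s False by (simp add: field_simps)
    have lin: "\<bar>k - h\<bar> \<le> 2 * E" if "\<bar>F + h - 1\<bar> \<le> E" "\<bar>F - (1 - k)\<bar> < E" for F h k E :: real
      using that by linarith
    have "\<bar>s\<^sup>2 * Q v - ?H / 2 * s\<^sup>2\<bar> \<le> 2 * (e / 2 * s\<^sup>2)" by (rule lin[OF 1 2])
    moreover have "s\<^sup>2 * Q v - ?H / 2 * s\<^sup>2 = s\<^sup>2 * (Q v - ?H / 2)" by (simp add: right_diff_distrib)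
    ultimately have "s\<^sup>2 * \<bar>Q v - ?H / 2\<bar> \<le> s\<^sup>2 * e" by (simp only: abs_mult abs_power2) (simp add: mult.commute)
    then show ?thesis using s by (subst (asm) mult_le_cancel_left_pos) auto
  qed
  then have "\<bar>Q v - ?H / 2\<bar> \<le> 0" by (rule field_le_epsilon[of _ 0, simplified])
  then show ?thesis by simp
qed

text \<open>In a direction where the form is negative, Re psi would exceed 1 on a short segment from
  0.\<close>

lemma neg_hess_nonneg_of_quadform:
  assumes "\<And>v. Q v = neg_hess v / 2" "((\<lambda>\<theta>. (Re (\<psi> \<theta>) - (1 - Q \<theta>)) / (norm \<theta>)\<^sup>2) \<longlongrightarrow> 0) (at 0)"
  shows "0 \<le> neg_hess v"
proof (rule ccontr)
  assume neg: "\<not> ?thesis"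
  then have v: "v \<noteq> 0" by (auto simp: neg_hess_def)
  have Qv: "Q v < 0" using neg assms(1)[of v] by simp
  have Qs: "Q (s *\<^sub>R v) = s\<^sup>2 * Q v" for s
    unfolding assms(1) by (simp add: neg_hess_def sum_distrib_left power2_eq_square algebra_simps)
  have pos: "0 < - Q v / (norm v)\<^sup>2" using Qv v by (simp add: divide_neg_pos)
  obtain d where d: "0 < d" "\<And>\<theta>. \<theta> \<noteq> 0 \<Longrightarrow> norm \<theta> < d \<Longrightarrow> \<bar>(Re (\<psi> \<theta>) - (1 - Q \<theta>)) / (norm \<theta>)\<^sup>2\<bar> < - Q v / (norm v)\<^sup>2"
    using LIM_D[OF assms(2) pos] by (auto simp only: diff_0_right real_norm_def)
  define s where "s = d / (2 * norm v)"
  have s: "0 < s" "norm (s *\<^sub>R v) < d" using d v by (auto simp: s_def)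
  have "\<bar>Re (\<psi> (s *\<^sub>R v)) - (1 - s\<^sup>2 * Q v)\<bar> / (s\<^sup>2 * (norm v)\<^sup>2) < - Q v / (norm v)\<^sup>2"
    using d(2)[of "s *\<^sub>R v"] s v by (simp add: Qs power_mult_distrib abs_divide)
  then have "\<bar>Re (\<psi> (s *\<^sub>R v)) - (1 - s\<^sup>2 * Q v)\<bar> < - (s\<^sup>2 * Q v)" using s v by (simp add: field_simps)
  moreover have "Re (\<psi> (s *\<^sub>R v)) \<le> 1" using complex_Re_le_cmod \<psi>1 order_trans by blast
  ultimately show False by linarith
qed

lemma neg_hess_scale: "neg_hess (s *\<^sub>R v) = s\<^sup>2 * neg_hess v"
  by (simp add: neg_hess_def sum_distrib_left power2_eq_square algebra_simps)

text \<open>Polarisation: the coefficient of s is the sum of the two mixed values of the underlying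
  bilinear form B.\<close>

lemma neg_hess_add_scale:
  "neg_hess (u + s *\<^sub>R v) = neg_hess u + s * (neg_hess (u + v) - neg_hess u - neg_hess v) + s\<^sup>2 * neg_hess v"
proof -
  define B where "B = (\<lambda>u v. - Re (\<Sum>k\<in>UNIV. \<Sum>l\<in>UNIV. (u$k * v$l) *\<^sub>R q k l 0))"
  have Bl: "B (x + y) z = B x z + B y z" "B z (x + y) = B z x + B z y" "B (r *\<^sub>R x) z = r * B x z" "B z (r *\<^sub>R x) = r * B z x" for x y z r
    by (simp_all add: B_def scaleR_add_left sum.distrib sum_distrib_left algebra_simps)
  have "neg_hess x = B x x" for x by (simp add: B_def neg_hess_def)
  then show ?thesis by (simp add: Bl power2_eq_square algebra_simps)
qed

lemma continuous_neg_hess: "continuous_on A neg_hess"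
  unfolding neg_hess_def by (intro continuous_intros)

text \<open>Between two null vectors the form is linear in the parameter; being nonnegative for both
  signs it vanishes. The null vectors of a semidefinite form thus make a subspace.\<close>

lemma neg_hess_zero_add:
  assumes nn: "\<And>v. 0 \<le> neg_hess v" and z: "neg_hess u = 0" "neg_hess v = 0"
  shows "neg_hess (u + s *\<^sub>R v) = 0"
proof -
  have "0 \<le> t * (neg_hess (u + v))" for t using nn[of "u + t *\<^sub>R v"] by (simp add: neg_hess_add_scale z)
  from this[of "-1"] have "neg_hess (u + v) = 0" using nn[of "u + v"] by simp
  then show ?thesis by (simp add: neg_hess_add_scale z)
qed

text \<open>Positivity on a plane leaves a null space of dimension at most 1. Suppose it contains a
  vector n annihilated by the gradient. Fixing a coordinate m with n_m nonzero removes the null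
  direction, and the gradient has a nonzero entry outside m, since otherwise it could not annihilate
  n. These indices dictate the order of slicing: m first, k0 last.\<close>

lemma transversal_indices:
  assumes nn: "\<And>v. 0 \<le> neg_hess v" and S: "subspace S" "2 \<le> dim S" "\<And>v. v \<in> S \<Longrightarrow> v \<noteq> 0 \<Longrightarrow> 0 < neg_hess v"
    and a: "a k1 \<noteq> 0"
  obtains m k0 where "k0 \<noteq> m" "a k0 \<noteq> 0" "\<And>v. neg_hess v = 0 \<Longrightarrow> (\<Sum>k\<in>UNIV. v$k * a k) = 0 \<Longrightarrow> v$m = 0 \<Longrightarrow> v = 0"
proof (cases "\<exists>n. n \<noteq> 0 \<and> neg_hess n = 0 \<and> (\<Sum>k\<in>UNIV. n$k * a k) = 0")
  case False
  obtain i j where "distinct [i,j,k1]" using ex_distinct_3 by blast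
  then show ?thesis using False a by (intro that[of k1 i]) auto
next
  case True
  then obtain n where n: "n \<noteq> 0" "neg_hess n = 0" "(\<Sum>k\<in>UNIV. n$k * a k) = 0" by blast
  obtain m where m: "n $ m \<noteq> 0" using n(1) by (auto simp: vec_eq_iff)
  have "\<exists>k0. k0 \<noteq> m \<and> a k0 \<noteq> 0"
  proof (rule ccontr)
    assume "\<not> ?thesis"
    then have z: "\<And>k. k \<noteq> m \<Longrightarrow> a k = 0" by blast
    then have "(\<Sum>k\<in>UNIV. n$k * a k) = n$m * a m" by (subst sum.remove[of _ m]) (auto intro!: sum.neutral)
    then show False using n(3) m z a by (cases "k1 = m") auto
  qed
  then obtain k0 where k0: "k0 \<noteq> m" "a k0 \<noteq> 0" by blast
  have "v = 0" if v: "neg_hess v = 0" "v$m = 0" for v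
  proof (rule ccontr)
    assume v0: "v \<noteq> 0"
    have nv: "n \<notin> span {v}" using m v(2) by (auto simp: span_singleton)
    have "independent {v}" using v0 by (simp add: dependent_single)
    then have ind: "independent {n, v}" using nv by (simp add: independent_insert)
    have ne: "n \<noteq> v" using m v(2) by auto
    have d2: "dim (span {n, v}) = 2" using ind ne by (simp add: dim_eq_card_independent)
    \<comment> \<open>Two planes in dimension 3 meet in a nonzero vector, which would be both null
      and positive.\<close>
    have "dim {x + y |x y. x \<in> S \<and> y \<in> span {n, v}} + dim (S \<inter> span {n, v}) = dim S + dim (span {n, v})"
      by (rule dim_sums_Int[OF S(1) subspace_span])
    moreover have "dim {x + y |x y. x \<in> S \<and> y \<in> span {n, v}} \<le> 3"
      using dim_subset_UNIV[of "{x + y |x y. x \<in> S \<and> y \<in> span {n, v}}"] by simp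
    ultimately have "dim (S \<inter> span {n, v}) \<noteq> 0" using d2 S(2) by linarith
    then obtain x where x: "x \<in> S" "x \<in> span {n, v}" "x \<noteq> 0" by (auto simp: dim_eq_0)
    obtain r t where "x = r *\<^sub>R n + t *\<^sub>R v"
      using x(2) by (auto simp: span_insert span_singleton algebra_simps)
    moreover have "neg_hess (r *\<^sub>R n) = 0" by (simp add: neg_hess_scale n)
    ultimately have "neg_hess x = 0" using neg_hess_zero_add[OF nn _ v(1), of "r *\<^sub>R n" t] by simp
    then show False using S(3)[OF x(1,3)] by simp
  qed
  then show ?thesis using k0 by (intro that[of k0 m]) auto
qed

text \<open>A positive continuous function has a positive minimum on the compact part of the unit
  sphere in the cone P, and homogeneity does the rest. If P misses the sphere, it contains no vector
  but 0.\<close>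

lemma quadratic_lower_bound:
  fixes h :: "real^3 \<Rightarrow> real"
  assumes c: "continuous_on UNIV h" and s: "\<And>r v. h (r *\<^sub>R v) = r\<^sup>2 * h v" and P: "closed P" "\<And>r v. v \<in> P \<Longrightarrow> r *\<^sub>R v \<in> P"
    and pos: "\<And>v. v \<in> P \<Longrightarrow> v \<noteq> 0 \<Longrightarrow> 0 < h v"
  obtains c where "0 < c" "\<And>v. v \<in> P \<Longrightarrow> c * (norm v)\<^sup>2 \<le> h v"
proof (cases "sphere 0 1 \<inter> P = {}")
  case True
  have "v = 0" if "v \<in> P" for v
  proof (rule ccontr)
    assume "v \<noteq> 0"
    then have "(1 / norm v) *\<^sub>R v \<in> sphere 0 1 \<inter> P" using P(2)[OF that] by simp
    then show False using True by blast
  qed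
  moreover have "h 0 = 0" using s[of 0 0] by simp
  ultimately have "1 * (norm v)\<^sup>2 \<le> h v" if "v \<in> P" for v using that by force
  then show ?thesis by (intro that[of 1]) auto
next
  case False
  have "compact (sphere 0 1 \<inter> P)" by (intro compact_Int_closed P) auto
  then obtain x where x: "x \<in> sphere 0 1 \<inter> P" "\<And>y. y \<in> sphere 0 1 \<inter> P \<Longrightarrow> h x \<le> h y"
    using continuous_attains_inf[OF _ False continuous_on_subset[OF c]] by blast
  show ?thesis
  proof (rule that[of "h x"])
    show "0 < h x" using x(1) by (intro pos) auto
    fix v assume v: "v \<in> P"
    show "h x * (norm v)\<^sup>2 \<le> h v"
    proof (cases "v = 0")
      case False
      then have "h x \<le> h ((1 / norm v) *\<^sub>R v)" using P(2)[OF v] by (intro x(2)) simp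
      then show ?thesis using False by (simp add: s power_divide field_simps)
    qed (use s[of 0 0] in simp)
  qed
qed

lemma closed_level_set: "{\<theta>. \<theta> \<in> cball \<alpha> \<rho> \<and> cmod (1 - \<beta> * \<psi> (\<theta> - \<alpha>)) \<le> \<delta>} \<in> sets borel"
proof -
  have \<psi>c: "continuous_on UNIV \<psi>" using d1 by (intro continuous_at_imp_continuous_on ballI has_derivative_continuous)
  have "closed {\<theta>. dist \<alpha> \<theta> \<le> \<rho> \<and> cmod (1 - \<beta> * \<psi> (\<theta> - \<alpha>)) \<le> \<delta>}"
    by (intro closed_Collect_conj closed_Collect_le continuous_intros continuous_on_compose2[OF \<psi>c]) auto
  then show ?thesis by simp
qed

text \<open>Slices in the order of \<open>transversal_indices\<close>. In direction m only
  boundedness is used. With that coordinate fixed, the Hessian plus the square of the gradient form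
  is definite, so differences are O(sqrt \<delta>). With two coordinates fixed, the difference
  points along k0, where the gradient is nonzero, and is O(\<delta>). The product is \<delta> to the
  power 3/2.\<close>

lemma single_measure_bound:
  assumes nn: "\<And>v. 0 \<le> neg_hess v" and S: "subspace S" "2 \<le> dim S" "\<And>v. v \<in> S \<Longrightarrow> v \<noteq> 0 \<Longrightarrow> 0 < neg_hess v"
    and a: "a k1 \<noteq> 0"
  obtains \<rho> K where "0 < \<rho>" "\<rho> \<le> 1" "0 < K"
    "\<And>\<alpha> \<beta> \<delta> r. cmod \<beta> = 1 \<Longrightarrow> 0 < \<delta> \<Longrightarrow> \<delta> \<le> \<rho> \<Longrightarrow> r \<le> \<rho> \<Longrightarrow> measure lborel {\<theta>. \<theta> \<in> cball \<alpha> r \<and> cmod (1 - \<beta> * \<psi> (\<theta> - \<alpha>)) \<le> \<delta>} \<le> K * (\<delta> * sqrt \<delta>)"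
proof -
  obtain m k0 where mk: "k0 \<noteq> m" "a k0 \<noteq> 0" "\<And>v. neg_hess v = 0 \<Longrightarrow> (\<Sum>k\<in>UNIV. v$k * a k) = 0 \<Longrightarrow> v$m = 0 \<Longrightarrow> v = 0"
    using transversal_indices[OF nn S a] by metis
  define L where "L = (\<lambda>v::real^3. \<Sum>k\<in>UNIV. v$k * a k)"
  obtain k where d: "distinct [m, k, k0]" using third_index[OF mk(1)] by blast
  obtain c where c: "0 < c" "\<And>v. v \<in> {v. v$m = 0} \<Longrightarrow> c * (norm v)\<^sup>2 \<le> neg_hess v + (L v)\<^sup>2"
  proof (rule quadratic_lower_bound[where h="\<lambda>v. neg_hess v + (L v)\<^sup>2" and P="{v. v$m = 0}"])
    show "continuous_on UNIV (\<lambda>v. neg_hess v + (L v)\<^sup>2)" unfolding L_def by (intro continuous_intros continuous_neg_hess)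
    show "neg_hess (r *\<^sub>R v) + (L (r *\<^sub>R v))\<^sup>2 = r\<^sup>2 * (neg_hess v + (L v)\<^sup>2)" for r v
    proof -
      have "L (r *\<^sub>R v) = r * L v" by (simp add: L_def sum_distrib_left mult.assoc)
      then show ?thesis by (simp add: neg_hess_scale power_mult_distrib distrib_left)
    qed
    show "closed {v::real^3. v$m = 0}" by (intro closed_Collect_eq continuous_intros)
    show "0 < neg_hess v + (L v)\<^sup>2" if "v \<in> {v. v$m = 0}" "v \<noteq> 0" for v
    proof (cases "neg_hess v = 0")
      case True
      then have "L v \<noteq> 0" using mk(3)[of v] that by (auto simp: L_def)
      then show ?thesis using True by simp
    next
      case False
      then have "0 < neg_hess v" using nn[of v] by simp
      then show ?thesis by (rule add_pos_nonneg) simp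
    qed
  qed auto
  \<comment> \<open>c/6 lets three error terms be absorbed into half of the definite form; half of
    |\<open>a k0\<close>| does the same for the linear estimate; \<epsilon> \<le> 1 replaces
    \<epsilon>^2 by \<epsilon>.\<close>
  define \<epsilon> where "\<epsilon> = min (min 1 (c / 6)) (\<bar>a k0\<bar> / 2)"
  have \<epsilon>: "0 < \<epsilon>" "\<epsilon> \<le> 1" "\<epsilon> \<le> c / 6" "\<epsilon> \<le> \<bar>a k0\<bar> / 2" using c mk(2) by (auto simp: \<epsilon>_def)
  obtain \<rho> where \<rho>: "0 < \<rho>" "\<rho> \<le> 1"
    "\<And>\<beta> \<delta> \<theta> \<theta>'. cmod \<beta> = 1 \<Longrightarrow> \<delta> \<le> \<rho> \<Longrightarrow> norm \<theta> \<le> \<rho> \<Longrightarrow> norm \<theta>' \<le> \<rho> \<Longrightarrow> cmod (1 - \<beta> * \<psi> \<theta>) \<le> \<delta> \<Longrightarrow> cmod (1 - \<beta> * \<psi> \<theta>') \<le> \<delta> \<Longrightarrow>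
      \<bar>\<Sum>k\<in>UNIV. (\<theta> - \<theta>')$k * a k\<bar> \<le> 2 * \<delta> + \<epsilon> * norm (\<theta> - \<theta>') \<and> neg_hess (\<theta> - \<theta>') \<le> 8 * \<delta> + \<epsilon> * (norm (\<theta> - \<theta>'))\<^sup>2"
    by (rule local_difference_bounds[OF \<epsilon>(1)]) blast
  \<comment> \<open>The Hessian contributes 8 \<delta> and the squared linear form at most 8
    \<delta>; after absorption c/2 times the squared norm is at most 16 \<delta>.\<close>
  define K1 where "K1 = sqrt (32 / c)"
  define K2 where "K2 = 4 / \<bar>a k0\<bar>"
  have K: "0 < K1" "0 < K2" using c mk(2) by (auto simp: K1_def K2_def)
  show ?thesis
  proof (rule that[of \<rho> "8 * 2 * K1 * K2", OF \<rho>(1,2)])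
    show "0 < 8 * 2 * K1 * K2" using K by simp
    fix \<alpha> \<beta> \<delta> r assume b: "cmod \<beta> = 1" and \<delta>: "0 < \<delta>" "\<delta> \<le> \<rho>" and r: "r \<le> \<rho>"
    let ?S = "{\<theta>. \<theta> \<in> cball \<alpha> r \<and> cmod (1 - \<beta> * \<psi> (\<theta> - \<alpha>)) \<le> \<delta>}"
    have diff: "\<bar>L (x - y)\<bar> \<le> 2 * \<delta> + \<epsilon> * norm (x - y)" "neg_hess (x - y) \<le> 8 * \<delta> + \<epsilon> * (norm (x - y))\<^sup>2"
      if "x \<in> ?S" "y \<in> ?S" for x y
      using \<rho>(3)[OF b \<delta>(2), of "x - \<alpha>" "y - \<alpha>"] that r unfolding L_def by (auto simp: dist_norm norm_minus_commute)
    have n2: "norm (x - y) \<le> K1 * sqrt \<delta>" if xy: "x \<in> ?S" "y \<in> ?S" "x$m = y$m" for x y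
    proof -
      let ?n = "norm (x - y)"
      have "c * ?n\<^sup>2 \<le> neg_hess (x - y) + (L (x - y))\<^sup>2" using xy(3) by (intro c) simp
      moreover have "(L (x - y))\<^sup>2 \<le> (2 * \<delta> + \<epsilon> * ?n)\<^sup>2" using diff(1)[OF xy(1,2)] \<delta> \<epsilon> by (simp add: abs_le_square_iff[symmetric])
      moreover have "(2 * \<delta> + \<epsilon> * ?n)\<^sup>2 \<le> 8 * \<delta>\<^sup>2 + 2 * (\<epsilon> * ?n)\<^sup>2"
        using zero_le_power2[of "2 * \<delta> - \<epsilon> * ?n"] by (simp only: power2_sum power2_diff power_mult_distrib) simp
      moreover have "8 * \<delta>\<^sup>2 \<le> 8 * \<delta>" using \<delta> \<rho> by (simp add: power2_eq_square mult_left_le)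
      moreover have "(\<epsilon> * ?n)\<^sup>2 \<le> \<epsilon> * ?n\<^sup>2"
        unfolding power_mult_distrib using \<epsilon> by (intro mult_right_mono) (auto simp: power2_eq_square mult_left_le)
      ultimately have "c * ?n\<^sup>2 \<le> 16 * \<delta> + 3 * (\<epsilon> * ?n\<^sup>2)" using diff(2)[OF xy(1,2)] by linarith
      moreover have "3 * (\<epsilon> * ?n\<^sup>2) \<le> c / 2 * ?n\<^sup>2" using mult_right_mono[OF \<epsilon>(3), of "?n\<^sup>2"] by simp
      ultimately have "?n\<^sup>2 \<le> 32 / c * \<delta>" using c(1) by (simp add: field_simps)
      then have "?n \<le> sqrt (32 / c * \<delta>)" by (rule real_le_rsqrt)
      then show ?thesis by (simp only: K1_def real_sqrt_mult)
    qed
    have "measure lborel ?S \<le> 8 * 2 * (K1 * sqrt \<delta>) * (K2 * \<delta>)"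
    proof (rule measure_nested_slices[OF d closed_level_set])
      fix x y assume xy: "x \<in> ?S" "y \<in> ?S"
      have "norm (x - y) \<le> 2"
        using xy \<rho>(2) r norm_triangle_ineq4[of "x - \<alpha>" "y - \<alpha>"] by (simp add: dist_norm norm_minus_commute)
      then show "\<bar>x$m - y$m\<bar> \<le> 2" using component_le_norm_cart[of "x - y" m] by simp
      assume e1: "x$m = y$m"
      show "\<bar>x$k - y$k\<bar> \<le> K1 * sqrt \<delta>" using n2[OF xy e1] component_le_norm_cart[of "x - y" k] by simp
      assume e2: "x$k = y$k"
      have n: "norm (x - y) \<le> \<bar>x$k0 - y$k0\<bar>" using norm_le_l1_cart[of "x - y"] e1 e2 by (simp add: sum_3_distinct[OF d])
      have "L (x - y) = (x$k0 - y$k0) * a k0" using e1 e2 by (simp add: L_def sum_3_distinct[OF d])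
      then have "\<bar>x$k0 - y$k0\<bar> * \<bar>a k0\<bar> \<le> 2 * \<delta> + \<epsilon> * norm (x - y)" using diff(1)[OF xy] by (simp add: abs_mult)
      also have "\<dots> \<le> 2 * \<delta> + \<epsilon> * \<bar>x$k0 - y$k0\<bar>" using n \<epsilon> by (intro add_left_mono mult_left_mono) auto
      also have "\<dots> \<le> 2 * \<delta> + \<bar>a k0\<bar> / 2 * \<bar>x$k0 - y$k0\<bar>" by (intro add_left_mono mult_right_mono \<epsilon>) auto
      finally show "\<bar>x$k0 - y$k0\<bar> \<le> K2 * \<delta>" using mk(2) by (simp add: K2_def field_simps)
    qed (use K \<delta> in auto)
    then show "measure lborel ?S \<le> 8 * 2 * K1 * K2 * (\<delta> * sqrt \<delta>)" by (simp add: mult_ac)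
  qed
qed

text \<open>A definite Hessian makes the full diameter of the level set O(sqrt \<delta>), with no
  slicing. The constant C is fixed before \<epsilon>; asking the error to be below both \<epsilon>
  and c/2 gives both estimates together.\<close>

lemma posdef_difference_bounds:
  assumes pos: "\<And>v. v \<noteq> 0 \<Longrightarrow> 0 < neg_hess v"
  shows "\<exists>C>0. \<forall>\<epsilon>>0. \<exists>\<rho>>0. \<rho> \<le> 1 \<and> (\<forall>\<beta> \<delta> \<theta> \<theta>'. cmod \<beta> = 1 \<longrightarrow> \<delta> \<le> \<rho> \<longrightarrow> norm \<theta> \<le> \<rho> \<longrightarrow> norm \<theta>' \<le> \<rho> \<longrightarrow>
     cmod (1 - \<beta> * \<psi> \<theta>) \<le> \<delta> \<longrightarrow> cmod (1 - \<beta> * \<psi> \<theta>') \<le> \<delta> \<longrightarrow>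
      \<bar>\<Sum>k\<in>UNIV. (\<theta> - \<theta>')$k * a k\<bar> \<le> 2 * \<delta> + \<epsilon> * norm (\<theta> - \<theta>') \<and> norm (\<theta> - \<theta>') \<le> C * sqrt \<delta>)"
proof -
  obtain c where c: "0 < c" "\<And>v. v \<in> UNIV \<Longrightarrow> c * (norm v)\<^sup>2 \<le> neg_hess v"
  proof (rule quadratic_lower_bound[where h=neg_hess and P=UNIV])
    show "0 < neg_hess v" if "v \<noteq> 0" for v using pos that .
  qed (auto simp: continuous_neg_hess neg_hess_scale)
  show ?thesis
  proof (rule exI[of _ "sqrt (16 / c)"], intro conjI allI impI)
    show "0 < sqrt (16 / c)" using c by simp
    fix \<epsilon> :: real assume "0 < \<epsilon>"
    then have "0 < min \<epsilon> (c / 2)" using c by simp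
    obtain \<rho> where \<rho>: "0 < \<rho>" "\<rho> \<le> 1"
    "\<And>\<beta> \<delta> \<theta> \<theta>'. cmod \<beta> = 1 \<Longrightarrow> \<delta> \<le> \<rho> \<Longrightarrow> norm \<theta> \<le> \<rho> \<Longrightarrow> norm \<theta>' \<le> \<rho> \<Longrightarrow> cmod (1 - \<beta> * \<psi> \<theta>) \<le> \<delta> \<Longrightarrow> cmod (1 - \<beta> * \<psi> \<theta>') \<le> \<delta> \<Longrightarrow>
      \<bar>\<Sum>k\<in>UNIV. (\<theta> - \<theta>')$k * a k\<bar> \<le> 2 * \<delta> + min \<epsilon> (c / 2) * norm (\<theta> - \<theta>') \<and> neg_hess (\<theta> - \<theta>') \<le> 8 * \<delta> + min \<epsilon> (c / 2) * (norm (\<theta> - \<theta>'))\<^sup>2"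
      by (rule local_difference_bounds[OF \<open>0 < min \<epsilon> (c / 2)\<close>]) blast
    show "\<exists>\<rho>>0. \<rho> \<le> 1 \<and> (\<forall>\<beta> \<delta> \<theta> \<theta>'. cmod \<beta> = 1 \<longrightarrow> \<delta> \<le> \<rho> \<longrightarrow> norm \<theta> \<le> \<rho> \<longrightarrow> norm \<theta>' \<le> \<rho> \<longrightarrow>
     cmod (1 - \<beta> * \<psi> \<theta>) \<le> \<delta> \<longrightarrow> cmod (1 - \<beta> * \<psi> \<theta>') \<le> \<delta> \<longrightarrow>
      \<bar>\<Sum>k\<in>UNIV. (\<theta> - \<theta>')$k * a k\<bar> \<le> 2 * \<delta> + \<epsilon> * norm (\<theta> - \<theta>') \<and> norm (\<theta> - \<theta>') \<le> sqrt (16 / c) * sqrt \<delta>)"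
    proof (rule exI[of _ \<rho>], intro conjI allI impI \<rho>(1,2))
      fix \<beta> \<delta> \<theta> \<theta>'
      assume "cmod \<beta> = 1" "\<delta> \<le> \<rho>" "norm \<theta> \<le> \<rho>" "norm \<theta>' \<le> \<rho>" "cmod (1 - \<beta> * \<psi> \<theta>) \<le> \<delta>" "cmod (1 - \<beta> * \<psi> \<theta>') \<le> \<delta>"
      note b = \<rho>(3)[OF this]
      have "min \<epsilon> (c / 2) * norm (\<theta> - \<theta>') \<le> \<epsilon> * norm (\<theta> - \<theta>')" by (intro mult_right_mono) auto
      then show "\<bar>\<Sum>k\<in>UNIV. (\<theta> - \<theta>')$k * a k\<bar> \<le> 2 * \<delta> + \<epsilon> * norm (\<theta> - \<theta>')" using b by linarith
      have "min \<epsilon> (c / 2) * (norm (\<theta> - \<theta>'))\<^sup>2 \<le> c / 2 * (norm (\<theta> - \<theta>'))\<^sup>2" by (intro mult_right_mono) auto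
      then have "c * (norm (\<theta> - \<theta>'))\<^sup>2 \<le> 8 * \<delta> + c / 2 * (norm (\<theta> - \<theta>'))\<^sup>2" using b c(2)[of "\<theta> - \<theta>'"] by simp
      then have "(norm (\<theta> - \<theta>'))\<^sup>2 \<le> 16 / c * \<delta>" using c(1) by (simp add: field_simps)
      then show "norm (\<theta> - \<theta>') \<le> sqrt (16 / c) * sqrt \<delta>" unfolding real_sqrt_mult[symmetric] by (rule real_le_rsqrt)
    qed
  qed
qed

end

section \<open>Two boundary coordinates at once\<close>

text \<open>Keeps what a definite Hessian yields without mentioning derivatives, so that the
  estimates for two different functions can be combined.\<close>

definition difference_control :: "(real^3 \<Rightarrow> complex) \<Rightarrow> (3 \<Rightarrow> real) \<Rightarrow> real \<Rightarrow> bool" where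
  "difference_control \<psi> a C \<longleftrightarrow> (\<forall>\<epsilon>>0. \<exists>\<rho>>0. \<rho> \<le> 1 \<and> (\<forall>\<beta> \<delta> \<theta> \<theta>'. cmod \<beta> = 1 \<longrightarrow> \<delta> \<le> \<rho> \<longrightarrow> norm \<theta> \<le> \<rho> \<longrightarrow> norm \<theta>' \<le> \<rho> \<longrightarrow>
     cmod (1 - \<beta> * \<psi> \<theta>) \<le> \<delta> \<longrightarrow> cmod (1 - \<beta> * \<psi> \<theta>') \<le> \<delta> \<longrightarrow>
      \<bar>\<Sum>k\<in>UNIV. (\<theta> - \<theta>')$k * a k\<bar> \<le> 2 * \<delta> + \<epsilon> * norm (\<theta> - \<theta>') \<and> norm (\<theta> - \<theta>') \<le> C * sqrt \<delta>))"

lemma difference_controlE: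
  assumes "difference_control \<psi> a C" "0 < \<epsilon>"
  obtains \<rho> where "0 < \<rho>" "\<rho> \<le> 1" "\<And>\<beta> \<delta> \<theta> \<theta>'. cmod \<beta> = 1 \<Longrightarrow> \<delta> \<le> \<rho> \<Longrightarrow> norm \<theta> \<le> \<rho> \<Longrightarrow> norm \<theta>' \<le> \<rho> \<Longrightarrow>
     cmod (1 - \<beta> * \<psi> \<theta>) \<le> \<delta> \<Longrightarrow> cmod (1 - \<beta> * \<psi> \<theta>') \<le> \<delta> \<Longrightarrow>
      \<bar>\<Sum>k\<in>UNIV. (\<theta> - \<theta>')$k * a k\<bar> \<le> 2 * \<delta> + \<epsilon> * norm (\<theta> - \<theta>') \<and> norm (\<theta> - \<theta>') \<le> C * sqrt \<delta>"
proof -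
  note D = assms(1)[unfolded difference_control_def, THEN spec, THEN mp, OF assms(2)]
  show thesis
    apply (insert D)
    apply (elim exE conjE)
    apply (rule that, assumption, assumption)
    subgoal premises H for \<rho> \<beta> \<delta> \<theta> \<theta>' by (rule H(3)[rule_format, OF H(4-9)])
    done
qed

text \<open>The extent in direction m is O(sqrt \<delta>1) from the definite Hessian of the first
  function. With m fixed, the two linear forms are inverted by Cramer's rule and everything is of
  the size of the larger level \<delta>2. With j fixed too, the first form alone gives O(\<delta>1)
  in direction i. Ordering the levels places the square root on the smaller one.\<close>

lemma pair_measure_bound_ordered:
  assumes c: "continuous_on UNIV \<psi>1" "continuous_on UNIV \<psi>2" and C: "0 < C1"
    and D: "difference_control \<psi>1 a C1" "difference_control \<psi>2 b C2"
    and minor: "a k1 * b k2 - a k2 * b k1 \<noteq> 0"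
  shows "\<exists>\<rho>>0. \<exists>K>0. \<rho> \<le> 1 \<and> (\<forall>\<alpha> \<beta>1 \<beta>2 \<delta>1 \<delta>2 r. cmod \<beta>1 = 1 \<longrightarrow> cmod \<beta>2 = 1 \<longrightarrow> 0 < \<delta>1 \<longrightarrow> \<delta>1 \<le> \<delta>2 \<longrightarrow> \<delta>2 \<le> \<rho> \<longrightarrow> r \<le> \<rho> \<longrightarrow>
     measure lborel {\<theta>. \<theta> \<in> cball \<alpha> r \<and> cmod (1 - \<beta>1 * \<psi>1 (\<theta> - \<alpha>)) \<le> \<delta>1 \<and> cmod (1 - \<beta>2 * \<psi>2 (\<theta> - \<alpha>)) \<le> \<delta>2} \<le> K * (\<delta>1 * \<delta>2 * sqrt \<delta>1))"
proof -
  \<comment> \<open>Exchanging the two columns of the minor if necessary makes the first gradient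
    nonzero in the direction that is sliced last.\<close>
  have "\<exists>i j. a i \<noteq> 0 \<and> a i * b j - a j * b i \<noteq> 0"
  proof (cases "a k1 = 0")
    case True
    then have "a k2 \<noteq> 0" using minor by auto
    then show ?thesis using minor by (intro exI[of _ k2] exI[of _ k1]) auto
  qed (use minor in blast)
  then obtain i j where ij: "a i \<noteq> 0" "a i * b j - a j * b i \<noteq> 0" by blast
  then have "j \<noteq> i" by auto
  then obtain m' where "distinct [i, m', j]" using third_index by blast
  then obtain m where d: "distinct [m, j, i]" by auto
  define \<Delta> where "\<Delta> = \<bar>a i * b j - a j * b i\<bar>"
  define A where "A = \<bar>a i\<bar> + \<bar>a j\<bar> + \<bar>b i\<bar> + \<bar>b j\<bar>"
  have A: "0 < A" "\<bar>a i\<bar> \<le> A" "\<bar>a j\<bar> \<le> A" "\<bar>b i\<bar> \<le> A" "\<bar>b j\<bar> \<le> A" using ij(1) by (auto simp: A_def)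
  have \<Delta>: "0 < \<Delta>" using ij by (simp add: \<Delta>_def)
  define M where "M = 2 * A / \<Delta>"
  have M: "0 < M" using A \<Delta> by (simp add: M_def)
  \<comment> \<open>The first bound absorbs half of the norm after inverting the two forms (M is the
    norm of the inverse up to constants), the second half of the leading term in the last
    slice.\<close>
  define \<epsilon> where "\<epsilon> = min (1 / (4 * M)) (\<bar>a i\<bar> / 2)"
  have \<epsilon>: "0 < \<epsilon>" "\<epsilon> \<le> 1 / (4 * M)" "\<epsilon> \<le> \<bar>a i\<bar> / 2" using M ij by (auto simp: \<epsilon>_def)
  obtain \<rho>1 where \<rho>1: "0 < \<rho>1" "\<rho>1 \<le> 1" "\<And>\<beta> \<delta> \<theta> \<theta>'. cmod \<beta> = 1 \<Longrightarrow> \<delta> \<le> \<rho>1 \<Longrightarrow> norm \<theta> \<le> \<rho>1 \<Longrightarrow> norm \<theta>' \<le> \<rho>1 \<Longrightarrow>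
     cmod (1 - \<beta> * \<psi>1 \<theta>) \<le> \<delta> \<Longrightarrow> cmod (1 - \<beta> * \<psi>1 \<theta>') \<le> \<delta> \<Longrightarrow>
      \<bar>\<Sum>k\<in>UNIV. (\<theta> - \<theta>')$k * a k\<bar> \<le> 2 * \<delta> + \<epsilon> * norm (\<theta> - \<theta>') \<and> norm (\<theta> - \<theta>') \<le> C1 * sqrt \<delta>"
    by (rule difference_controlE[OF D(1) \<epsilon>(1)]) blast
  obtain \<rho>2 where \<rho>2: "0 < \<rho>2" "\<rho>2 \<le> 1" "\<And>\<beta> \<delta> \<theta> \<theta>'. cmod \<beta> = 1 \<Longrightarrow> \<delta> \<le> \<rho>2 \<Longrightarrow> norm \<theta> \<le> \<rho>2 \<Longrightarrow> norm \<theta>' \<le> \<rho>2 \<Longrightarrow>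
     cmod (1 - \<beta> * \<psi>2 \<theta>) \<le> \<delta> \<Longrightarrow> cmod (1 - \<beta> * \<psi>2 \<theta>') \<le> \<delta> \<Longrightarrow>
      \<bar>\<Sum>k\<in>UNIV. (\<theta> - \<theta>')$k * b k\<bar> \<le> 2 * \<delta> + \<epsilon> * norm (\<theta> - \<theta>') \<and> norm (\<theta> - \<theta>') \<le> C2 * sqrt \<delta>"
    by (rule difference_controlE[OF D(2) \<epsilon>(1)]) blast
  define \<rho> where "\<rho> = min \<rho>1 \<rho>2"
  have \<rho>: "0 < \<rho>" "\<rho> \<le> 1" "\<rho> \<le> \<rho>1" "\<rho> \<le> \<rho>2" using \<rho>1 \<rho>2 by (auto simp: \<rho>_def)
  define K where "K = 8 * C1 * (16 * M) * (4 / \<bar>a i\<bar>)"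
  have K: "0 < K" using C M ij by (simp add: K_def)
  have bound: "measure lborel {\<theta>. \<theta> \<in> cball \<alpha> r \<and> cmod (1 - \<beta>1 * \<psi>1 (\<theta> - \<alpha>)) \<le> \<delta>1 \<and> cmod (1 - \<beta>2 * \<psi>2 (\<theta> - \<alpha>)) \<le> \<delta>2} \<le> K * (\<delta>1 * \<delta>2 * sqrt \<delta>1)"
    if b: "cmod \<beta>1 = 1" "cmod \<beta>2 = 1" and \<delta>: "0 < \<delta>1" "\<delta>1 \<le> \<delta>2" "\<delta>2 \<le> \<rho>" and r: "r \<le> \<rho>" for \<alpha> \<beta>1 \<beta>2 \<delta>1 \<delta>2 r
  proof -
    let ?S = "{\<theta>. \<theta> \<in> cball \<alpha> r \<and> cmod (1 - \<beta>1 * \<psi>1 (\<theta> - \<alpha>)) \<le> \<delta>1 \<and> cmod (1 - \<beta>2 * \<psi>2 (\<theta> - \<alpha>)) \<le> \<delta>2}"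
    have "closed {\<theta>. dist \<alpha> \<theta> \<le> r \<and> cmod (1 - \<beta>1 * \<psi>1 (\<theta> - \<alpha>)) \<le> \<delta>1 \<and> cmod (1 - \<beta>2 * \<psi>2 (\<theta> - \<alpha>)) \<le> \<delta>2}"
      by (intro closed_Collect_conj closed_Collect_le continuous_intros continuous_on_compose2[OF c(1)] continuous_on_compose2[OF c(2)]) auto
    then have S: "?S \<in> sets borel" by simp
    define L1 where "L1 = (\<lambda>v::real^3. \<Sum>k\<in>UNIV. v$k * a k)"
    define L2 where "L2 = (\<lambda>v::real^3. \<Sum>k\<in>UNIV. v$k * b k)"
    have f1: "\<bar>L1 (x - y)\<bar> \<le> 2 * \<delta>1 + \<epsilon> * norm (x - y)" "norm (x - y) \<le> C1 * sqrt \<delta>1"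
      and f2: "\<bar>L2 (x - y)\<bar> \<le> 2 * \<delta>2 + \<epsilon> * norm (x - y)" if "x \<in> ?S" "y \<in> ?S" for x y
      using \<rho>1(3)[OF b(1), of \<delta>1 "x - \<alpha>" "y - \<alpha>"] \<rho>2(3)[OF b(2), of \<delta>2 "x - \<alpha>" "y - \<alpha>"] that r \<rho> \<delta>
      unfolding L1_def L2_def by (auto simp: dist_norm norm_minus_commute)
    have "measure lborel ?S \<le> 8 * (C1 * sqrt \<delta>1) * (16 * M * \<delta>2) * (4 / \<bar>a i\<bar> * \<delta>1)"
    proof (rule measure_nested_slices[OF d S])
      fix x y assume xy: "x \<in> ?S" "y \<in> ?S"
      show "\<bar>x$m - y$m\<bar> \<le> C1 * sqrt \<delta>1" using f1(2)[OF xy] component_le_norm_cart[of "x - y" m] by simp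
      assume e1: "x$m = y$m"
      let ?i = "x$i - y$i" and ?j = "x$j - y$j" and ?n = "norm (x - y)"
      have L: "L1 (x - y) = ?i * a i + ?j * a j" "L2 (x - y) = ?i * b i + ?j * b j"
        using e1 by (simp_all add: L1_def L2_def sum_3_distinct[OF d])
      have nle: "?n \<le> \<bar>?i\<bar> + \<bar>?j\<bar>" using norm_le_l1_cart[of "x - y"] e1 by (simp add: sum_3_distinct[OF d])
      have tri: "\<bar>u - v\<bar> \<le> s + t" if "\<bar>u\<bar> \<le> s" "\<bar>v\<bar> \<le> t" for u v s t :: real using that by linarith
      have pb: "\<bar>c * l\<bar> \<le> A * \<bar>l\<bar>" if "\<bar>c\<bar> \<le> A" for c l using that by (simp add: abs_mult mult_right_mono)
      have "\<Delta> * \<bar>?j\<bar> = \<bar>a i * L2 (x - y) - b i * L1 (x - y)\<bar>"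
        unfolding \<Delta>_def abs_mult[symmetric] L by (simp add: algebra_simps)
      also have "\<dots> \<le> A * \<bar>L2 (x - y)\<bar> + A * \<bar>L1 (x - y)\<bar>" by (intro tri pb A)
      finally have j: "\<Delta> * \<bar>?j\<bar> \<le> A * \<bar>L2 (x - y)\<bar> + A * \<bar>L1 (x - y)\<bar>" .
      have "\<Delta> * \<bar>?i\<bar> = \<bar>b j * L1 (x - y) - a j * L2 (x - y)\<bar>"
        unfolding \<Delta>_def abs_mult[symmetric] L by (simp add: algebra_simps)
      also have "\<dots> \<le> A * \<bar>L1 (x - y)\<bar> + A * \<bar>L2 (x - y)\<bar>" by (intro tri pb A)
      finally have i: "\<Delta> * \<bar>?i\<bar> \<le> A * \<bar>L1 (x - y)\<bar> + A * \<bar>L2 (x - y)\<bar>" .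
      have "\<Delta> * ?n \<le> \<Delta> * (\<bar>?i\<bar> + \<bar>?j\<bar>)" using nle \<Delta> by (intro mult_left_mono) auto
      also have "\<dots> \<le> 2 * A * (\<bar>L1 (x - y)\<bar> + \<bar>L2 (x - y)\<bar>)" using i j by (simp add: algebra_simps)
      finally have "?n \<le> M * (\<bar>L1 (x - y)\<bar> + \<bar>L2 (x - y)\<bar>)" using \<Delta> by (simp add: M_def field_simps)
      also have "\<dots> \<le> M * (4 * \<delta>2 + 2 * \<epsilon> * ?n)" using f1(1)[OF xy] f2[OF xy] \<delta> M by (intro mult_left_mono) auto
      also have "\<dots> = 4 * M * \<delta>2 + 2 * M * ?n * \<epsilon>" by (simp add: algebra_simps)
      also have "\<dots> \<le> 4 * M * \<delta>2 + 2 * M * ?n * (1 / (4 * M))" using \<epsilon> M by (intro add_left_mono mult_left_mono) auto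
      finally have "?n \<le> 8 * M * \<delta>2" using M by simp
      then have "?n \<le> 16 * M * \<delta>2" using mult_nonneg_nonneg[of M \<delta>2] M \<delta> by linarith
      then show "\<bar>x$j - y$j\<bar> \<le> 16 * M * \<delta>2" using component_le_norm_cart[of "x - y" j] by simp
      assume e2: "x$j = y$j"
      have "\<bar>?i\<bar> * \<bar>a i\<bar> \<le> 2 * \<delta>1 + \<epsilon> * ?n" using f1(1)[OF xy] L(1) e2 by (simp add: abs_mult)
      also have "\<dots> \<le> 2 * \<delta>1 + \<bar>a i\<bar> / 2 * \<bar>?i\<bar>" using nle e2 \<epsilon> by (intro add_left_mono mult_mono) auto
      finally show "\<bar>x$i - y$i\<bar> \<le> 4 / \<bar>a i\<bar> * \<delta>1" using ij by (simp add: field_simps)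
    qed (use C M \<delta> ij in auto)
    then show ?thesis by (simp add: K_def mult_ac)
  qed
  show ?thesis
    by (rule exI[of _ \<rho>], rule conjI[OF \<rho>(1)], rule exI[of _ K], intro conjI allI impI K \<rho>(2) bound)
qed

section \<open>Schur test and composition with a cutoff\<close>

lemma integral_norm_square:
  fixes h :: "'a::euclidean_space \<Rightarrow> complex"
  assumes "continuous_on (cbox a b) h"
  shows "complex_of_real (integral (cbox a b) (\<lambda>y. (cmod (h y))\<^sup>2)) = integral (cbox a b) (\<lambda>y. h y * cnj (h y))"
proof -
  have i: "(\<lambda>y. (cmod (h y))\<^sup>2) integrable_on cbox a b" by (intro integrable_continuous continuous_intros assms)
  show ?thesis
    unfolding complex_norm_square[symmetric]
    using integral_linear[OF i bounded_linear_of_real[where 'a=complex]] by (simp only: o_def)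
qed

text \<open>Here h = T f for the operator T with kernel A, and \<kappa> is the kernel of T T*. From
  |h|^2 = <f, T* h> one gets |h|^4 \<le> |f|^2 <T T* h, h>, and the last factor is at most C |h|^2
  by the Schur test for \<kappa>. Working with T T* keeps the test on the side where the size of the
  kernel is known.\<close>

lemma schur_bound:
  fixes A \<kappa> :: "real^3 \<Rightarrow> real^3 \<Rightarrow> complex" and f h :: "real^3 \<Rightarrow> complex"
  assumes cA: "continuous_on UNIV (\<lambda>x. A (fst x) (snd x))" and cf: "continuous_on UNIV f"
    and ch: "continuous_on UNIV h" and ck: "continuous_on UNIV (\<lambda>x. \<kappa> (fst x) (snd x))"
    and h: "\<And>y. h y = integral cube (\<lambda>z. f z * A y z)"
    and \<kappa>: "\<And>y y'. integral cube (\<lambda>z. A y z * cnj (A y' z)) = \<kappa> y y'"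
    and b1: "\<And>y. integral cube (\<lambda>y'. cmod (\<kappa> y y')) \<le> C" and sym: "\<And>y y'. cmod (\<kappa> y y') = cmod (\<kappa> y' y)"
  shows "integral cube (\<lambda>y. (cmod (h y))\<^sup>2) \<le> C * integral cube (\<lambda>z. (cmod (f z))\<^sup>2)"
proof -
  have A: "continuous_on S (\<lambda>x. A (u x) (v x))" if "continuous_on S u" "continuous_on S v" for S :: "'a::topological_space set" and u v
    using continuous_on_compose2[OF cA continuous_on_Pair[OF that]] by simp
  have k: "continuous_on S (\<lambda>x. \<kappa> (u x) (v x))" if "continuous_on S u" "continuous_on S v" for S :: "'a::topological_space set" and u v
    using continuous_on_compose2[OF ck continuous_on_Pair[OF that]] by simp
  have F: "continuous_on S (\<lambda>x. f (u x))" if "continuous_on S u" for S :: "'a::topological_space set" and u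
    using continuous_on_compose2[OF cf that] by simp
  have H: "continuous_on S (\<lambda>x. h (u x))" if "continuous_on S u" for S :: "'a::topological_space set" and u
    using continuous_on_compose2[OF ch that] by simp
  \<comment> \<open>The complex conjugate of T* h.\<close>
  define g where "g = (\<lambda>z. integral cube (\<lambda>y. A y z * cnj (h y)))"
  have cg: "continuous_on S g" for S
  proof (rule continuous_on_subset[OF _ subset_UNIV])
    show "continuous_on UNIV g" unfolding g_def
      by (rule integral_continuous_on_param) (unfold split_beta, intro continuous_intros A H)
  qed
  have G: "continuous_on S (\<lambda>x. g (u x))" if "continuous_on S u" for S :: "'a::topological_space set" and u
    using continuous_on_compose2[OF cg[of UNIV] that] by simp
  define X where "X = integral cube (\<lambda>y. (cmod (h y))\<^sup>2)"
  define Y where "Y = integral cube (\<lambda>z. (cmod (g z))\<^sup>2)"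
  define Fn where "Fn = integral cube (\<lambda>z. (cmod (f z))\<^sup>2)"
  have X0: "0 \<le> X" unfolding X_def by (intro Henstock_Kurzweil_Integration.integral_nonneg integrable_continuous continuous_intros H) auto
  have Fn0: "0 \<le> Fn" unfolding Fn_def by (intro Henstock_Kurzweil_Integration.integral_nonneg integrable_continuous continuous_intros F) auto
  have "complex_of_real X = integral cube (\<lambda>y. h y * cnj (h y))"
    unfolding X_def by (rule integral_norm_square[OF H[OF continuous_on_id]])
  also have "\<dots> = integral cube (\<lambda>y. integral cube (\<lambda>z. f z * A y z * cnj (h y)))"
    by (simp only: integral_mult_left h[symmetric])
  also have "\<dots> = integral cube (\<lambda>z. integral cube (\<lambda>y. f z * A y z * cnj (h y)))"
    by (rule integral_swap_continuous) (unfold split_beta, intro continuous_intros A H F)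
  also have "\<dots> = integral cube (\<lambda>z. f z * g z)"
    by (simp only: g_def integral_mult_right mult.assoc)
  finally have Xfg: "cmod (integral cube (\<lambda>z. f z * g z)) = X" using X0 by (metis abs_of_nonneg norm_of_real)
  have half: "integral cube (\<lambda>y. ((cmod (h y))\<^sup>2 / 2) * J y) \<le> integral cube (\<lambda>y. ((cmod (h y))\<^sup>2 / 2) * C)"
    if "continuous_on cube J" "\<And>y. J y \<le> C" for J
    using that by (intro integral_le integrable_continuous continuous_intros H mult_left_mono) auto
  have cJ: "continuous_on cube (\<lambda>y. integral cube (\<lambda>y'. cmod (\<kappa> y y')))"
    by (rule integral_continuous_on_param) (unfold split_beta, intro continuous_intros k)
  have XFY: "X\<^sup>2 \<le> Fn * Y"
    using integral_Cauchy_Schwarz[of 0 "\<chi> k. 2 * pi" f g, OF F[OF continuous_on_id] G[OF continuous_on_id]] unfolding Xfg Fn_def Y_def by simp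
  have gk: "integral cube (\<lambda>z. g z * cnj (A y' z)) = integral cube (\<lambda>y. cnj (h y) * \<kappa> y y')" for y'
  proof -
    have "integral cube (\<lambda>z. g z * cnj (A y' z)) = integral cube (\<lambda>z. integral cube (\<lambda>y. A y z * cnj (h y) * cnj (A y' z)))"
      by (simp only: g_def integral_mult_left)
    also have "\<dots> = integral cube (\<lambda>y. integral cube (\<lambda>z. A y z * cnj (h y) * cnj (A y' z)))"
      by (rule integral_swap_continuous) (unfold split_beta, intro continuous_intros A H)
    also have "\<dots> = integral cube (\<lambda>y. integral cube (\<lambda>z. cnj (h y) * (A y z * cnj (A y' z))))"
      by (intro integral_cong) (simp add: mult_ac)
    finally show ?thesis by (simp only: integral_mult_right \<kappa>)
  qed
  have gc: "integral cube (\<lambda>y'. cnj (A y' z) * h y') = cnj (g z)" for z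
    unfolding g_def integral_cnj by (intro integral_cong) simp
  have "complex_of_real Y = integral cube (\<lambda>z. g z * cnj (g z))"
    unfolding Y_def by (rule integral_norm_square[OF cg])
  also have "\<dots> = integral cube (\<lambda>z. integral cube (\<lambda>y'. g z * (cnj (A y' z) * h y')))"
    by (simp only: integral_mult_right gc)
  also have "\<dots> = integral cube (\<lambda>y'. integral cube (\<lambda>z. g z * (cnj (A y' z) * h y')))"
    by (rule integral_swap_continuous) (unfold split_beta, intro continuous_intros A H G)
  also have "\<dots> = integral cube (\<lambda>y'. integral cube (\<lambda>z. g z * cnj (A y' z)) * h y')"
    by (simp only: integral_mult_left mult.assoc[symmetric])
  also have "\<dots> = integral cube (\<lambda>y'. integral cube (\<lambda>y. cnj (h y) * \<kappa> y y' * h y'))"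
    by (simp only: gk integral_mult_left)
  finally have "cmod (integral cube (\<lambda>y'. integral cube (\<lambda>y. cnj (h y) * \<kappa> y y' * h y'))) = \<bar>Y\<bar>"
    by (metis norm_of_real)
  then have "Y \<le> cmod (integral cube (\<lambda>y'. integral cube (\<lambda>y. cnj (h y) * \<kappa> y y' * h y')))" by simp
  \<comment> \<open>The product of two values of |h| is split by the arithmetic-geometric mean
    inequality; the symmetry of |\<kappa>| then reduces both halves to the same row bound.\<close>
  also have "\<dots> \<le> integral cube (\<lambda>y'. integral cube (\<lambda>y. ((cmod (h y))\<^sup>2 / 2) * cmod (\<kappa> y y') + cmod (\<kappa> y y') * ((cmod (h y'))\<^sup>2 / 2)))"
  proof (intro integral_norm_bound_integral integrable_continuous integral_continuous_on_param)
    fix y' y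
    show "norm (cnj (h y) * \<kappa> y y' * h y') \<le> ((cmod (h y))\<^sup>2 / 2) * cmod (\<kappa> y y') + cmod (\<kappa> y y') * ((cmod (h y'))\<^sup>2 / 2)"
    proof -
      have "2 * (cmod (h y) * cmod (h y')) \<le> (cmod (h y))\<^sup>2 + (cmod (h y'))\<^sup>2" using sum_squares_bound[of "cmod (h y)" "cmod (h y')"] by (simp add: mult.assoc)
      from mult_right_mono[OF this, of "cmod (\<kappa> y y') / 2"] show ?thesis by (simp add: norm_mult algebra_simps)
    qed
  qed (unfold split_beta, (intro continuous_intros H k; simp)+)
  also have "\<dots> = integral cube (\<lambda>y'. integral cube (\<lambda>y. ((cmod (h y))\<^sup>2 / 2) * cmod (\<kappa> y y')) + integral cube (\<lambda>y. cmod (\<kappa> y y') * ((cmod (h y'))\<^sup>2 / 2)))"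
    by (intro integral_cong integral_add integrable_continuous continuous_intros H k) auto
  also have "\<dots> = integral cube (\<lambda>y'. integral cube (\<lambda>y. ((cmod (h y))\<^sup>2 / 2) * cmod (\<kappa> y y'))) + integral cube (\<lambda>y'. integral cube (\<lambda>y. cmod (\<kappa> y y') * ((cmod (h y'))\<^sup>2 / 2)))"
    by (intro integral_add integrable_continuous integral_continuous_on_param) (unfold split_beta, (intro continuous_intros H k; simp)+)
  also have "integral cube (\<lambda>y'. integral cube (\<lambda>y. ((cmod (h y))\<^sup>2 / 2) * cmod (\<kappa> y y'))) = integral cube (\<lambda>y. integral cube (\<lambda>y'. ((cmod (h y))\<^sup>2 / 2) * cmod (\<kappa> y y')))"
    by (rule integral_swap_continuous) (unfold split_beta, intro continuous_intros H k; simp)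
  also have "\<dots> = integral cube (\<lambda>y. ((cmod (h y))\<^sup>2 / 2) * integral cube (\<lambda>y'. cmod (\<kappa> y y')))"
    by (simp add: integral_mult_right)
  also have "\<dots> \<le> integral cube (\<lambda>y. ((cmod (h y))\<^sup>2 / 2) * C)"
    by (rule half[OF cJ b1])
  also have "integral cube (\<lambda>y'. integral cube (\<lambda>y. cmod (\<kappa> y y') * ((cmod (h y'))\<^sup>2 / 2))) = integral cube (\<lambda>y'. ((cmod (h y'))\<^sup>2 / 2) * integral cube (\<lambda>y. cmod (\<kappa> y' y)))"
    by (subst sym) (simp add: integral_mult_left mult.commute)
  also have "\<dots> \<le> integral cube (\<lambda>y. ((cmod (h y))\<^sup>2 / 2) * C)"
    by (rule half[OF cJ b1])
  finally have "Y \<le> C * X" by (simp add: X_def integral_mult_left integral_divide mult.commute)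
  then have "X\<^sup>2 \<le> Fn * (C * X)" using XFY mult_left_mono[OF _ Fn0] by (meson order_trans)
  then have "X * X \<le> (C * Fn) * X" by (simp add: power2_eq_square mult_ac)
  moreover have "0 \<le> integral cube (\<lambda>y'. cmod (\<kappa> 0 y'))"
    by (intro Henstock_Kurzweil_Integration.integral_nonneg integrable_continuous continuous_intros k) auto
  then have "0 \<le> C" using b1[of 0] by linarith
  ultimately show ?thesis using X0 Fn0 unfolding X_def[symmetric] Fn_def[symmetric]
    by (cases "X = 0") auto
qed

text \<open>The operator \<open>G \<mapsto> \<omega> \<cdot> (G \<circ> t\<^sup>2\<phi>)\<close> factors through the Cauchy kernel, and its composition with its adjoint has the
  Szego kernel of \<open>\<phi>\<close> as kernel; the Schur test applies to the latter.\<close>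

lemma cutoff_composition_bound:
  fixes G :: "complex^3 \<Rightarrow> complex" and \<Phi> :: "real^3 \<Rightarrow> complex^3" and \<omega> :: "real^3 \<Rightarrow> real"
  assumes G: "G \<in> H2" and t: "0 < t" "t < 1" and c\<Phi>: "continuous_on UNIV \<Phi>" and \<Phi>: "\<And>y. \<Phi> y \<in> poly_cD"
    and c\<omega>: "continuous_on UNIV \<omega>" and \<omega>: "\<And>y. 0 \<le> \<omega> y" "\<And>y. \<omega> y \<le> 1"
    and b: "\<And>b. b \<in> poly_D \<Longrightarrow> integral cube (\<lambda>y. \<omega> y * cmod (szego b (\<Phi> y))) \<le> \<eta>"
  shows "integral cube (\<lambda>y. (cmod (\<omega> y * G (complex_of_real (t\<^sup>2) *s \<Phi> y)))\<^sup>2) \<le> \<eta> * (H2_norm G)\<^sup>2"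
proof -
  define c :: real where "c = (2*pi)^3"
  have c: "0 < c" using two_pi_cube_pos by (simp add: c_def)
  \<comment> \<open>The factor t^2 is split: one t moves \<Phi> y inside the polydisc, so that the
    Cauchy kernel stays bounded, the other places the integration on the torus of radius t.\<close>
  define w where "w = (\<lambda>y. complex_of_real t *s \<Phi> y)"
  have w: "w y \<in> poly_D" for y using t by (auto simp: w_def intro!: scale_cD_D \<Phi>)
  have w2: "complex_of_real t *s w y = complex_of_real (t\<^sup>2) *s \<Phi> y" for y by (simp add: w_def vec_eq_iff power2_eq_square)
  have P: "continuous_on S (\<lambda>x. \<Phi> (u x))" if "continuous_on S u" for S :: "'a::topological_space set" and u
    using continuous_on_compose2[OF c\<Phi> that] by simp
  have X: "continuous_on S (\<lambda>x. \<omega> (u x))" if "continuous_on S u" for S :: "'a::topological_space set" and u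
    using continuous_on_compose2[OF c\<omega> that] by simp
  have tw: "complex_of_real (t\<^sup>2) *s \<Phi> y \<in> poly_D" for y unfolding w2[symmetric] using t by (intro scale_D_D w) auto
  define cn where "cn = (\<lambda>z::complex^3. \<chi> k. cnj (z$k))"
  have ccn: "continuous_on S (\<lambda>x. cn (u x))" if "continuous_on S u" for S :: "'a::topological_space set" and u
    unfolding cn_def using that by (intro continuous_intros)
  define A where "A = (\<lambda>y z. complex_of_real (\<omega> y / c) * szego (expi (- z)) (w y))"
  define \<kappa> where "\<kappa> = (\<lambda>y y'. complex_of_real (\<omega> y * \<omega> y' / c) * szego (cn (\<Phi> y')) (complex_of_real (t\<^sup>2) *s \<Phi> y))"
  define f where "f = (\<lambda>z. G (complex_of_real t *s expi z))"
  define h where "h = (\<lambda>y. complex_of_real (\<omega> y) * G (complex_of_real (t\<^sup>2) *s \<Phi> y))"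
  have hG: "holo3 G poly_D" by (rule H2_holo3[OF G])
  \<comment> \<open>Conjugation moves the dilation to the kernel parameter, which brings the modulus
    of \<kappa> to the form assumed in \<open>b\<close>.\<close>
  have swap: "cmod (szego (cn (\<Phi> y')) (complex_of_real (t\<^sup>2) *s \<Phi> y)) = cmod (szego (cn (complex_of_real (t\<^sup>2) *s \<Phi> y)) (\<Phi> y'))" for y y'
  proof -
    have eq: "cmod (inverse (1 - cnj a * b)) = cmod (inverse (1 - cnj b * a))" for a b
    proof -
      have "cmod (inverse (1 - cnj a * b)) = cmod (cnj (inverse (1 - cnj a * b)))" by (simp only: complex_mod_cnj)
      also have "cnj (inverse (1 - cnj a * b)) = inverse (1 - cnj b * a)" by (simp add: mult.commute)
      finally show ?thesis .
    qed
    show ?thesis unfolding szego_def prod_norm[symmetric] cn_def vec_lambda_beta by (intro prod.cong refl eq)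
  qed
  have sym0: "cmod (szego (cn (\<Phi> y')) (complex_of_real (t\<^sup>2) *s \<Phi> y)) = cmod (szego (cn (\<Phi> y)) (complex_of_real (t\<^sup>2) *s \<Phi> y'))" for y y'
  proof -
    have "szego (cn (complex_of_real (t\<^sup>2) *s \<Phi> y)) (\<Phi> y') = szego (cn (\<Phi> y)) (complex_of_real (t\<^sup>2) *s \<Phi> y')"
      by (simp add: szego_def cn_def mult_ac)
    then show ?thesis using swap[of y' y] by simp
  qed
  have "integral cube (\<lambda>y. (cmod (h y))\<^sup>2) \<le> \<eta> / c * integral cube (\<lambda>z. (cmod (f z))\<^sup>2)"
  proof (rule schur_bound[where A=A and \<kappa>=\<kappa>])
    show "continuous_on UNIV (\<lambda>x. A (fst x) (snd x))" unfolding A_def w_def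
    proof (intro continuous_intros P X)
      fix x :: "(real^3) \<times> (real^3)" and k
      show "expi (- snd x) $ k * (complex_of_real t *s \<Phi> (fst x)) $ k \<noteq> 1"
        using poly_D_nth[OF w[of "fst x"], of k] by (intro mult_neq_1_of_norm) (auto simp: w_def)
    qed (use c in auto)
    show "continuous_on UNIV f" unfolding f_def using t by (intro continuous_dilate hG) auto
    show "continuous_on UNIV h" unfolding h_def
      by (intro continuous_intros X continuous_on_compose2[OF holo3_continuous[OF hG]] P) (use tw in auto)
    show "continuous_on UNIV (\<lambda>x. \<kappa> (fst x) (snd x))" unfolding \<kappa>_def
    proof (intro continuous_intros P X ccn)
      fix x :: "(real^3) \<times> (real^3)" and k
      show "cn (\<Phi> (snd x)) $ k * (complex_of_real (t\<^sup>2) *s \<Phi> (fst x)) $ k \<noteq> 1"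
        using poly_D_nth[OF tw[of "fst x"], of k] poly_cD_nth[OF \<Phi>[of "snd x"], of k] by (intro mult_neq_1_of_norm) (auto simp: cn_def)
    qed (use c in auto)
    show "h y = integral cube (\<lambda>z. f z * A y z)" for y
    proof -
      have "integral cube (\<lambda>z. f z * A y z) = integral cube (\<lambda>z. complex_of_real (\<omega> y / c) * (f z * szego (expi (- z)) (w y)))"
        unfolding A_def by (simp add: mult_ac)
      also have "\<dots> = complex_of_real (\<omega> y / c) * ((2*pi)^3 * G (complex_of_real t *s w y))"
        unfolding f_def integral_mult_right using t by (subst cauchy_polydisc[OF hG _ _ w]) auto
      also have "\<dots> = h y" using c unfolding h_def w2 by (simp add: c_def)
      finally show ?thesis by simp
    qed
    show "integral cube (\<lambda>z. A y z * cnj (A y' z)) = \<kappa> y y'" for y y'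
    proof -
      have hs: "holo3 (szego (cn (\<Phi> y'))) poly_D" using poly_cD_nth[OF \<Phi>[of y']] by (intro holo3_szego) (auto simp: cn_def)
      have "cnj (szego (expi (- z)) (w y')) = szego (cn (\<Phi> y')) (complex_of_real t *s expi z)" for z
        by (simp add: szego_def cn_def w_def cis_cnj mult_ac)
      then have "integral cube (\<lambda>z. A y z * cnj (A y' z)) = integral cube (\<lambda>z. complex_of_real (\<omega> y / c * (\<omega> y' / c)) *
          (szego (cn (\<Phi> y')) (complex_of_real t *s expi z) * szego (expi (- z)) (w y)))"
        unfolding A_def by (simp add: mult_ac)
      also have "\<dots> = complex_of_real (\<omega> y / c * (\<omega> y' / c)) * ((2*pi)^3 * szego (cn (\<Phi> y')) (complex_of_real t *s w y))"
        unfolding integral_mult_right using t by (subst cauchy_polydisc[OF hs _ _ w]) auto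
      also have "\<dots> = \<kappa> y y'" unfolding \<kappa>_def w2 by (simp add: c_def field_simps eval_nat_numeral)
      finally show ?thesis .
    qed
    have ck: "cmod (\<kappa> y y') = \<omega> y / c * (\<omega> y' * cmod (szego (cn (complex_of_real (t\<^sup>2) *s \<Phi> y)) (\<Phi> y')))" for y y'
      unfolding \<kappa>_def norm_mult swap norm_of_real using c \<omega>(1)[of y] \<omega>(1)[of y'] by simp
    show "cmod (\<kappa> y y') = cmod (\<kappa> y' y)" for y y'
      unfolding \<kappa>_def norm_mult sym0[of y' y] by (simp add: mult.commute)
    show "integral cube (\<lambda>y'. cmod (\<kappa> y y')) \<le> \<eta> / c" for y
    proof -
      \<comment> \<open>The parameter of the kernel varies with y; for this reason the hypothesis
        has to hold uniformly over the polydisc.\<close>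
      let ?b = "cn (complex_of_real (t\<^sup>2) *s \<Phi> y)"
      have bD: "?b \<in> poly_D" using tw[of y] by (simp add: poly_D_def cn_def norm_mult)
      have cb: "continuous_on cube (\<lambda>y'. \<omega> y' * cmod (szego ?b (\<Phi> y')))"
      proof (intro continuous_intros X P)
        show "?b $ k * \<Phi> y' $ k \<noteq> 1" for y' k
          using poly_D_nth[OF bD, of k] poly_cD_nth[OF \<Phi>[of y'], of k] mult_neq_1_of_norm[of "\<Phi> y' $ k" "?b $ k"] by (auto simp: mult.commute)
      qed
      have nn: "0 \<le> integral cube (\<lambda>y'. \<omega> y' * cmod (szego ?b (\<Phi> y')))"
        using \<omega> by (intro Henstock_Kurzweil_Integration.integral_nonneg integrable_continuous cb) auto
      have "integral cube (\<lambda>y'. cmod (\<kappa> y y')) = \<omega> y / c * integral cube (\<lambda>y'. \<omega> y' * cmod (szego ?b (\<Phi> y')))"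
        unfolding ck by (rule integral_mult_right)
      also have "\<dots> \<le> 1 / c * \<eta>" using c \<omega> nn by (intro mult_mono b[OF bD] divide_right_mono) auto
      finally show ?thesis by simp
    qed
  qed
  also have "\<dots> \<le> \<eta> / c * (c * (H2_norm G)\<^sup>2)"
  proof (intro mult_left_mono)
    show "integral cube (\<lambda>z. (cmod (f z))\<^sup>2) \<le> c * (H2_norm G)\<^sup>2"
      unfolding f_def c_def by (rule integral_dilate_le[OF G t])
    \<comment> \<open>At parameter 0 the kernel is 1, so the hypothesis also shows that \<eta> is
      nonnegative.\<close>
    have "0 \<in> (poly_D :: (complex^3) set)" by (simp add: poly_D_def)
    from b[OF this] have "integral cube \<omega> \<le> \<eta>" by (simp add: szego_def)
    moreover have "0 \<le> integral cube \<omega>" using \<omega> by (intro Henstock_Kurzweil_Integration.integral_nonneg integrable_continuous X continuous_on_id) auto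
    ultimately show "0 \<le> \<eta> / c" using c by simp
  qed
  finally show ?thesis using c by (simp add: h_def)
qed

section \<open>Compactness from cutoffs\<close>

lemma holo3_comp_dilate:
  fixes \<phi> :: "complex^3 \<Rightarrow> complex^3"
  assumes G: "holo3 G poly_D" and holo: "\<And>j. holo3 (\<lambda>z. \<phi> z $ j) poly_D" and maps: "\<phi> ` poly_D \<subseteq> poly_D" and c: "cmod c \<le> 1"
  shows "holo3 (\<lambda>z. G (c *s \<phi> z)) poly_D"
  unfolding holo3_def
proof
  fix z :: "complex^3" assume z: "z \<in> poly_D"
  have "\<forall>j. \<exists>f'. ((\<lambda>z. \<phi> z $ j) has_derivative f') (at z) \<and> (\<forall>c v. f' (c *s v) = c * f' v)"
    using holo z by (auto simp: holo3_def)
  then obtain f' where f': "\<And>j. ((\<lambda>z. \<phi> z $ j) has_derivative f' j) (at z)" "\<And>j c v. f' j (c *s v) = c * f' j v" by metis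
  have "((\<lambda>z. \<Sum>j\<in>UNIV. (c * \<phi> z $ j) *s (axis j 1 :: complex^3)) has_derivative (\<lambda>v. \<Sum>j\<in>UNIV. (c * f' j v) *s axis j 1)) (at z)"
    by (intro has_derivative_sum bounded_linear.has_derivative[OF bounded_linear_smult_left] bounded_linear.has_derivative[OF bounded_linear_mult_right] f'(1))
  moreover have "(\<Sum>j\<in>UNIV. (c * \<phi> z $ j) *s (axis j 1 :: complex^3)) = c *s \<phi> z" for z
    using basis_expansion[of "c *s \<phi> z"] by (simp only: vector_smult_component)
  ultimately have d: "((\<lambda>z. c *s \<phi> z) has_derivative (\<lambda>v. \<Sum>j\<in>UNIV. (c * f' j v) *s axis j 1)) (at z)" by simp
  have "c *s \<phi> z \<in> poly_D" using maps z c by (intro scale_D_D) auto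
  then obtain G' where G': "(G has_derivative G') (at (c *s \<phi> z))" "\<And>c v. G' (c *s v) = c * G' v"
    using G unfolding holo3_def by blast
  have "((\<lambda>z. G (c *s \<phi> z)) has_derivative (\<lambda>v. G' (\<Sum>j\<in>UNIV. (c * f' j v) *s axis j 1))) (at z)"
    by (rule has_derivative_compose[OF d G'(1)])
  moreover have "G' (\<Sum>j\<in>UNIV. (c * f' j (a *s v)) *s axis j 1) = a * G' (\<Sum>j\<in>UNIV. (c * f' j v) *s axis j 1)" for a v
  proof -
    have "(\<Sum>j\<in>UNIV. (c * f' j (a *s v)) *s (axis j 1 :: complex^3)) = a *s (\<Sum>j\<in>UNIV. (c * f' j v) *s axis j 1)"
      unfolding vec.scale_sum_right f'(2) vec.scale_scale by (intro sum.cong refl) (simp only: mult.left_commute)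
    then show ?thesis by (simp only: G'(2))
  qed
  ultimately show "\<exists>f'. ((\<lambda>z. G (c *s \<phi> z)) has_derivative f') (at z) \<and> (\<forall>c v. f' (c *s v) = c * f' v)" by blast
qed

lemma compact_polydisc: "compact {w :: complex^3. \<forall>j. cmod (w$j) \<le> s}"
proof (rule compact_eq_bounded_closed[THEN iffD2], rule conjI)
  have "norm w \<le> 3 * s" if "\<forall>j. cmod (w$j) \<le> s" for w :: "complex^3"
    unfolding norm_vec_def using L2_set_le_sum[of UNIV "\<lambda>i. norm (w$i)"] sum_bounded_above[of UNIV "\<lambda>i. norm (w$i)" s] that by simp
  then show "bounded {w :: complex^3. \<forall>j. cmod (w$j) \<le> s}" by (auto simp: bounded_iff)
  show "closed {w :: complex^3. \<forall>j. cmod (w$j) \<le> s}"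
    by (intro closed_Collect_all closed_Collect_le continuous_intros)
qed

context
  fixes \<phi> :: "complex^3 \<Rightarrow> complex^3"
  assumes holo: "\<And>j. holo3 (\<lambda>z. \<phi> z $ j) poly_D" and maps: "\<phi> ` poly_D \<subseteq> poly_D"
    and cont: "continuous_on poly_cD \<phi>" and cD: "\<phi> ` poly_cD \<subseteq> poly_cD"
begin

text \<open>Where \<omega> = 1 the cutoff estimate applies; elsewhere all coordinates of \<phi> have
  modulus at most 1 - \<epsilon> and G is bounded by S. This is done on the torus for the dilate by
  t^2, which is continuous up to the boundary; the mean of radius r is smaller, and for fixed r < 1
  the factor t may tend to 1.\<close>

lemma circ_mean_comp_le:
  fixes \<omega> :: "real^3 \<Rightarrow> real" and G :: "complex^3 \<Rightarrow> complex"
  assumes G: "G \<in> H2" and \<epsilon>: "0 < \<epsilon>" "\<epsilon> < 1" and c\<omega>: "continuous_on UNIV \<omega>" and \<omega>: "\<And>y. 0 \<le> \<omega> y" "\<And>y. \<omega> y \<le> 1"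
    and \<omega>1: "\<And>y j. 1 - \<epsilon> \<le> cmod (\<phi> (expi y) $ j) \<Longrightarrow> \<omega> y = 1"
    and b: "\<And>b. b \<in> poly_D \<Longrightarrow> integral cube (\<lambda>y. \<omega> y * cmod (szego b (\<phi> (expi y)))) \<le> \<eta>"
    and S: "\<And>w. (\<forall>j. cmod (w$j) \<le> 1 - \<epsilon>) \<Longrightarrow> cmod (G w) \<le> S" and r: "0 < r" "r < 1"
  shows "circ_mean (G \<circ> \<phi>) r \<le> \<eta> * (H2_norm G)\<^sup>2 + S\<^sup>2"
proof -
  have hG: "holo3 G poly_D" by (rule H2_holo3[OF G])
  have ce: "continuous_on A (\<lambda>y. \<phi> (expi y))" for A
    by (intro continuous_on_compose2[OF cont] continuous_intros) (auto intro: expi_in_cD)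
  have c\<omega>': "continuous_on A \<omega>" for A by (rule continuous_on_subset[OF c\<omega> subset_UNIV])
  have pc: "\<phi> (expi y) \<in> poly_cD" for y using cD expi_in_cD by blast
  have bd: "circ_mean (\<lambda>z. G (complex_of_real (t\<^sup>2) *s \<phi> z)) r \<le> \<eta> * (H2_norm G)\<^sup>2 + S\<^sup>2" if t: "0 < t" "t < 1" for t
  proof -
    have t2: "cmod (complex_of_real (t\<^sup>2)) < 1" using t by (simp add: norm_power power_less_one_iff)
    have D: "complex_of_real (t\<^sup>2) *s z \<in> poly_D" if "z \<in> poly_cD" for z using t2 that by (rule scale_cD_D)
    let ?g = "\<lambda>z. G (complex_of_real (t\<^sup>2) *s \<phi> z)"
    have cg: "continuous_on poly_cD ?g"
      by (intro continuous_on_compose2[OF holo3_continuous[OF hG]] continuous_intros cont) (use cD D in blast)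
    have "circ_mean ?g r \<le> circ_mean ?g 1"
      using r t2 by (intro circ_mean_le_boundary cg holo3_comp_dilate hG holo maps) auto
    also have "\<dots> = integral cube (\<lambda>y. (cmod (?g (expi y)))\<^sup>2) / (2*pi)^3" by (simp add: circ_mean_def)
    also have "\<dots> \<le> (\<eta> * (H2_norm G)\<^sup>2 + (2*pi)^3 * S\<^sup>2) / (2*pi)^3"
    proof (intro divide_right_mono)
      have c1: "continuous_on cube (\<lambda>y. ?g (expi y))"
        by (intro continuous_on_compose2[OF cg] continuous_intros) (auto intro: expi_in_cD)
      have "integral cube (\<lambda>y. (cmod (?g (expi y)))\<^sup>2) \<le> integral cube (\<lambda>y. (cmod (\<omega> y * ?g (expi y)))\<^sup>2 + S\<^sup>2)"
      proof (intro integral_le integrable_continuous continuous_intros c1 c\<omega>')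
        fix y
        show "(cmod (?g (expi y)))\<^sup>2 \<le> (cmod (\<omega> y * ?g (expi y)))\<^sup>2 + S\<^sup>2"
        proof (cases "\<omega> y = 1")
          case False
          then have l: "cmod (\<phi> (expi y) $ j) \<le> 1 - \<epsilon>" for j using \<omega>1[of y j] by linarith
          have "cmod (?g (expi y)) \<le> S"
          proof (intro S allI)
            fix j
            have "cmod ((complex_of_real (t\<^sup>2) *s \<phi> (expi y)) $ j) \<le> 1 * cmod (\<phi> (expi y) $ j)"
              using t2 unfolding vector_smult_component norm_mult by (intro mult_right_mono) auto
            then show "cmod ((complex_of_real (t\<^sup>2) *s \<phi> (expi y)) $ j) \<le> 1 - \<epsilon>" using l[of j] by linarith
          qed
          then have "(cmod (?g (expi y)))\<^sup>2 \<le> S\<^sup>2" by (intro power_mono) auto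
          then show ?thesis by (simp add: add_increasing)
        qed simp
      qed
      also have "\<dots> = integral cube (\<lambda>y. (cmod (\<omega> y * ?g (expi y)))\<^sup>2) + integral cube (\<lambda>y::real^3. S\<^sup>2)"
        by (intro integral_add integrable_continuous continuous_intros c1 c\<omega>')
      also have "\<dots> \<le> \<eta> * (H2_norm G)\<^sup>2 + (2*pi)^3 * S\<^sup>2"
        using measure_cube by (intro add_mono cutoff_composition_bound[OF G t ce pc c\<omega> \<omega> b]) auto
      finally show "integral cube (\<lambda>y. (cmod (?g (expi y)))\<^sup>2) \<le> \<eta> * (H2_norm G)\<^sup>2 + (2*pi)^3 * S\<^sup>2" .
    qed (use two_pi_cube_pos in auto)
    also have "\<dots> = \<eta> * (H2_norm G)\<^sup>2 / (2*pi)^3 + S\<^sup>2" using two_pi_cube_pos by (simp only: add_divide_distrib) simp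
    also have "\<dots> \<le> \<eta> * (H2_norm G)\<^sup>2 + S\<^sup>2"
    proof -
      have "0 \<in> (poly_D :: (complex^3) set)" by (simp add: poly_D_def)
      from b[OF this] have "integral cube \<omega> \<le> \<eta>" by (simp add: szego_def)
      moreover have "0 \<le> integral cube \<omega>"
        using \<omega> by (intro Henstock_Kurzweil_Integration.integral_nonneg integrable_continuous c\<omega>') auto
      ultimately have "0 \<le> \<eta> * (H2_norm G)\<^sup>2" by simp
      moreover have "(1::real) \<le> (2*pi)^3" using pi_ge_two by (intro one_le_power) auto
      ultimately show ?thesis using two_pi_cube_pos by (simp add: divide_le_eq mult_le_cancel_left1)
    qed
    finally show ?thesis .
  qed
  have pr: "\<phi> (complex_of_real r *s expi \<theta>) \<in> poly_D" for \<theta>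
    using r maps scale_cD_D[of "complex_of_real r" "expi \<theta>"] expi_in_cD by fastforce
  have cr: "continuous_on A (\<lambda>x. \<phi> (complex_of_real r *s expi (snd x)))" for A :: "(real \<times> (real^3)) set"
    using r by (intro continuous_on_compose2[OF cont] continuous_intros) (auto intro!: scale_cD expi_in_cD)
  have "continuous_on {0..1} (\<lambda>t::real. integral cube (\<lambda>\<theta>. (cmod (G (complex_of_real (t\<^sup>2) *s \<phi> (complex_of_real r *s expi \<theta>))))\<^sup>2))"
  proof (rule integral_continuous_on_param)
    show "continuous_on ({0..1} \<times> cube) (\<lambda>(t, \<theta>). (cmod (G (complex_of_real (t\<^sup>2) *s \<phi> (complex_of_real r *s expi \<theta>))))\<^sup>2)"
      unfolding split_beta
    proof (intro continuous_intros continuous_on_compose2[OF holo3_continuous[OF hG]] cr)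
      show "(\<lambda>p. complex_of_real ((fst p)\<^sup>2) *s \<phi> (complex_of_real r *s expi (snd p))) ` ({0..1} \<times> cube) \<subseteq> poly_D"
        using pr by (auto intro!: scale_D_D simp: norm_power power_le_one simp del: of_real_power)
    qed
  qed
  then have "continuous_on {0..1} (\<lambda>t. circ_mean (\<lambda>z. G (complex_of_real (t\<^sup>2) *s \<phi> z)) r)"
    unfolding circ_mean_def by (intro continuous_intros) auto
  from this[unfolded continuous_on, rule_format, of 1]
  have "((\<lambda>t. circ_mean (\<lambda>z. G (complex_of_real (t\<^sup>2) *s \<phi> z)) r) \<longlongrightarrow> circ_mean (\<lambda>z. G (complex_of_real (1\<^sup>2) *s \<phi> z)) r) (at_left 1)"
    by (simp add: at_within_Icc_at_left)
  moreover have "eventually (\<lambda>t. circ_mean (\<lambda>z. G (complex_of_real (t\<^sup>2) *s \<phi> z)) r \<le> \<eta> * (H2_norm G)\<^sup>2 + S\<^sup>2) (at_left 1)"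
    using eventually_at_left_unit by eventually_elim (use bd in auto)
  ultimately have "circ_mean (\<lambda>z. G (complex_of_real (1\<^sup>2) *s \<phi> z)) r \<le> \<eta> * (H2_norm G)\<^sup>2 + S\<^sup>2" by (intro tendsto_upperbound) auto
  then show ?thesis by (simp add: o_def)
qed

text \<open>Montel's theorem provides a subsequence converging uniformly on compact sets, with
  differences bounded in H2. In the estimate for these differences the first term is small by the
  choice of \<eta>, the second by uniform convergence on the closed polydisc of radius 1 -
  \<epsilon>. Membership in H2 is the same estimate with \<eta> = 1.\<close>

lemma compact_comp_op_of_cutoffs:
  assumes E: "\<And>\<eta>::real. 0 < \<eta> \<Longrightarrow> \<exists>\<epsilon> \<omega>. 0 < \<epsilon> \<and> \<epsilon> < (1::real) \<and> continuous_on UNIV \<omega> \<and> (\<forall>y. 0 \<le> \<omega> y \<and> \<omega> y \<le> (1::real)) \<and>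
     (\<forall>y j. 1 - \<epsilon> \<le> cmod (\<phi> (expi y) $ j) \<longrightarrow> \<omega> y = 1) \<and> (\<forall>b\<in>poly_D. integral cube (\<lambda>y. \<omega> y * cmod (szego b (\<phi> (expi y)))) \<le> \<eta>)"
  shows "compact_comp_op \<phi>"
proof -
  have key: "\<exists>\<epsilon>>0. \<epsilon> < 1 \<and> (\<forall>G\<in>H2. \<forall>S r. (\<forall>w. (\<forall>j. cmod (w$j) \<le> 1 - \<epsilon>) \<longrightarrow> cmod (G w) \<le> S) \<longrightarrow> 0 < r \<longrightarrow> r < 1 \<longrightarrow>
      circ_mean (G \<circ> \<phi>) r \<le> \<eta> * (H2_norm G)\<^sup>2 + S\<^sup>2)" if "0 < \<eta>" for \<eta>
  proof -
    show ?thesis using E[OF that]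
    proof (elim exE conjE)
      fix \<epsilon> and \<omega> :: "real^3 \<Rightarrow> real"
      assume e: "0 < \<epsilon>" "\<epsilon> < 1" "continuous_on UNIV \<omega>" and o: "\<forall>y. 0 \<le> \<omega> y \<and> \<omega> y \<le> 1"
        "\<forall>y j. 1 - \<epsilon> \<le> cmod (\<phi> (expi y) $ j) \<longrightarrow> \<omega> y = 1" "\<forall>b\<in>poly_D. integral cube (\<lambda>y. \<omega> y * cmod (szego b (\<phi> (expi y)))) \<le> \<eta>"
      show ?thesis
        by (rule exI[of _ \<epsilon>], intro conjI e(1,2) ballI allI impI, rule circ_mean_comp_le[OF _ e]) (use o in auto)
    qed
  qed
  have sub: "{w :: complex^3. \<forall>j. cmod (w$j) \<le> 1 - \<epsilon>} \<subseteq> poly_D" if "0 < \<epsilon>" for \<epsilon>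
  proof
    fix w :: "complex^3" assume "w \<in> {w. \<forall>j. cmod (w$j) \<le> 1 - \<epsilon>}"
    then have le: "cmod (w$j) \<le> 1 - \<epsilon>" for j by simp
    have "cmod (w$j) < 1" for j using le[of j] that by linarith
    then show "w \<in> poly_D" by (simp add: poly_D_def)
  qed
  have hcomp: "holo3 (G \<circ> \<phi>) poly_D" if "holo3 G poly_D" for G
    using holo3_comp_dilate[OF that holo maps, of 1] by (simp add: o_def)
  have mem: "G \<circ> \<phi> \<in> H2" if G: "G \<in> H2" for G
  proof -
    obtain \<epsilon> where e: "0 < \<epsilon>" "\<epsilon> < 1" and le': "(\<forall>G\<in>H2. \<forall>S r. (\<forall>w. (\<forall>j. cmod (w$j) \<le> 1 - \<epsilon>) \<longrightarrow> cmod (G w) \<le> S) \<longrightarrow> 0 < r \<longrightarrow> r < 1 \<longrightarrow>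
      circ_mean (G \<circ> \<phi>) r \<le> 1 * (H2_norm G)\<^sup>2 + S\<^sup>2)" using key[OF zero_less_one] by blast
    note le = le'[THEN bspec, THEN spec, THEN spec, THEN mp, THEN mp, THEN mp, OF G]
    have "compact (G ` {w. \<forall>j. cmod (w$j) \<le> 1 - \<epsilon>})"
      by (rule compact_continuous_image[OF continuous_on_subset[OF holo3_continuous[OF H2_holo3[OF G]] sub[OF e(1)]] compact_polydisc])
    then obtain S where "\<forall>x \<in> G ` {w. \<forall>j. cmod (w$j) \<le> 1 - \<epsilon>}. norm x \<le> S"
      using compact_imp_bounded bounded_iff by blast
    then have S: "\<forall>w. (\<forall>j. cmod (w$j) \<le> 1 - \<epsilon>) \<longrightarrow> cmod (G w) \<le> S" by auto
    show ?thesis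
    proof (rule H2_norm_le(1)[OF hcomp[OF H2_holo3[OF G]]])
      show "circ_mean (G \<circ> \<phi>) t \<le> (sqrt ((H2_norm G)\<^sup>2 + S\<^sup>2))\<^sup>2" if "0 < t" "t < 1" for t
        using le[OF S that] by simp
    qed simp
  qed
  show ?thesis unfolding compact_comp_op_def
  proof (intro conjI ballI allI impI mem)
    fix F :: "nat \<Rightarrow> complex^3 \<Rightarrow> complex" assume "(\<forall>n. F n \<in> H2) \<and> (\<exists>B. \<forall>n. H2_norm (F n) \<le> B)"
    then obtain B where F: "\<And>n. F n \<in> H2" and B: "\<And>n. H2_norm (F n) \<le> B" by blast
    obtain g r where g: "g \<in> H2" "H2_norm g \<le> B" "strict_mono (r :: nat \<Rightarrow> nat)"
      and ul: "\<And>K. compact K \<Longrightarrow> K \<subseteq> poly_D \<Longrightarrow> uniform_limit K (\<lambda>n. F (r n)) g sequentially"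
      by (rule H2_Montel[where F=F, OF F B]) blast
    have B0: "0 \<le> B" using B[of 0] H2_norm_nonneg[OF F[of 0]] by simp
    let ?D = "\<lambda>n z. F (r n) z - g z"
    have D: "?D n \<in> H2" for n by (rule H2_diff(1)[OF F g(1)])
    have D2: "(H2_norm (?D n))\<^sup>2 \<le> 4 * B\<^sup>2" for n
    proof -
      have "(H2_norm (F (r n)))\<^sup>2 \<le> B\<^sup>2" "(H2_norm g)\<^sup>2 \<le> B\<^sup>2" using B g F by (auto intro!: power_mono H2_norm_nonneg)
      moreover have "(H2_norm (?D n))\<^sup>2 \<le> (sqrt (2 * (H2_norm (F (r n)))\<^sup>2 + 2 * (H2_norm g)\<^sup>2))\<^sup>2"
        by (intro power_mono H2_diff(2)[OF F g(1)] H2_norm_nonneg D)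
      ultimately show ?thesis by simp
    qed
    have "(\<lambda>n. H2_norm (\<lambda>z. (F (r n) \<circ> \<phi>) z - (g \<circ> \<phi>) z)) \<longlonglongrightarrow> 0"
    proof (rule LIMSEQ_I)
      fix e :: real assume e: "0 < e"
      \<comment> \<open>The squared norms of the differences are at most 4 B^2; the 1 avoids
        division by zero, and both terms of the estimate become e^2/16.\<close>
      define \<eta> where "\<eta> = e\<^sup>2 / (16 * (4 * B\<^sup>2 + 1))"
      have B1: "0 < 4 * B\<^sup>2 + 1" by (rule add_nonneg_pos) auto
      have \<eta>T: "e\<^sup>2 / (16 * T) * T = e\<^sup>2 / 16" if "0 < T" for T :: real using that by simp
      have \<eta>: "0 < \<eta>" using e B1 by (simp add: \<eta>_def)
      obtain \<epsilon> where \<epsilon>: "0 < \<epsilon>" "\<epsilon> < 1" and le': "(\<forall>G\<in>H2. \<forall>S r. (\<forall>w. (\<forall>j. cmod (w$j) \<le> 1 - \<epsilon>) \<longrightarrow> cmod (G w) \<le> S) \<longrightarrow> 0 < r \<longrightarrow> r < 1 \<longrightarrow>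
      circ_mean (G \<circ> \<phi>) r \<le> \<eta> * (H2_norm G)\<^sup>2 + S\<^sup>2)" using key[OF \<eta>] by blast
      note le = le'[THEN bspec, THEN spec, THEN spec, THEN mp, THEN mp, THEN mp]
      have "\<forall>\<^sub>F n in sequentially. \<forall>w\<in>{w. \<forall>j. cmod (w$j) \<le> 1 - \<epsilon>}. dist (F (r n) w) (g w) < e / 4"
        by (rule ul[OF compact_polydisc sub[OF \<epsilon>(1)], unfolded uniform_limit_iff, THEN spec, THEN mp]) (use e in simp)
      then obtain N where N': "\<forall>n\<ge>N. \<forall>w\<in>{w. \<forall>j. cmod (w$j) \<le> 1 - \<epsilon>}. dist (F (r n) w) (g w) < e / 4"
        unfolding eventually_sequentially by blast
      have N: "cmod (?D n w) \<le> e / 4" if "N \<le> n" "\<forall>j. cmod (w$j) \<le> 1 - \<epsilon>" for n w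
        using N' that by (simp add: dist_norm less_imp_le)
      have small: "H2_norm (?D n \<circ> \<phi>) \<le> e / 2" if n: "N \<le> n" for n
      proof (rule H2_norm_le(2)[OF hcomp[OF H2_holo3[OF D]]])
        fix t :: real assume t: "0 < t" "t < 1"
        have "circ_mean (?D n \<circ> \<phi>) t \<le> \<eta> * (H2_norm (?D n))\<^sup>2 + (e / 4)\<^sup>2"
          using N[OF n] by (intro le[OF D _ t]) auto
        also have "\<eta> * (H2_norm (?D n))\<^sup>2 \<le> \<eta> * (4 * B\<^sup>2 + 1)" using D2[of n] \<eta> by (intro mult_left_mono) auto
        also have "\<eta> * (4 * B\<^sup>2 + 1) = e\<^sup>2 / 16" using \<eta>T[OF B1] by (simp only: \<eta>_def)
        finally have "circ_mean (?D n \<circ> \<phi>) t \<le> e\<^sup>2 / 16 + (e / 4)\<^sup>2" by (simp add: o_def)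
        moreover have "(e / 4)\<^sup>2 = e\<^sup>2 / 16" "(e / 2)\<^sup>2 = e\<^sup>2 / 4" "0 \<le> e\<^sup>2" by (simp_all add: power_divide)
        ultimately show "circ_mean (?D n \<circ> \<phi>) t \<le> (e / 2)\<^sup>2" by linarith
      qed (use e in auto)
      have "norm (H2_norm (\<lambda>z. (F (r n) \<circ> \<phi>) z - (g \<circ> \<phi>) z) - 0) < e" if "N \<le> n" for n
        using small[OF that] H2_norm_nonneg[OF mem[OF D[of n]]] e by (simp add: o_def)
      then show "\<exists>N. \<forall>n\<ge>N. norm (H2_norm (\<lambda>z. (F (r n) \<circ> \<phi>) z - (g \<circ> \<phi>) z) - 0) < e" by blast
    qed
    then show "\<exists>g\<in>H2. \<exists>r. strict_mono r \<and> (\<lambda>n. H2_norm (\<lambda>z. (F (r n) \<circ> \<phi>) z - g z)) \<longlonglongrightarrow> 0"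
      using mem[OF g(1)] g(3) by blast
  qed
qed

end

section \<open>Dyadic summation over level sets\<close>

text \<open>n is least with \<rho> \<le> v 2^n. This bounds the inverse of v, and for positive n
  minimality bounds v from above. The level n = 0 collects all points where v is not small, and
  there no upper bound is claimed.\<close>

lemma dyadic_majorant:
  fixes v \<rho> :: real
  assumes "0 < v" "0 < \<rho>"
  obtains n :: nat where "n = 0 \<or> v \<le> \<rho> * 2 / 2^n" "inverse v \<le> inverse \<rho> * 2^n"
proof -
  define P where "P = (\<lambda>n::nat. \<rho> \<le> v * 2^n)"
  obtain n0 where "\<rho> / v < 2^n0" using real_arch_pow[of 2 "\<rho> / v"] by auto
  then have "P n0" using assms by (simp add: P_def field_simps)
  define n where "n = (LEAST n. P n)"
  have L: "P n" unfolding n_def by (rule LeastI) (rule \<open>P n0\<close>)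
  have "inverse v \<le> inverse \<rho> * 2^n" using L assms unfolding P_def by (simp add: field_simps)
  moreover have "n = 0 \<or> v \<le> \<rho> * 2 / 2^n"
  proof (cases n)
    case (Suc m)
    then have "\<not> P m" using not_less_Least[of m P] by (simp add: n_def)
    then show ?thesis using Suc by (simp add: P_def field_simps)
  qed simp
  ultimately show ?thesis using that by blast
qed

text \<open>Layer-cake summation over the dyadic levels \<open>v\<^sub>i \<approx> \<rho> / 2\<^sup>n\<close>: the level sets gain the tenth power of the level,
  the integrand loses only the ninth.\<close>

lemma dyadic_integral_bound:
  fixes v1 v2 :: "real^3 \<Rightarrow> real"
  assumes v: "v1 \<in> borel_measurable borel" "v2 \<in> borel_measurable borel" "\<And>x. 0 < v1 x" "\<And>x. 0 < v2 x" and B: "B \<in> sets borel"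
    and \<rho>: "0 < \<rho>" "\<rho> \<le> 1" and K: "0 \<le> K" and m0: "emeasure lborel B \<le> ennreal K"
    and m1: "\<And>s. 0 < s \<Longrightarrow> s \<le> \<rho> \<Longrightarrow> emeasure lborel {x \<in> B. v1 x \<le> s} \<le> ennreal (K * s^10)"
    and m2: "\<And>s. 0 < s \<Longrightarrow> s \<le> \<rho> \<Longrightarrow> emeasure lborel {x \<in> B. v2 x \<le> s} \<le> ennreal (K * s^10)"
    and m12: "\<And>s t. 0 < s \<Longrightarrow> s \<le> \<rho> \<Longrightarrow> 0 < t \<Longrightarrow> t \<le> \<rho> \<Longrightarrow> emeasure lborel {x \<in> B. v1 x \<le> s \<and> v2 x \<le> t} \<le> ennreal (K * (s^10 * t^10))"
  shows "(\<integral>\<^sup>+x. ennreal (inverse (v1 x)^9 * inverse (v2 x)^9) * indicator B x \<partial>lborel) \<le> ennreal (K * (2^10 * inverse \<rho>^9)\<^sup>2 * 4)"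
proof -
  \<comment> \<open>\<open>a n\<close> majorises the integrand on level n and \<open>c n\<close> the
    measure of that level relative to K. The factor 2 in \<open>c\<close> makes \<open>c 0\<close>
    at least 1, so the same formula covers level 0, which is all of B.\<close>
  define a where "a = (\<lambda>n::nat. (inverse \<rho> * 2^n)^9)"
  define E where "E = (\<lambda>v n. {x \<in> B. n = (0::nat) \<or> v x \<le> \<rho> * 2 / 2^n})"
  define c :: "nat \<Rightarrow> real" where "c = (\<lambda>n. (2 / 2^n)^10)"
  define D where "D = 2^10 * inverse \<rho>^9"
  have a0: "0 \<le> a n" for n using \<rho> by (simp add: a_def)
  have c0: "0 \<le> c n" for n by (simp add: c_def)
  have D0: "0 \<le> D" using \<rho> by (simp add: D_def)
  \<comment> \<open>Nine powers of 2^n against ten: one power is left, and the double sum is a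
    product of two geometric series.\<close>
  have acD: "a n * c n = D * (1/2)^n" for n
  proof -
    have "x^9 * (2 / x)^10 = 2^10 / x" if "x \<noteq> 0" for x :: real
    proof -
      have "x^10 = x * x^9" using power_Suc[of x 9] by simp
      then show ?thesis using that by (simp add: power_divide)
    qed
    from this[of "2^n"] show ?thesis by (simp add: a_def c_def D_def power_mult_distrib mult.assoc power_one_over)
  qed
  have mE: "E w n \<in> sets lborel" if "w \<in> borel_measurable borel" for w n
  proof -
    have "{x. w x \<le> \<rho> * 2 / 2^n} \<in> sets borel" using that borel_measurable_iff_le[of w borel] by simp
    moreover have "E w n = (if n = 0 then B else B \<inter> {x. w x \<le> \<rho> * 2 / 2^n})" by (auto simp: E_def)
    ultimately show ?thesis using B by simp
  qed
  have meas: "E v1 n \<in> sets lborel" "E v2 n \<in> sets lborel" for n using mE v(1,2) by auto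
  have pt: "ennreal (inverse (w x)^9) \<le> (\<Sum>n. ennreal (a n) * indicator (E w n) x)" if xB: "x \<in> B" and wx: "0 < w x" for w x
  proof -
    obtain n where n: "n = 0 \<or> w x \<le> \<rho> * 2 / 2^n" "inverse (w x) \<le> inverse \<rho> * 2^n"
      by (rule dyadic_majorant[OF wx \<rho>(1)])
    then have "ennreal (inverse (w x)^9) \<le> ennreal (a n) * indicator (E w n) x"
      using xB wx by (simp add: E_def a_def) (intro ennreal_leI power_mono; simp)
    also have "\<dots> \<le> (\<Sum>n. ennreal (a n) * indicator (E w n) x)"
    proof -
      define f where "f = (\<lambda>n. ennreal (a n) * indicator (E w n) x)"
      have "f n \<le> suminf f" using sum_le_suminf[of f "{n}"] by simp
      then show ?thesis by (simp add: f_def)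
    qed
    finally show ?thesis .
  qed
  have sc: "0 < \<rho> * 2 / 2^n \<and> \<rho> * 2 / 2^n \<le> \<rho> \<and> (\<rho> * 2 / 2^n)^10 \<le> c n" if "n \<noteq> 0" for n :: nat
  proof -
    have "(2::real) * 1 \<le> 2 ^ n" using that by (cases n) auto
    then have "\<rho> * 2 / 2^n \<le> \<rho>" using \<rho> by (simp add: field_simps)
    moreover have "\<rho> * 2 / 2^n \<le> 2 / 2^n" using \<rho> by (simp add: field_simps)
    ultimately show ?thesis using \<rho> unfolding c_def by (intro conjI power_mono) auto
  qed
  have em: "emeasure lborel (E v1 n \<inter> E v2 m) \<le> ennreal (K * (c n * c m))" for n m
  proof -
    have one: "c 0 = 1024" by (simp add: c_def)
    consider "n = 0" "m = 0" | "n = 0" "m \<noteq> 0" | "n \<noteq> 0" "m = 0" | "n \<noteq> 0" "m \<noteq> 0" by blast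
    then show ?thesis
    proof cases
      case 1
      have "emeasure lborel (E v1 n \<inter> E v2 m) \<le> ennreal K" using 1 m0 by (simp add: E_def)
      also have "\<dots> \<le> ennreal (K * (c n * c m))" using 1 K by (intro ennreal_leI) (simp add: one)
      finally show ?thesis .
    next
      case 2
      have "E v1 n \<inter> E v2 m = {x\<in>B. v2 x \<le> \<rho> * 2 / 2^m}" using 2 by (auto simp: E_def)
      then have "emeasure lborel (E v1 n \<inter> E v2 m) \<le> ennreal (K * (\<rho> * 2 / 2^m)^10)" using m2 sc[OF 2(2)] by simp
      also have "\<dots> \<le> ennreal (K * (c n * c m))"
        using 2 K sc[OF 2(2)] c0[of m] by (intro ennreal_leI mult_left_mono) (simp_all add: one)
      finally show ?thesis .
    next
      case 3
      have "E v1 n \<inter> E v2 m = {x\<in>B. v1 x \<le> \<rho> * 2 / 2^n}" using 3 by (auto simp: E_def)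
      then have "emeasure lborel (E v1 n \<inter> E v2 m) \<le> ennreal (K * (\<rho> * 2 / 2^n)^10)" using m1 sc[OF 3(1)] by simp
      also have "\<dots> \<le> ennreal (K * (c n * c m))"
        using 3 K sc[OF 3(1)] c0[of n] by (intro ennreal_leI mult_left_mono) (simp_all add: one)
      finally show ?thesis .
    next
      case 4
      have "E v1 n \<inter> E v2 m = {x\<in>B. v1 x \<le> \<rho> * 2 / 2^n \<and> v2 x \<le> \<rho> * 2 / 2^m}" using 4 by (auto simp: E_def)
      then have "emeasure lborel (E v1 n \<inter> E v2 m) \<le> ennreal (K * ((\<rho> * 2 / 2^n)^10 * (\<rho> * 2 / 2^m)^10))"
        using m12 sc[OF 4(1)] sc[OF 4(2)] by simp
      also have "\<dots> \<le> ennreal (K * (c n * c m))"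
        using K sc[OF 4(1)] sc[OF 4(2)] \<rho> c0 by (intro ennreal_leI mult_left_mono mult_mono) auto
      finally show ?thesis .
    qed
  qed
  let ?f = "\<lambda>n m x. ennreal (a n) * indicator (E v1 n) x * (ennreal (a m) * indicator (E v2 m) x)"
  have mf: "?f n m \<in> borel_measurable lborel" for n m using meas by measurable
  have "(\<integral>\<^sup>+x. ennreal (inverse (v1 x)^9 * inverse (v2 x)^9) * indicator B x \<partial>lborel) \<le> (\<integral>\<^sup>+x. (\<Sum>n. \<Sum>m. ?f n m x) \<partial>lborel)"
  proof (intro nn_integral_mono)
    fix x
    show "ennreal (inverse (v1 x)^9 * inverse (v2 x)^9) * indicator B x \<le> (\<Sum>n. \<Sum>m. ?f n m x)"
    proof (cases "x \<in> B")
      case True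
      have "ennreal (inverse (v1 x)^9 * inverse (v2 x)^9) = ennreal (inverse (v1 x)^9) * ennreal (inverse (v2 x)^9)"
        using v(3)[of x] by (intro ennreal_mult') simp
      also have "\<dots> \<le> (\<Sum>n. ennreal (a n) * indicator (E v1 n) x) * (\<Sum>m. ennreal (a m) * indicator (E v2 m) x)"
        by (intro mult_mono pt True v) auto
      also have "\<dots> = (\<Sum>n. \<Sum>m. ?f n m x)" by (simp only: ennreal_suminf_cmult ennreal_suminf_multc)
      finally show ?thesis using True by simp
    qed simp
  qed
  also have "\<dots> = (\<Sum>n. \<integral>\<^sup>+x. (\<Sum>m. ?f n m x) \<partial>lborel)"
  proof (rule nn_integral_suminf)
    show "(\<lambda>x. \<Sum>m. ?f n m x) \<in> borel_measurable lborel" for n using meas by measurable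
  qed
  also have "\<dots> = (\<Sum>n. \<Sum>m. \<integral>\<^sup>+x. ?f n m x \<partial>lborel)"
    by (intro suminf_cong nn_integral_suminf mf)
  also have "\<dots> \<le> (\<Sum>n. \<Sum>m. ennreal (K * D\<^sup>2 * (1/2)^n * (1/2)^m))"
  proof (intro suminf_le)
    fix n m
    have "(\<integral>\<^sup>+x. ?f n m x \<partial>lborel) = (\<integral>\<^sup>+x. ennreal (a n * a m) * indicator (E v1 n \<inter> E v2 m) x \<partial>lborel)"
      using a0 by (intro nn_integral_cong) (simp add: indicator_def ennreal_mult')
    also have "\<dots> = ennreal (a n * a m) * emeasure lborel (E v1 n \<inter> E v2 m)" using meas by (intro nn_integral_cmult_indicator) auto
    also have "\<dots> \<le> ennreal (a n * a m) * ennreal (K * (c n * c m))" by (intro mult_left_mono em) auto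
    also have "\<dots> = ennreal (K * ((a n * c n) * (a m * c m)))"
      using a0 by (simp add: ennreal_mult'[symmetric] mult_ac)
    also have "K * ((a n * c n) * (a m * c m)) = K * D\<^sup>2 * (1/2)^n * (1/2)^m" unfolding acD by (simp add: power2_eq_square mult_ac)
    finally show "(\<integral>\<^sup>+x. ?f n m x \<partial>lborel) \<le> ennreal (K * D\<^sup>2 * (1/2)^n * (1/2)^m)" .
  qed auto
  also have "\<dots> = (\<Sum>n. ennreal (K * D\<^sup>2 * (1/2)^n * 2))"
  proof -
    have "(\<Sum>m. ennreal (K * D\<^sup>2 * (1/2)^n * (1/2)^m)) = ennreal (K * D\<^sup>2 * (1/2)^n * 2)" for n
      using K sums_mult[OF geometric_sums[of "1/2::real"], of "K * D\<^sup>2 * (1/2)^n"] by (intro suminf_ennreal_eq) simp_all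
    then show ?thesis by simp
  qed
  also have "\<dots> = ennreal (K * D\<^sup>2 * 4)"
  proof -
    have "(\<lambda>n. (K * D\<^sup>2 * 2) * (1/2)^n) sums ((K * D\<^sup>2 * 2) * 2)" using sums_mult[OF geometric_sums[of "1/2::real"], of "K * D\<^sup>2 * 2"] by simp
    then have "(\<lambda>n. K * D\<^sup>2 * (1/2)^n * 2) sums (K * D\<^sup>2 * 4)" by (simp add: mult_ac)
    then show ?thesis using K by (intro suminf_ennreal_eq) simp_all
  qed
  finally show ?thesis by (simp add: D_def)
qed

section \<open>Decay of the measure of level sets\<close>

text \<open>The level is written s^8 and the bound s^10, that is, exponent 5/4. K is uniform in b
  over the open disc. Admitting every r \<le> \<rho> allows several such conditions to be used on
  one common ball.\<close>

definition decay1 :: "(real^3 \<Rightarrow> complex) \<Rightarrow> real^3 \<Rightarrow> bool" where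
  "decay1 g \<alpha> \<longleftrightarrow> (\<exists>\<rho>>0. \<exists>K\<ge>0. \<rho> \<le> 1 \<and> (\<forall>b s r. cmod b < 1 \<longrightarrow> 0 < s \<longrightarrow> s \<le> \<rho> \<longrightarrow> r \<le> \<rho> \<longrightarrow>
     emeasure lborel {\<theta> \<in> cball \<alpha> r. cmod (1 - b * g \<theta>) \<le> s^8} \<le> ennreal (K * s^10)))"

text \<open>The product form lets the two dyadic scales be summed independently.\<close>

definition decay2 :: "(real^3 \<Rightarrow> complex) \<Rightarrow> (real^3 \<Rightarrow> complex) \<Rightarrow> real^3 \<Rightarrow> bool" where
  "decay2 g h \<alpha> \<longleftrightarrow> (\<exists>\<rho>>0. \<exists>K\<ge>0. \<rho> \<le> 1 \<and> (\<forall>b c s t r. cmod b < 1 \<longrightarrow> cmod c < 1 \<longrightarrow> 0 < s \<longrightarrow> s \<le> \<rho> \<longrightarrow> 0 < t \<longrightarrow> t \<le> \<rho> \<longrightarrow> r \<le> \<rho> \<longrightarrow>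
     emeasure lborel {\<theta> \<in> cball \<alpha> r. cmod (1 - b * g \<theta>) \<le> s^8 \<and> cmod (1 - c * h \<theta>) \<le> t^8} \<le> ennreal (K * (s^10 * t^10))))"

lemma decay2_sym: "decay2 g h \<alpha> \<Longrightarrow> decay2 h g \<alpha>"
proof -
  assume "decay2 g h \<alpha>"
  then obtain \<rho> K where "0 < \<rho>" "0 \<le> K" "\<rho> \<le> 1" and e: "\<forall>b c s t r. cmod b < 1 \<longrightarrow> cmod c < 1 \<longrightarrow> 0 < s \<longrightarrow> s \<le> \<rho> \<longrightarrow> 0 < t \<longrightarrow> t \<le> \<rho> \<longrightarrow> r \<le> \<rho> \<longrightarrow>
     emeasure lborel {\<theta> \<in> cball \<alpha> r. cmod (1 - b * g \<theta>) \<le> s^8 \<and> cmod (1 - c * h \<theta>) \<le> t^8} \<le> ennreal (K * (s^10 * t^10))"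
    unfolding decay2_def by blast
  have "emeasure lborel {\<theta> \<in> cball \<alpha> r. cmod (1 - b * h \<theta>) \<le> s^8 \<and> cmod (1 - c * g \<theta>) \<le> t^8} \<le> ennreal (K * (s^10 * t^10))"
    if "cmod b < 1" "cmod c < 1" "0 < s" "s \<le> \<rho>" "0 < t" "t \<le> \<rho>" "r \<le> \<rho>" for b c s t r
    using e[rule_format, of c b t s r] that by (simp add: conj_commute mult.commute)
  then show ?thesis unfolding decay2_def using \<open>0 < \<rho>\<close> \<open>0 \<le> K\<close> \<open>\<rho> \<le> 1\<close> by blast
qed

lemma inside_bound:
  fixes g :: "real^3 \<Rightarrow> complex"
  assumes "continuous_on UNIV g" "cmod (g \<alpha>) < 1"
  obtains c where "0 < c" "c \<le> 1" "\<And>\<theta> b. dist \<alpha> \<theta> \<le> c \<Longrightarrow> cmod b < 1 \<Longrightarrow> c < cmod (1 - b * g \<theta>)"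
proof -
  define e where "e = (1 - cmod (g \<alpha>)) / 2"
  have e: "0 < e" using assms(2) by (simp add: e_def)
  obtain d where d: "0 < d" "\<And>\<theta>. dist \<theta> \<alpha> < d \<Longrightarrow> dist (g \<theta>) (g \<alpha>) < e"
    using assms(1) e unfolding continuous_on_iff by (metis UNIV_I)
  define c where "c = min (min 1 (d / 2)) e"
  have c: "0 < c" "c \<le> 1" "c < d" "c \<le> e" using d e by (auto simp: c_def)
  show ?thesis
  proof (rule that[OF c(1,2)])
    fix \<theta> b assume "dist \<alpha> \<theta> \<le> c" and b: "cmod b < 1"
    then have "dist (g \<theta>) (g \<alpha>) < e" using c by (intro d) (simp add: dist_commute)
    then have "cmod (g \<theta>) < cmod (g \<alpha>) + e" using norm_triangle_sub[of "g \<theta>" "g \<alpha>"] by (simp add: dist_norm)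
    then have "cmod (g \<theta>) < 1 - e" by (simp add: e_def field_simps)
    moreover have "cmod (b * g \<theta>) \<le> cmod (g \<theta>)" using b by (simp add: norm_mult mult_left_le_one_le)
    ultimately show "c < cmod (1 - b * g \<theta>)" using norm_triangle_ineq2[of 1 "b * g \<theta>"] c by simp
  qed
qed

lemma pow8_le: "0 < s \<Longrightarrow> s \<le> c \<Longrightarrow> c \<le> 1 \<Longrightarrow> s^8 \<le> (c::real)"
  using power_decreasing[of 1 8 s] by simp

text \<open>Near a point where |g| < 1 the modulus of 1 - b g has a lower bound uniform in b, so the
  small level sets are empty and K = 0 works.\<close>

lemma decay1_inside:
  assumes "continuous_on UNIV g" "cmod (g \<alpha>) < 1"
  shows "decay1 g \<alpha>"
proof -
  obtain c where c: "0 < c" "c \<le> 1" "\<And>\<theta> b. dist \<alpha> \<theta> \<le> c \<Longrightarrow> cmod b < 1 \<Longrightarrow> c < cmod (1 - b * g \<theta>)" by (rule inside_bound[OF assms]) blast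
  have em: "{\<theta> \<in> cball \<alpha> r. cmod (1 - b * g \<theta>) \<le> s^8} = {}" if "cmod b < 1" "0 < s" "s \<le> c" "r \<le> c" for b s r
  proof -
    have "s^8 < cmod (1 - b * g \<theta>)" if "\<theta> \<in> cball \<alpha> r" for \<theta>
    proof -
      have "dist \<alpha> \<theta> \<le> c" using that \<open>r \<le> c\<close> by simp
      from c(3)[OF this \<open>cmod b < 1\<close>] show ?thesis using pow8_le[OF \<open>0 < s\<close> \<open>s \<le> c\<close> c(2)] by linarith
    qed
    then show ?thesis by (auto simp: not_le[symmetric])
  qed
  show ?thesis unfolding decay1_def by (rule exI[of _ c], rule conjI[OF c(1)], rule exI[of _ 0]) (simp add: em c(2) del: mem_cball)
qed

lemma decay2_inside:
  assumes "continuous_on UNIV g" "cmod (g \<alpha>) < 1"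
  shows "decay2 g h \<alpha>"
proof -
  obtain c where c: "0 < c" "c \<le> 1" "\<And>\<theta> b. dist \<alpha> \<theta> \<le> c \<Longrightarrow> cmod b < 1 \<Longrightarrow> c < cmod (1 - b * g \<theta>)" by (rule inside_bound[OF assms]) blast
  have em: "{\<theta> \<in> cball \<alpha> r. cmod (1 - b * g \<theta>) \<le> s^8 \<and> cmod (1 - d * h \<theta>) \<le> t^8} = {}" if "cmod b < 1" "0 < s" "s \<le> c" "r \<le> c" for b s r d t
  proof -
    have "s^8 < cmod (1 - b * g \<theta>)" if "\<theta> \<in> cball \<alpha> r" for \<theta>
    proof -
      have "dist \<alpha> \<theta> \<le> c" using that \<open>r \<le> c\<close> by simp
      from c(3)[OF this \<open>cmod b < 1\<close>] show ?thesis using pow8_le[OF \<open>0 < s\<close> \<open>s \<le> c\<close> c(2)] by linarith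
    qed
    then show ?thesis by (auto simp: not_le[symmetric])
  qed
  show ?thesis unfolding decay2_def by (rule exI[of _ c], rule conjI[OF c(1)], rule exI[of _ 0]) (simp add: em c(2) del: mem_cball)
qed

text \<open>Moving from r w to w along the ray changes the distance to 1 by (1 - r) |w|, which is at
  most 1 - r |w| and hence at most |1 - r w|.\<close>

lemma cmod_one_minus_le:
  assumes "cmod w \<le> 1" "0 \<le> r" "r \<le> 1"
  shows "cmod (1 - w) \<le> 2 * cmod (1 - of_real r * w)"
proof -
  have "cmod (1 - w) = cmod ((1 - of_real r * w) - of_real (1 - r) * w)" by (simp add: algebra_simps)
  also have "\<dots> \<le> cmod (1 - of_real r * w) + cmod (of_real (1 - r) * w)" by (rule norm_triangle_ineq4)
  also have "cmod (of_real (1 - r) * w) = (1 - r) * cmod w" using assms by (simp add: norm_mult del: of_real_diff)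
  finally have "cmod (1 - w) \<le> cmod (1 - of_real r * w) + (1 - r) * cmod w" .
  moreover have "(1 - r) * cmod w \<le> 1 - r * cmod w"
    using assms by (simp add: algebra_simps)
  moreover have "1 - r * cmod w \<le> cmod (1 - of_real r * w)"
    using norm_triangle_ineq2[of 1 "of_real r * w"] assms by (simp add: norm_mult)
  ultimately show ?thesis by linarith
qed

text \<open>The argument of b and the boundary value u are collected in \<beta>, the modulus of b is
  removed at the price of a factor 2. Kernel parameters inside the disc are thus reduced to
  unimodular ones, for which the measure estimates hold.\<close>

lemma rotate_to_boundary:
  assumes g: "\<And>\<theta>. g \<theta> = u * \<psi> (\<theta> - \<alpha>)" "cmod u = 1" "\<And>\<theta>. cmod (\<psi> \<theta>) \<le> 1" and b: "cmod b < 1"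
  obtains \<beta> where "cmod \<beta> = 1" "\<And>\<theta> s. cmod (1 - b * g \<theta>) \<le> s \<Longrightarrow> cmod (1 - \<beta> * \<psi> (\<theta> - \<alpha>)) \<le> 2 * s"
proof -
  have bc: "b = of_real (cmod b) * cis (Arg b)" using rcis_cmod_Arg[of b] by (simp add: rcis_def)
  show ?thesis
  proof (rule that[of "cis (Arg b) * u"])
    fix \<theta> s assume le: "cmod (1 - b * g \<theta>) \<le> s"
    have "b * g \<theta> = of_real (cmod b) * (cis (Arg b) * u * \<psi> (\<theta> - \<alpha>))" by (subst bc) (simp add: g(1) mult_ac)
    moreover have "cmod (1 - cis (Arg b) * u * \<psi> (\<theta> - \<alpha>)) \<le> 2 * cmod (1 - of_real (cmod b) * (cis (Arg b) * u * \<psi> (\<theta> - \<alpha>)))"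
      using g b by (intro cmod_one_minus_le) (auto simp: norm_mult)
    ultimately show "cmod (1 - cis (Arg b) * u * \<psi> (\<theta> - \<alpha>)) \<le> 2 * s" using le by simp
  qed (simp add: norm_mult g)
qed

lemma sqrt_two_pow8_le: "0 < s \<Longrightarrow> sqrt (2 * s^8) \<le> 2 * s^4"
  by (rule real_le_lsqrt) (auto simp: power_mult_distrib power_mult[symmetric])

text \<open>At level 2 s^8 the exponent 3/2 gives at most 4 s^12, better than the s^10 asked
  for.\<close>

lemma decay1_boundary:
  assumes g: "\<And>\<theta>. g \<theta> = u * \<psi> (\<theta> - \<alpha>)" "cmod u = 1" "\<And>\<theta>. cmod (\<psi> \<theta>) \<le> 1" and c: "continuous_on UNIV \<psi>"
    and \<rho>: "0 < \<rho>" "\<rho> \<le> 1" "0 < K"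
    and m: "\<And>\<alpha> \<beta> \<delta> r. cmod \<beta> = 1 \<Longrightarrow> 0 < \<delta> \<Longrightarrow> \<delta> \<le> \<rho> \<Longrightarrow> r \<le> \<rho> \<Longrightarrow> measure lborel {\<theta>. \<theta> \<in> cball \<alpha> r \<and> cmod (1 - \<beta> * \<psi> (\<theta> - \<alpha>)) \<le> \<delta>} \<le> K * (\<delta> * sqrt \<delta>)"
  shows "decay1 g \<alpha>"
  unfolding decay1_def
proof (rule exI[of _ "\<rho> / 2"], intro conjI exI[of _ "4 * K"] allI impI)
  fix b s r assume b: "cmod b < 1" and s: "0 < s" "s \<le> \<rho> / 2" and r: "r \<le> \<rho> / 2"
  obtain \<beta> where \<beta>: "cmod \<beta> = 1" "\<And>\<theta> s. cmod (1 - b * g \<theta>) \<le> s \<Longrightarrow> cmod (1 - \<beta> * \<psi> (\<theta> - \<alpha>)) \<le> 2 * s"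
    by (rule rotate_to_boundary[where g=g and u=u and \<psi>=\<psi> and \<alpha>=\<alpha>, OF g b]) blast
  let ?S = "{\<theta>. \<theta> \<in> cball \<alpha> r \<and> cmod (1 - \<beta> * \<psi> (\<theta> - \<alpha>)) \<le> 2 * s^8}"
  have "closed {\<theta>. dist \<alpha> \<theta> \<le> r \<and> cmod (1 - \<beta> * \<psi> (\<theta> - \<alpha>)) \<le> 2 * s^8}"
    by (intro closed_Collect_conj closed_Collect_le continuous_intros continuous_on_compose2[OF c]) auto
  then have cl: "?S \<in> sets lborel" by simp
  have fin: "emeasure lborel ?S \<noteq> top" using emeasure_bounded_finite[OF bounded_subset[OF bounded_cball[of \<alpha> r]], of ?S] by force
  have "emeasure lborel {\<theta> \<in> cball \<alpha> r. cmod (1 - b * g \<theta>) \<le> s^8} \<le> emeasure lborel ?S" using \<beta>(2) by (intro emeasure_mono cl) auto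
  also have "\<dots> = ennreal (measure lborel ?S)" by (rule emeasure_eq_ennreal_measure[OF fin])
  also have "\<dots> \<le> ennreal (K * (2 * s^8 * sqrt (2 * s^8)))"
    using s r \<rho> pow8_le[of s "\<rho> / 2"] by (intro ennreal_leI m \<beta>) auto
  also have "\<dots> \<le> ennreal (4 * K * s^10)"
  proof (intro ennreal_leI)
    have "2 * s^8 * sqrt (2 * s^8) \<le> 2 * s^8 * (2 * s^4)" using s sqrt_two_pow8_le[of s] by (intro mult_left_mono) auto
    also have "\<dots> = 4 * (s^10 * s^2)" by (simp add: power_add[symmetric])
    also have "\<dots> \<le> 4 * s^10" using s \<rho> by (simp add: mult_left_le power_le_one)
    finally show "K * (2 * s^8 * sqrt (2 * s^8)) \<le> 4 * K * s^10" using \<rho>(3) by (simp add: mult.assoc mult.left_commute[of 4 K])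
  qed
  finally show "emeasure lborel {\<theta> \<in> cball \<alpha> r. cmod (1 - b * g \<theta>) \<le> s^8} \<le> ennreal (4 * K * s^10)" .
qed (use \<rho> in auto)

text \<open>The gain s^4 from the square root is shared: s^2 stays with s and s^2 \<le> t^2 goes to
  t. This is where the exponent 5/4 comes from.\<close>

lemma pow_split_le:
  fixes s t :: real assumes "0 < s" "s \<le> t"
  shows "s^8 * t^8 * s^4 \<le> s^10 * t^10"
proof -
  have "s^8 * t^8 * s^4 = s^10 * t^8 * s^2" by (simp add: power_add[symmetric] mult.commute mult.left_commute)
  also have "\<dots> \<le> s^10 * t^8 * t^2" using assms by (intro mult_left_mono power_mono) auto
  finally show ?thesis by (simp add: power_add[symmetric] mult.assoc)
qed

text \<open>Stated for ordered levels only, with the square root on the smaller one; the opposite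
  order is obtained from the condition with the two functions exchanged.\<close>

definition pair_decay :: "(real^3 \<Rightarrow> complex) \<Rightarrow> (real^3 \<Rightarrow> complex) \<Rightarrow> bool" where
  "pair_decay \<psi>1 \<psi>2 \<longleftrightarrow> (\<exists>\<rho>>0. \<exists>K>0. \<rho> \<le> 1 \<and> (\<forall>\<alpha> \<beta>1 \<beta>2 \<delta>1 \<delta>2 r. cmod \<beta>1 = 1 \<longrightarrow> cmod \<beta>2 = 1 \<longrightarrow> 0 < \<delta>1 \<longrightarrow> \<delta>1 \<le> \<delta>2 \<longrightarrow> \<delta>2 \<le> \<rho> \<longrightarrow> r \<le> \<rho> \<longrightarrow>
     measure lborel {\<theta>. \<theta> \<in> cball \<alpha> r \<and> cmod (1 - \<beta>1 * \<psi>1 (\<theta> - \<alpha>)) \<le> \<delta>1 \<and> cmod (1 - \<beta>2 * \<psi>2 (\<theta> - \<alpha>)) \<le> \<delta>2} \<le> K * (\<delta>1 * \<delta>2 * sqrt \<delta>1)))"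

lemma pair_decay_emeasure:
  assumes g: "\<And>\<theta>. g \<theta> = u * \<psi>1 (\<theta> - \<alpha>)" "cmod u = 1" "\<And>\<theta>. cmod (\<psi>1 \<theta>) \<le> 1" and c1: "continuous_on UNIV \<psi>1"
    and h: "\<And>\<theta>. h \<theta> = w * \<psi>2 (\<theta> - \<alpha>)" "cmod w = 1" "\<And>\<theta>. cmod (\<psi>2 \<theta>) \<le> 1" and c2: "continuous_on UNIV \<psi>2"
    and D: "pair_decay \<psi>1 \<psi>2"
  shows "\<exists>\<rho>>0. \<exists>K\<ge>0. \<rho> \<le> 1 \<and> (\<forall>b c s t r. cmod b < 1 \<longrightarrow> cmod c < 1 \<longrightarrow> 0 < s \<longrightarrow> s \<le> t \<longrightarrow> t \<le> \<rho> \<longrightarrow> r \<le> \<rho> \<longrightarrow>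
     emeasure lborel {\<theta> \<in> cball \<alpha> r. cmod (1 - b * g \<theta>) \<le> s^8 \<and> cmod (1 - c * h \<theta>) \<le> t^8} \<le> ennreal (K * (s^10 * t^10)))"
proof -
  obtain \<rho> K where \<rho>: "0 < \<rho>" "0 < K" "\<rho> \<le> 1" and m: "\<forall>\<alpha> \<beta>1 \<beta>2 \<delta>1 \<delta>2 r. cmod \<beta>1 = 1 \<longrightarrow> cmod \<beta>2 = 1 \<longrightarrow> 0 < \<delta>1 \<longrightarrow> \<delta>1 \<le> \<delta>2 \<longrightarrow> \<delta>2 \<le> \<rho> \<longrightarrow> r \<le> \<rho> \<longrightarrow>
     measure lborel {\<theta>. \<theta> \<in> cball \<alpha> r \<and> cmod (1 - \<beta>1 * \<psi>1 (\<theta> - \<alpha>)) \<le> \<delta>1 \<and> cmod (1 - \<beta>2 * \<psi>2 (\<theta> - \<alpha>)) \<le> \<delta>2} \<le> K * (\<delta>1 * \<delta>2 * sqrt \<delta>1)"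
    using D unfolding pair_decay_def by blast
  show ?thesis
  proof (rule exI[of _ "\<rho> / 2"], intro conjI exI[of _ "8 * K"] allI impI)
    fix b c s t r assume b: "cmod b < 1" and c: "cmod c < 1" and s: "0 < s" "s \<le> t" "t \<le> \<rho> / 2" and r: "r \<le> \<rho> / 2"
    obtain \<beta> where \<beta>: "cmod \<beta> = 1" "\<And>\<theta> s. cmod (1 - b * g \<theta>) \<le> s \<Longrightarrow> cmod (1 - \<beta> * \<psi>1 (\<theta> - \<alpha>)) \<le> 2 * s"
      by (rule rotate_to_boundary[where g=g and u=u and \<psi>=\<psi>1 and \<alpha>=\<alpha>, OF g b]) blast
    obtain \<gamma> where \<gamma>: "cmod \<gamma> = 1" "\<And>\<theta> s. cmod (1 - c * h \<theta>) \<le> s \<Longrightarrow> cmod (1 - \<gamma> * \<psi>2 (\<theta> - \<alpha>)) \<le> 2 * s"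
      by (rule rotate_to_boundary[where g=h and u=w and \<psi>=\<psi>2 and \<alpha>=\<alpha>, OF h c]) blast
    let ?S = "{\<theta>. \<theta> \<in> cball \<alpha> r \<and> cmod (1 - \<beta> * \<psi>1 (\<theta> - \<alpha>)) \<le> 2 * s^8 \<and> cmod (1 - \<gamma> * \<psi>2 (\<theta> - \<alpha>)) \<le> 2 * t^8}"
    have "closed {\<theta>. dist \<alpha> \<theta> \<le> r \<and> cmod (1 - \<beta> * \<psi>1 (\<theta> - \<alpha>)) \<le> 2 * s^8 \<and> cmod (1 - \<gamma> * \<psi>2 (\<theta> - \<alpha>)) \<le> 2 * t^8}"
      by (intro closed_Collect_conj closed_Collect_le continuous_intros continuous_on_compose2[OF c1] continuous_on_compose2[OF c2]) auto
    then have cl: "?S \<in> sets lborel" by simp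
    have fin: "emeasure lborel ?S \<noteq> top" using emeasure_bounded_finite[OF bounded_subset[OF bounded_cball[of \<alpha> r]], of ?S] by force
    have "emeasure lborel {\<theta> \<in> cball \<alpha> r. cmod (1 - b * g \<theta>) \<le> s^8 \<and> cmod (1 - c * h \<theta>) \<le> t^8} \<le> emeasure lborel ?S"
      using \<beta>(2) \<gamma>(2) by (intro emeasure_mono cl) auto
    also have "\<dots> = ennreal (measure lborel ?S)" by (rule emeasure_eq_ennreal_measure[OF fin])
    also have "\<dots> \<le> ennreal (K * (2 * s^8 * (2 * t^8) * sqrt (2 * s^8)))"
      using s r \<rho> pow8_le[of t "\<rho> / 2"] power_mono[of s t 8] by (intro ennreal_leI m[rule_format] \<beta> \<gamma>) auto
    also have "\<dots> \<le> ennreal (8 * K * (s^10 * t^10))"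
    proof (intro ennreal_leI)
      have "2 * s^8 * (2 * t^8) * sqrt (2 * s^8) \<le> 2 * s^8 * (2 * t^8) * (2 * s^4)" using s sqrt_two_pow8_le[of s] by (intro mult_left_mono) auto
      also have "\<dots> = 8 * (s^8 * t^8 * s^4)" by simp
      also have "\<dots> \<le> 8 * (s^10 * t^10)" using pow_split_le[OF s(1,2)] by simp
      finally show "K * (2 * s^8 * (2 * t^8) * sqrt (2 * s^8)) \<le> 8 * K * (s^10 * t^10)"
        using \<rho>(2) mult_left_mono[of _ "8 * (s^10 * t^10)" K] by (simp add: mult.assoc mult.left_commute[of 8 K])
    qed
    finally show "emeasure lborel {\<theta> \<in> cball \<alpha> r. cmod (1 - b * g \<theta>) \<le> s^8 \<and> cmod (1 - c * h \<theta>) \<le> t^8} \<le> ennreal (8 * K * (s^10 * t^10))" .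
  qed (use \<rho> in auto)
qed

lemma decay2_boundary:
  assumes g: "\<And>\<theta>. g \<theta> = u * \<psi>1 (\<theta> - \<alpha>)" "cmod u = 1" "\<And>\<theta>. cmod (\<psi>1 \<theta>) \<le> 1" and c1: "continuous_on UNIV \<psi>1"
    and h: "\<And>\<theta>. h \<theta> = w * \<psi>2 (\<theta> - \<alpha>)" "cmod w = 1" "\<And>\<theta>. cmod (\<psi>2 \<theta>) \<le> 1" and c2: "continuous_on UNIV \<psi>2"
    and D: "pair_decay \<psi>1 \<psi>2" "pair_decay \<psi>2 \<psi>1"
  shows "decay2 g h \<alpha>"
proof -
  obtain \<rho>1 K1 where 1: "0 < \<rho>1" "0 \<le> K1" "\<rho>1 \<le> 1" "\<forall>b c s t r. cmod b < 1 \<longrightarrow> cmod c < 1 \<longrightarrow> 0 < s \<longrightarrow> s \<le> t \<longrightarrow> t \<le> \<rho>1 \<longrightarrow> r \<le> \<rho>1 \<longrightarrow>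
     emeasure lborel {\<theta> \<in> cball \<alpha> r. cmod (1 - b * g \<theta>) \<le> s^8 \<and> cmod (1 - c * h \<theta>) \<le> t^8} \<le> ennreal (K1 * (s^10 * t^10))"
    using pair_decay_emeasure[where g=g and u=u and ?\<psi>1.0=\<psi>1 and h=h and w=w and ?\<psi>2.0=\<psi>2 and \<alpha>=\<alpha>, OF g c1 h c2 D(1)] by blast
  obtain \<rho>2 K2 where 2: "0 < \<rho>2" "0 \<le> K2" "\<rho>2 \<le> 1" "\<forall>b c s t r. cmod b < 1 \<longrightarrow> cmod c < 1 \<longrightarrow> 0 < s \<longrightarrow> s \<le> t \<longrightarrow> t \<le> \<rho>2 \<longrightarrow> r \<le> \<rho>2 \<longrightarrow>
     emeasure lborel {\<theta> \<in> cball \<alpha> r. cmod (1 - b * h \<theta>) \<le> s^8 \<and> cmod (1 - c * g \<theta>) \<le> t^8} \<le> ennreal (K2 * (s^10 * t^10))"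
    using pair_decay_emeasure[where g=h and u=w and ?\<psi>1.0=\<psi>2 and h=g and w=u and ?\<psi>2.0=\<psi>1 and \<alpha>=\<alpha>, OF h c2 g c1 D(2)] by blast
  have em: "emeasure lborel {\<theta> \<in> cball \<alpha> r. cmod (1 - b * g \<theta>) \<le> s^8 \<and> cmod (1 - c * h \<theta>) \<le> t^8} \<le> ennreal ((K1 + K2) * (s^10 * t^10))"
    if a: "cmod b < 1" "cmod c < 1" "0 < s" "s \<le> min \<rho>1 \<rho>2" "0 < t" "t \<le> min \<rho>1 \<rho>2" "r \<le> min \<rho>1 \<rho>2" for b c s t r
  proof (cases "s \<le> t")
    case True
    then have "emeasure lborel {\<theta> \<in> cball \<alpha> r. cmod (1 - b * g \<theta>) \<le> s^8 \<and> cmod (1 - c * h \<theta>) \<le> t^8} \<le> ennreal (K1 * (s^10 * t^10))"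
      using a by (intro 1(4)[rule_format]) auto
    also have "\<dots> \<le> ennreal ((K1 + K2) * (s^10 * t^10))" using 2(2) a by (intro ennreal_leI mult_right_mono) auto
    finally show ?thesis .
  next
    case False
    then have "emeasure lborel {\<theta> \<in> cball \<alpha> r. cmod (1 - c * h \<theta>) \<le> t^8 \<and> cmod (1 - b * g \<theta>) \<le> s^8} \<le> ennreal (K2 * (t^10 * s^10))"
      using a by (intro 2(4)[rule_format]) auto
    also have "\<dots> \<le> ennreal ((K1 + K2) * (t^10 * s^10))" using 1(2) a by (intro ennreal_leI mult_right_mono) auto
    finally show ?thesis by (simp add: conj_commute mult.commute)
  qed
  show ?thesis unfolding decay2_def by (rule exI[of _ "min \<rho>1 \<rho>2"], rule conjI, use 1(1) 2(1) in simp, rule exI[of _ "K1 + K2"]) (use 1(1-3) 2(1-3) em in auto)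
qed

section \<open>Uniform bounds for the kernels in the exponent 9/8\<close>

lemma root8_le_iff: "0 \<le> x \<Longrightarrow> 0 < s \<Longrightarrow> root 8 x \<le> s \<longleftrightarrow> x \<le> s^8"
  using real_root_le_iff[of 8 x "s^8"] real_root_power_cancel[of 8 s] by simp

lemma borel_measurable_root_cmod:
  assumes "continuous_on UNIV (g :: real^3 \<Rightarrow> complex)"
  shows "(\<lambda>\<theta>. root 8 (cmod (g \<theta>))) \<in> borel_measurable borel"
  by (intro borel_measurable_continuous_onI continuous_intros assms)

text \<open>The coordinate k stays inside the disc and contributes a bounded factor. The other two
  factors are handled by the dyadic estimate for the eighth roots of their moduli, whose level sets
  are those in \<open>decay1\<close> and \<open>decay2\<close>.\<close>

lemma local_kernel_bound:
  fixes \<Phi> :: "real^3 \<Rightarrow> complex^3"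
  assumes c: "continuous_on UNIV \<Phi>" and le: "\<And>\<theta> l. cmod (\<Phi> \<theta> $ l) \<le> 1" and d: "distinct [i, j, k]" and inside: "cmod (\<Phi> \<alpha> $ k) < 1"
    and D1: "decay1 (\<lambda>\<theta>. \<Phi> \<theta> $ i) \<alpha>" "decay1 (\<lambda>\<theta>. \<Phi> \<theta> $ j) \<alpha>" and D2: "decay2 (\<lambda>\<theta>. \<Phi> \<theta> $ i) (\<lambda>\<theta>. \<Phi> \<theta> $ j) \<alpha>"
  shows "\<exists>\<rho> C. 0 < \<rho> \<and> 0 \<le> C \<and> (\<forall>b\<in>poly_D. (\<integral>\<^sup>+\<theta>. ennreal (root 8 (cmod (szego b (\<Phi> \<theta>)))^9) * indicator (cball \<alpha> \<rho>) \<theta> \<partial>lborel) \<le> ennreal C)"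
proof -
  have cl: "continuous_on UNIV (\<lambda>\<theta>. \<Phi> \<theta> $ l)" for l by (intro continuous_intros c)
  obtain \<rho>1 K1 where 1: "0 < \<rho>1" "0 \<le> K1" "\<rho>1 \<le> 1" "\<forall>b s r. cmod b < 1 \<longrightarrow> 0 < s \<longrightarrow> s \<le> \<rho>1 \<longrightarrow> r \<le> \<rho>1 \<longrightarrow>
     emeasure lborel {\<theta> \<in> cball \<alpha> r. cmod (1 - b * \<Phi> \<theta> $ i) \<le> s^8} \<le> ennreal (K1 * s^10)" using D1(1) unfolding decay1_def by blast
  obtain \<rho>2 K2 where 2: "0 < \<rho>2" "0 \<le> K2" "\<rho>2 \<le> 1" "\<forall>b s r. cmod b < 1 \<longrightarrow> 0 < s \<longrightarrow> s \<le> \<rho>2 \<longrightarrow> r \<le> \<rho>2 \<longrightarrow>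
     emeasure lborel {\<theta> \<in> cball \<alpha> r. cmod (1 - b * \<Phi> \<theta> $ j) \<le> s^8} \<le> ennreal (K2 * s^10)" using D1(2) unfolding decay1_def by blast
  obtain \<rho>3 K3 where 3: "0 < \<rho>3" "0 \<le> K3" "\<rho>3 \<le> 1" "\<forall>b c s t r. cmod b < 1 \<longrightarrow> cmod c < 1 \<longrightarrow> 0 < s \<longrightarrow> s \<le> \<rho>3 \<longrightarrow> 0 < t \<longrightarrow> t \<le> \<rho>3 \<longrightarrow> r \<le> \<rho>3 \<longrightarrow>
     emeasure lborel {\<theta> \<in> cball \<alpha> r. cmod (1 - b * \<Phi> \<theta> $ i) \<le> s^8 \<and> cmod (1 - c * \<Phi> \<theta> $ j) \<le> t^8} \<le> ennreal (K3 * (s^10 * t^10))"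
    using D2 unfolding decay2_def by blast
  obtain e where e: "0 < e" "e \<le> 1" "\<And>\<theta> b. dist \<alpha> \<theta> \<le> e \<Longrightarrow> cmod b < 1 \<Longrightarrow> e < cmod (1 - b * \<Phi> \<theta> $ k)"
    by (rule inside_bound[OF cl inside]) blast
  define \<rho> where "\<rho> = min (min \<rho>1 \<rho>2) (min \<rho>3 e)"
  have \<rho>: "0 < \<rho>" "\<rho> \<le> 1" "\<rho> \<le> \<rho>1" "\<rho> \<le> \<rho>2" "\<rho> \<le> \<rho>3" "\<rho> \<le> e" using 1 2 3 e by (auto simp: \<rho>_def)
  \<comment> \<open>The measure of the ball is included for the levels at which neither factor is
    small.\<close>
  define K where "K = K1 + K2 + K3 + measure lborel (cball \<alpha> \<rho>)"
  have K: "0 \<le> K" "K1 \<le> K" "K2 \<le> K" "K3 \<le> K" "measure lborel (cball \<alpha> \<rho>) \<le> K"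
    using 1(2) 2(2) 3(2) measure_nonneg[of lborel "cball \<alpha> \<rho>"] unfolding K_def by linarith+
  define C where "C = inverse (root 8 e)^9 * (K * (2^10 * inverse \<rho>^9)\<^sup>2 * 4)"
  have C: "0 \<le> C" using K \<rho> e by (simp add: C_def)
  have "(\<integral>\<^sup>+\<theta>. ennreal (root 8 (cmod (szego b (\<Phi> \<theta>)))^9) * indicator (cball \<alpha> \<rho>) \<theta> \<partial>lborel) \<le> ennreal C" if b: "b \<in> poly_D" for b
  proof -
    define v where "v = (\<lambda>l \<theta>. root 8 (cmod (1 - b$l * \<Phi> \<theta> $ l)))"
    have bl: "cmod (b$l) < 1" for l by (rule poly_D_nth[OF b])
    have vm: "v l \<in> borel_measurable borel" for l
      unfolding v_def by (intro borel_measurable_root_cmod continuous_intros cl)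
    have vp: "0 < v l \<theta>" for l \<theta>
      using mult_neq_1_of_norm[OF le bl, of \<theta> l l] by (auto simp: v_def mult.commute)
    have vle: "v l \<theta> \<le> s \<longleftrightarrow> cmod (1 - b$l * \<Phi> \<theta> $ l) \<le> s^8" if "0 < s" for l \<theta> s
      unfolding v_def by (rule root8_le_iff[OF norm_ge_zero that])
    have fin: "emeasure lborel (cball \<alpha> \<rho>) \<noteq> top" using emeasure_bounded_finite[OF bounded_cball[of \<alpha> \<rho>]] by simp
    have int: "(\<integral>\<^sup>+x. ennreal (inverse (v i x)^9 * inverse (v j x)^9) * indicator (cball \<alpha> \<rho>) x \<partial>lborel) \<le> ennreal (K * (2^10 * inverse \<rho>^9)\<^sup>2 * 4)"
    proof (rule dyadic_integral_bound[OF vm vm vp vp _ \<rho>(1,2) K(1)])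
      show "cball \<alpha> \<rho> \<in> sets borel" by simp
      show "emeasure lborel (cball \<alpha> \<rho>) \<le> ennreal K"
        unfolding emeasure_eq_ennreal_measure[OF fin] by (rule ennreal_leI[OF K(5)])
      fix s assume s: "0 < s" "s \<le> \<rho>"
      have "emeasure lborel {x \<in> cball \<alpha> \<rho>. v i x \<le> s} \<le> ennreal (K1 * s^10)"
        unfolding vle[OF s(1)] using s \<rho> bl by (intro 1(4)[rule_format]) auto
      also have "\<dots> \<le> ennreal (K * s^10)" using s K by (intro ennreal_leI mult_right_mono) auto
      finally show "emeasure lborel {x \<in> cball \<alpha> \<rho>. v i x \<le> s} \<le> ennreal (K * s^10)" .
      have "emeasure lborel {x \<in> cball \<alpha> \<rho>. v j x \<le> s} \<le> ennreal (K2 * s^10)"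
        unfolding vle[OF s(1)] using s \<rho> bl by (intro 2(4)[rule_format]) auto
      also have "\<dots> \<le> ennreal (K * s^10)" using s K by (intro ennreal_leI mult_right_mono) auto
      finally show "emeasure lborel {x \<in> cball \<alpha> \<rho>. v j x \<le> s} \<le> ennreal (K * s^10)" .
      fix t assume t: "0 < t" "t \<le> \<rho>"
      have "emeasure lborel {x \<in> cball \<alpha> \<rho>. v i x \<le> s \<and> v j x \<le> t} \<le> ennreal (K3 * (s^10 * t^10))"
        unfolding vle[OF s(1)] vle[OF t(1)] using s t \<rho> bl by (intro 3(4)[rule_format]) auto
      also have "\<dots> \<le> ennreal (K * (s^10 * t^10))" using s t K by (intro ennreal_leI mult_right_mono) auto
      finally show "emeasure lborel {x \<in> cball \<alpha> \<rho>. v i x \<le> s \<and> v j x \<le> t} \<le> ennreal (K * (s^10 * t^10))" .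
    qed
    have sz: "root 8 (cmod (szego b (\<Phi> \<theta>)))^9 = inverse (v k \<theta>)^9 * (inverse (v i \<theta>)^9 * inverse (v j \<theta>)^9)" for \<theta>
      by (simp add: szego_vec[OF d] norm_mult norm_inverse real_root_mult real_root_inverse power_mult_distrib v_def mult_ac)
    have "(\<integral>\<^sup>+\<theta>. ennreal (root 8 (cmod (szego b (\<Phi> \<theta>)))^9) * indicator (cball \<alpha> \<rho>) \<theta> \<partial>lborel) \<le>
       (\<integral>\<^sup>+\<theta>. ennreal (inverse (root 8 e)^9) * (ennreal (inverse (v i \<theta>)^9 * inverse (v j \<theta>)^9) * indicator (cball \<alpha> \<rho>) \<theta>) \<partial>lborel)"
    proof (intro nn_integral_mono)
      fix \<theta>
      show "ennreal (root 8 (cmod (szego b (\<Phi> \<theta>)))^9) * indicator (cball \<alpha> \<rho>) \<theta> \<le> ennreal (inverse (root 8 e)^9) * (ennreal (inverse (v i \<theta>)^9 * inverse (v j \<theta>)^9) * indicator (cball \<alpha> \<rho>) \<theta>)"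
      proof (cases "\<theta> \<in> cball \<alpha> \<rho>")
        case True
        then have "e < cmod (1 - b$k * \<Phi> \<theta> $ k)" using \<rho> bl by (intro e) auto
        then have "root 8 e \<le> v k \<theta>" unfolding v_def by (simp add: real_root_le_iff)
        then have "inverse (v k \<theta>)^9 \<le> inverse (root 8 e)^9" using e(1) vp[of k \<theta>] by (intro power_mono le_imp_inverse_le) auto
        then have "inverse (v k \<theta>)^9 * (inverse (v i \<theta>)^9 * inverse (v j \<theta>)^9) \<le> inverse (root 8 e)^9 * (inverse (v i \<theta>)^9 * inverse (v j \<theta>)^9)"
          using vp by (intro mult_right_mono) (auto simp: less_imp_le)
        then show ?thesis unfolding sz using True e(1) by (simp add: ennreal_mult'[symmetric] ennreal_leI)
      qed simp
    qed
    also have "\<dots> = ennreal (inverse (root 8 e)^9) * (\<integral>\<^sup>+\<theta>. ennreal (inverse (v i \<theta>)^9 * inverse (v j \<theta>)^9) * indicator (cball \<alpha> \<rho>) \<theta> \<partial>lborel)"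
    proof (rule nn_integral_cmult)
      show "(\<lambda>\<theta>. ennreal (inverse (v i \<theta>)^9 * inverse (v j \<theta>)^9) * indicator (cball \<alpha> \<rho>) \<theta>) \<in> borel_measurable lborel"
        using vm by (intro borel_measurable_times_ennreal borel_measurable_indicator measurable_compose[OF _ measurable_ennreal] borel_measurable_times borel_measurable_power borel_measurable_inverse) auto
    qed
    also have "\<dots> \<le> ennreal (inverse (root 8 e)^9) * ennreal (K * (2^10 * inverse \<rho>^9)\<^sup>2 * 4)" by (intro mult_left_mono int) simp
    also have "\<dots> = ennreal C" unfolding C_def using e(1) by (intro ennreal_mult'[symmetric]) simp
    finally show ?thesis .
  qed
  then show ?thesis using \<rho>(1) C by blast
qed

lemma continuous_cmod_szego:
  assumes "continuous_on UNIV \<Phi>" "\<And>y. \<Phi> y \<in> poly_cD" "b \<in> poly_D"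
  shows "continuous_on A (\<lambda>y. cmod (szego b (\<Phi> y)))"
proof (intro continuous_intros continuous_on_subset[OF assms(1) subset_UNIV])
  show "b $ k * \<Phi> y $ k \<noteq> 1" for y k
    using poly_D_nth[OF assms(3), of k] poly_cD_nth[OF assms(2)[of y], of k] mult_neq_1_of_norm[of "\<Phi> y $ k" "b $ k"] by (auto simp: mult.commute)
qed

text \<open>Finitely many of the local balls cover the compact cube, and neither the balls nor the
  constants depend on b.\<close>

lemma global_kernel_bound:
  fixes \<Phi> :: "real^3 \<Rightarrow> complex^3"
  assumes c: "continuous_on UNIV \<Phi>" "\<And>y. \<Phi> y \<in> poly_cD"
    and L: "\<And>\<alpha>. \<exists>\<rho> C. 0 < \<rho> \<and> 0 \<le> C \<and> (\<forall>b\<in>poly_D. (\<integral>\<^sup>+\<theta>. ennreal (root 8 (cmod (szego b (\<Phi> \<theta>)))^9) * indicator (cball \<alpha> \<rho>) \<theta> \<partial>lborel) \<le> ennreal C)"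
  obtains M where "0 \<le> M" "\<And>b. b \<in> poly_D \<Longrightarrow> integral cube (\<lambda>y. root 8 (cmod (szego b (\<Phi> y)))^9) \<le> M"
proof -
  define P where "P = (\<lambda>\<alpha> \<rho> C. 0 < \<rho> \<and> 0 \<le> C \<and> (\<forall>b\<in>poly_D. (\<integral>\<^sup>+\<theta>. ennreal (root 8 (cmod (szego b (\<Phi> \<theta>)))^9) * indicator (cball \<alpha> \<rho>) \<theta> \<partial>lborel) \<le> ennreal C))"
  have "\<forall>\<alpha>. \<exists>\<rho> C. P \<alpha> \<rho> C" unfolding P_def by (intro allI L)
  then obtain \<rho> C where "\<forall>\<alpha>. P \<alpha> (\<rho> \<alpha>) (C \<alpha>)" by metis
  then have C: "\<forall>\<alpha>. 0 < \<rho> \<alpha> \<and> 0 \<le> C \<alpha> \<and> (\<forall>b\<in>poly_D. (\<integral>\<^sup>+\<theta>. ennreal (root 8 (cmod (szego b (\<Phi> \<theta>)))^9) * indicator (cball \<alpha> (\<rho> \<alpha>)) \<theta> \<partial>lborel) \<le> ennreal (C \<alpha>))"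
    unfolding P_def .
  have cover: "cube \<subseteq> (\<Union>\<alpha>\<in>UNIV. ball \<alpha> (\<rho> \<alpha>))"
  proof
    fix x assume "x \<in> cube"
    have "x \<in> ball x (\<rho> x)" using C[rule_format, of x] by simp
    then show "x \<in> (\<Union>\<alpha>\<in>UNIV. ball \<alpha> (\<rho> \<alpha>))" by blast
  qed
  obtain T where "T \<subseteq> UNIV" and T: "finite T" "cube \<subseteq> (\<Union>\<alpha>\<in>T. ball \<alpha> (\<rho> \<alpha>))"
    by (rule compactE_image[where S=cube and C=UNIV and f="\<lambda>\<alpha>. ball \<alpha> (\<rho> \<alpha>)", OF compact_cbox open_ball cover]) blast
  show ?thesis
  proof (rule that[of "\<Sum>\<alpha>\<in>T. C \<alpha>"])
    show sC: "0 \<le> (\<Sum>\<alpha>\<in>T. C \<alpha>)" using C by (intro sum_nonneg) auto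
    fix b :: "complex^3" assume b: "b \<in> poly_D"
    let ?f = "\<lambda>y. root 8 (cmod (szego b (\<Phi> y)))^9"
    have cf: "continuous_on A ?f" for A by (rule continuous_on_power[OF continuous_on_real_root[OF continuous_cmod_szego[OF c b]]])
    have mf: "?f \<in> borel_measurable borel" by (rule borel_measurable_continuous_onI[OF cf])
    have "ennreal (integral cube ?f) = (\<integral>\<^sup>+y. ennreal (?f y) * indicator cube y \<partial>lborel)"
      by (rule nn_integral_has_integral_lebesgue'[symmetric]) (auto intro!: integrable_integral integrable_continuous cf)
    also have "\<dots> \<le> (\<integral>\<^sup>+y. (\<Sum>\<alpha>\<in>T. ennreal (?f y) * indicator (cball \<alpha> (\<rho> \<alpha>)) y) \<partial>lborel)"
    proof (intro nn_integral_mono)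
      fix y
      show "ennreal (?f y) * indicator cube y \<le> (\<Sum>\<alpha>\<in>T. ennreal (?f y) * indicator (cball \<alpha> (\<rho> \<alpha>)) y)"
      proof (cases "y \<in> cube")
        case True
        then obtain \<alpha> where \<alpha>: "\<alpha> \<in> T" "y \<in> ball \<alpha> (\<rho> \<alpha>)" using T by blast
        have "ennreal (?f y) * indicator cube y = ennreal (?f y) * indicator (cball \<alpha> (\<rho> \<alpha>)) y" using True \<alpha> by (simp add: less_imp_le)
        also have "\<dots> \<le> (\<Sum>\<alpha>\<in>T. ennreal (?f y) * indicator (cball \<alpha> (\<rho> \<alpha>)) y)"
          by (rule member_le_sum[OF \<alpha>(1) _ T(1), of "\<lambda>\<alpha>. ennreal (?f y) * indicator (cball \<alpha> (\<rho> \<alpha>)) y"]) simp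
        finally show ?thesis .
      qed simp
    qed
    also have "\<dots> = (\<Sum>\<alpha>\<in>T. \<integral>\<^sup>+y. ennreal (?f y) * indicator (cball \<alpha> (\<rho> \<alpha>)) y \<partial>lborel)"
    proof (intro nn_integral_sum)
      show "(\<lambda>y. ennreal (?f y) * indicator (cball \<alpha> (\<rho> \<alpha>)) y) \<in> borel_measurable lborel" for \<alpha>
        using mf by (intro borel_measurable_times_ennreal borel_measurable_indicator measurable_compose[OF _ measurable_ennreal]) auto
    qed
    also have "\<dots> \<le> (\<Sum>\<alpha>\<in>T. ennreal (C \<alpha>))" using C b by (intro sum_mono) auto
    also have "\<dots> = ennreal (\<Sum>\<alpha>\<in>T. C \<alpha>)" using C by (intro sum_ennreal) auto
    finally show "integral cube ?f \<le> (\<Sum>\<alpha>\<in>T. C \<alpha>)" using ennreal_le_iff[OF sC, of "integral cube ?f"] by blast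
  qed
qed

section \<open>Cutoffs near the boundary\<close>

lemma cmod_one_minus_cis_le: "cmod (1 - cis \<tau>) \<le> \<bar>\<tau>\<bar>"
proof -
  have "(cmod (1 - cis \<tau>))\<^sup>2 = (1 - cos \<tau>)\<^sup>2 + (sin \<tau>)\<^sup>2" by (simp add: cmod_power2)
  also have "\<dots> = 2 - 2 * cos (2 * (\<tau> / 2))" using sin_cos_squared_add[of \<tau>] by (simp add: power2_eq_square algebra_simps)
  also have "\<dots> = 4 * (sin (\<tau> / 2))\<^sup>2" by (subst cos_double_sin) simp
  also have "\<dots> \<le> 4 * (\<tau> / 2)\<^sup>2" using abs_sin_x_le_abs_x[of "\<tau> / 2"] by (simp only: abs_le_square_iff)
  also have "\<dots> = \<bar>\<tau>\<bar>\<^sup>2" by (simp add: power2_eq_square)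
  finally show ?thesis by (rule power2_le_imp_le) simp
qed

text \<open>N equally spaced parameters of modulus 1 - 1/N suffice to detect every w in the outer
  annulus. The radial error is at most 3/N, the angular error is less than 2 pi / N and so at most
  8/N; together 11/N.\<close>

lemma near_arc:
  fixes w :: complex and N :: nat
  assumes N: "2 \<le> N" and w: "cmod w \<le> 1" "1 - 2 / real N < cmod w"
  obtains k where "k < N" "cmod (1 - complex_of_real (1 - 1 / real N) * cis (- (2 * pi * real k / real N)) * w) \<le> 11 / real N"
proof -
  define \<theta> where "\<theta> = Arg2pi w"
  have \<theta>: "0 \<le> \<theta>" "\<theta> < 2 * pi" and wp: "w = of_real (cmod w) * cis \<theta>"
    using Arg2pi[of w] unfolding \<theta>_def is_Arg_def cis_conv_exp by auto
  define n where "n = real N"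
  have n: "2 \<le> n" using N by (simp add: n_def)
  define x where "x = n * \<theta> / (2 * pi)"
  define k where "k = nat \<lfloor>x\<rfloor>"
  have x: "0 \<le> x" "x < n" using \<theta> n by (auto simp: x_def field_simps)
  have kx: "real k \<le> x" "x < real k + 1" using x(1) by (auto simp: k_def)
  have kN: "k < N" using kx(1) x(2) unfolding n_def by linarith
  define \<tau> where "\<tau> = \<theta> - 2 * pi * real k / n"
  have te: "\<tau> = 2 * pi * (x - real k) / n" using n by (simp add: \<tau>_def x_def field_simps)
  have A: "0 \<le> 2 * pi * (x - real k)" "2 * pi * (x - real k) \<le> 2 * pi * 1" using kx by (auto intro!: mult_left_mono)
  have "0 \<le> \<tau>" unfolding te using A(1) n by (intro divide_nonneg_nonneg) auto
  moreover have "2 * pi * (x - real k) \<le> 8" using A(2) pi_less_4 by linarith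
  then have "\<tau> \<le> 8 / n" unfolding te using n by (intro divide_right_mono) auto
  ultimately have \<tau>: "0 \<le> \<tau>" "\<tau> \<le> 8 / n" by auto
  define r where "r = (1 - 1 / n) * cmod w"
  have "(1 - 1 / n) * (1 - 2 / n) \<le> r" unfolding r_def using n w by (intro mult_left_mono) (auto simp: n_def)
  moreover have "(1 - 1 / n) * (1 - 2 / n) = 1 - 3 / n + 2 / n\<^sup>2" using n by (simp add: field_simps power2_eq_square)
  moreover have "0 \<le> 2 / n\<^sup>2" by simp
  ultimately have r: "1 - 3 / n \<le> r" by linarith
  have r1: "0 \<le> r" "r \<le> 1" using n w unfolding r_def by (auto intro!: mult_le_one)
  have ct: "cis \<tau> = cis \<theta> * cis (- (2 * pi * real k / n))" by (simp add: cis_mult \<tau>_def)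
  have "complex_of_real (1 - 1 / n) * cis (- (2 * pi * real k / n)) * w = of_real r * cis \<tau>"
    by (subst wp) (simp only: r_def ct of_real_mult mult_ac)
  moreover have "cmod (1 - of_real r * cis \<tau>) \<le> 11 / n"
  proof -
    have "1 - of_real r * cis \<tau> = of_real (1 - r) + of_real r * (1 - cis \<tau>)" by (simp add: algebra_simps)
    then have "cmod (1 - of_real r * cis \<tau>) \<le> cmod (of_real (1 - r)) + cmod (of_real r * (1 - cis \<tau>))" by (metis norm_triangle_ineq)
    also have "cmod (of_real (1 - r)) = 1 - r" using r1 by (simp only: norm_of_real)
    also have "cmod (of_real r * (1 - cis \<tau>)) = r * cmod (1 - cis \<tau>)" using r1 by (simp add: norm_mult)
    also have "r * cmod (1 - cis \<tau>) \<le> 1 * \<tau>" using r1 \<tau> cmod_one_minus_cis_le[of \<tau>] by (intro mult_mono) auto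
    finally show ?thesis using r \<tau> by linarith
  qed
  ultimately show ?thesis using that[OF kN] by (simp add: n_def)
qed

lemma szego_axis: "szego (axis j a) z = inverse (1 - a * z$j)"
proof -
  have "szego (axis j a) z = inverse (1 - axis j a $ j * z$j) * (\<Prod>k\<in>UNIV - {j}. inverse (1 - axis j a $ k * z$k))"
    unfolding szego_def by (rule prod.remove) auto
  also have "(\<Prod>k\<in>UNIV - {j}. inverse (1 - axis j a $ k * z$k)) = 1" by (intro prod.neutral) (auto simp: axis_def)
  finally show ?thesis by (simp add: axis_def)
qed

text \<open>The bound in the exponent 9/8 is used twice. Tested on one-variable kernels at the
  parameters of \<open>near_arc\<close>, it shows that \<omega> has small integral. Applied to an
  arbitrary kernel it gives uniform integrability: the kernel is cut at height L^8, below which the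
  small integral of \<omega> suffices and above which one spare power of the eighth root yields the
  factor 1/L.\<close>

lemma exists_cutoff:
  fixes \<Phi> :: "real^3 \<Rightarrow> complex^3"
  assumes c: "continuous_on UNIV \<Phi>" "\<And>y. \<Phi> y \<in> poly_cD"
    and M: "0 \<le> M" "\<And>b. b \<in> poly_D \<Longrightarrow> integral cube (\<lambda>y. root 8 (cmod (szego b (\<Phi> y)))^9) \<le> M" and \<eta>: "0 < \<eta>"
  shows "\<exists>\<epsilon> \<omega>. 0 < \<epsilon> \<and> \<epsilon> < (1::real) \<and> continuous_on UNIV \<omega> \<and> (\<forall>y. 0 \<le> \<omega> y \<and> \<omega> y \<le> (1::real)) \<and>
     (\<forall>y j. 1 - \<epsilon> \<le> cmod (\<Phi> y $ j) \<longrightarrow> \<omega> y = 1) \<and> (\<forall>b\<in>poly_D. integral cube (\<lambda>y. \<omega> y * cmod (szego b (\<Phi> y))) \<le> \<eta>)"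
proof -
  define L where "L = 2 * M / \<eta> + 1"
  have L: "1 \<le> L" using M \<eta> by (simp add: L_def)
  have "\<eta> / 2 * L = M + \<eta> / 2" using \<eta> by (simp add: L_def field_simps)
  then have ratio: "M / L \<le> \<eta> / 2" using L \<eta> by (simp add: divide_le_eq)
  \<comment> \<open>66 is twice the constant 33 = 3 * 11 from three coordinates and 11 m^8
    parameters, so the truncated part stays below \<eta>/2.\<close>
  obtain m0 :: nat where m0: "66 * L^8 * M / \<eta> \<le> real m0" using real_arch_simple by blast
  define m where "m = m0 + 1"
  have m: "1 \<le> real m" by (simp add: m_def)
  have "66 * L^8 * M / \<eta> \<le> real m" using m0 by (simp add: m_def)
  then have mL: "L^8 * (33 * M / real m) \<le> \<eta> / 2" using \<eta> m by (simp add: field_simps)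
  define N where "N = 11 * m^8"
  define n where "n = real N"
  have nm: "n = 11 * real m^8" by (simp add: n_def N_def)
  have "11 * 1 \<le> n" unfolding nm using m by (intro mult_left_mono one_le_power) auto
  then have n: "11 \<le> n" by simp
  have N2: "2 \<le> N" using n by (simp add: n_def)
  \<comment> \<open>Each ramp vanishes up to modulus 1 - 2/n and reaches 1 at modulus 1 -
    1/n.\<close>
  define \<omega> where "\<omega> = (\<lambda>y. min 1 (\<Sum>j\<in>UNIV. max 0 (n * cmod (\<Phi> y $ j) - n + 2)))"
  define a where "a = (\<lambda>k::nat. complex_of_real (1 - 1 / n) * cis (- (2 * pi * real k / n)))"
  define u where "u = (\<lambda>j k y. root 8 (cmod (szego (axis j (a k)) (\<Phi> y)))^9)"
  have c': "continuous_on A \<Phi>" for A by (rule continuous_on_subset[OF c(1) subset_UNIV])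
  have c\<omega>: "continuous_on A \<omega>" for A unfolding \<omega>_def by (intro continuous_intros c')
  have \<omega>0: "0 \<le> \<omega> y" "\<omega> y \<le> 1" for y unfolding \<omega>_def by (auto intro!: sum_nonneg)
  have "cmod (a k) < 1" for k
    unfolding a_def norm_mult norm_cis norm_of_real using n by simp
  then have aD: "axis j (a k) \<in> poly_D" for j k by (auto simp: poly_D_def axis_def)
  have cs: "continuous_on A (\<lambda>y. root 8 (cmod (szego b (\<Phi> y)))^9)" if "b \<in> poly_D" for A b
    by (rule continuous_on_power[OF continuous_on_real_root[OF continuous_cmod_szego[OF c that]]])
  have cu: "continuous_on A (u j k)" for A j k unfolding u_def by (rule cs[OF aD])
  have u0: "0 \<le> u j k y" for j k y by (simp add: u_def)
  have dom: "\<omega> y \<le> (\<Sum>j\<in>UNIV. \<Sum>k<N. u j k y) / real m^9" for y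
  proof (cases "\<exists>j. 0 < n * cmod (\<Phi> y $ j) - n + 2")
    case False
    then have "max 0 (n * cmod (\<Phi> y $ j) - n + 2) = 0" for j by (auto simp: not_less)
    then have "\<omega> y = 0" by (simp add: \<omega>_def)
    then show ?thesis using u0 m by (simp add: sum_nonneg)
  next
    case True
    then obtain j where j: "0 < n * cmod (\<Phi> y $ j) - n + 2" by blast
    let ?w = "\<Phi> y $ j"
    have w: "cmod ?w \<le> 1" by (rule poly_cD_nth[OF c(2)])
    have "1 - 2 / n < cmod ?w" using j n by (simp add: field_simps)
    then obtain k where k: "k < N" "cmod (1 - a k * ?w) \<le> 11 / n"
      using near_arc[OF N2 w] unfolding a_def n_def by blast
    have "1 - a k * ?w \<noteq> 0" using mult_neq_1_of_norm[OF w \<open>cmod (a k) < 1\<close>] by (auto simp: mult.commute)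
    moreover have "cmod (1 - a k * ?w) \<le> 1 / real m^8" using k(2) m unfolding nm by simp
    ultimately have "real m^8 \<le> inverse (cmod (1 - a k * ?w))"
      using m le_imp_inverse_le[of "cmod (1 - a k * ?w)" "1 / real m^8"] by simp
    then have "real m^8 \<le> cmod (szego (axis j (a k)) (\<Phi> y))" by (simp add: szego_axis norm_inverse)
    then have "root 8 (real m^8) \<le> root 8 (cmod (szego (axis j (a k)) (\<Phi> y)))" by (subst real_root_le_iff) auto
    then have "real m \<le> root 8 (cmod (szego (axis j (a k)) (\<Phi> y)))" using m by (simp add: real_root_power_cancel)
    then have "real m^9 \<le> u j k y" unfolding u_def using m by (intro power_mono) auto
    also have "\<dots> \<le> (\<Sum>k<N. u j k y)" using k(1) u0 by (intro member_le_sum[of k _ "\<lambda>k. u j k y"]) auto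
    also have "\<dots> \<le> (\<Sum>j\<in>UNIV. \<Sum>k<N. u j k y)" using u0 by (intro member_le_sum[of j _ "\<lambda>j. \<Sum>k<N. u j k y"] sum_nonneg) auto
    finally have "1 \<le> (\<Sum>j\<in>UNIV. \<Sum>k<N. u j k y) / real m^9" using m by simp
    then show ?thesis using \<omega>0(2)[of y] by linarith
  qed
  have int\<omega>: "integral cube \<omega> \<le> 33 * M / real m"
  proof -
    have cS: "continuous_on A (\<lambda>y. \<Sum>j\<in>UNIV. \<Sum>k<N. u j k y)" for A by (intro continuous_intros cu)
    have "integral cube \<omega> \<le> integral cube (\<lambda>y. (\<Sum>j\<in>UNIV. \<Sum>k<N. u j k y) / real m^9)"
      using m by (intro integral_le integrable_continuous continuous_intros c\<omega> cS dom) auto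
    also have "\<dots> = integral cube (\<lambda>y. \<Sum>j\<in>UNIV. \<Sum>k<N. u j k y) / real m^9" by (rule integral_divide)
    also have "integral cube (\<lambda>y. \<Sum>j\<in>UNIV. \<Sum>k<N. u j k y) = (\<Sum>j\<in>UNIV. integral cube (\<lambda>y. \<Sum>k<N. u j k y))"
      by (intro integral_sum integrable_continuous continuous_intros cu) auto
    also have "\<dots> = (\<Sum>j\<in>UNIV. \<Sum>k<N. integral cube (u j k))"
      by (intro sum.cong refl integral_sum integrable_continuous cu) auto
    also have "\<dots> \<le> (\<Sum>j\<in>(UNIV::3 set). \<Sum>k<N. M)" unfolding u_def by (intro sum_mono M aD)
    finally have "integral cube \<omega> \<le> (\<Sum>j\<in>(UNIV::3 set). \<Sum>k<N. M) / real m^9" using m by (simp add: divide_right_mono)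
    also have "\<dots> = 3 * n * M / real m^9" by (simp add: n_def)
    also have "\<dots> = 33 * M / real m" using m unfolding nm by (simp add: power_Suc[of "real m" 8, simplified] field_simps)
    finally show ?thesis .
  qed
  have "integral cube (\<lambda>y. \<omega> y * cmod (szego b (\<Phi> y))) \<le> \<eta>" if b: "b \<in> poly_D" for b
  proof -
    let ?v = "\<lambda>y. root 8 (cmod (szego b (\<Phi> y)))"
    have c1: "continuous_on A (\<lambda>y. \<omega> y * cmod (szego b (\<Phi> y)))" for A
      by (rule continuous_on_mult[OF c\<omega> continuous_cmod_szego[OF c b]])
    have c2: "continuous_on A (\<lambda>y. L^8 * \<omega> y)" for A by (intro continuous_intros c\<omega>)
    have c3: "continuous_on A (\<lambda>y. ?v y^9 / L)" for A
      by (rule continuous_on_divide[OF cs[OF b] continuous_on_const]) (use L in auto)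
    have "integral cube (\<lambda>y. \<omega> y * cmod (szego b (\<Phi> y))) \<le> integral cube (\<lambda>y. L^8 * \<omega> y + ?v y^9 / L)"
    proof (rule integral_le[OF integrable_continuous[OF c1] integrable_continuous[OF continuous_on_add[OF c2 c3]]])
      fix y
      define v where "v = ?v y"
      have v: "0 \<le> v" "cmod (szego b (\<Phi> y)) = v^8" by (simp_all add: v_def)
      have "\<omega> y * v^8 \<le> L^8 * \<omega> y + v^9 / L"
      proof (cases "v \<le> L")
        case True
        then have "\<omega> y * v^8 \<le> \<omega> y * L^8" using v \<omega>0 by (intro mult_left_mono power_mono) auto
        moreover have "0 \<le> v^9 / L" using v L by simp
        ultimately show ?thesis by (simp add: mult.commute)
      next
        case False
        have "\<omega> y * v^8 \<le> 1 * v^8" using \<omega>0 v by (intro mult_right_mono) auto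
        moreover have "v^8 * L \<le> v^8 * v" using False v by (intro mult_left_mono) auto
        then have "v^8 \<le> v^9 / L" using L power_Suc[of v 8] by (simp add: le_divide_eq mult.commute)
        moreover have "0 \<le> L^8 * \<omega> y" using L \<omega>0 by simp
        ultimately show ?thesis by linarith
      qed
      then show "\<omega> y * cmod (szego b (\<Phi> y)) \<le> L^8 * \<omega> y + ?v y^9 / L"
        unfolding v(2)[symmetric] unfolding v_def .
    qed
    also have "\<dots> = integral cube (\<lambda>y. L^8 * \<omega> y) + integral cube (\<lambda>y. ?v y^9 / L)"
      by (rule integral_add[OF integrable_continuous[OF c2] integrable_continuous[OF c3]])
    also have "\<dots> = L^8 * integral cube \<omega> + integral cube (\<lambda>y. ?v y^9) / L" by (simp only: integral_mult_right integral_divide)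
    also have "\<dots> \<le> L^8 * (33 * M / real m) + M / L" using L by (intro add_mono mult_left_mono divide_right_mono int\<omega> M b) auto
    also have "\<dots> \<le> \<eta>" using mL ratio by linarith
    finally show ?thesis .
  qed
  moreover have "\<omega> y = 1" if "1 - 1 / n \<le> cmod (\<Phi> y $ j)" for y j
  proof -
    have "1 \<le> n * cmod (\<Phi> y $ j) - n + 2" using that n by (simp add: field_simps)
    also have "\<dots> \<le> max 0 (n * cmod (\<Phi> y $ j) - n + 2)" by simp
    also have "\<dots> \<le> (\<Sum>j\<in>UNIV. max 0 (n * cmod (\<Phi> y $ j) - n + 2))"
      by (rule member_le_sum[of j _ "\<lambda>j. max 0 (n * cmod (\<Phi> y $ j) - n + 2)"]) auto
    finally show ?thesis by (simp add: \<omega>_def)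
  qed
  moreover have "0 < 1 / n" "1 / n < 1" using n by auto
  ultimately show ?thesis using c\<omega> \<omega>0 by (intro exI[of _ "1 / n"]) (rule exI[of _ \<omega>], blast)
qed

section \<open>Sufficiency\<close>

text \<open>The maximum in \<open>pos_index\<close> is attained: the dimensions are at most 3 and
  the zero subspace qualifies, so the set is finite and nonempty.\<close>

lemma pos_index_witness:
  obtains S :: "(real^3) set" where "subspace S" "dim S = pos_index Q" "\<And>x. x \<in> S \<Longrightarrow> x \<noteq> 0 \<Longrightarrow> 0 < Q x"
proof -
  let ?D = "{dim S | S :: (real^3) set. subspace S \<and> (\<forall>x\<in>S. x \<noteq> 0 \<longrightarrow> Q x > 0)}"
  have "?D \<subseteq> {..DIM(real^3)}" using dim_subset_UNIV by blast
  then have "finite ?D" by (rule finite_subset) simp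
  moreover have "subspace {0 :: real^3}" by (simp add: subspace_def)
  then have "dim {0 :: real^3} \<in> ?D" by blast
  ultimately have "Max ?D \<in> ?D" by (intro Max_in) auto
  then have "\<exists>S :: (real^3) set. Max ?D = dim S \<and> subspace S \<and> (\<forall>x\<in>S. x \<noteq> 0 \<longrightarrow> Q x > 0)" unfolding mem_Collect_eq .
  then obtain S :: "(real^3) set" where S: "Max ?D = dim S" "subspace S" "\<forall>x\<in>S. x \<noteq> 0 \<longrightarrow> Q x > 0" by blast
  show ?thesis
  proof (rule that[of S])
    show "dim S = pos_index Q" unfolding pos_index_def by (rule S(1)[symmetric])
    show "subspace S" by (rule S(2))
    fix x assume "x \<in> S" "x \<noteq> 0"
    then show "0 < Q x" using S(3) by blast
  qed
qed

lemma psi_shift: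
  assumes "cmod (g (expi \<alpha>)) = 1"
  shows "g (expi \<theta>) = g (expi \<alpha>) * psi g (expi \<alpha>) (\<theta> - \<alpha>)"
proof -
  have "g (expi \<alpha>) * cnj (g (expi \<alpha>)) = 1" using complex_norm_square[of "g (expi \<alpha>)"] assms by simp
  then show ?thesis by (simp add: psi_def expi_add[symmetric] mult.assoc[symmetric])
qed

context
  fixes \<phi> :: "complex^3 \<Rightarrow> complex^3"
  assumes holo: "\<forall>j. holo3 (\<lambda>z. \<phi> z $ j) poly_D"
    and maps: "\<phi> ` poly_D \<subseteq> poly_D"
    and smooth: "Ck_upto 3 \<phi> poly_D poly_cD"
begin

lemma continuous_comp_torus: "continuous_on A (\<lambda>\<theta>. \<phi> (expi \<theta>))"
  by (intro continuous_on_compose2[OF phi_continuous[OF holo maps smooth]] continuous_intros) (auto intro: expi_in_cD)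

lemma comp_torus_le: "cmod (\<phi> (expi \<theta>) $ j) \<le> 1"
  using phi_cD[OF holo maps smooth] expi_in_cD[of \<theta>] by (intro poly_cD_nth) blast

lemma continuous_psi_comp: "\<xi> \<in> torus3 \<Longrightarrow> continuous_on A (psi (\<lambda>z. \<phi> z $ j) \<xi>)"
  unfolding psi_def
  by (intro continuous_intros continuous_on_compose2[OF phi_continuous[OF holo maps smooth]]) (auto intro!: torus_mult_cD expi_in_cD)

text \<open>The signature supplies a subspace of dimension at least 2 on which the Hessian is
  definite. The order-2 condition says nothing about first derivatives; a nonzero one is provided by
  the boundary Schwarz lemma.\<close>

lemma decay1_of_ord2:
  assumes u: "cmod (\<phi> (expi \<alpha>) $ j) = 1" and T: "truly2d_ord2 (\<lambda>z. \<phi> z $ j) (expi \<alpha>)"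
  shows "decay1 (\<lambda>\<theta>. \<phi> (expi \<theta>) $ j) \<alpha>"
proof -
  let ?g = "\<lambda>z. \<phi> z $ j" and ?\<psi> = "psi (\<lambda>z. \<phi> z $ j) (expi \<alpha>)"
  have \<xi>: "expi \<alpha> \<in> torus3" by (rule expi_in_torus3)
  obtain p q where p: "\<And>\<theta>. (?\<psi> has_derivative (\<lambda>v. \<Sum>k\<in>UNIV. (v$k) *\<^sub>R p k \<theta>)) (at \<theta>)"
    "\<And>k \<theta>. (p k has_derivative (\<lambda>v. \<Sum>l\<in>UNIV. (v$l) *\<^sub>R q k l \<theta>)) (at \<theta>)"
    "\<And>k l. continuous_on UNIV (q k l)" "\<And>k. continuous_on UNIV (p k)"
    "\<And>k. p k 0 = \<i> * of_real (Im (p k 0))" "\<And>k. cpartial (ttilde ?g (expi \<alpha>)) one3 k = of_real (Im (p k 0))"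
    by (rule psi_data[OF holo maps smooth \<xi> u]) blast
  define a where "a = (\<lambda>k. Im (p k 0))"
  have p0: "p k 0 = \<i> * of_real (a k)" for k unfolding a_def by (rule p(5))
  note P = p(1-4) p0 phi_psi_0[OF holo maps smooth u \<xi>] phi_norm_psi_le[OF holo maps smooth u \<xi>]
  obtain Q A where Q: "Q = quadform A" and lim: "((\<lambda>\<theta>. (Re (?\<psi> \<theta>) - (1 - Q \<theta>)) / (norm \<theta>)\<^sup>2) \<longlongrightarrow> 0) (at 0)"
    and sg: "signature Q \<in> {(2,0),(3,0)}"
    using T unfolding truly2d_ord2_def quad_expansion_def by blast
  have h: "Q v = neg_hess q v / 2" for v
    by (rule quadform_eq_neg_hess[where \<psi>="?\<psi>" and p=p and q=q and a=a, OF P Q lim])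
  have nn: "0 \<le> neg_hess q v" for v
    by (rule neg_hess_nonneg_of_quadform[where \<psi>="?\<psi>" and p=p and q=q and a=a and Q=Q, OF P h lim])
  obtain S :: "(real^3) set" where S: "subspace S" "dim S = pos_index Q" "\<And>x. x \<in> S \<Longrightarrow> x \<noteq> 0 \<Longrightarrow> 0 < Q x"
    by (rule pos_index_witness[where Q=Q]) blast
  have S2: "2 \<le> dim S" using sg S(2) by (auto simp: signature_def)
  have S3: "0 < neg_hess q v" if "v \<in> S" "v \<noteq> 0" for v using S(3)[OF that] h[of v] by simp
  obtain k where "cpartial (ttilde ?g (expi \<alpha>)) one3 k \<noteq> 0"
    using cpartial_nonzero[OF comp_holo[OF holo maps smooth] comp_C2[OF holo maps smooth] comp_maps[OF holo maps smooth] \<xi> u] by blast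
  then have ak: "a k \<noteq> 0" unfolding p(6) a_def by simp
  have "\<exists>\<rho>>0. \<exists>K>0. \<rho> \<le> 1 \<and> (\<forall>\<alpha>' \<beta> \<delta> r. cmod \<beta> = 1 \<longrightarrow> 0 < \<delta> \<longrightarrow> \<delta> \<le> \<rho> \<longrightarrow> r \<le> \<rho> \<longrightarrow>
      measure lborel {\<theta>. \<theta> \<in> cball \<alpha>' r \<and> cmod (1 - \<beta> * ?\<psi> (\<theta> - \<alpha>')) \<le> \<delta>} \<le> K * (\<delta> * sqrt \<delta>))"
  proof (rule single_measure_bound[where \<psi>="?\<psi>" and p=p and q=q and a=a, OF P nn S(1) S2 S3 ak])
    fix \<rho> K :: real
    assume H: "0 < \<rho>" "\<rho> \<le> 1" "0 < K" "\<And>\<alpha> \<beta> \<delta> r. cmod \<beta> = 1 \<Longrightarrow> 0 < \<delta> \<Longrightarrow> \<delta> \<le> \<rho> \<Longrightarrow> r \<le> \<rho> \<Longrightarrow>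
      measure lborel {\<theta>. \<theta> \<in> cball \<alpha> r \<and> cmod (1 - \<beta> * ?\<psi> (\<theta> - \<alpha>)) \<le> \<delta>} \<le> K * (\<delta> * sqrt \<delta>)"
    show ?thesis
      by (rule exI[of _ \<rho>], rule conjI[OF H(1)], rule exI[of _ K], rule conjI[OF H(3)], rule conjI[OF H(2)], intro allI impI, rule H(4))
  qed
  then obtain \<rho> K where m: "0 < \<rho>" "\<rho> \<le> 1" "0 < K" and mb: "\<forall>\<alpha>' \<beta> \<delta> r. cmod \<beta> = 1 \<longrightarrow> 0 < \<delta> \<longrightarrow> \<delta> \<le> \<rho> \<longrightarrow> r \<le> \<rho> \<longrightarrow>
      measure lborel {\<theta>. \<theta> \<in> cball \<alpha>' r \<and> cmod (1 - \<beta> * ?\<psi> (\<theta> - \<alpha>')) \<le> \<delta>} \<le> K * (\<delta> * sqrt \<delta>)" by blast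
  show ?thesis
  proof (rule decay1_boundary[where u="\<phi> (expi \<alpha>) $ j" and \<psi>="?\<psi>" and \<rho>=\<rho> and K=K])
    show "\<phi> (expi \<theta>) $ j = \<phi> (expi \<alpha>) $ j * ?\<psi> (\<theta> - \<alpha>)" for \<theta>
      by (rule psi_shift[where g="?g" and \<alpha>=\<alpha>, OF u])
    show "cmod (?\<psi> \<theta>) \<le> 1" for \<theta> by (rule phi_norm_psi_le[OF holo maps smooth u \<xi>])
    show "continuous_on UNIV ?\<psi>" by (rule continuous_psi_comp[OF \<xi>])
    fix \<alpha>' \<beta> \<delta> r assume "cmod \<beta> = 1" "0 < \<delta>" "\<delta> \<le> \<rho>" "r \<le> \<rho>"
    then show "measure lborel {\<theta>. \<theta> \<in> cball \<alpha>' r \<and> cmod (1 - \<beta> * ?\<psi> (\<theta> - \<alpha>')) \<le> \<delta>} \<le> K * (\<delta> * sqrt \<delta>)" by (rule mb[rule_format])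
  qed (rule u m)+
qed

text \<open>Signature (3,0) means that the witnessing subspace is the whole space, so the Hessian is
  positive definite.\<close>

lemma difference_control_of_ord2:
  assumes u: "cmod (\<phi> (expi \<alpha>) $ j) = 1" and T: "quad_expansion (\<lambda>z. \<phi> z $ j) (expi \<alpha>) Q" "signature Q = (3,0)"
  obtains a C where "0 < C" "difference_control (psi (\<lambda>z. \<phi> z $ j) (expi \<alpha>)) a C"
    "\<And>k. cpartial (ttilde (\<lambda>z. \<phi> z $ j) (expi \<alpha>)) one3 k = of_real (a k)"
proof -
  let ?g = "\<lambda>z. \<phi> z $ j" and ?\<psi> = "psi (\<lambda>z. \<phi> z $ j) (expi \<alpha>)"
  have \<xi>: "expi \<alpha> \<in> torus3" by (rule expi_in_torus3)
  obtain p q where p: "\<And>\<theta>. (?\<psi> has_derivative (\<lambda>v. \<Sum>k\<in>UNIV. (v$k) *\<^sub>R p k \<theta>)) (at \<theta>)"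
    "\<And>k \<theta>. (p k has_derivative (\<lambda>v. \<Sum>l\<in>UNIV. (v$l) *\<^sub>R q k l \<theta>)) (at \<theta>)"
    "\<And>k l. continuous_on UNIV (q k l)" "\<And>k. continuous_on UNIV (p k)"
    "\<And>k. p k 0 = \<i> * of_real (Im (p k 0))" "\<And>k. cpartial (ttilde ?g (expi \<alpha>)) one3 k = of_real (Im (p k 0))"
    by (rule psi_data[OF holo maps smooth \<xi> u]) blast
  define a where "a = (\<lambda>k. Im (p k 0))"
  have p0: "p k 0 = \<i> * of_real (a k)" for k unfolding a_def by (rule p(5))
  note P = p(1-4) p0 phi_psi_0[OF holo maps smooth u \<xi>] phi_norm_psi_le[OF holo maps smooth u \<xi>]
  obtain A where Q: "Q = quadform A" and lim: "((\<lambda>\<theta>. (Re (?\<psi> \<theta>) - (1 - Q \<theta>)) / (norm \<theta>)\<^sup>2) \<longlongrightarrow> 0) (at 0)"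
    using T(1) unfolding quad_expansion_def by blast
  have h: "Q v = neg_hess q v / 2" for v
    by (rule quadform_eq_neg_hess[where \<psi>="?\<psi>" and p=p and q=q and a=a, OF P Q lim])
  obtain S :: "(real^3) set" where S: "subspace S" "dim S = pos_index Q" "\<And>x. x \<in> S \<Longrightarrow> x \<noteq> 0 \<Longrightarrow> 0 < Q x"
    by (rule pos_index_witness[where Q=Q]) blast
  have "dim S = DIM(real^3)" using T(2) S(2) by (simp add: signature_def)
  then have "span S = UNIV" by (rule dim_eq_full[THEN iffD1])
  moreover have "span S = S" using S(1) by (rule span_eq_iff[THEN iffD2])
  ultimately have "S = UNIV" by simp
  then have pos: "0 < neg_hess q v" if "v \<noteq> 0" for v using S(3)[of v] that h[of v] by simp
  obtain C where C: "0 < C" "difference_control ?\<psi> a C"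
    using posdef_difference_bounds[where \<psi>="?\<psi>" and p=p and q=q and a=a, OF P pos] unfolding difference_control_def by blast
  show ?thesis by (rule that[OF C]) (simp only: p(6) a_def)
qed

lemma decay2_of_ord2:
  assumes u: "cmod (\<phi> (expi \<alpha>) $ i) = 1" "cmod (\<phi> (expi \<alpha>) $ j) = 1"
    and T: "truly3d_ord2 (\<lambda>z. \<phi> z $ i) (\<lambda>z. \<phi> z $ j) (expi \<alpha>)"
  shows "decay2 (\<lambda>\<theta>. \<phi> (expi \<theta>) $ i) (\<lambda>\<theta>. \<phi> (expi \<theta>) $ j) \<alpha>"
proof -
  let ?g = "\<lambda>z. \<phi> z $ i" and ?h = "\<lambda>z. \<phi> z $ j"
  have \<xi>: "expi \<alpha> \<in> torus3" by (rule expi_in_torus3)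
  obtain Q1 Q2 where Q: "quad_expansion ?g (expi \<alpha>) Q1" "signature Q1 = (3,0)" "quad_expansion ?h (expi \<alpha>) Q2" "signature Q2 = (3,0)"
    using T unfolding truly3d_ord2_def by blast
  obtain a C1 where a: "0 < C1" "difference_control (psi ?g (expi \<alpha>)) a C1" "\<And>k. cpartial (ttilde ?g (expi \<alpha>)) one3 k = of_real (a k)"
    by (rule difference_control_of_ord2[OF u(1) Q(1,2)]) blast
  obtain b C2 where b: "0 < C2" "difference_control (psi ?h (expi \<alpha>)) b C2" "\<And>k. cpartial (ttilde ?h (expi \<alpha>)) one3 k = of_real (b k)"
    by (rule difference_control_of_ord2[OF u(2) Q(3,4)]) blast
  have li: "lin_indep2 (\<chi> k. complex_of_real (a k)) (\<chi> k. complex_of_real (b k))"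
    using T unfolding truly3d_ord2_def cgrad_def a(3) b(3) by blast
  \<comment> \<open>If all minors vanished, b_k1 a - a_k1 b would be a trivial combination for every
    k1; independence gives a = 0, and then a alone is dependent.\<close>
  have "\<exists>k1 k2. a k1 * b k2 - a k2 * b k1 \<noteq> 0"
  proof (rule ccontr)
    assume "\<not> ?thesis"
    then have z: "a k1 * b k2 = a k2 * b k1" for k1 k2 by auto
    have "a k1 = 0" for k1
    proof -
      have "complex_of_real (b k1) *s (\<chi> k. complex_of_real (a k)) + complex_of_real (- a k1) *s (\<chi> k. complex_of_real (b k)) = 0"
        using z[of k1] by (simp add: vec_eq_iff mult.commute flip: of_real_mult)
      then have "complex_of_real (- a k1) = 0" using li unfolding lin_indep2_def by blast
      then show ?thesis by simp
    qed
    then have "1 *s (\<chi> k. complex_of_real (a k)) + 0 *s (\<chi> k. complex_of_real (b k)) = 0" by (simp add: vec_eq_iff)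
    then show False using li unfolding lin_indep2_def by (metis zero_neq_one)
  qed
  then obtain k1 k2 where minor: "a k1 * b k2 - a k2 * b k1 \<noteq> 0" by blast
  then have minor': "b k1 * a k2 - b k2 * a k1 \<noteq> 0" by (simp add: mult.commute)
  note cg = continuous_psi_comp[OF \<xi>, of UNIV i] and ch = continuous_psi_comp[OF \<xi>, of UNIV j]
  have D: "pair_decay (psi ?g (expi \<alpha>)) (psi ?h (expi \<alpha>))" "pair_decay (psi ?h (expi \<alpha>)) (psi ?g (expi \<alpha>))"
    unfolding pair_decay_def
    by (rule pair_measure_bound_ordered[OF cg ch a(1,2) b(2) minor], rule pair_measure_bound_ordered[OF ch cg b(1,2) a(2) minor'])
  show ?thesis
  proof (rule decay2_boundary[where u="\<phi> (expi \<alpha>) $ i" and w="\<phi> (expi \<alpha>) $ j" and ?\<psi>1.0="psi ?g (expi \<alpha>)" and ?\<psi>2.0="psi ?h (expi \<alpha>)"])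
    show "\<phi> (expi \<theta>) $ i = \<phi> (expi \<alpha>) $ i * psi ?g (expi \<alpha>) (\<theta> - \<alpha>)" for \<theta>
      by (rule psi_shift[where g="?g" and \<alpha>=\<alpha>, OF u(1)])
    show "\<phi> (expi \<theta>) $ j = \<phi> (expi \<alpha>) $ j * psi ?h (expi \<alpha>) (\<theta> - \<alpha>)" for \<theta>
      by (rule psi_shift[where g="?h" and \<alpha>=\<alpha>, OF u(2)])
    show "cmod (psi ?g (expi \<alpha>) \<theta>) \<le> 1" for \<theta> by (rule phi_norm_psi_le[OF holo maps smooth u(1) \<xi>])
    show "cmod (psi ?h (expi \<alpha>) \<theta>) \<le> 1" for \<theta> by (rule phi_norm_psi_le[OF holo maps smooth u(2) \<xi>])
  qed (rule u cg ch D)+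
qed

text \<open>Local conditions at each point of the torus are turned into the uniform kernel bound by
  compactness, and from there into cutoffs. By (1) every point has a coordinate k of \<phi> strictly
  inside; the remaining two satisfy the decay conditions, by the order-2 hypotheses where they have
  modulus 1 and trivially otherwise.\<close>

lemma sufficiency:
  assumes T1: "\<phi> ` torus3 \<inter> torus3 = {}"
    and T2: "\<And>\<xi> i1 i2. \<xi> \<in> torus3 \<Longrightarrow> i1 < i2 \<Longrightarrow> cmod (\<phi> \<xi> $ i1) = 1 \<Longrightarrow> cmod (\<phi> \<xi> $ i2) = 1 \<Longrightarrow> truly3d_ord2 (\<lambda>z. \<phi> z $ i1) (\<lambda>z. \<phi> z $ i2) \<xi>"
    and T3: "\<And>\<xi> j. \<xi> \<in> torus3 \<Longrightarrow> cmod (\<phi> \<xi> $ j) = 1 \<Longrightarrow> truly2d_ord2 (\<lambda>z. \<phi> z $ j) \<xi>"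
  shows "compact_comp_op \<phi>"
proof -
  have cj: "continuous_on UNIV (\<lambda>\<theta>. \<phi> (expi \<theta>) $ j)" for j by (intro continuous_intros continuous_comp_torus)
  have lt: "cmod (\<phi> (expi \<alpha>) $ j) = 1 \<or> cmod (\<phi> (expi \<alpha>) $ j) < 1" for \<alpha> j using comp_torus_le[of \<alpha> j] by linarith
  have d1: "decay1 (\<lambda>\<theta>. \<phi> (expi \<theta>) $ j) \<alpha>" for \<alpha> j
    using lt[of \<alpha> j]
  proof
    assume "cmod (\<phi> (expi \<alpha>) $ j) = 1"
    then show ?thesis by (intro decay1_of_ord2 T3 expi_in_torus3)
  qed (rule decay1_inside[OF cj])
  have d2: "decay2 (\<lambda>\<theta>. \<phi> (expi \<theta>) $ i) (\<lambda>\<theta>. \<phi> (expi \<theta>) $ j) \<alpha>" if "i \<noteq> j" for \<alpha> i j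
  proof -
    consider "cmod (\<phi> (expi \<alpha>) $ i) < 1" | "cmod (\<phi> (expi \<alpha>) $ j) < 1" | "cmod (\<phi> (expi \<alpha>) $ i) = 1" "cmod (\<phi> (expi \<alpha>) $ j) = 1"
      using lt[of \<alpha> i] lt[of \<alpha> j] by blast
    then show ?thesis
    proof cases
      case 1 then show ?thesis by (rule decay2_inside[OF cj])
    next
      case 2 then show ?thesis by (rule decay2_sym[OF decay2_inside[OF cj]])
    next
      case 3
      show ?thesis
      proof (cases "i < j")
        case True show ?thesis by (rule decay2_of_ord2[OF 3 T2[OF expi_in_torus3 True 3]])
      next
        case False
        then have "j < i" using that by simp
        from T2[OF expi_in_torus3 this 3(2,1)] show ?thesis by (rule decay2_sym[OF decay2_of_ord2[OF 3(2,1)]])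
      qed
    qed
  qed
  have L: "\<exists>\<rho> C. 0 < \<rho> \<and> 0 \<le> C \<and> (\<forall>b\<in>poly_D. (\<integral>\<^sup>+\<theta>. ennreal (root 8 (cmod (szego b (\<phi> (expi \<theta>))))^9) * indicator (cball \<alpha> \<rho>) \<theta> \<partial>lborel) \<le> ennreal C)" for \<alpha>
  proof -
    have "\<phi> (expi \<alpha>) \<notin> torus3" using T1 expi_in_torus3[of \<alpha>] by blast
    then obtain k where "cmod (\<phi> (expi \<alpha>) $ k) \<noteq> 1" by (auto simp: torus3_def)
    then have k: "cmod (\<phi> (expi \<alpha>) $ k) < 1" using lt[of \<alpha> k] by blast
    have "(1::3) \<noteq> 2" by simp
    then obtain m where "k \<noteq> m" by metis
    then obtain l where d: "distinct [m, l, k]" using third_index by blast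
    then have "m \<noteq> l" by simp
    show ?thesis
      by (rule local_kernel_bound[where \<Phi>="\<lambda>\<theta>. \<phi> (expi \<theta>)", OF continuous_comp_torus comp_torus_le d k d1 d1 d2[OF \<open>m \<noteq> l\<close>]])
  qed
  have pc: "\<phi> (expi y) \<in> poly_cD" for y using phi_cD[OF holo maps smooth] expi_in_cD[of y] by blast
  obtain M where M: "0 \<le> M" "\<And>b. b \<in> poly_D \<Longrightarrow> integral cube (\<lambda>y. root 8 (cmod (szego b (\<phi> (expi y))))^9) \<le> M"
    by (rule global_kernel_bound[where \<Phi>="\<lambda>\<theta>. \<phi> (expi \<theta>)", OF continuous_comp_torus pc L]) blast
  show ?thesis
    by (rule compact_comp_op_of_cutoffs[OF comp_holo[OF holo maps smooth] maps phi_continuous[OF holo maps smooth] phi_cD[OF holo maps smooth]])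
      (rule exists_cutoff[where \<Phi>="\<lambda>\<theta>. \<phi> (expi \<theta>)", OF continuous_comp_torus pc M])
qed

end

theorem mainTheorem17:
  fixes \<phi> :: "complex^3 \<Rightarrow> complex^3"
  assumes holo: "\<forall>j. holo3 (\<lambda>z. \<phi> z $ j) poly_D"
    and maps: "\<phi> ` poly_D \<subseteq> poly_D"
    and smooth: "Ck_upto 3 \<phi> poly_D poly_cD"
  shows "(compact_comp_op \<phi> \<longrightarrow>
            \<phi> ` torus3 \<inter> torus3 = {} \<and>
            (\<forall>\<xi>\<in>torus3. \<forall>i1 i2::3. i1 < i2 \<and> cmod (\<phi> \<xi> $ i1) = 1 \<and> cmod (\<phi> \<xi> $ i2) = 1 \<longrightarrow>
                truly3d (\<lambda>z. \<phi> z $ i1) (\<lambda>z. \<phi> z $ i2) \<xi>) \<and>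
            (\<forall>\<xi>\<in>torus3. \<forall>j. cmod (\<phi> \<xi> $ j) = 1 \<longrightarrow> truly2d (\<lambda>z. \<phi> z $ j) \<xi>))
       \<and> ((\<phi> ` torus3 \<inter> torus3 = {} \<and>
            (\<forall>\<xi>\<in>torus3. \<forall>i1 i2::3. i1 < i2 \<and> cmod (\<phi> \<xi> $ i1) = 1 \<and> cmod (\<phi> \<xi> $ i2) = 1 \<longrightarrow>
                truly3d_ord2 (\<lambda>z. \<phi> z $ i1) (\<lambda>z. \<phi> z $ i2) \<xi>) \<and>
            (\<forall>\<xi>\<in>torus3. \<forall>j. cmod (\<phi> \<xi> $ j) = 1 \<longrightarrow> truly2d_ord2 (\<lambda>z. \<phi> z $ j) \<xi>))
          \<longrightarrow> compact_comp_op \<phi>)"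
proof (intro conjI impI ballI allI)
  assume c: "compact_comp_op \<phi>"
  show "\<phi> ` torus3 \<inter> torus3 = {}" by (rule necessity_torus[OF holo maps smooth c])
  show "truly3d (\<lambda>z. \<phi> z $ i1) (\<lambda>z. \<phi> z $ i2) \<xi>"
    if "\<xi> \<in> torus3" "i1 < i2 \<and> cmod (\<phi> \<xi> $ i1) = 1 \<and> cmod (\<phi> \<xi> $ i2) = 1" for \<xi> and i1 i2 :: 3
    using that by (intro necessity_pair[OF holo maps smooth c]) auto
  show "truly2d (\<lambda>z. \<phi> z $ j) \<xi>" if "\<xi> \<in> torus3" "cmod (\<phi> \<xi> $ j) = 1" for \<xi> j
    by (rule necessity_single[OF holo maps smooth c that])
qed (elim conjE, rule sufficiency[OF holo maps smooth], auto)

end
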